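(* Let $G \subset \mathrm{GL}(V)$ be a pseudo-reflection group with rank $r = \dim(V/V^G)$. Suppose $r \leq 2$ and that either $G = G(m,1,n)$ for some $m,n \ge 1$, or $G$ is real. Then $$\mathcal{SH}_G = K[\partial_{x_1}, \ldots, \partial_{x_n}]\, \mathcal{SH}_G^{\det} = \mathrm{Span}_K\{\partial_g\, \mathrm{d}_{i_1} \cdots \mathrm{d}_{i_k} \Delta_G : g \in K[x_1, \ldots, x_n],\ k\ge 0,\ i_1,\dots,i_k \in \{1,\dots,r\} \}.$$
   Context: Setting. $K \subset \mathbb{C}$ is a subfield closed under complex conjugation, $V = K^n$. A pseudo-reflection group $G \subset \mathrm{GL}(V)$ is a finite group of unitary matrices generated by pseudo-reflections (non-identity transformations of finite order fixing a hyperplane pointwise). $G$ is real if its reflection representation is realizable over $\mathbb{R}$, i.e. after a unitary change of coordinates all its matrices have real entries. $G(m,p,n)$ (with $p\mid m$) is the group of $n\times n$ matrices with exactly one non-zero entry in each row and column, each such entry an $m$th root of unity (assumed to lie in $K$), such that the product of the non-zero entries raised to the power $m/p$ is $1$. $V^G$ is the space of $G$-fixed vectors. Differential forms. $x_1,\dots,x_n$ are the coordinate functions on $V$. $K[x_1,\dots,x_n,\theta_1,\dots,\theta_n]$ is the $K$-algebra with $x_ix_j=x_jx_i$, $x_i\theta_j=\theta_jx_i$, $\theta_i\theta_j=-\theta_j\theta_i$ (so $\theta_i^2=0$), bigraded by $x$-degree and $\theta$-degree. $G$ acts by $K$-algebra automorphisms with $\sigma\cdot x_j=\sum_i\overline{\sigma_{ij}}x_i$,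 $\sigma\cdot\theta_j=\sum_i\overline{\sigma_{ij}}\theta_i$. $\partial_{x_i}$ is the usual ($\theta$-linear) partial derivative; $\partial_{\theta_i}$ is the $x$-linear interior product: for $i_1<\dots<i_k$, $\partial_{\theta_i}\theta_{i_1}\cdots\theta_{i_k}=(-1)^{\ell-1}\theta_{i_1}\cdots\widehat{\theta_{i_\ell}}\cdots\theta_{i_k}$ if $i=i_\ell$, and $0$ otherwise. For $\omega=\sum c_{\alpha,I}x^\alpha\theta_{i_1}\cdots\theta_{i_k}$ put $\partial_\omega=\sum\overline{c_{\alpha,I}}\,\partial_{x_1}^{\alpha_1}\cdots\partial_{x_n}^{\alpha_n}\partial_{\theta_{i_k}}\cdots\partial_{\theta_{i_1}}$. Super harmonics. $\mathcal{J}_G$ is the ideal of $K[x_1,\dots,x_n,\theta_1,\dots,\theta_n]$ generated by the bi-homogeneous $G$-invariant elements of positive total degree, and $\mathcal{SH}_G=\{\eta:\partial_\omega\eta=0\text{ for all }\omega\in\mathcal{J}_G\}$. $\mathcal{SH}_G^{\det}=\{\eta\in\mathcal{SH}_G:\sigma\cdot\eta=\det(\sigma)\eta\ \forall\sigma\in G\}$. $K[\partial_{x_1},\dots,\partial_{x_n}]\mathcal{SH}_G^{\det}$ is the span of all $\partial_g\eta$ with $g\in K[x_1,\dots,x_n]$, $\eta\in\mathcal{SH}_G^{\det}$. Vandermondian. $\mathcal{H}_G\subset K[x_1,\dots,x_n]$ is the $\theta$-degree $0$ part of $\mathcal{SH}_G$. Its top-degree component is one-dimensional; $\Delta_G$ is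 a spanning element (it satisfies $\sigma\cdot\Delta_G=\det(\sigma)\Delta_G$). Generalized exterior derivatives. Let $f_1,\dots,f_n$ be algebraically independent homogeneous generators of $K[x_1,\dots,x_n]^G$. Viewing $\theta_j$ as left multiplication, there are bi-homogeneous $G$-equivariant operators $\mathrm{d}_1,\dots,\mathrm{d}_n\in K[\partial_{x_1},\dots,\partial_{x_n},\theta_1,\dots,\theta_n]$, each raising $\theta$-degree by $1$, such that $\{\partial_{f_1}^{\alpha_1}\cdots\partial_{f_n}^{\alpha_n}\mathrm{d}_{i_1}\cdots\mathrm{d}_{i_k}:\alpha_i\ge0,\ 1\le i_1<\dots<i_k\le n,\ 0\le k\le n\}$ is a $K$-basis of the $G$-equivariant operators in that algebra (Orlik--Solomon). They are indexed so that $\mathrm{d}_1,\dots,\mathrm{d}_r$ are those strictly lowering $x$-degree. *)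

theory Defs
  imports
    "HOL-Analysis.Analysis"
    "HOL-Algebra.Generated_Groups"
    "HOL-Library.Poly_Mapping"
    "HOL-Library.Function_Algebras"
begin

section \<open>Linear algebra over a subfield of the complex numbers\<close>

text \<open>The ground field \<open>K\<close> is a set of complex numbers, and \<open>V = K^n\<close> is the set of vectors of
  \<open>complex ^ 'n\<close> with entries in \<open>K\<close>. The order on the index type \<open>'n\<close> plays the role
  of the order on \<open>{1..n}\<close>.\<close>

type_synonym 'n cvec = "(complex, 'n) vec"
type_synonym 'n cmat = "((complex, 'n) vec, 'n) vec"

definition conj_subfield :: "complex set \<Rightarrow> bool" where
  "conj_subfield K \<longleftrightarrow> 0 \<in> K \<and> 1 \<in> K \<and>
     (\<forall>a\<in>K. \<forall>b\<in>K. a + b \<in> K \<and> a * b \<in> K) \<and>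
     (\<forall>a\<in>K. - a \<in> K \<and> inverse a \<in> K \<and> cnj a \<in> K)"

definition K_span ::
  "(complex \<Rightarrow> 'v \<Rightarrow> 'v) \<Rightarrow> complex set \<Rightarrow> 'v set \<Rightarrow> 'v::comm_monoid_add set" where
  "K_span scl K S = {\<Sum>v\<in>T. scl (c v) v | T c. finite T \<and> T \<subseteq> S \<and> c ` T \<subseteq> K}"

definition K_independent_family ::
  "(complex \<Rightarrow> 'v \<Rightarrow> 'v) \<Rightarrow> complex set \<Rightarrow> 'i set \<Rightarrow> ('i \<Rightarrow> 'v::comm_monoid_add) \<Rightarrow> bool" where
  "K_independent_family scl K J b \<longleftrightarrow>
     (\<forall>T c. finite T \<and> T \<subseteq> J \<and> c ` T \<subseteq> K \<and> (\<Sum>i\<in>T. scl (c i) (b i)) = 0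
        \<longrightarrow> (\<forall>i\<in>T. c i = 0))"

definition K_basis ::
  "(complex \<Rightarrow> 'v \<Rightarrow> 'v) \<Rightarrow> complex set \<Rightarrow> 'i set \<Rightarrow> ('i \<Rightarrow> 'v) \<Rightarrow> 'v::comm_monoid_add set \<Rightarrow> bool"
  where
  "K_basis scl K J b W \<longleftrightarrow> K_independent_family scl K J b \<and> K_span scl K (b ` J) = W"

definition K_vectors :: "complex set \<Rightarrow> 'n::finite cvec set" where
  "K_vectors K = {v. \<forall>i. v $ i \<in> K}"

definition K_dim :: "complex set \<Rightarrow> 'n::finite cvec set \<Rightarrow> nat" where
  "K_dim K W = (THE k. \<exists>B. finite B \<and> card B = k \<and> K_basis (*s) K B id W)"

definition conj_transpose :: "'n::finite cmat \<Rightarrow> 'n cmat" where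
  "conj_transpose A = (\<chi> i j. cnj (A $ j $ i))"

definition unitary_matrix :: "'n::finite cmat \<Rightarrow> bool" where
  "unitary_matrix A \<longleftrightarrow> A ** conj_transpose A = mat 1 \<and> conj_transpose A ** A = mat 1"

definition GL :: "complex set \<Rightarrow> 'n::finite cmat monoid" where
  "GL K = \<lparr>carrier = {A. (\<forall>i j. A $ i $ j \<in> K) \<and> invertible A}, mult = (**), one = mat 1\<rparr>"


section \<open>Pseudo-reflection groups\<close>

text \<open>A hyperplane of \<open>V\<close> is the kernel of a non-zero linear functional \<open>v \<mapsto> \<Sum>i. a $ i * v $ i\<close>.\<close>

definition pseudo_reflection :: "complex set \<Rightarrow> 'n::finite cmat \<Rightarrow> bool" where
  "pseudo_reflection K s \<longleftrightarrow> s \<in> carrier (GL K) \<and> s \<noteq> mat 1 \<and>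
     (\<exists>k>0. s [^]\<^bsub>GL K\<^esub> (k::nat) = mat 1) \<and>
     (\<exists>a\<in>K_vectors K. a \<noteq> 0 \<and>
        (\<forall>v\<in>K_vectors K. (\<Sum>i\<in>UNIV. a $ i * v $ i) = 0 \<longrightarrow> s *v v = v))"

definition pseudo_reflection_group :: "complex set \<Rightarrow> 'n::finite cmat set \<Rightarrow> bool" where
  "pseudo_reflection_group K G \<longleftrightarrow> subgroup G (GL K) \<and> finite G \<and> (\<forall>s\<in>G. unitary_matrix s) \<and>
     G = generate (GL K) {s \<in> G. pseudo_reflection K s}"

text \<open>The change of coordinates is an arbitrary complex unitary matrix; its entries need not lie
  in \<open>K\<close>.\<close>

definition real_group :: "'n::finite cmat set \<Rightarrow> bool" where
  "real_group G \<longleftrightarrow> (\<exists>U. unitary_matrix U \<and>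
     (\<forall>s\<in>G. \<forall>i j. (U ** s ** conj_transpose U) $ i $ j \<in> \<real>))"

definition Gmpn :: "nat \<Rightarrow> nat \<Rightarrow> 'n::finite cmat set" where
  "Gmpn m p = {A. (\<forall>i. \<exists>!j. A $ i $ j \<noteq> 0) \<and> (\<forall>j. \<exists>!i. A $ i $ j \<noteq> 0) \<and>
     (\<forall>i j. A $ i $ j \<noteq> 0 \<longrightarrow> (A $ i $ j) ^ m = 1) \<and>
     (\<Prod>(i, j)\<in>{(i, j). A $ i $ j \<noteq> 0}. A $ i $ j) ^ (m div p) = 1}"

definition fixed_vectors ::
  "complex set \<Rightarrow> 'n::finite cmat set \<Rightarrow> 'n cvec set" where
  "fixed_vectors K G = {v \<in> K_vectors K. \<forall>s\<in>G. s *v v = v}"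

definition group_rank :: "complex set \<Rightarrow> 'n::finite cmat set \<Rightarrow> nat" where
  "group_rank K G = K_dim K (K_vectors K :: 'n cvec set) - K_dim K (fixed_vectors K G)"


section \<open>Polynomials\<close>

type_synonym 'n mpoly = "('n \<Rightarrow>\<^sub>0 nat) \<Rightarrow>\<^sub>0 complex"

definition Const :: "complex \<Rightarrow> 'n mpoly" where
  "Const c = Poly_Mapping.single 0 c"

definition X :: "'n \<Rightarrow> 'n mpoly" where
  "X i = Poly_Mapping.single (Poly_Mapping.single i 1) 1"

definition K_polys :: "complex set \<Rightarrow> 'n mpoly set" where
  "K_polys K = {p. \<forall>\<alpha>. Poly_Mapping.lookup p \<alpha> \<in> K}"

definition mdeg :: "('n::finite \<Rightarrow>\<^sub>0 nat) \<Rightarrow> nat" where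
  "mdeg \<alpha> = (\<Sum>i\<in>UNIV. Poly_Mapping.lookup \<alpha> i)"

definition homog :: "nat \<Rightarrow> 'n::finite mpoly \<Rightarrow> bool" where
  "homog a p \<longleftrightarrow> (\<forall>\<alpha>\<in>Poly_Mapping.keys p. mdeg \<alpha> = a)"

definition subst :: "('n \<Rightarrow> 'n mpoly) \<Rightarrow> 'n::finite mpoly \<Rightarrow> 'n mpoly" where
  "subst f p = (\<Sum>\<alpha>\<in>Poly_Mapping.keys p.
     Const (Poly_Mapping.lookup p \<alpha>) * (\<Prod>j\<in>UNIV. f j ^ Poly_Mapping.lookup \<alpha> j))"

definition act_poly :: "'n cmat \<Rightarrow> 'n::finite mpoly \<Rightarrow> 'n mpoly" where
  "act_poly s = subst (\<lambda>j. \<Sum>i\<in>UNIV. Const (cnj (s $ i $ j)) * X i)"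

definition invariant_polys ::
  "complex set \<Rightarrow> 'n cmat set \<Rightarrow> 'n::finite mpoly set" where
  "invariant_polys K G = {p \<in> K_polys K. \<forall>s\<in>G. act_poly s p = p}"

text \<open>The truncated subtraction on exponents is harmless: the coefficient vanishes where it
  truncates.\<close>

definition pdx :: "'n \<Rightarrow> 'n mpoly \<Rightarrow> 'n mpoly" where
  "pdx i p = (\<Sum>\<alpha>\<in>Poly_Mapping.keys p. Poly_Mapping.single (\<alpha> - Poly_Mapping.single i 1)
     (of_nat (Poly_Mapping.lookup \<alpha> i) * Poly_Mapping.lookup p \<alpha>))"

definition basic_invariants ::
  "complex set \<Rightarrow> 'n cmat set \<Rightarrow> ('n::finite \<Rightarrow> 'n mpoly) \<Rightarrow> bool" where
  "basic_invariants K G f \<longleftrightarrow>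
     (\<forall>i. f i \<in> K_polys K \<and> (\<exists>a. homog a (f i))) \<and>
     (\<forall>p\<in>K_polys K. subst f p = 0 \<longrightarrow> p = 0) \<and>
     subst f ` K_polys K = invariant_polys K G"


section \<open>Polynomial differential forms\<close>

text \<open>The component \<open>\<omega> $ I\<close> is the coefficient of \<open>\<theta>\<^sub>i\<^sub>1 \<cdots> \<theta>\<^sub>i\<^sub>k\<close>, where \<open>I = {i\<^sub>1 < \<cdots> < i\<^sub>k}\<close>.
  The algebra product is \<open>\<star>\<close> below, and not the componentwise product of vectors; the vector
  scaling \<open>p *s \<omega>\<close> is the multiplication of a form by a polynomial.\<close>

type_synonym 'n form = "('n mpoly, 'n set) vec"

definition K_forms :: "complex set \<Rightarrow> 'n::finite form set" where
  "K_forms K = {\<omega>. \<forall>I. \<omega> $ I \<in> K_polys K}"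

text \<open>The sign with \<open>\<theta>\<^sub>I \<theta>\<^sub>J = theta_sign I J \<theta>\<^bsub>I \<union> J\<^esub>\<close> for disjoint \<open>I\<close> and \<open>J\<close>: it counts the
  inversions.\<close>

definition theta_sign :: "'n::linorder set \<Rightarrow> 'n set \<Rightarrow> 'n mpoly" where
  "theta_sign I J = (- 1) ^ card {(i, j). i \<in> I \<and> j \<in> J \<and> j < i}"

definition form_mult ::
  "'n::{finite,linorder} form \<Rightarrow> 'n form \<Rightarrow> 'n form"  (infixl "\<star>" 70) where
  "\<omega> \<star> \<eta> = (\<chi> L. \<Sum>I\<in>Pow L. theta_sign I (L - I) * (\<omega> $ I) * (\<eta> $ (L - I)))"

definition of_poly :: "'n::finite mpoly \<Rightarrow> 'n form" where
  "of_poly p = (\<chi> I. if I = {} then p else 0)"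

definition theta :: "'n::finite \<Rightarrow> 'n form" where
  "theta i = (\<chi> I. if I = {i} then 1 else 0)"

definition form_scale :: "complex \<Rightarrow> 'n::finite form \<Rightarrow> 'n form" where
  "form_scale c \<omega> = Const c *s \<omega>"

definition bihomog :: "nat \<Rightarrow> nat \<Rightarrow> 'n::finite form \<Rightarrow> bool" where
  "bihomog a b \<omega> \<longleftrightarrow> (\<forall>I. \<omega> $ I \<noteq> 0 \<longrightarrow> homog a (\<omega> $ I) \<and> card I = b)"

definition act_theta :: "'n cmat \<Rightarrow> 'n::finite \<Rightarrow> 'n form" where
  "act_theta s j = (\<Sum>i\<in>UNIV. form_scale (cnj (s $ i $ j)) (theta i))"

definition act :: "'n cmat \<Rightarrow> 'n::{finite,linorder} form \<Rightarrow> 'n form" where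
  "act s \<omega> = (\<Sum>I\<in>UNIV. act_poly s (\<omega> $ I) *s
     foldr (\<star>) (map (act_theta s) (sorted_list_of_set I)) (of_poly 1))"

definition dx :: "'n \<Rightarrow> 'n::finite form \<Rightarrow> 'n form" where
  "dx i \<omega> = (\<chi> I. pdx i (\<omega> $ I))"

definition dtheta :: "'n \<Rightarrow> 'n::{finite,linorder} form \<Rightarrow> 'n form" where
  "dtheta i \<omega> = (\<chi> I. if i \<in> I then 0 else (- 1) ^ card {j \<in> I. j < i} * \<omega> $ (insert i I))"

definition dx_monom :: "('n \<Rightarrow>\<^sub>0 nat) \<Rightarrow> 'n::{finite,linorder} form \<Rightarrow> 'n form" where
  "dx_monom \<alpha> = foldr (\<lambda>i. (\<circ>) (dx i ^^ Poly_Mapping.lookup \<alpha> i)) (sorted_list_of_set UNIV) id"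

text \<open>\<open>fold\<close> applies \<open>dtheta i\<^sub>1\<close> first, so that it computes \<open>\<partial>\<^sub>\<theta>\<^sub>i\<^sub>k \<cdots> \<partial>\<^sub>\<theta>\<^sub>i\<^sub>1\<close>.\<close>

definition dform :: "'n::{finite,linorder} form \<Rightarrow> 'n form \<Rightarrow> 'n form" where
  "dform \<omega> \<eta> = (\<Sum>I\<in>UNIV. \<Sum>\<alpha>\<in>Poly_Mapping.keys (\<omega> $ I).
     form_scale (cnj (Poly_Mapping.lookup (\<omega> $ I) \<alpha>))
       (dx_monom \<alpha> (fold dtheta (sorted_list_of_set I) \<eta>)))"


section \<open>Super harmonics\<close>

inductive_set super_ideal :: "complex set \<Rightarrow> 'n::{finite,linorder} form set \<Rightarrow> 'n form set"
  for K S where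
  zero: "0 \<in> super_ideal K S"
| gen: "\<omega> \<in> S \<Longrightarrow> \<omega> \<in> super_ideal K S"
| add: "\<omega> \<in> super_ideal K S \<Longrightarrow> \<eta> \<in> super_ideal K S \<Longrightarrow> \<omega> + \<eta> \<in> super_ideal K S"
| mult_left: "\<eta> \<in> K_forms K \<Longrightarrow> \<omega> \<in> super_ideal K S \<Longrightarrow> \<eta> \<star> \<omega> \<in> super_ideal K S"
| mult_right: "\<eta> \<in> K_forms K \<Longrightarrow> \<omega> \<in> super_ideal K S \<Longrightarrow> \<omega> \<star> \<eta> \<in> super_ideal K S"

definition J_ideal ::
  "complex set \<Rightarrow> 'n cmat set \<Rightarrow> 'n::{finite,linorder} form set" where
  "J_ideal K G = super_ideal K
     {\<omega> \<in> K_forms K. (\<forall>s\<in>G. act s \<omega> = \<omega>) \<and> (\<exists>a b. a + b > 0 \<and> bihomog a b \<omega>)}"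

definition SH :: "complex set \<Rightarrow> 'n cmat set \<Rightarrow> 'n::{finite,linorder} form set" where
  "SH K G = {\<eta> \<in> K_forms K. \<forall>\<omega>\<in>J_ideal K G. dform \<omega> \<eta> = 0}"

definition SH_det ::
  "complex set \<Rightarrow> 'n cmat set \<Rightarrow> 'n::{finite,linorder} form set" where
  "SH_det K G = {\<eta> \<in> SH K G. \<forall>s\<in>G. act s \<eta> = form_scale (det s) \<eta>}"

definition harmonic_polys ::
  "complex set \<Rightarrow> 'n cmat set \<Rightarrow> 'n::{finite,linorder} mpoly set" where
  "harmonic_polys K G = {p. of_poly p \<in> SH K G}"

definition vandermondian ::
  "complex set \<Rightarrow> 'n cmat set \<Rightarrow> 'n::{finite,linorder} mpoly \<Rightarrow> bool" where
  "vandermondian K G \<Delta> \<longleftrightarrow> \<Delta> \<noteq> 0 \<and>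
     (\<exists>N. {p \<in> harmonic_polys K G. homog N p} = {Const c * \<Delta> | c. c \<in> K} \<and>
          (\<forall>a>N. {p \<in> harmonic_polys K G. homog a p} = {0}))"


section \<open>Generalized exterior derivatives\<close>

text \<open>The algebra generated by the \<open>\<partial>\<^sub>x\<^sub>i\<close> and by left multiplication with the \<open>\<theta>\<^sub>i\<close>.\<close>

inductive_set diff_ops :: "complex set \<Rightarrow> ('n::{finite,linorder} form \<Rightarrow> 'n form) set"
  for K where
  scalar: "c \<in> K \<Longrightarrow> form_scale c \<in> diff_ops K"
| dx: "dx i \<in> diff_ops K"
| theta: "(\<star>) (theta i) \<in> diff_ops K"
| add: "D \<in> diff_ops K \<Longrightarrow> E \<in> diff_ops K \<Longrightarrow> D + E \<in> diff_ops K"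
| comp: "D \<in> diff_ops K \<Longrightarrow> E \<in> diff_ops K \<Longrightarrow> D \<circ> E \<in> diff_ops K"

definition equivariant_ops ::
  "complex set \<Rightarrow> 'n cmat set \<Rightarrow> ('n::{finite,linorder} form \<Rightarrow> 'n form) set" where
  "equivariant_ops K G =
     {D \<in> diff_ops K. \<forall>s\<in>G. \<forall>\<eta>\<in>K_forms K. D (act s \<eta>) = act s (D \<eta>)}"

text \<open>Bi-homogeneous operators lowering the \<open>x\<close>-degree by \<open>e\<close> and raising the \<open>\<theta>\<close>-degree by 1.\<close>

definition op_bidegree ::
  "complex set \<Rightarrow> nat \<Rightarrow> ('n::{finite,linorder} form \<Rightarrow> 'n form) \<Rightarrow> bool" where
  "op_bidegree K e D \<longleftrightarrow> (\<forall>a b. \<forall>\<eta>\<in>K_forms K. bihomog a b \<eta> \<longrightarrow>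
     (if e \<le> a then bihomog (a - e) (b + 1) (D \<eta>) else D \<eta> = 0))"

definition op_scale :: "complex \<Rightarrow> ('n::finite form \<Rightarrow> 'n form) \<Rightarrow> 'n form \<Rightarrow> 'n form" where
  "op_scale c D = (\<lambda>\<eta>. form_scale c (D \<eta>))"

definition op_product :: "(nat \<Rightarrow> 'n::finite form \<Rightarrow> 'n form) \<Rightarrow> nat list \<Rightarrow> 'n form \<Rightarrow> 'n form" where
  "op_product d is = foldr (\<lambda>i. (\<circ>) (d i)) is id"

definition invariant_dop ::
  "('n \<Rightarrow> 'n mpoly) \<Rightarrow> ('n \<Rightarrow> nat) \<Rightarrow> 'n::{finite,linorder} form \<Rightarrow> 'n form" where
  "invariant_dop f \<alpha> =
     foldr (\<lambda>i. (\<circ>) (dform (of_poly (f i)) ^^ \<alpha> i)) (sorted_list_of_set UNIV) id"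

text \<open>The operators \<open>d\<^sub>1, \<dots>, d\<^sub>n\<close> for \<open>n = CARD('n)\<close>, indexed so that exactly the first
  \<open>group_rank K G\<close> of them strictly lower the \<open>x\<close>-degree; values of \<open>d\<close> outside of \<open>{1..n}\<close> are
  irrelevant.\<close>

definition generalized_exterior_derivatives ::
  "complex set \<Rightarrow> 'n cmat set \<Rightarrow> ('n \<Rightarrow> 'n mpoly) \<Rightarrow>
   (nat \<Rightarrow> 'n::{finite,linorder} form \<Rightarrow> 'n form) \<Rightarrow> bool" where
  "generalized_exterior_derivatives K G f d \<longleftrightarrow>
     (\<forall>i\<in>{1..CARD('n)}. d i \<in> equivariant_ops K G \<and>
        (\<exists>e. op_bidegree K e (d i) \<and> (i \<le> group_rank K G \<longleftrightarrow> e > 0))) \<and>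
     K_basis op_scale K (UNIV \<times> Pow {1..CARD('n)})
       (\<lambda>(\<alpha>, I). invariant_dop f \<alpha> \<circ> op_product d (sorted_list_of_set I))
       (equivariant_ops K G)"

end

theory Submission
  imports Defs
begin

text \<open>A form is super harmonic if the operators \<open>\<partial>\<^sub>\<omega>\<close> of the invariant forms \<open>\<omega>\<close> of positive degree kill it. Left
  multiplication by \<open>\<omega>\<close> is adjoint to \<open>\<partial>\<^sub>\<omega>\<close> for a Hermitian inner product on forms, and super harmonics are stable
  under the derivatives \<open>\<partial>\<^sub>x\<^sub>i\<close>, under the group, and under the exterior derivative \<open>d\<close>, because \<open>d\<close> supercommutes with
  \<open>\<partial>\<^sub>\<omega>\<close> up to the operator of another invariant form (\<open>SH_exterior_op\<close>).

  The first equality. Invariant linear forms kill super harmonics, so only the directions complementary to the fixed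
  vectors matter, and in rank at most two all super harmonics of \<open>\<theta>\<close>-degree at least three vanish (\<open>three_form_zero\<close>).

  In \<open>\<theta>\<close>-degree zero, every harmonic polynomial is a combination of derivatives of determinantal ones
  (\<open>harmonic_det_span\<close>). By downward induction on the degree it suffices to treat a harmonic \<open>p\<close> such that every
  \<open>x\<^sub>i p\<close> lies in the ideal of the invariants; divided differences preserve this ideal, and the divided difference
  of \<open>\<alpha> p\<close> for a reflection \<open>s\<close> with root \<open>\<alpha>\<close> is a harmonic combination of \<open>p\<close> and \<open>s p\<close>. It vanishes, which says
  that \<open>s p = det(s) p\<close>.

  In \<open>\<theta>\<close>-degree one, a closed super harmonic is the differential of a harmonic polynomial (\<open>closed_one_form\<close>), so one only has to
  realize the two-forms \<open>d \<omega>\<close> as differentials of elements of the span (\<open>SH_eq_det_spanI\<close>). The groups enter through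
  the two-forms. For a real group, the operator of the invariant quadratic form forces the coefficients of a two-form
  to be constant, and constant two-forms are determinantal. For \<open>G(m,1,2)\<close> with \<open>m \<ge> 2\<close>, the invariant form
  \<open>\<Sum>\<^sub>i x\<^sub>i\<^sup>m\<^sup>-\<^sup>1 \<theta>\<^sub>i\<close> bounds the exponents, and all two-forms are derivatives of
  \<open>(x\<^sub>1 x\<^sub>2)\<^sup>m\<^sup>-\<^sup>2 \<theta>\<^sub>1 \<theta>\<^sub>2\<close>, which is determinantal. Together these give \<open>SH_eq_det_span\<close>.

  The second equality. The determinantal harmonic polynomials are the multiples of \<open>\<Delta>\<close> (\<open>det_harmonics_unique\<close>).
  For \<open>G(m,1,n)\<close> this is visible on exponents. For a real group, a determinantal polynomial \<open>P\<close> gives the equivariant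
  operator \<open>\<theta>\<^sub>1 \<cdots> \<theta>\<^sub>n \<partial>\<^sub>P\<close>, and the given basis of the equivariant operators shows that \<open>P\<close> is a multiple of one fixed
  polynomial modulo the ideal of the invariants, which contains no harmonic polynomial except zero. Consequently the
  components of a determinantal super harmonic \<open>\<eta>\<close> are derivatives of \<open>\<Delta>\<close>, so \<open>\<eta> = D \<Delta>\<close> for an operator \<open>D\<close> with
  constant coefficients. Averaging makes \<open>D\<close> equivariant, and its expansion in the basis writes \<open>\<eta>\<close> as a combination
  of the \<open>d\<^sub>I \<Delta>\<close> for \<open>I \<subseteq> {1..n}\<close> (\<open>SH_det_ext_prod_span\<close>). If \<open>I\<close> contains an index beyond the rank, then \<open>d\<^sub>I \<Delta>\<close> is a
  multiple of an invariant one-form and thus orthogonal to all super harmonics; the sum of these terms is itself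
  super harmonic, so it vanishes (\<open>SH_det_rank_span\<close>).\<close>

section \<open>Polynomials and their constant coefficient differential operators\<close>

abbreviation (input) coeff :: "'n mpoly \<Rightarrow> ('n \<Rightarrow>\<^sub>0 nat) \<Rightarrow> complex"
  where "coeff \<equiv> Poly_Mapping.lookup"

abbreviation (input) monomial :: "('n \<Rightarrow>\<^sub>0 nat) \<Rightarrow> complex \<Rightarrow> 'n mpoly"
  where "monomial \<equiv> Poly_Mapping.single"

abbreviation (input) expo :: "('n \<Rightarrow>\<^sub>0 nat) \<Rightarrow> 'n \<Rightarrow> nat"
  where "expo \<equiv> Poly_Mapping.lookup"

abbreviation (input) unit_expo :: "'n \<Rightarrow> ('n \<Rightarrow>\<^sub>0 nat)"
  where "unit_expo i \<equiv> Poly_Mapping.single i 1"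

lemma mpoly_as_sum: "p = (\<Sum>\<alpha>\<in>Poly_Mapping.keys p. monomial \<alpha> (coeff p \<alpha>))"
  by (rule poly_mapping_eqI) (auto simp: lookup_sum lookup_single when_def in_keys_iff)

lemma mpoly_induct [case_names monomial add]:
  assumes "\<And>\<alpha> c. P (monomial \<alpha> c)" and "\<And>p q. P p \<Longrightarrow> P q \<Longrightarrow> P (p + q)"
  shows "P (p :: 'n mpoly)"
proof -
  have "P (\<Sum>\<alpha>\<in>A. monomial \<alpha> (coeff p \<alpha>))" if "finite A" for A
    using that
  proof (induction A)
    case empty
    show ?case using assms(1)[of 0 0] by simp
  qed (simp add: assms)
  then show ?thesis by (subst mpoly_as_sum) simp
qed

lemma monomial_eq_Const_prod:
  fixes \<alpha> :: "'n::finite \<Rightarrow>\<^sub>0 nat"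
  shows "monomial \<alpha> c = Const c * (\<Prod>i\<in>UNIV. X i ^ expo \<alpha> i)"
proof -
  have pow: "X i ^ k = monomial (Poly_Mapping.single i k) 1" for i :: 'n and k
    by (induction k) (simp_all add: X_def mult_single single_add[symmetric] flip: single_one)
  have "(\<Prod>i\<in>A. monomial (f i) 1) = (monomial (\<Sum>i\<in>A. f i) 1 :: 'n mpoly)"
    if "finite A" for f and A :: "'n set"
    using that by (induction A) (simp_all add: mult_single flip: single_one)
  then have "(\<Prod>i\<in>UNIV. X i ^ expo \<alpha> i)
      = monomial (\<Sum>i\<in>UNIV. Poly_Mapping.single i (expo \<alpha> i)) 1"
    by (simp add: pow)
  also have "(\<Sum>i\<in>UNIV. Poly_Mapping.single i (expo \<alpha> i)) = \<alpha>"
    by (rule poly_mapping_eqI) (simp add: lookup_sum lookup_single when_def)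
  finally show ?thesis by (simp add: Const_def mult_single)
qed

lemma mpoly_induct_gen [case_names Const X add mult]:
  assumes "\<And>c. P (Const c)" and "\<And>i. P (X i)"
    and "\<And>p q. P p \<Longrightarrow> P q \<Longrightarrow> P (p + q)" and "\<And>p q. P p \<Longrightarrow> P q \<Longrightarrow> P (p * q)"
  shows "P (p :: 'n::finite mpoly)"
proof (induction p rule: mpoly_induct)
  case (monomial \<alpha> c)
  have one: "P 1" using assms(1)[of 1] by (simp add: Const_def)
  have pow: "P (X i ^ k)" for i k by (induction k) (auto simp: one intro: assms)
  have "P (\<Prod>i\<in>A. X i ^ expo \<alpha> i)" if "finite A" for A
    using that by (induction A) (auto simp: one intro: assms pow)
  then show ?case by (simp add: monomial_eq_Const_prod assms)
qed (rule assms)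

lemma Const_simps [simp]: "Const 0 = 0" "Const 1 = 1"
  by (simp_all add: Const_def)

lemma Const_add: "Const (a + b) = Const a + Const b"
  and Const_mult: "Const (a * b) = Const a * Const b"
  and Const_uminus: "Const (- a) = - Const a"
  and Const_diff: "Const (a - b) = Const a - Const b"
  by (simp_all add: Const_def single_add mult_single single_uminus single_diff)

lemma Const_sum: "Const (sum f A) = (\<Sum>i\<in>A. Const (f i))"
  by (induction A rule: infinite_finite_induct) (simp_all add: Const_add)

lemma Const_power: "Const (a ^ k) = Const a ^ k"
  by (induction k) (simp_all add: Const_mult)

lemma Const_eq_0_iff [simp]: "Const a = 0 \<longleftrightarrow> a = 0"
  unfolding Const_def by (metis lookup_single_eq lookup_zero single_zero)

lemma monomial_mult_Const: "Const c * monomial \<alpha> d = monomial \<alpha> (c * d)"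
  by (simp add: Const_def mult_single)

lemma coeff_Const_mult [simp]: "coeff (Const c * p) \<alpha> = c * coeff p \<alpha>"
  by (induction p rule: mpoly_induct)
    (simp_all add: monomial_mult_Const lookup_single when_def lookup_add algebra_simps)

definition hcomp :: "nat \<Rightarrow> 'n::finite mpoly \<Rightarrow> 'n mpoly" where
  "hcomp a p = (\<Sum>\<alpha>\<in>{\<alpha> \<in> Poly_Mapping.keys p. mdeg \<alpha> = a}. monomial \<alpha> (coeff p \<alpha>))"

lemma coeff_hcomp: "coeff (hcomp a p) \<alpha> = (if mdeg \<alpha> = a then coeff p \<alpha> else 0)"
  by (auto simp: hcomp_def lookup_sum lookup_single when_def in_keys_iff)

lemma mdeg_add: "mdeg (\<alpha> + \<beta>) = mdeg \<alpha> + mdeg \<beta>"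
  by (simp add: mdeg_def lookup_add sum.distrib)

lemma mdeg_0 [simp]: "mdeg 0 = 0"
  by (simp add: mdeg_def)

lemma mdeg_eq_0_iff: "mdeg \<alpha> = 0 \<longleftrightarrow> \<alpha> = 0"
  by (auto simp: mdeg_def poly_mapping_eq_iff fun_eq_iff)

lemma mdeg_unit [simp]: "mdeg (Poly_Mapping.single i k) = k"
  by (simp add: mdeg_def lookup_single when_def)

lemma homog_iff: "homog a p \<longleftrightarrow> (\<forall>\<alpha>. coeff p \<alpha> \<noteq> 0 \<longrightarrow> mdeg \<alpha> = a)"
  by (auto simp: homog_def in_keys_iff)

lemma homog_hcomp [simp]: "homog a (hcomp a p)"
  by (auto simp: homog_iff coeff_hcomp split: if_splits)

lemma homog_0 [simp]: "homog a 0"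
  by (simp add: homog_iff)

lemma homog_monomial [intro]: "mdeg \<alpha> = a \<Longrightarrow> homog a (monomial \<alpha> c)"
  by (simp add: homog_iff lookup_single when_def)

lemma homog_Const [simp]: "homog 0 (Const c)"
  by (simp add: Const_def homog_monomial)

lemma homog_1 [simp]: "homog 0 1"
  using homog_Const[of 1] by simp

lemma homog_X [simp]: "homog 1 (X i)"
  by (simp add: X_def homog_monomial)

lemma homog_add: "homog a p \<Longrightarrow> homog a q \<Longrightarrow> homog a (p + q)"
  by (auto simp: homog_iff lookup_add) (metis add_0_left)

lemma homog_sum: "(\<And>i. i \<in> A \<Longrightarrow> homog a (f i)) \<Longrightarrow> homog a (sum f A)"
  by (induction A rule: infinite_finite_induct) (auto intro: homog_add)

lemma homog_diff: "homog a p \<Longrightarrow> homog a q \<Longrightarrow> homog a (p - q)"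
  unfolding homog_iff lookup_minus by (metis diff_zero)

lemma homog_mult:
  assumes "homog a p" "homog b q"
  shows "homog (a + b) (p * q)"
proof -
  have "homog (a + b) (\<Sum>\<alpha>\<in>Poly_Mapping.keys p. \<Sum>\<beta>\<in>Poly_Mapping.keys q.
      monomial (\<alpha> + \<beta>) (coeff p \<alpha> * coeff q \<beta>))"
    using assms by (intro homog_sum homog_monomial) (auto simp: mdeg_add homog_def)
  also have "\<dots> = (\<Sum>\<alpha>\<in>Poly_Mapping.keys p. monomial \<alpha> (coeff p \<alpha>))
      * (\<Sum>\<beta>\<in>Poly_Mapping.keys q. monomial \<beta> (coeff q \<beta>))"
    by (simp add: sum_product mult_single)
  also have "\<dots> = p * q"
    by (simp flip: mpoly_as_sum)
  finally show ?thesis .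
qed

lemma homog_Const_mult [intro]: "homog a p \<Longrightarrow> homog a (Const c * p)"
  by (simp add: homog_iff)

lemma homog_power: "homog a p \<Longrightarrow> homog (a * k) (p ^ k)"
  by (induction k) (auto simp: intro: homog_mult)

lemma homog_prod: "(\<And>i. i \<in> A \<Longrightarrow> homog (a i) (f i)) \<Longrightarrow> homog (sum a A) (prod f A)"
  by (induction A rule: infinite_finite_induct) (auto intro: homog_mult)

lemma hcomp_homog: "homog a p \<Longrightarrow> hcomp b p = (if a = b then p else 0)"
  by (rule poly_mapping_eqI) (auto simp: coeff_hcomp homog_iff)

lemma hcomp_simps:
  "hcomp a 0 = 0" "hcomp a (p + q) = hcomp a p + hcomp a q" "hcomp a (Const c * p) = Const c * hcomp a p"
  by (rule poly_mapping_eqI; simp add: coeff_hcomp lookup_add)+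

lemma hcomp_sum: "hcomp a (sum f A) = (\<Sum>i\<in>A. hcomp a (f i))"
  by (induction A rule: infinite_finite_induct) (simp_all add: hcomp_simps)

text \<open>The zero makes the maximum defined for the zero polynomial.\<close>

definition deg_bound :: "'n::finite mpoly \<Rightarrow> nat" where
  "deg_bound p = Max (insert 0 (mdeg ` Poly_Mapping.keys p))"

lemma deg_bound: "coeff p \<alpha> \<noteq> 0 \<Longrightarrow> mdeg \<alpha> \<le> deg_bound p"
  unfolding deg_bound_def by (rule Max_ge) (auto simp: in_keys_iff)

lemma sum_hcomp:
  assumes "deg_bound p \<le> N"
  shows "(\<Sum>a\<le>N. hcomp a p) = p"
proof (rule poly_mapping_eqI)
  fix \<alpha>
  show "coeff (\<Sum>a\<le>N. hcomp a p) \<alpha> = coeff p \<alpha>"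
    using assms deg_bound[of p \<alpha>] by (cases "coeff p \<alpha> = 0") (auto simp: lookup_sum coeff_hcomp)
qed


subsection \<open>Partial derivatives\<close>

lemma coeff_pdx:
  "coeff (pdx i p) \<beta> = of_nat (expo \<beta> i + 1) * coeff p (\<beta> + unit_expo i)"
proof -
  have "coeff (pdx i p) \<beta> = (\<Sum>\<alpha>\<in>Poly_Mapping.keys p.
      if \<alpha> = \<beta> + unit_expo i then of_nat (expo \<beta> i + 1) * coeff p (\<beta> + unit_expo i) else 0)"
    unfolding pdx_def lookup_sum
  proof (rule sum.cong)
    fix \<alpha> assume "\<alpha> \<in> Poly_Mapping.keys p"
    have "\<alpha> - unit_expo i = \<beta> \<longleftrightarrow> \<alpha> = \<beta> + unit_expo i" if "expo \<alpha> i \<noteq> 0"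
    proof -
      have "\<alpha> - unit_expo i + unit_expo i = \<alpha>"
        using that by (intro poly_mapping_eqI) (auto simp: lookup_add lookup_minus lookup_single when_def)
      then show ?thesis by (metis add_diff_cancel_right')
    qed
    moreover have "\<alpha> \<noteq> \<beta> + unit_expo i" if "expo \<alpha> i = 0"
      using that by (auto simp: lookup_add)
    ultimately show "coeff (monomial (\<alpha> - unit_expo i) (of_nat (expo \<alpha> i) * coeff p \<alpha>)) \<beta>
      = (if \<alpha> = \<beta> + unit_expo i then of_nat (expo \<beta> i + 1) * coeff p (\<beta> + unit_expo i) else 0)"
      by (cases "expo \<alpha> i = 0") (auto simp: lookup_single when_def lookup_add)
  qed simp
  also have "\<dots> = of_nat (expo \<beta> i + 1) * coeff p (\<beta> + unit_expo i)"
    by (auto simp: in_keys_iff)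
  finally show ?thesis .
qed

lemma pdx_add: "pdx i (p + q) = pdx i p + pdx i q"
  by (rule poly_mapping_eqI) (simp add: coeff_pdx lookup_add algebra_simps)

lemma pdx_0 [simp]: "pdx i 0 = 0"
  by (rule poly_mapping_eqI) (simp add: coeff_pdx)

lemma pdx_Const_mult: "pdx i (Const c * p) = Const c * pdx i p"
  by (rule poly_mapping_eqI) (simp add: coeff_pdx)

lemma pdx_sum: "pdx i (sum f A) = (\<Sum>j\<in>A. pdx i (f j))"
  by (induction A rule: infinite_finite_induct) (simp_all add: pdx_add)

lemma pdx_monomial:
  "pdx i (monomial \<alpha> c) = monomial (\<alpha> - unit_expo i) (of_nat (expo \<alpha> i) * c)"
  by (cases "c = 0") (simp_all add: pdx_def)

lemma pdx_Const [simp]: "pdx i (Const c) = 0"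
  by (simp add: Const_def pdx_monomial)

lemma pdx_1 [simp]: "pdx i 1 = 0"
  using pdx_Const[of i 1] by simp

lemma pdx_X: "pdx i (X j) = (if i = j then 1 else 0)"
  by (auto simp: X_def pdx_monomial lookup_single when_def)

lemma pdx_mult: "pdx i (p * q) = pdx i p * q + p * pdx i q"
proof (induction p rule: mpoly_induct)
  case (monomial \<alpha> c)
  show ?case
  proof (induction q rule: mpoly_induct)
    case (monomial \<beta> d)
    have 1: "\<alpha> + \<beta> - unit_expo i = \<alpha> - unit_expo i + \<beta>" if "expo \<alpha> i \<noteq> 0"
      using that by (intro poly_mapping_eqI) (auto simp: lookup_add lookup_minus lookup_single when_def)
    have 2: "\<alpha> + \<beta> - unit_expo i = \<alpha> + (\<beta> - unit_expo i)" if "expo \<beta> i \<noteq> 0"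
      using that by (intro poly_mapping_eqI) (auto simp: lookup_add lookup_minus lookup_single when_def)
    show ?case
      using 1 2 by (cases "expo \<alpha> i = 0"; cases "expo \<beta> i = 0")
        (simp_all add: pdx_monomial mult_single lookup_add algebra_simps flip: single_add)
  qed (simp add: pdx_add distrib_left algebra_simps)
qed (simp add: pdx_add algebra_simps)

lemma homog_pdx: "homog (Suc a) p \<Longrightarrow> homog a (pdx i p)"
  by (auto simp: homog_iff coeff_pdx mdeg_add)

lemma euler_identity:
  assumes "homog a p"
  shows "(\<Sum>i\<in>UNIV. X i * pdx i p) = Const (of_nat a) * p"
proof -
  have mon: "(\<Sum>i\<in>UNIV. X i * pdx i (monomial \<alpha> c)) = Const (of_nat (mdeg \<alpha>)) * monomial \<alpha> c"
    for \<alpha> :: "'a \<Rightarrow>\<^sub>0 nat" and c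
  proof -
    have "X i * pdx i (monomial \<alpha> c) = Const (of_nat (expo \<alpha> i)) * monomial \<alpha> c" for i
    proof (cases "expo \<alpha> i = 0")
      case False
      then have "unit_expo i + (\<alpha> - unit_expo i) = \<alpha>"
        by (intro poly_mapping_eqI) (auto simp: lookup_add lookup_minus lookup_single when_def)
      then show ?thesis by (simp add: pdx_monomial X_def mult_single monomial_mult_Const)
    qed (simp add: pdx_monomial)
    then show ?thesis by (simp add: mdeg_def Const_sum sum_distrib_right)
  qed
  have "(\<Sum>i\<in>UNIV. X i * pdx i (\<Sum>\<alpha>\<in>Poly_Mapping.keys p. monomial \<alpha> (coeff p \<alpha>))) =
      (\<Sum>\<alpha>\<in>Poly_Mapping.keys p. \<Sum>i\<in>UNIV. X i * pdx i (monomial \<alpha> (coeff p \<alpha>)))"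
    unfolding pdx_sum sum_distrib_left by (rule sum.swap)
  also have "\<dots> = (\<Sum>\<alpha>\<in>Poly_Mapping.keys p. Const (of_nat a) * monomial \<alpha> (coeff p \<alpha>))"
    using assms by (intro sum.cong) (auto simp: mon homog_def)
  also have "\<dots> = Const (of_nat a) * (\<Sum>\<alpha>\<in>Poly_Mapping.keys p. monomial \<alpha> (coeff p \<alpha>))"
    by (rule sum_distrib_left[symmetric])
  finally show ?thesis by (simp flip: mpoly_as_sum)
qed


subsection \<open>The operator attached to a polynomial\<close>

definition pd_monom :: "('n \<Rightarrow>\<^sub>0 nat) \<Rightarrow> 'n::{finite,linorder} mpoly \<Rightarrow> 'n mpoly" where
  "pd_monom \<alpha> = foldr (\<lambda>i. (\<circ>) (pdx i ^^ expo \<alpha> i)) (sorted_list_of_set UNIV) id"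

text \<open>The polynomial \<open>p\<close> acts by the operator \<open>\<partial>\<^sub>p\<close>, conjugate linear in \<open>p\<close>.\<close>

definition pdop :: "'n mpoly \<Rightarrow> 'n::{finite,linorder} mpoly \<Rightarrow> 'n mpoly" where
  "pdop p q = (\<Sum>\<alpha>\<in>Poly_Mapping.keys p. Const (cnj (coeff p \<alpha>)) * pd_monom \<alpha> q)"

definition mfact :: "('n::finite \<Rightarrow>\<^sub>0 nat) \<Rightarrow> complex" where
  "mfact \<alpha> = (\<Prod>i\<in>UNIV. fact (expo \<alpha> i))"

lemma mfact_nonzero [simp]: "mfact \<alpha> \<noteq> 0"
  by (simp add: mfact_def)

lemma coeff_pdx_pow:
  "fact (expo \<beta> i) * coeff ((pdx i ^^ k) q) \<beta>
     = fact (expo \<beta> i + k) * coeff q (\<beta> + Poly_Mapping.single i k)"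
proof (induction k arbitrary: \<beta>)
  case (Suc k)
  have "fact (expo \<beta> i) * coeff ((pdx i ^^ Suc k) q) \<beta>
    = fact (expo (\<beta> + unit_expo i) i) * coeff ((pdx i ^^ k) q) (\<beta> + unit_expo i)"
    by (simp add: coeff_pdx lookup_add mult.assoc[symmetric] mult.commute)
  also have "\<dots> = fact (expo \<beta> i + Suc k) * coeff q (\<beta> + unit_expo i + Poly_Mapping.single i k)"
    by (subst Suc) (simp add: lookup_add)
  also have "\<beta> + unit_expo i + Poly_Mapping.single i k = \<beta> + Poly_Mapping.single i (Suc k)"
    by (simp add: add.assoc single_add[symmetric])
  finally show ?case .
qed simp

lemma coeff_pd_monom:
  "mfact \<beta> * coeff (pd_monom \<alpha> q) \<beta> = mfact (\<alpha> + \<beta>) * coeff q (\<alpha> + \<beta>)"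
proof -
  have "(\<Prod>i\<in>set l. fact (expo \<beta> i)) * coeff (foldr (\<lambda>i. (\<circ>) (pdx i ^^ expo \<alpha> i)) l id q) \<beta>
     = (\<Prod>i\<in>set l. fact (expo \<alpha> i + expo \<beta> i)) * coeff q (\<beta> + (\<Sum>i\<in>set l. Poly_Mapping.single i (expo \<alpha> i)))"
    if "distinct l" for l
    using that
  proof (induction l arbitrary: \<beta>)
    case (Cons i l)
    let ?b = "\<beta> + Poly_Mapping.single i (expo \<alpha> i)"
    let ?F = "foldr (\<lambda>i. (\<circ>) (pdx i ^^ expo \<alpha> i)) l id q"
    have b: "expo ?b j = expo \<beta> j" if "j \<in> set l" for j
      using that Cons.prems by (auto simp: lookup_add lookup_single when_def)
    have "(\<Prod>i\<in>set (i # l). fact (expo \<beta> i)) * coeff (foldr (\<lambda>i. (\<circ>) (pdx i ^^ expo \<alpha> i)) (i # l) id q) \<beta>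
      = (\<Prod>j\<in>set l. fact (expo \<beta> j)) * (fact (expo \<beta> i) * coeff ((pdx i ^^ expo \<alpha> i) ?F) \<beta>)"
      using Cons.prems by (simp add: mult.assoc mult.left_commute)
    also have "\<dots> = fact (expo \<alpha> i + expo \<beta> i) * ((\<Prod>j\<in>set l. fact (expo ?b j)) * coeff ?F ?b)"
      by (subst coeff_pdx_pow) (simp add: b add.commute mult.left_commute)
    also have "(\<Prod>j\<in>set l. fact (expo ?b j)) * coeff ?F ?b
      = (\<Prod>j\<in>set l. fact (expo \<alpha> j + expo ?b j)) * coeff q (?b + (\<Sum>i\<in>set l. Poly_Mapping.single i (expo \<alpha> i)))"
      by (rule Cons.IH) (use Cons.prems in simp)
    finally show ?case using Cons.prems by (simp add: b mult.assoc add.assoc)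
  qed simp
  from this[of "sorted_list_of_set UNIV"]
  have "mfact \<beta> * coeff (pd_monom \<alpha> q) \<beta> = mfact (\<alpha> + \<beta>) * coeff q (\<beta> + (\<Sum>i\<in>UNIV. Poly_Mapping.single i (expo \<alpha> i)))"
    by (simp add: pd_monom_def mfact_def lookup_add)
  also have "(\<Sum>i\<in>UNIV. Poly_Mapping.single i (expo \<alpha> i)) = \<alpha>"
    by (rule poly_mapping_eqI) (simp add: lookup_sum lookup_single when_def)
  finally show ?thesis by (simp add: add.commute)
qed

lemma coeff_pdop:
  "mfact \<beta> * coeff (pdop p q) \<beta>
     = (\<Sum>\<alpha>\<in>Poly_Mapping.keys p. cnj (coeff p \<alpha>) * (mfact (\<alpha> + \<beta>) * coeff q (\<alpha> + \<beta>)))"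
  by (simp add: pdop_def lookup_sum sum_distrib_left mult.left_commute[of "mfact \<beta>"] coeff_pd_monom)

lemma coeff_pdop_superset:
  assumes "finite A" "Poly_Mapping.keys p \<subseteq> A"
  shows "mfact \<beta> * coeff (pdop p q) \<beta>
     = (\<Sum>\<alpha>\<in>A. cnj (coeff p \<alpha>) * (mfact (\<alpha> + \<beta>) * coeff q (\<alpha> + \<beta>)))"
  unfolding coeff_pdop using assms
  by (intro sum.mono_neutral_left) (auto simp: in_keys_iff)

lemma mpoly_eqI_mfact:
  assumes "\<And>\<beta>. mfact \<beta> * coeff p \<beta> = mfact \<beta> * coeff q \<beta>"
  shows "p = q"
  using assms by (intro poly_mapping_eqI) simp

lemma coeff_pdop_monomial:
  "mfact \<beta> * coeff (pdop (monomial \<alpha> c) q) \<beta> = cnj c * (mfact (\<alpha> + \<beta>) * coeff q (\<alpha> + \<beta>))"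
  by (subst coeff_pdop_superset[of "{\<alpha>}"]) (auto simp: lookup_single)

lemma pdop_add_left: "pdop (p + p') q = pdop p q + pdop p' q"
proof (rule mpoly_eqI_mfact)
  fix \<beta>
  let ?A = "Poly_Mapping.keys p \<union> Poly_Mapping.keys p'"
  have "Poly_Mapping.keys (p + p') \<subseteq> ?A" by (rule keys_add)
  then show "mfact \<beta> * coeff (pdop (p + p') q) \<beta> = mfact \<beta> * coeff (pdop p q + pdop p' q) \<beta>"
    by (simp add: coeff_pdop_superset[of ?A] lookup_add distrib_left distrib_right sum.distrib)
qed

lemma pdop_0_left [simp]: "pdop 0 q = 0"
  by (simp add: pdop_def)

lemma pdop_sum_left: "pdop (sum f A) q = (\<Sum>i\<in>A. pdop (f i) q)"
  by (induction A rule: infinite_finite_induct) (simp_all add: pdop_add_left)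

lemma pdop_add_right: "pdop p (q + q') = pdop p q + pdop p q'"
  by (rule mpoly_eqI_mfact)
    (simp add: lookup_add distrib_left coeff_pdop sum.distrib)

lemma pdop_0_right [simp]: "pdop p 0 = 0"
  by (rule mpoly_eqI_mfact) (simp add: coeff_pdop)

lemma pdop_sum_right: "pdop p (sum f A) = (\<Sum>i\<in>A. pdop p (f i))"
  by (induction A rule: infinite_finite_induct) (simp_all add: pdop_add_right)

lemma pdop_Const_right: "pdop p (Const c * q) = Const c * pdop p q"
  by (rule mpoly_eqI_mfact)
    (simp add: mult.left_commute[of _ c] coeff_pdop sum_distrib_left)

lemma pdop_uminus_right: "pdop p (- q) = - pdop p q"
  using pdop_add_right[of p q "- q"] by (simp add: eq_neg_iff_add_eq_0 add.commute)

lemma pdop_diff_right: "pdop p (q - q') = pdop p q - pdop p q'"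
  using pdop_add_right[of p q "- q'"] by (simp add: pdop_uminus_right)

lemma pdop_mult: "pdop (p * p') q = pdop p (pdop p' q)"
proof (induction p rule: mpoly_induct)
  case (monomial \<alpha> c)
  show ?case
  proof (induction p' rule: mpoly_induct)
    case (monomial \<beta> d)
    show ?case
      by (rule mpoly_eqI_mfact) (simp add: mult_single coeff_pdop_monomial add_ac)
  qed (simp add: distrib_left pdop_add_left pdop_add_right)
qed (simp add: distrib_right pdop_add_left)

lemma pdop_commute: "pdop p (pdop p' q) = pdop p' (pdop p q)"
  by (simp add: mult.commute[of p p'] flip: pdop_mult)

lemma pdop_Const: "pdop (Const c) q = Const (cnj c) * q"
  by (rule mpoly_eqI_mfact) (subst coeff_Const_mult, simp add: Const_def coeff_pdop_monomial)

lemma pdop_1 [simp]: "pdop 1 q = q"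
  using pdop_Const[of 1 q] by simp

lemma pdop_Const_left: "pdop (Const c * p) q = Const (cnj c) * pdop p q"
  by (simp add: pdop_mult pdop_Const)

lemma mfact_unit: "mfact (unit_expo i + \<beta>) = of_nat (expo \<beta> i + 1) * mfact \<beta>"
proof -
  have "mfact (unit_expo i + \<beta>) = fact (expo (unit_expo i + \<beta>) i) * (\<Prod>j\<in>UNIV - {i}. fact (expo (unit_expo i + \<beta>) j))"
    unfolding mfact_def by (rule prod.remove) auto
  also have "(\<Prod>j\<in>UNIV - {i}. fact (expo (unit_expo i + \<beta>) j)) = (\<Prod>j\<in>UNIV - {i}. fact (expo \<beta> j) :: complex)"
    by (intro prod.cong) (auto simp: lookup_add lookup_single when_def)
  also have "fact (expo (unit_expo i + \<beta>) i) = (of_nat (expo \<beta> i + 1) * fact (expo \<beta> i) :: complex)"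
    by (simp add: lookup_add)
  also have "of_nat (expo \<beta> i + 1) * fact (expo \<beta> i) * (\<Prod>j\<in>UNIV - {i}. fact (expo \<beta> j)) = of_nat (expo \<beta> i + 1) * mfact \<beta>"
    unfolding mfact_def by (simp add: prod.remove[of UNIV i] mult.assoc)
  finally show ?thesis .
qed

lemma pdop_X: "pdop (X i) q = pdx i q"
proof (rule mpoly_eqI_mfact)
  fix \<beta>
  show "mfact \<beta> * coeff (pdop (X i) q) \<beta> = mfact \<beta> * coeff (pdx i q) \<beta>"
    unfolding X_def coeff_pdop_monomial mfact_unit coeff_pdx
    by (simp add: add.commute[of "Poly_Mapping.single i _" \<beta>])
qed

lemma pdop_pdx: "pdop p (pdx i q) = pdx i (pdop p q)"
  using pdop_commute[of p "X i" q] by (simp add: pdop_X)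

lemma pdop_homog:
  assumes "homog a p" "homog b q"
  shows "homog (b - a) (pdop p q)" "b < a \<Longrightarrow> pdop p q = 0"
proof -
  have *: "\<exists>\<alpha>. mdeg \<alpha> = a \<and> mdeg (\<alpha> + \<beta>) = b" if "coeff (pdop p q) \<beta> \<noteq> 0" for \<beta>
  proof (rule ccontr)
    assume "\<not> ?thesis"
    then have "mfact \<beta> * coeff (pdop p q) \<beta> = 0"
      unfolding coeff_pdop using assms by (intro sum.neutral) (auto simp: homog_iff in_keys_iff)
    with that show False by simp
  qed
  then show "homog (b - a) (pdop p q)"
    by (fastforce simp: homog_iff mdeg_add)
  show "pdop p q = 0" if "b < a"
  proof (rule poly_mapping_eqI)
    fix \<beta>
    show "coeff (pdop p q) \<beta> = coeff 0 \<beta>"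
      using *[of \<beta>] that by (auto simp: mdeg_add)
  qed
qed

lemma pdop_hcomp:
  assumes "homog d p"
  shows "pdop p (hcomp (a + d) q) = hcomp a (pdop p q)"
proof (rule mpoly_eqI_mfact)
  fix \<beta>
  have "mfact \<beta> * coeff (pdop p (hcomp (a + d) q)) \<beta> =
    (\<Sum>\<alpha>\<in>Poly_Mapping.keys p. if mdeg \<beta> = a then cnj (coeff p \<alpha>) * (mfact (\<alpha> + \<beta>) * coeff q (\<alpha> + \<beta>)) else 0)"
    unfolding coeff_pdop using assms
    by (intro sum.cong) (auto simp: coeff_hcomp homog_def mdeg_add)
  also have "\<dots> = (if mdeg \<beta> = a then mfact \<beta> * coeff (pdop p q) \<beta> else 0)"
    by (auto simp: coeff_pdop)
  finally show "mfact \<beta> * coeff (pdop p (hcomp (a + d) q)) \<beta> = mfact \<beta> * coeff (hcomp a (pdop p q)) \<beta>"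
    by (simp add: coeff_hcomp)
qed

lemma pdop_hcomp_small:
  assumes "homog d p" "a < d"
  shows "pdop p (hcomp a q) = 0"
  using pdop_homog(2)[OF assms(1) homog_hcomp assms(2)] .

text \<open>These values recover all coefficients of \<open>p\<close> from its operator.\<close>

lemma coeff_0_pdop_monomial:
  fixes p :: "'n::{finite,linorder} mpoly"
  shows "coeff (pdop p (monomial \<alpha> 1)) 0 = cnj (coeff p \<alpha>) * mfact \<alpha>"
proof -
  have "mfact (0 :: 'n \<Rightarrow>\<^sub>0 nat) * coeff (pdop p (monomial \<alpha> 1)) 0 = (\<Sum>\<gamma>\<in>Poly_Mapping.keys p. if \<gamma> = \<alpha> then cnj (coeff p \<alpha>) * mfact \<alpha> else 0)"
    unfolding coeff_pdop[of 0] by (intro sum.cong) (auto simp: lookup_single when_def)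
  also have "\<dots> = cnj (coeff p \<alpha>) * mfact \<alpha>" by (auto simp: in_keys_iff)
  finally show ?thesis by (simp add: mfact_def)
qed

lemma X_power: "X i ^ k = monomial (Poly_Mapping.single i k) 1"
  by (induction k) (simp_all add: X_def mult_single single_add[symmetric] flip: single_one)

lemma expo_lt_of_pdop_X_power:
  assumes "pdop (X i ^ k) p = 0" "coeff p \<alpha> \<noteq> 0"
  shows "expo \<alpha> i < k"
proof (rule ccontr)
  assume le: "\<not> expo \<alpha> i < k"
  let ?e = "Poly_Mapping.single i k"
  have \<alpha>: "?e + (\<alpha> - ?e) = \<alpha>"
    using le by (intro poly_mapping_eqI) (auto simp: lookup_add lookup_minus lookup_single when_def)
  have "mfact (\<alpha> - ?e) * coeff (pdop (monomial ?e 1) p) (\<alpha> - ?e) = 0"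
    using assms(1) by (simp add: X_power)
  then have "mfact \<alpha> * coeff p \<alpha> = 0" unfolding coeff_pdop_monomial \<alpha> by simp
  then show False using assms(2) by simp
qed

lemma pdop_inject:
  assumes "\<And>\<alpha>. pdop p (monomial \<alpha> 1) = pdop p' (monomial \<alpha> 1)"
  shows "p = p'"
proof (rule poly_mapping_eqI)
  fix \<alpha>
  have "cnj (coeff p \<alpha>) * mfact \<alpha> = cnj (coeff p' \<alpha>) * mfact \<alpha>"
    using assms[of \<alpha>] coeff_0_pdop_monomial by metis
  then show "coeff p \<alpha> = coeff p' \<alpha>" by simp
qed


subsection \<open>Substitution and the action of matrices\<close>

definition mono_subst :: "('n \<Rightarrow> 'n mpoly) \<Rightarrow> ('n::finite \<Rightarrow>\<^sub>0 nat) \<Rightarrow> 'n mpoly" where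
  "mono_subst f \<alpha> = (\<Prod>j\<in>UNIV. f j ^ expo \<alpha> j)"

lemma mono_subst_add: "mono_subst f (\<alpha> + \<beta>) = mono_subst f \<alpha> * mono_subst f \<beta>"
  by (simp add: mono_subst_def lookup_add power_add prod.distrib)

lemma mono_subst_0 [simp]: "mono_subst f 0 = 1"
  by (simp add: mono_subst_def)

lemma mono_subst_unit: "mono_subst f (unit_expo i) = f i"
proof -
  have "mono_subst f (unit_expo i) = (\<Prod>j\<in>UNIV. if j = i then f i else 1)"
    unfolding mono_subst_def by (intro prod.cong) (auto simp: lookup_single when_def)
  then show ?thesis by simp
qed

lemma subst_superset:
  assumes "finite A" "Poly_Mapping.keys p \<subseteq> A"
  shows "subst f p = (\<Sum>\<alpha>\<in>A. Const (coeff p \<alpha>) * mono_subst f \<alpha>)"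
  unfolding subst_def mono_subst_def using assms
  by (intro sum.mono_neutral_left) (auto simp: in_keys_iff)

lemma subst_monomial: "subst f (monomial \<alpha> c) = Const c * mono_subst f \<alpha>"
  by (subst subst_superset[of "{\<alpha>}"]) (auto simp: lookup_single)

lemma subst_add: "subst f (p + q) = subst f p + subst f q"
proof -
  let ?A = "Poly_Mapping.keys p \<union> Poly_Mapping.keys q"
  have "Poly_Mapping.keys (p + q) \<subseteq> ?A" by (rule keys_add)
  then show ?thesis
    by (simp add: subst_superset[of ?A] lookup_add Const_add distrib_right sum.distrib)
qed

lemma subst_mult: "subst f (p * q) = subst f p * subst f q"
proof (induction p rule: mpoly_induct)
  case (monomial \<alpha> c)
  show ?case
    by (induction q rule: mpoly_induct)
      (simp_all add: mult_single subst_monomial Const_mult mono_subst_add subst_add distrib_left mult_ac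
        distrib_right)
qed (simp add: distrib_right subst_add)

lemma subst_Const [simp]: "subst f (Const c) = Const c"
  using subst_monomial[of f 0 c] by (simp add: Const_def)

lemma subst_X [simp]: "subst f (X i) = f i"
  using subst_monomial[of f "unit_expo i" 1] by (simp add: X_def mono_subst_unit[unfolded One_nat_def])

definition lin_poly :: "'n::finite cvec \<Rightarrow> 'n mpoly" where
  "lin_poly u = (\<Sum>i\<in>UNIV. Const (u $ i) * X i)"

lemma act_poly_X: "act_poly s (X j) = (\<Sum>i\<in>UNIV. Const (cnj (s $ i $ j)) * X i)"
  by (simp add: act_poly_def)

lemma act_poly_add: "act_poly s (p + q) = act_poly s p + act_poly s q"
  and act_poly_mult: "act_poly s (p * q) = act_poly s p * act_poly s q"
  and act_poly_Const [simp]: "act_poly s (Const c) = Const c"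
  by (simp_all add: act_poly_def subst_add subst_mult)

lemma act_poly_0 [simp]: "act_poly s 0 = 0"
  using act_poly_Const[of s 0] by simp

lemma act_poly_1 [simp]: "act_poly s 1 = 1"
  using act_poly_Const[of s 1] by simp

lemma act_poly_uminus: "act_poly s (- p) = - act_poly s p"
  using act_poly_add[of s p "- p"] by (simp add: eq_neg_iff_add_eq_0 add.commute)

lemma act_poly_diff: "act_poly s (p - q) = act_poly s p - act_poly s q"
  using act_poly_add[of s p "- q"] by (simp add: act_poly_uminus)

lemma act_poly_sum: "act_poly s (sum f A) = (\<Sum>i\<in>A. act_poly s (f i))"
  by (induction A rule: infinite_finite_induct) (simp_all add: act_poly_add)

lemma act_poly_prod: "act_poly s (prod f A) = (\<Prod>i\<in>A. act_poly s (f i))"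
  by (induction A rule: infinite_finite_induct) (simp_all add: act_poly_mult)

lemma act_poly_power: "act_poly s (p ^ k) = act_poly s p ^ k"
  by (induction k) (simp_all add: act_poly_mult)

lemma act_poly_compose: "act_poly s (act_poly t p) = act_poly (s ** t) p"
proof (induction p rule: mpoly_induct_gen)
  case (X j)
  have "act_poly s (act_poly t (X j))
      = (\<Sum>k\<in>UNIV. \<Sum>i\<in>UNIV. Const (cnj (s $ i $ k * t $ k $ j)) * X i)"
    by (simp add: act_poly_X act_poly_sum act_poly_mult sum_distrib_left Const_mult mult_ac)
  also have "\<dots> = act_poly (s ** t) (X j)"
    by (subst sum.swap)
      (simp add: act_poly_X matrix_matrix_mult_def Const_sum sum_distrib_right)
  finally show ?case .
qed (simp_all add: act_poly_add act_poly_mult)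

lemma act_poly_mat_1 [simp]: "act_poly (mat 1) p = p"
proof (induction p rule: mpoly_induct_gen)
  case (X j)
  have "act_poly (mat 1) (X j) = (\<Sum>i\<in>UNIV. if i = j then X i else 0)"
    unfolding act_poly_X by (intro sum.cong) (auto simp: mat_def)
  then show ?case by simp
qed (simp_all add: act_poly_add act_poly_mult)

lemma homog_act_poly:
  assumes "homog a p"
  shows "homog a (act_poly s p)"
proof -
  have *: "homog a (act_poly s (monomial \<alpha> c))" if "mdeg \<alpha> = a" for \<alpha> c
  proof -
    have "homog (1 * expo \<alpha> i) (act_poly s (X i) ^ expo \<alpha> i)" for i
      unfolding act_poly_X by (intro homog_power homog_sum homog_Const_mult homog_X)
    then have "homog (\<Sum>i\<in>UNIV. expo \<alpha> i) (\<Prod>i\<in>UNIV. act_poly s (X i) ^ expo \<alpha> i)"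
      by (intro homog_prod) simp
    then show ?thesis using that
      by (simp add: monomial_eq_Const_prod act_poly_mult act_poly_prod act_poly_power mdeg_def homog_Const_mult)
  qed
  have "act_poly s p = (\<Sum>\<alpha>\<in>Poly_Mapping.keys p. act_poly s (monomial \<alpha> (coeff p \<alpha>)))"
    by (subst mpoly_as_sum) (simp add: act_poly_sum)
  moreover have "homog a (act_poly s (monomial \<alpha> (coeff p \<alpha>)))" if "\<alpha> \<in> Poly_Mapping.keys p" for \<alpha>
    using that assms by (intro *) (auto simp: homog_def)
  ultimately show ?thesis by (simp add: homog_sum)
qed

text \<open>Both sides are derivations over the ring homomorphism \<open>act_poly s\<close>, and agree on the
  variables.\<close>

lemma pdx_act_poly:
  "pdx i (act_poly s p) = (\<Sum>j\<in>UNIV. Const (cnj (s $ i $ j)) * act_poly s (pdx j p))"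
proof (induction p rule: mpoly_induct_gen)
  case (Const c)
  then show ?case by simp
next
  case (X k)
  have "pdx i (act_poly s (X k)) = (\<Sum>j\<in>UNIV. if j = i then Const (cnj (s $ i $ k)) else 0)"
    unfolding act_poly_X pdx_sum pdx_Const_mult by (intro sum.cong) (auto simp: pdx_X)
  moreover have "(\<Sum>j\<in>UNIV. Const (cnj (s $ i $ j)) * act_poly s (pdx j (X k)))
      = (\<Sum>j\<in>UNIV. if j = k then Const (cnj (s $ i $ k)) else 0)"
    by (intro sum.cong) (auto simp: pdx_X)
  ultimately show ?case by simp
next
  case (add p q)
  then show ?case by (simp add: act_poly_add pdx_add distrib_left sum.distrib)
next
  case (mult p q)
  then show ?case
    by (simp add: act_poly_mult pdx_mult act_poly_add distrib_left sum.distrib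
        sum_distrib_left sum_distrib_right mult_ac)
qed

lemma unitary_columns:
  assumes "unitary_matrix s"
  shows "(\<Sum>i\<in>UNIV. s $ i $ k * cnj (s $ i $ j)) = (if k = j then 1 else 0)"
proof -
  have "(\<Sum>i\<in>UNIV. cnj (s $ i $ j) * s $ i $ k) = (conj_transpose s ** s) $ j $ k"
    by (simp add: matrix_matrix_mult_def conj_transpose_def)
  also have "\<dots> = (if k = j then 1 else 0)"
    using assms by (simp add: unitary_matrix_def mat_def)
  finally show ?thesis by (simp add: mult.commute)
qed

lemma act_poly_pdx:
  assumes "unitary_matrix s"
  shows "act_poly s (pdx k p) = (\<Sum>i\<in>UNIV. Const (s $ i $ k) * pdx i (act_poly s p))"
proof -
  have "(\<Sum>i\<in>UNIV. Const (s $ i $ k) * pdx i (act_poly s p))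
      = (\<Sum>i\<in>UNIV. \<Sum>j\<in>UNIV. Const (s $ i $ k * cnj (s $ i $ j)) * act_poly s (pdx j p))"
    by (simp add: pdx_act_poly sum_distrib_left Const_mult mult.assoc)
  also have "\<dots> = (\<Sum>j\<in>UNIV. Const (\<Sum>i\<in>UNIV. s $ i $ k * cnj (s $ i $ j)) * act_poly s (pdx j p))"
    by (subst sum.swap) (simp add: sum_distrib_right Const_sum)
  also have "\<dots> = (\<Sum>j\<in>UNIV. if j = k then act_poly s (pdx k p) else 0)"
    unfolding unitary_columns[OF assms] by (intro sum.cong) auto
  finally show ?thesis by simp
qed

lemma act_poly_pdop:
  assumes "unitary_matrix s"
  shows "act_poly s (pdop g p) = pdop (act_poly s g) (act_poly s p)"
proof (induction g arbitrary: p rule: mpoly_induct_gen)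
  case (X k)
  then show ?case
    by (simp add: pdop_X act_poly_pdx[OF assms] act_poly_X pdop_sum_left pdop_Const_left)
qed (simp_all add: pdop_Const pdop_add_left pdop_mult act_poly_add act_poly_mult)


subsection \<open>Polynomials over the subfield\<close>

lemma coeff_mult_closed:
  assumes "\<And>a b. a \<in> K \<Longrightarrow> b \<in> K \<Longrightarrow> a + b \<in> K \<and> a * b \<in> K" "0 \<in> K"
    and "p \<in> K_polys K" "q \<in> K_polys K"
  shows "p * q \<in> K_polys K"
proof -
  have sums: "sum f A \<in> K" if "\<And>i. i \<in> A \<Longrightarrow> f i \<in> K" for f and A :: "('a \<Rightarrow>\<^sub>0 nat) set"
    using that assms(1,2) by (induction A rule: infinite_finite_induct) auto
  have "coeff (p * q) \<gamma> \<in> K" for \<gamma>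
  proof -
    have "p * q = (\<Sum>\<alpha>\<in>Poly_Mapping.keys p. \<Sum>\<beta>\<in>Poly_Mapping.keys q.
      monomial (\<alpha> + \<beta>) (coeff p \<alpha> * coeff q \<beta>))"
      by (subst mpoly_as_sum[of p], subst mpoly_as_sum[of q]) (simp add: sum_product mult_single)
    moreover have "\<dots> \<in> K_polys K"
      using assms unfolding K_polys_def
      by (auto simp: lookup_sum lookup_single when_def intro!: sums)
    ultimately show ?thesis by (simp add: K_polys_def)
  qed
  then show ?thesis by (simp add: K_polys_def)
qed

locale subfield_conj =
  fixes K :: "complex set"
  assumes K: "conj_subfield K"
begin

lemma K_0 [simp, intro]: "0 \<in> K" and K_1 [simp, intro]: "1 \<in> K"
  and K_add [intro]: "a \<in> K \<Longrightarrow> b \<in> K \<Longrightarrow> a + b \<in> K"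
  and K_mult [intro]: "a \<in> K \<Longrightarrow> b \<in> K \<Longrightarrow> a * b \<in> K"
  and K_uminus [intro]: "a \<in> K \<Longrightarrow> - a \<in> K"
  and K_inverse [intro]: "a \<in> K \<Longrightarrow> inverse a \<in> K"
  and K_cnj [intro]: "a \<in> K \<Longrightarrow> cnj a \<in> K"
  using K by (auto simp: conj_subfield_def)

lemma K_diff [intro]: "a \<in> K \<Longrightarrow> b \<in> K \<Longrightarrow> a - b \<in> K"
  using K_add[of a "- b"] by auto

lemma K_divide [intro]: "a \<in> K \<Longrightarrow> b \<in> K \<Longrightarrow> a / b \<in> K"
  by (auto simp: divide_inverse)

lemma K_sum [intro]: "(\<And>i. i \<in> A \<Longrightarrow> f i \<in> K) \<Longrightarrow> sum f A \<in> K"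
  by (induction A rule: infinite_finite_induct) auto

lemma K_prod [intro]: "(\<And>i. i \<in> A \<Longrightarrow> f i \<in> K) \<Longrightarrow> prod f A \<in> K"
  by (induction A rule: infinite_finite_induct) auto

lemma K_of_nat [simp, intro]: "of_nat k \<in> K"
  by (induction k) auto

lemma K_mfact [simp, intro]: "mfact \<alpha> \<in> K"
  unfolding mfact_def by (metis K_of_nat K_prod of_nat_fact)

lemma K_polys_0 [simp, intro]: "0 \<in> K_polys K"
  and K_polys_Const [intro]: "c \<in> K \<Longrightarrow> Const c \<in> K_polys K"
  and K_polys_monomial [intro]: "c \<in> K \<Longrightarrow> monomial \<alpha> c \<in> K_polys K"
  and K_polys_X [simp, intro]: "X i \<in> K_polys K"
  and K_polys_add [intro]: "p \<in> K_polys K \<Longrightarrow> q \<in> K_polys K \<Longrightarrow> p + q \<in> K_polys K"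
  and K_polys_uminus [intro]: "p \<in> K_polys K \<Longrightarrow> - p \<in> K_polys K"
  and K_polys_diff [intro]: "p \<in> K_polys K \<Longrightarrow> q \<in> K_polys K \<Longrightarrow> p - q \<in> K_polys K"
  by (auto simp: K_polys_def Const_def X_def lookup_single when_def lookup_add lookup_minus)

lemma K_polys_coeff: "p \<in> K_polys K \<Longrightarrow> coeff p \<alpha> \<in> K"
  by (simp add: K_polys_def)

lemma K_polys_1 [simp, intro]: "1 \<in> K_polys K"
  using K_polys_Const[OF K_1] by simp

lemma K_polys_mult [intro]: "p \<in> K_polys K \<Longrightarrow> q \<in> K_polys K \<Longrightarrow> p * q \<in> K_polys K"
  by (rule coeff_mult_closed) auto

lemma K_polys_sum [intro]: "(\<And>i. i \<in> A \<Longrightarrow> f i \<in> K_polys K) \<Longrightarrow> sum f A \<in> K_polys K"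
  by (induction A rule: infinite_finite_induct) auto

lemma K_polys_prod [intro]: "(\<And>i. i \<in> A \<Longrightarrow> f i \<in> K_polys K) \<Longrightarrow> prod f A \<in> K_polys K"
  by (induction A rule: infinite_finite_induct) auto

lemma K_polys_power [intro]: "p \<in> K_polys K \<Longrightarrow> p ^ k \<in> K_polys K"
  by (induction k) auto

lemma K_polys_hcomp [intro]: "p \<in> K_polys K \<Longrightarrow> hcomp a p \<in> K_polys K"
  by (simp add: K_polys_def coeff_hcomp)

lemma K_polys_pdx [intro]: "p \<in> K_polys K \<Longrightarrow> pdx i p \<in> K_polys K"
  unfolding K_polys_def mem_Collect_eq coeff_pdx by blast

lemma K_polys_pdop [intro]:
  assumes "p \<in> K_polys K" "q \<in> K_polys K"
  shows "pdop p q \<in> K_polys K"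
proof -
  have "mfact \<beta> * coeff (pdop p q) \<beta> \<in> K" for \<beta>
    unfolding coeff_pdop using assms by (intro K_sum K_mult K_cnj) (auto simp: K_polys_def)
  then have "inverse (mfact \<beta>) * (mfact \<beta> * coeff (pdop p q) \<beta>) \<in> K" for \<beta>
    by blast
  then show ?thesis by (simp add: K_polys_def mult.assoc[symmetric])
qed

lemma K_polys_induct [consumes 1, case_names Const X add mult]:
  assumes "p \<in> K_polys K"
    and "\<And>c. c \<in> K \<Longrightarrow> P (Const c)" and "\<And>i. P (X i)"
    and "\<And>p q. p \<in> K_polys K \<Longrightarrow> q \<in> K_polys K \<Longrightarrow> P p \<Longrightarrow> P q \<Longrightarrow> P (p + q)"
    and "\<And>p q. p \<in> K_polys K \<Longrightarrow> q \<in> K_polys K \<Longrightarrow> P p \<Longrightarrow> P q \<Longrightarrow> P (p * q)"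
  shows "P (p :: 'n::finite mpoly)"
proof -
  let ?Q = "\<lambda>p. P p \<and> p \<in> K_polys K"
  have one: "?Q 1" using assms(2)[of 1] by auto
  have pow: "?Q (X i ^ k)" for i k by (induction k) (auto simp: one intro: assms)
  have prd: "?Q (\<Prod>i\<in>A. X i ^ expo \<alpha> i)" if "finite A" for A \<alpha>
    using that
  proof (induction A)
    case (insert i A)
    then show ?case using pow[of i "expo \<alpha> i"] by (auto intro: assms)
  qed (use one in simp)
  have mon: "?Q (monomial \<alpha> c)" if "c \<in> K" for \<alpha> c
    using prd[of UNIV \<alpha>] that by (auto simp: monomial_eq_Const_prod intro: assms)
  have "?Q (\<Sum>\<alpha>\<in>A. monomial \<alpha> (coeff p \<alpha>))" if "finite A" for A
    using that
  proof (induction A)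
    case empty
    show ?case using assms(2)[of 0] by auto
  next
    case (insert \<alpha> A)
    then show ?case using mon[of "coeff p \<alpha>" \<alpha>] assms(1) by (auto intro: assms K_polys_coeff)
  qed
  then show ?thesis by (subst mpoly_as_sum) simp
qed

lemma K_polys_act_poly [intro]:
  assumes "\<And>i j. s $ i $ j \<in> K" and "p \<in> K_polys K"
  shows "act_poly s p \<in> K_polys K"
  using assms(2)
proof (induction rule: K_polys_induct)
  case (X j)
  have "Const (cnj (s $ i $ j)) * X i \<in> K_polys K" for i
    by (intro K_polys_mult K_polys_Const K_cnj assms(1) K_polys_X)
  then show ?case unfolding act_poly_X by (intro K_polys_sum)
qed (auto simp: act_poly_add act_poly_mult)

end

section \<open>Differential forms\<close>

abbreviation (input) eps :: "'n::linorder \<Rightarrow> 'n set \<Rightarrow> 'n mpoly"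
  where "eps i L \<equiv> (- 1) ^ card {j \<in> L. j < i}"

lemma form_scale_component [simp]: "form_scale c \<omega> $ I = Const c * \<omega> $ I"
  by (simp add: form_scale_def)

lemma form_scale_simps [simp]:
  "form_scale c 0 = 0" "form_scale 0 \<omega> = 0" "form_scale 1 \<omega> = \<omega>"
  by (simp_all add: vec_eq_iff)

lemma form_scale_add: "form_scale c (\<omega> + \<eta>) = form_scale c \<omega> + form_scale c \<eta>"
  by (simp add: vec_eq_iff distrib_left)

lemma form_scale_add_left: "form_scale (c + d) \<omega> = form_scale c \<omega> + form_scale d \<omega>"
  by (simp add: vec_eq_iff distrib_right Const_add)

lemma form_scale_scale: "form_scale c (form_scale d \<omega>) = form_scale (c * d) \<omega>"
  by (simp add: vec_eq_iff Const_mult mult_ac)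

lemma form_scale_minus_one: "form_scale (- 1) \<omega> = - \<omega>"
  by (simp add: vec_eq_iff Const_uminus)

lemma form_scale_uminus: "form_scale (- c) \<omega> = - form_scale c \<omega>" "form_scale c (- \<omega>) = - form_scale c \<omega>"
  by (simp_all add: vec_eq_iff Const_uminus)

lemma form_eq_neg:
  assumes "\<omega> = - \<omega>"
  shows "\<omega> = (0 :: 'n::finite form)"
proof -
  have 0: "\<omega> + \<omega> = 0" by (rule eq_neg_iff_add_eq_0[THEN iffD1, OF assms])
  have "2 * coeff (\<omega> $ L) \<alpha> = coeff ((\<omega> + \<omega>) $ L) \<alpha>" for L \<alpha>
    by (simp only: vector_add_component lookup_add mult_2)
  then have "coeff (\<omega> $ L) \<alpha> = 0" for L \<alpha> by (simp add: 0)
  then show ?thesis by (simp add: vec_eq_iff poly_mapping_eq_iff fun_eq_iff)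
qed

lemma form_scale_sum: "form_scale c (sum f A) = (\<Sum>i\<in>A. form_scale c (f i))"
  by (induction A rule: infinite_finite_induct) (simp_all add: form_scale_add)

lemma form_scale_sum_left: "form_scale (sum c A) \<omega> = (\<Sum>i\<in>A. form_scale (c i) \<omega>)"
  by (induction A rule: infinite_finite_induct) (simp_all add: form_scale_add_left)

lemma vector_space_form: "vector_space form_scale"
  by standard (simp_all add: form_scale_add form_scale_add_left form_scale_scale)

lemma of_poly_component: "of_poly p $ I = (if I = {} then p else 0)"
  by (simp add: of_poly_def)

lemma of_poly_add: "of_poly (p + q) = of_poly p + of_poly q"
  and of_poly_0 [simp]: "of_poly 0 = 0"
  and of_poly_Const: "of_poly (Const c * p) = form_scale c (of_poly p)"
  by (simp_all add: vec_eq_iff of_poly_component)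

lemma of_poly_sum: "of_poly (sum f A) = (\<Sum>i\<in>A. of_poly (f i))"
  by (induction A rule: infinite_finite_induct) (simp_all add: of_poly_add)

lemma of_poly_eq_iff: "of_poly p = of_poly q \<longleftrightarrow> p = q"
  by (auto simp: vec_eq_iff of_poly_component)


subsection \<open>Signs\<close>

lemma theta_sign_as_Const: "theta_sign I J = Const ((- 1) ^ card {(i, j). i \<in> I \<and> j \<in> J \<and> j < i})"
  by (simp add: theta_sign_def Const_power Const_uminus)

lemma theta_sign_union_left:
  fixes I I' J :: "'n::{finite,linorder} set"
  assumes "I \<inter> I' = {}"
  shows "theta_sign (I \<union> I') J = theta_sign I J * theta_sign I' J"
proof -
  have "{(i, j). i \<in> I \<union> I' \<and> j \<in> J \<and> j < i}
      = {(i, j). i \<in> I \<and> j \<in> J \<and> j < i} \<union> {(i, j). i \<in> I' \<and> j \<in> J \<and> j < i}" by auto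
  then show ?thesis using assms
    by (simp add: theta_sign_def power_add[symmetric]) (subst card_Un_disjoint; auto)
qed

lemma theta_sign_union_right:
  fixes I J J' :: "'n::{finite,linorder} set"
  assumes "J \<inter> J' = {}"
  shows "theta_sign I (J \<union> J') = theta_sign I J * theta_sign I J'"
proof -
  have "{(i, j). i \<in> I \<and> j \<in> J \<union> J' \<and> j < i}
      = {(i, j). i \<in> I \<and> j \<in> J \<and> j < i} \<union> {(i, j). i \<in> I \<and> j \<in> J' \<and> j < i}" by auto
  then show ?thesis using assms
    by (simp add: theta_sign_def power_add[symmetric]) (subst card_Un_disjoint; auto)
qed

lemma theta_sign_empty [simp]: "theta_sign {} J = 1" "theta_sign I {} = 1"
  by (simp_all add: theta_sign_def)

lemma theta_sign_singleton: "theta_sign {i} J = eps i J"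
proof -
  have "{(k, j). k \<in> {i} \<and> j \<in> J \<and> j < k} = Pair i ` {j \<in> J. j < i}" by auto
  then show ?thesis by (simp add: theta_sign_def card_image inj_on_def)
qed

lemma theta_sign_swap:
  fixes I :: "'n::{finite,linorder} set"
  assumes "i \<notin> I"
  shows "theta_sign I {i} = (- 1) ^ card I * theta_sign {i} I"
proof -
  have "{(k, j). k \<in> I \<and> j \<in> {i} \<and> j < k} = (\<lambda>k. (k, i)) ` {k \<in> I. i < k}" by auto
  then have 1: "theta_sign I {i} = (- 1) ^ card {k \<in> I. i < k}"
    by (simp add: theta_sign_def card_image inj_on_def)
  have "card ({k \<in> I. i < k} \<union> {k \<in> I. k < i}) = card {k \<in> I. i < k} + card {k \<in> I. k < i}"
    by (rule card_Un_disjoint) auto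
  moreover have "{k \<in> I. i < k} \<union> {k \<in> I. k < i} = I"
    using assms by (auto simp: not_less order.order_iff_strict)
  ultimately have "card I = card {k \<in> I. i < k} + card {k \<in> I. k < i}"
    by simp
  then have "(- 1 :: 'n mpoly) ^ card I = (- 1) ^ card {k \<in> I. i < k} * (- 1) ^ card {k \<in> I. k < i}"
    by (simp add: power_add)
  moreover have "(- 1 :: 'n mpoly) ^ b * (- 1) ^ b = 1" for b
    by (simp add: power_add[symmetric] mult_2[symmetric])
  ultimately show ?thesis
    by (simp add: 1 theta_sign_singleton mult.assoc)
qed

lemma theta_sign_swap_singletons:
  fixes i j :: "'n::{finite,linorder}"
  assumes "i \<noteq> j"
  shows "theta_sign {i} {j} = - theta_sign {j} {i}"
  using theta_sign_swap[of i "{j}"] assms by simp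

lemma theta_sign_sq: "theta_sign I J * theta_sign I J = 1" "theta_sign I J * (theta_sign I J * p) = p"
  by (simp_all add: theta_sign_def)

lemma theta_sign_insert:
  fixes L :: "'n::{finite,linorder} set"
  assumes "j \<notin> L"
  shows "theta_sign {i} (insert j L) = theta_sign {i} {j} * theta_sign {i} L"
  using theta_sign_union_right[of "{j}" L "{i}"] assms by simp

lemma theta_sign_remove:
  fixes L :: "'n::{finite,linorder} set"
  shows "theta_sign {i} (L - {i}) = theta_sign {i} L" "theta_sign {i} (insert i L) = theta_sign {i} L"
proof -
  have "{j \<in> L - {i}. j < i} = {j \<in> L. j < i}" "{j \<in> insert i L. j < i} = {j \<in> L. j < i}" by auto
  then show "theta_sign {i} (L - {i}) = theta_sign {i} L" "theta_sign {i} (insert i L) = theta_sign {i} L"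
    by (simp_all only: theta_sign_singleton)
qed


subsection \<open>Components of products and contractions\<close>

lemma dtheta_component:
  "dtheta i \<omega> $ I = (if i \<in> I then 0 else theta_sign {i} I * \<omega> $ (insert i I))"
  by (simp add: dtheta_def theta_sign_singleton)

lemma form_mult_component:
  "(\<omega> \<star> \<eta>) $ L = (\<Sum>I\<in>Pow L. theta_sign I (L - I) * (\<omega> $ I) * (\<eta> $ (L - I)))"
  by (simp add: form_mult_def)

lemma theta_mult_component:
  "(theta i \<star> \<omega>) $ L = (if i \<in> L then theta_sign {i} L * \<omega> $ (L - {i}) else 0)"
proof -
  have "(theta i \<star> \<omega>) $ L = (\<Sum>I\<in>Pow L. if I = {i} then theta_sign {i} (L - {i}) * \<omega> $ (L - {i}) else 0)"
    unfolding form_mult_component by (intro sum.cong) (auto simp: theta_def)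
  then show ?thesis by (simp add: theta_sign_remove)
qed

lemma mult_theta_component:
  "(\<omega> \<star> theta i) $ L = (if i \<in> L then theta_sign (L - {i}) {i} * \<omega> $ (L - {i}) else 0)"
proof -
  have "(\<omega> \<star> theta i) $ L = (\<Sum>I\<in>Pow L. if I = L - {i} then (if i \<in> L then theta_sign (L - {i}) {i} * \<omega> $ (L - {i}) else 0) else 0)"
    unfolding form_mult_component
  proof (intro sum.cong refl)
    fix I assume "I \<in> Pow L"
    then have "L - I = {i} \<longleftrightarrow> I = L - {i} \<and> i \<in> L" by auto
    then show "theta_sign I (L - I) * \<omega> $ I * theta i $ (L - I)
      = (if I = L - {i} then if i \<in> L then theta_sign (L - {i}) {i} * \<omega> $ (L - {i}) else 0 else 0)"
      by (auto simp: theta_def)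
  qed
  then show ?thesis by (simp only: sum.delta[OF finite] Pow_iff Diff_subset if_True)
qed

lemma of_poly_mult: "of_poly p \<star> \<omega> = p *s \<omega>"
proof -
  have "(of_poly p \<star> \<omega>) $ L = (\<Sum>I\<in>Pow L. if I = {} then p * \<omega> $ L else 0)" for L
    unfolding form_mult_component by (intro sum.cong) (auto simp: of_poly_component)
  then show ?thesis by (simp add: vec_eq_iff)
qed

lemma form_mult_add_left: "(\<omega> + \<omega>') \<star> \<eta> = \<omega> \<star> \<eta> + \<omega>' \<star> \<eta>"
  by (simp add: vec_eq_iff form_mult_component distrib_left distrib_right sum.distrib)

lemma form_mult_add_right: "\<omega> \<star> (\<eta> + \<eta>') = \<omega> \<star> \<eta> + \<omega> \<star> \<eta>'"
  by (simp add: vec_eq_iff form_mult_component distrib_left distrib_right sum.distrib)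

lemma form_mult_smult_left: "(p *s \<omega>) \<star> \<eta> = p *s (\<omega> \<star> \<eta>)"
  by (simp add: vec_eq_iff form_mult_component sum_distrib_left mult_ac)

lemma form_mult_smult_right: "\<omega> \<star> (p *s \<eta>) = p *s (\<omega> \<star> \<eta>)"
  by (simp add: vec_eq_iff form_mult_component sum_distrib_left mult_ac)

lemma form_mult_scale_left: "form_scale c \<omega> \<star> \<eta> = form_scale c (\<omega> \<star> \<eta>)"
  by (simp add: form_scale_def form_mult_smult_left)

lemma form_mult_scale_right: "\<omega> \<star> form_scale c \<eta> = form_scale c (\<omega> \<star> \<eta>)"
  by (simp add: form_scale_def form_mult_smult_right)

lemma form_mult_0 [simp]: "0 \<star> \<eta> = 0" "\<omega> \<star> 0 = 0"
  by (simp_all add: vec_eq_iff form_mult_component)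

lemma form_mult_uminus_right: "\<omega> \<star> (- \<eta>) = - (\<omega> \<star> \<eta>)"
  by (simp add: vec_eq_iff form_mult_component sum_negf)

lemma form_mult_sum_left: "sum f A \<star> \<eta> = (\<Sum>i\<in>A. f i \<star> \<eta>)"
  by (induction A rule: infinite_finite_induct) (simp_all add: form_mult_add_left)

lemma form_mult_sum_right: "\<omega> \<star> sum f A = (\<Sum>i\<in>A. \<omega> \<star> f i)"
  by (induction A rule: infinite_finite_induct) (simp_all add: form_mult_add_right)

lemma dtheta_add: "dtheta i (\<omega> + \<eta>) = dtheta i \<omega> + dtheta i \<eta>"
  and dtheta_0 [simp]: "dtheta i 0 = 0"
  and dtheta_smult: "dtheta i (p *s \<omega>) = p *s dtheta i \<omega>"
  and dtheta_scale: "dtheta i (form_scale c \<omega>) = form_scale c (dtheta i \<omega>)"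
  and dtheta_uminus: "dtheta i (- \<omega>) = - dtheta i \<omega>"
  by (auto simp: vec_eq_iff dtheta_component distrib_left mult_ac)

lemma dtheta_sum: "dtheta i (sum f A) = (\<Sum>j\<in>A. dtheta i (f j))"
  by (induction A rule: infinite_finite_induct) (simp_all add: dtheta_add)

lemma dx_component [simp]: "dx i \<omega> $ I = pdx i (\<omega> $ I)"
  by (simp add: dx_def)

lemma dx_add: "dx i (\<omega> + \<eta>) = dx i \<omega> + dx i \<eta>"
  and dx_0 [simp]: "dx i 0 = 0"
  and dx_scale: "dx i (form_scale c \<omega>) = form_scale c (dx i \<omega>)"
  by (simp_all add: vec_eq_iff pdx_add pdx_Const_mult)

lemma dx_sum: "dx i (sum f A) = (\<Sum>j\<in>A. dx i (f j))"
  by (induction A rule: infinite_finite_induct) (simp_all add: dx_add)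

lemma theta_sign_pdx: "pdx i (theta_sign I J * p) = theta_sign I J * pdx i p"
  by (simp add: theta_sign_as_Const pdx_Const_mult)

lemma dx_dtheta: "dx i (dtheta j \<omega>) = dtheta j (dx i \<omega>)"
  by (simp add: vec_eq_iff dtheta_component theta_sign_pdx)

lemma dx_theta: "dx i (theta j \<star> \<omega>) = theta j \<star> dx i \<omega>"
  by (simp add: vec_eq_iff theta_mult_component theta_sign_pdx)

lemma dtheta_anticommute: "dtheta i (dtheta j \<omega>) = - dtheta j (dtheta i \<omega>)"
proof (cases "i = j")
  case False
  show ?thesis
  proof (rule vec_eq_iff[THEN iffD2], rule allI)
    fix I
    show "dtheta i (dtheta j \<omega>) $ I = (- dtheta j (dtheta i \<omega>)) $ I"
    proof (cases "i \<in> I \<or> j \<in> I")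
      case nI: False
      then have "dtheta i (dtheta j \<omega>) $ I
          = theta_sign {i} I * (theta_sign {j} {i} * theta_sign {j} I * \<omega> $ (insert j (insert i I)))"
        "dtheta j (dtheta i \<omega>) $ I
          = theta_sign {j} I * (theta_sign {i} {j} * theta_sign {i} I * \<omega> $ (insert i (insert j I)))"
        using False by (simp_all add: dtheta_component theta_sign_insert[of i I j] theta_sign_insert[of j I i])
      then show ?thesis
        using theta_sign_swap_singletons[OF False] insert_commute[of i j I] by (simp add: mult_ac)
    qed (auto simp: dtheta_component)
  qed
qed (simp add: vec_eq_iff dtheta_component)

lemma theta_anticommute: "theta i \<star> (theta j \<star> \<omega>) = - (theta j \<star> (theta i \<star> \<omega>))"
proof (cases "i = j")
  case False
  show ?thesis
  proof (rule vec_eq_iff[THEN iffD2], rule allI)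
    fix L
    show "(theta i \<star> (theta j \<star> \<omega>)) $ L = (- (theta j \<star> (theta i \<star> \<omega>))) $ L"
    proof (cases "i \<in> L \<and> j \<in> L")
      case True
      define M where "M = L - {i} - {j}"
      have M: "i \<notin> M" "j \<notin> M" "L - {i} - {j} = M" "L - {j} - {i} = M"
        using True False by (auto simp: M_def)
      have L: "L = insert i (insert j M)" "L = insert j (insert i M)"
        "L - {i} = insert j M" "L - {j} = insert i M"
        using True False by (auto simp: M_def)
      have "theta_sign {i} L = theta_sign {i} {j} * theta_sign {i} M"
        unfolding L(1) by (simp add: theta_sign_remove theta_sign_insert[OF M(2)])
      moreover have "theta_sign {j} L = theta_sign {j} {i} * theta_sign {j} M"
        unfolding L(2) by (simp add: theta_sign_remove theta_sign_insert[OF M(1)])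
      moreover have "theta_sign {j} (L - {i}) = theta_sign {j} M" "theta_sign {i} (L - {j}) = theta_sign {i} M"
        by (simp_all only: L(3,4) theta_sign_remove)
      moreover have "(theta i \<star> (theta j \<star> \<omega>)) $ L = theta_sign {i} L * (theta_sign {j} (L - {i}) * \<omega> $ M)"
        "(theta j \<star> (theta i \<star> \<omega>)) $ L = theta_sign {j} L * (theta_sign {i} (L - {j}) * \<omega> $ M)"
        using True False by (simp_all add: theta_mult_component M)
      ultimately show ?thesis
        using theta_sign_swap_singletons[OF False] by (simp add: mult_ac)
    qed (auto simp: theta_mult_component)
  qed
qed (simp add: vec_eq_iff theta_mult_component)

lemma dtheta_theta:
  "dtheta i (theta j \<star> \<omega>) = (if i = j then \<omega> else 0) - theta j \<star> dtheta i \<omega>"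
proof (rule vec_eq_iff[THEN iffD2], rule allI)
  fix L
  show "dtheta i (theta j \<star> \<omega>) $ L = ((if i = j then \<omega> else 0) - theta j \<star> dtheta i \<omega>) $ L"
  proof (cases "i = j")
    case True
    then show ?thesis
      by (auto simp: dtheta_component theta_mult_component theta_sign_remove theta_sign_sq insert_absorb)
  next
    case False
    show ?thesis
    proof (cases "j \<in> L \<and> i \<notin> L")
      case True
      define M where "M = L - {j}"
      have M: "L = insert j M" "j \<notin> M" "i \<notin> M" using True by (auto simp: M_def)
      have M2: "insert i L - {j} = insert i M" "insert i L = insert j (insert i M)" using False M by auto
      have "theta_sign {i} L = theta_sign {i} {j} * theta_sign {i} M"
        unfolding M(1) by (simp add: theta_sign_insert[OF M(2)])
      moreover have "theta_sign {j} (insert i L) = theta_sign {j} {i} * theta_sign {j} M"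
        unfolding M2(2) by (simp add: theta_sign_remove theta_sign_insert[OF M(3)])
      moreover have "theta_sign {j} L = theta_sign {j} M"
        unfolding M(1) by (simp add: theta_sign_remove)
      moreover have "dtheta i (theta j \<star> \<omega>) $ L = theta_sign {i} L * (theta_sign {j} (insert i L) * \<omega> $ (insert i M))"
        "(theta j \<star> dtheta i \<omega>) $ L = theta_sign {j} L * (theta_sign {i} M * \<omega> $ (insert i M))"
        using True False M M2(1) by (simp_all add: theta_mult_component dtheta_component flip: M_def)
      ultimately show ?thesis
        using False theta_sign_swap_singletons[OF False] theta_sign_sq(1)[of "{j}" "{i}"]
        by (simp add: mult_ac)
    qed (use False in \<open>auto simp: dtheta_component theta_mult_component\<close>)
  qed
qed


subsection \<open>The operator attached to a form\<close>

lemma dx_monom_component: "dx_monom \<alpha> \<omega> $ I = pd_monom \<alpha> (\<omega> $ I)"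
proof -
  have pow: "(dx i ^^ k) \<eta> $ I = (pdx i ^^ k) (\<eta> $ I)" for i k and \<eta> :: "'a form"
    by (induction k) simp_all
  have "foldr (\<lambda>i. (\<circ>) (dx i ^^ expo \<alpha> i)) l id \<omega> $ I
      = foldr (\<lambda>i. (\<circ>) (pdx i ^^ expo \<alpha> i)) l id (\<omega> $ I)" for l
    by (induction l) (simp_all add: pow)
  then show ?thesis by (simp add: dx_monom_def pd_monom_def)
qed

lemma fold_dtheta_component:
  assumes "sorted l" "distinct l"
  shows "fold dtheta l \<eta> $ J = (if set l \<inter> J = {} then theta_sign (set l) J * \<eta> $ (set l \<union> J) else 0)"
  using assms
proof (induction l arbitrary: \<eta>)
  case (Cons i l)
  have i: "i < j" if "j \<in> set l" for j
    using Cons.prems that by (auto simp: order.order_iff_strict)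
  have eq: "theta_sign {i} (set l \<union> J) = theta_sign {i} J"
  proof -
    have "{j \<in> set l \<union> J. j < i} = {j \<in> J. j < i}" using i by force
    then show ?thesis by (simp only: theta_sign_singleton)
  qed
  have sgn: "theta_sign (insert i (set l)) J = theta_sign (set l) J * theta_sign {i} J"
    using Cons.prems theta_sign_union_left[of "{i}" "set l" J] by (simp add: mult.commute)
  show ?case
    using Cons by (auto simp: dtheta_component eq sgn mult.assoc)
qed simp

lemma dform_fold: "dform \<omega> \<eta> $ J
    = (\<Sum>I\<in>UNIV. pdop (\<omega> $ I) (fold dtheta (sorted_list_of_set I) \<eta> $ J))"
  by (simp add: dform_def pdop_def dx_monom_component)

lemma pdop_theta_sign:
  "pdop p (theta_sign I J * q) = theta_sign I J * pdop p q"
  "pdop (theta_sign I J * p) q = theta_sign I J * pdop p q"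
  "pdop (theta_sign I J) q = theta_sign I J * q"
  by (simp_all add: theta_sign_as_Const pdop_Const_right pdop_Const_left pdop_Const)

lemma dform_component:
  "dform \<omega> \<eta> $ J = (\<Sum>I\<in>Pow (- J). theta_sign I J * pdop (\<omega> $ I) (\<eta> $ (I \<union> J)))"
proof -
  have "dform \<omega> \<eta> $ J = (\<Sum>I\<in>UNIV. if I \<in> Pow (- J) then theta_sign I J * pdop (\<omega> $ I) (\<eta> $ (I \<union> J)) else 0)"
    unfolding dform_fold
    by (intro sum.cong refl) (auto simp: fold_dtheta_component pdop_theta_sign)
  then show ?thesis by (simp add: sum.If_cases Pow_def)
qed

lemma dform_add_left: "dform (\<omega> + \<omega>') \<eta> = dform \<omega> \<eta> + dform \<omega>' \<eta>"
  by (simp add: vec_eq_iff dform_component pdop_add_left distrib_left sum.distrib)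

lemma dform_add_right: "dform \<omega> (\<eta> + \<eta>') = dform \<omega> \<eta> + dform \<omega> \<eta>'"
  by (simp add: vec_eq_iff dform_component pdop_add_right distrib_left sum.distrib)

lemma dform_0 [simp]: "dform 0 \<eta> = 0" "dform \<omega> 0 = 0"
  by (simp_all add: vec_eq_iff dform_component)

lemma dform_scale_left: "dform (form_scale c \<omega>) \<eta> = form_scale (cnj c) (dform \<omega> \<eta>)"
  by (simp add: vec_eq_iff dform_component pdop_Const_left sum_distrib_left mult_ac)

lemma dform_scale_right: "dform \<omega> (form_scale c \<eta>) = form_scale c (dform \<omega> \<eta>)"
  by (simp add: vec_eq_iff dform_component pdop_Const_right sum_distrib_left mult_ac)

lemma dform_uminus_right: "dform \<omega> (- \<eta>) = - dform \<omega> \<eta>"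
  using dform_scale_right[of \<omega> "- 1" \<eta>] by (simp add: form_scale_minus_one)

lemma dform_uminus_left: "dform (- \<omega>) \<eta> = - dform \<omega> \<eta>"
  using dform_scale_left[of "- 1" \<omega> \<eta>] by (simp add: form_scale_minus_one)

lemma dform_diff_right: "dform \<omega> (\<eta> - \<eta>') = dform \<omega> \<eta> - dform \<omega> \<eta>'"
  using dform_add_right[of \<omega> \<eta> "- \<eta>'"] by (simp add: dform_uminus_right)

lemma dform_diff_left: "dform (\<omega> - \<omega>') \<eta> = dform \<omega> \<eta> - dform \<omega>' \<eta>"
  using dform_add_left[of \<omega> "- \<omega>'" \<eta>] by (simp add: dform_uminus_left)

lemma dform_sum_left: "dform (sum f A) \<eta> = (\<Sum>i\<in>A. dform (f i) \<eta>)"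
  by (induction A rule: infinite_finite_induct) (simp_all add: dform_add_left)

lemma dform_sum_right: "dform \<omega> (sum f A) = (\<Sum>i\<in>A. dform \<omega> (f i))"
  by (induction A rule: infinite_finite_induct) (simp_all add: dform_add_right)

lemma dform_of_poly_component [simp]: "dform (of_poly p) \<eta> $ J = pdop p (\<eta> $ J)"
proof -
  have "dform (of_poly p) \<eta> $ J = (\<Sum>I\<in>Pow (- J). if I = {} then pdop p (\<eta> $ J) else 0)"
    unfolding dform_component by (intro sum.cong) (auto simp: of_poly_component)
  then show ?thesis by simp
qed

lemma dform_of_poly_1 [simp]: "dform (of_poly 1) \<eta> = \<eta>"
  by (simp add: vec_eq_iff)

lemma dform_theta: "dform (theta i) \<eta> = dtheta i \<eta>"
proof -
  have "dform (theta i) \<eta> $ J = (\<Sum>I\<in>Pow (- J). if I = {i} then theta_sign {i} J * \<eta> $ (insert i J) else 0)" for J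
    unfolding dform_component by (intro sum.cong) (auto simp: theta_def)
  then show ?thesis by (simp add: vec_eq_iff dtheta_component)
qed

text \<open>The signs agree because each side counts the inversions of the three blocks \<open>I\<close>, \<open>I'\<close>, \<open>J\<close>
  of factors pairwise.\<close>

lemma dform_mult: "dform (\<omega> \<star> \<zeta>) \<eta> = dform \<zeta> (dform \<omega> \<eta>)"
proof (rule vec_eq_iff[THEN iffD2], rule allI)
  fix J :: "'a set"
  let ?A = "Sigma (Pow (- J)) Pow"
  let ?B = "Sigma (Pow (- J)) (\<lambda>I'. Pow (- (I' \<union> J)))"
  have "dform (\<omega> \<star> \<zeta>) \<eta> $ J = (\<Sum>L\<in>Pow (- J). \<Sum>I\<in>Pow L.
      theta_sign L J * theta_sign I (L - I) * pdop (\<omega> $ I) (pdop (\<zeta> $ (L - I)) (\<eta> $ (L \<union> J))))"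
    by (simp add: dform_component form_mult_component pdop_sum_left pdop_theta_sign pdop_mult
        sum_distrib_left mult.assoc)
  also have "\<dots> = (\<Sum>(L, I)\<in>?A.
      theta_sign L J * theta_sign I (L - I) * pdop (\<omega> $ I) (pdop (\<zeta> $ (L - I)) (\<eta> $ (L \<union> J))))"
    by (simp add: sum.Sigma)
  also have "\<dots> = (\<Sum>(I', I)\<in>?B.
      theta_sign I' J * theta_sign I (I' \<union> J) * pdop (\<zeta> $ I') (pdop (\<omega> $ I) (\<eta> $ (I \<union> (I' \<union> J)))))"
  proof (rule sum.reindex_bij_witness[where i = "\<lambda>(I', I). (I' \<union> I, I)" and j = "\<lambda>(L, I). (L - I, I)"];
      clarsimp)
    fix L I assume LI: "L \<subseteq> - J" "I \<subseteq> L"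
    define I' where "I' = L - I"
    have L: "L = I \<union> I'" "I \<inter> I' = {}" "I' \<inter> J = {}" using LI by (auto simp: I'_def)
    have "theta_sign L J * theta_sign I I' = theta_sign I' J * theta_sign I (I' \<union> J)"
      by (simp add: L(1) theta_sign_union_left[OF L(2)] theta_sign_union_right[OF L(3)] mult_ac)
    then show "theta_sign (L - I) J * theta_sign I (L - I \<union> J) *
        pdop (\<zeta> $ (L - I)) (pdop (\<omega> $ I) (\<eta> $ (I \<union> (L - I \<union> J))))
      = theta_sign L J * theta_sign I (L - I) * pdop (\<omega> $ I) (pdop (\<zeta> $ (L - I)) (\<eta> $ (L \<union> J)))"
      using LI by (simp add: I'_def pdop_commute[of "\<omega> $ I"] Un_assoc[symmetric] Un_absorb1)
  qed auto
  also have "\<dots> = dform \<zeta> (dform \<omega> \<eta>) $ J"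
    by (simp add: dform_component pdop_sum_right pdop_theta_sign sum_distrib_left mult.assoc sum.Sigma)
  finally show "dform (\<omega> \<star> \<zeta>) \<eta> $ J = dform \<zeta> (dform \<omega> \<eta>) $ J" .
qed

lemma dform_smult: "dform (p *s \<omega>) \<eta> = dform \<omega> (dform (of_poly p) \<eta>)"
  by (simp add: dform_mult flip: of_poly_mult)

lemma dform_of_poly_commute: "dform (of_poly p) (dform \<omega> \<eta>) = dform \<omega> (dform (of_poly p) \<eta>)"
  by (simp only: vec_eq_iff dform_of_poly_component dform_component[of \<omega>] pdop_sum_right
      pdop_theta_sign pdop_commute[of p]) simp

lemma dform_of_poly_add: "dform (of_poly (p + q)) \<eta> = dform (of_poly p) \<eta> + dform (of_poly q) \<eta>"
  by (simp add: of_poly_add dform_add_left)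

lemma dform_of_poly_mult: "dform (of_poly (p * q)) \<eta> = dform (of_poly p) (dform (of_poly q) \<eta>)"
  by (simp add: vec_eq_iff pdop_mult)

lemma dform_of_poly_theta: "dform (of_poly p) (theta i \<star> \<eta>) = theta i \<star> dform (of_poly p) \<eta>"
  by (simp add: vec_eq_iff theta_mult_component pdop_theta_sign)

lemma dform_of_poly_X: "dform (of_poly (X i)) \<eta> = dx i \<eta>"
  by (simp add: vec_eq_iff pdop_X)

lemma dform_of_poly_of_poly: "dform (of_poly p) (of_poly q) = of_poly (pdop p q)"
  by (simp add: vec_eq_iff of_poly_component)


subsection \<open>Exterior monomials\<close>

definition Theta :: "'n::{finite,linorder} list \<Rightarrow> 'n form" where
  "Theta l = foldr (\<star>) (map theta l) (of_poly 1)"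

lemma Theta_simps: "Theta [] = of_poly 1" "Theta (i # l) = theta i \<star> Theta l"
  by (simp_all add: Theta_def)

lemma Theta_sorted:
  assumes "sorted l" "distinct l"
  shows "Theta l $ L = (if L = set l then 1 else 0)"
  using assms
proof (induction l arbitrary: L)
  case (Cons i l)
  have i: "i < j" if "j \<in> set l" for j
    using Cons.prems that by (auto simp: order.order_iff_strict)
  have "theta_sign {i} (insert i (set l)) = 1"
  proof -
    have "{j \<in> insert i (set l). j < i} = {}" using i by force
    then show ?thesis by (simp only: theta_sign_singleton card.empty power_0)
  qed
  moreover have "L - {i} = set l \<and> i \<in> L \<longleftrightarrow> L = insert i (set l)"
    using Cons.prems by auto
  ultimately show ?case
    using Cons by (auto simp: Theta_simps theta_mult_component)
qed (simp add: Theta_simps of_poly_component)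

lemma form_as_sum: "\<omega> = (\<Sum>I\<in>UNIV. \<omega> $ I *s Theta (sorted_list_of_set I))"
proof (rule vec_eq_iff[THEN iffD2], rule allI)
  fix L
  have "(\<Sum>I\<in>UNIV. \<omega> $ I *s Theta (sorted_list_of_set I)) $ L = (\<Sum>I\<in>UNIV. if I = L then \<omega> $ L else 0)"
    unfolding sum_component vector_smult_component by (intro sum.cong refl) (auto simp: Theta_sorted)
  then show "\<omega> $ L = (\<Sum>I\<in>UNIV. \<omega> $ I *s Theta (sorted_list_of_set I)) $ L" by simp
qed

lemma form_induct [case_names one smult theta add]:
  assumes "P (of_poly 1)" and "\<And>p \<omega>. P \<omega> \<Longrightarrow> P (p *s \<omega>)"
    and "\<And>i \<omega>. P \<omega> \<Longrightarrow> P (theta i \<star> \<omega>)" and "\<And>\<omega> \<eta>. P \<omega> \<Longrightarrow> P \<eta> \<Longrightarrow> P (\<omega> + \<eta>)"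
  shows "P (\<omega> :: 'n::{finite,linorder} form)"
proof -
  have Th: "P (Theta l)" for l by (induction l) (auto simp: Theta_simps assms)
  have z: "P 0" using assms(2)[OF assms(1), of 0] by simp
  have "P (\<Sum>I\<in>A. \<omega> $ I *s Theta (sorted_list_of_set I))" if "finite A" for A
    using that by (induction A) (auto simp: z assms Th)
  from this[OF finite] show ?thesis by (subst form_as_sum)
qed


text \<open>The parity involution of the exterior algebra.\<close>

definition par :: "'n::finite form \<Rightarrow> 'n form" where
  "par \<omega> = (\<chi> I. (- 1) ^ card I * \<omega> $ I)"

lemma par_component [simp]: "par \<omega> $ I = (- 1) ^ card I * \<omega> $ I"
  by (simp add: par_def)

lemma par_simps: "par (\<omega> + \<eta>) = par \<omega> + par \<eta>" "par (p *s \<omega>) = p *s par \<omega>"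
  "par (of_poly p) = of_poly p"
  by (simp_all add: vec_eq_iff distrib_left mult_ac of_poly_component)

lemma par_theta: "par (theta i \<star> \<omega>) = - (theta i \<star> par \<omega>)"
proof -
  have "(- 1 :: 'a mpoly) ^ card L = - ((- 1) ^ card (L - {i}))" if "i \<in> L" for L
    using card.remove[OF finite that] by simp
  then show ?thesis by (auto simp: vec_eq_iff theta_mult_component mult_ac)
qed

lemma mult_theta: "\<omega> \<star> theta i = theta i \<star> par \<omega>"
  by (auto simp: vec_eq_iff mult_theta_component theta_mult_component theta_sign_swap theta_sign_remove mult_ac)

text \<open>The commutation rule \<open>\<partial>\<^sub>\<theta>\<^sub>j \<theta>\<^sub>k + \<theta>\<^sub>k \<partial>\<^sub>\<theta>\<^sub>j = \<delta>\<^sub>j\<^sub>k\<close>, extended multiplicatively to all of \<open>\<omega>\<close>: the sign of each exchange is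
  collected in the parity involution, and each contraction in the derivative \<open>\<partial>\<^sub>\<theta>\<^sub>j \<omega>\<close>.\<close>

lemma dform_theta_mult:
  "dform \<omega> (theta j \<star> \<eta>) = theta j \<star> dform (par \<omega>) \<eta> + dform (dtheta j \<omega>) \<eta>"
proof (induction \<omega> arbitrary: \<eta> rule: form_induct)
  case one
  have "dtheta j (of_poly 1) = (0 :: 'a form)" by (simp add: vec_eq_iff dtheta_component of_poly_component)
  then show ?case by (simp add: par_simps)
next
  case (smult p \<omega>)
  then show ?case by (simp add: dform_smult par_simps dtheta_smult dform_of_poly_theta)
next
  case (theta k \<omega>)
  have "dform (theta k \<star> \<omega>) (theta j \<star> \<eta>) = dform \<omega> (if k = j then \<eta> else 0)
      - (theta j \<star> dform (par \<omega>) (dtheta k \<eta>) + dform (dtheta j \<omega>) (dtheta k \<eta>))"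
    by (simp only: dform_mult dform_theta dtheta_theta dform_diff_right theta)
  moreover have "theta j \<star> dform (par (theta k \<star> \<omega>)) \<eta> = - (theta j \<star> dform (par \<omega>) (dtheta k \<eta>))"
    by (simp only: par_theta dform_uminus_left form_mult_uminus_right dform_mult dform_theta)
  moreover have "dform (dtheta j (theta k \<star> \<omega>)) \<eta>
      = dform (if j = k then \<omega> else 0) \<eta> - dform (dtheta j \<omega>) (dtheta k \<eta>)"
    by (simp only: dtheta_theta dform_diff_left dform_mult dform_theta)
  ultimately show ?case by (cases "j = k") simp_all
next
  case (add \<omega> \<omega>')
  have "dform (\<omega> + \<omega>') (theta j \<star> \<eta>) = (theta j \<star> dform (par \<omega>) \<eta> + dform (dtheta j \<omega>) \<eta>)
      + (theta j \<star> dform (par \<omega>') \<eta> + dform (dtheta j \<omega>') \<eta>)"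
    unfolding dform_add_left by (intro arg_cong2[where f = "(+)"] add.IH)
  moreover have "theta j \<star> dform (par (\<omega> + \<omega>')) \<eta> = theta j \<star> dform (par \<omega>) \<eta> + theta j \<star> dform (par \<omega>') \<eta>"
    unfolding par_simps(1) dform_add_left form_mult_add_right ..
  moreover have "dform (dtheta j (\<omega> + \<omega>')) \<eta> = dform (dtheta j \<omega>) \<eta> + dform (dtheta j \<omega>') \<eta>"
    unfolding dtheta_add dform_add_left ..
  ultimately show ?case by (simp only: add.assoc add.left_commute)
qed

lemma dform_dtheta: "dform \<omega> (dtheta i \<eta>) = dtheta i (dform (par \<omega>) \<eta>)"
proof -
  have "par (par \<omega>) = \<omega>"
    by (simp add: vec_eq_iff)
  then have "par \<omega> \<star> theta i = theta i \<star> \<omega>" by (simp add: mult_theta)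
  from arg_cong[where f = "\<lambda>\<zeta>. dform \<zeta> \<eta>", OF this] show ?thesis
    by (simp add: dform_mult dform_theta)
qed


subsection \<open>The Hermitian form\<close>

text \<open>The inner product for which multiplication by \<open>\<omega>\<close> is adjoint to \<open>\<partial>\<^sub>\<omega>\<close>; the monomial forms are orthogonal, and
  \<open>ppair\<close> is its restriction to polynomials.\<close>

definition pair :: "'n::{finite,linorder} form \<Rightarrow> 'n form \<Rightarrow> complex" where
  "pair \<omega> \<eta> = coeff (dform \<omega> \<eta> $ {}) 0"

definition ppair :: "'n::{finite,linorder} mpoly \<Rightarrow> 'n mpoly \<Rightarrow> complex" where
  "ppair p q = coeff (pdop p q) 0"

lemma mfact_0 [simp]: "mfact 0 = 1"
  by (simp add: mfact_def)

lemma ppair_eq: "ppair p q = (\<Sum>\<alpha>\<in>Poly_Mapping.keys p. cnj (coeff p \<alpha>) * mfact \<alpha> * coeff q \<alpha>)"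
  using coeff_pdop[of 0 p q] by (simp add: ppair_def mult.assoc)

lemma cnj_mfact [simp]: "cnj (mfact \<alpha>) = mfact \<alpha>"
  by (simp add: mfact_def)

lemma ppair_cnj: "ppair q p = cnj (ppair p q)"
proof -
  have *: "ppair p q = (\<Sum>\<alpha>\<in>Poly_Mapping.keys p \<union> Poly_Mapping.keys q. cnj (coeff p \<alpha>) * mfact \<alpha> * coeff q \<alpha>)"
    for p q :: "'a mpoly"
    unfolding ppair_eq by (rule sum.mono_neutral_left) (auto simp: in_keys_iff)
  show ?thesis by (simp add: * Un_commute mult_ac)
qed

lemma ppair_self:
  "ppair p p = of_real (\<Sum>\<alpha>\<in>Poly_Mapping.keys p. (\<Prod>i\<in>UNIV. fact (expo \<alpha> i)) * (cmod (coeff p \<alpha>))\<^sup>2)"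
  unfolding ppair_eq mfact_def
  by (simp add: complex_norm_square of_real_prod mult_ac del: of_real_power)

lemma ppair_self_nonneg: "0 \<le> Re (ppair p p)" "Im (ppair p p) = 0"
  unfolding ppair_self Re_complex_of_real Im_complex_of_real
  by (auto intro!: sum_nonneg mult_nonneg_nonneg prod_nonneg)

lemma ppair_self_eq_0: "Re (ppair p p) = 0 \<Longrightarrow> p = 0"
proof -
  assume "Re (ppair p p) = 0"
  then have "(\<Sum>\<alpha>\<in>Poly_Mapping.keys p. (\<Prod>i\<in>UNIV. fact (expo \<alpha> i)) * (cmod (coeff p \<alpha>))\<^sup>2) = 0"
    unfolding ppair_self Re_complex_of_real .
  then have "\<forall>\<alpha>\<in>Poly_Mapping.keys p. (\<Prod>i\<in>UNIV. fact (expo \<alpha> i)) * (cmod (coeff p \<alpha>))\<^sup>2 = 0"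
    by (subst (asm) sum_nonneg_eq_0_iff) (auto intro!: mult_nonneg_nonneg prod_nonneg)
  then show "p = 0" by (intro poly_mapping_eqI) (auto simp: in_keys_iff)
qed

lemma ppair_add_left: "ppair (p + p') q = ppair p q + ppair p' q"
  and ppair_add_right: "ppair p (q + q') = ppair p q + ppair p q'"
  and ppair_diff_right: "ppair p (q - q') = ppair p q - ppair p q'"
  and ppair_Const_left: "ppair (Const c * p) q = cnj c * ppair p q"
  and ppair_Const_right: "ppair p (Const c * q) = c * ppair p q"
  and ppair_0 [simp]: "ppair 0 q = 0" "ppair p 0 = 0"
  by (simp_all add: ppair_def pdop_add_left pdop_add_right pdop_Const_left pdop_Const_right
      pdop_diff_right lookup_add lookup_minus)

lemma ppair_mult: "ppair (g * p) q = ppair p (pdop g q)"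
  by (simp add: ppair_def pdop_mult mult.commute[of g])

lemma pair_mult: "pair (\<omega> \<star> \<zeta>) \<eta> = pair \<zeta> (dform \<omega> \<eta>)"
  by (simp add: pair_def dform_mult)

lemma pair_eq: "pair \<omega> \<eta> = (\<Sum>I\<in>UNIV. ppair (\<omega> $ I) (\<eta> $ I))"
  by (simp add: pair_def dform_component ppair_def lookup_sum)

lemma pair_self_eq_0:
  assumes "pair \<omega> \<omega> = 0"
  shows "\<omega> = 0"
proof -
  have "(\<Sum>I\<in>UNIV. Re (ppair (\<omega> $ I) (\<omega> $ I))) = 0"
    using assms by (simp add: pair_eq flip: Re_sum)
  then have "Re (ppair (\<omega> $ I) (\<omega> $ I)) = 0" for I
    by (subst (asm) sum_nonneg_eq_0_iff) (auto intro: ppair_self_nonneg)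
  then show ?thesis by (auto simp: vec_eq_iff intro: ppair_self_eq_0)
qed

lemma pair_add_left: "pair (\<omega> + \<omega>') \<eta> = pair \<omega> \<eta> + pair \<omega>' \<eta>"
  and pair_scale_left: "pair (form_scale c \<omega>) \<eta> = cnj c * pair \<omega> \<eta>"
  and pair_0 [simp]: "pair 0 \<eta> = 0"
  by (simp_all add: pair_def dform_add_left dform_scale_left lookup_add)

subsection \<open>Linear forms and contractions\<close>

definition lin_theta :: "'n::finite cvec \<Rightarrow> 'n form" where
  "lin_theta w = (\<Sum>i\<in>UNIV. form_scale (w $ i) (theta i))"

definition iota :: "'n cvec \<Rightarrow> 'n::{finite,linorder} form \<Rightarrow> 'n form" where
  "iota u \<eta> = (\<Sum>i\<in>UNIV. form_scale (u $ i) (dtheta i \<eta>))"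

definition dirx :: "'n cvec \<Rightarrow> 'n::{finite,linorder} form \<Rightarrow> 'n form" where
  "dirx u \<eta> = (\<Sum>i\<in>UNIV. form_scale (u $ i) (dx i \<eta>))"

definition dot :: "'n::finite cvec \<Rightarrow> 'n cvec \<Rightarrow> complex" where
  "dot u v = (\<Sum>i\<in>UNIV. u $ i * v $ i)"

definition vcnj :: "'n::finite cvec \<Rightarrow> 'n cvec" where
  "vcnj v = (\<chi> i. cnj (v $ i))"

lemma vcnj_component [simp]: "vcnj v $ i = cnj (v $ i)"
  by (simp add: vcnj_def)

lemma vcnj_vcnj [simp]: "vcnj (vcnj v) = v"
  by (simp add: vec_eq_iff)

lemma dot_commute: "dot u v = dot v u"
  by (simp add: dot_def mult.commute)

lemma dform_lin_theta: "dform (lin_theta w) \<eta> = iota (vcnj w) \<eta>"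
  by (simp add: lin_theta_def iota_def dform_sum_left dform_scale_left dform_theta)

lemma dform_lin_poly: "dform (of_poly (lin_poly w)) \<eta> = dirx (vcnj w) \<eta>"
  by (simp add: lin_poly_def dirx_def of_poly_sum of_poly_Const dform_sum_left dform_scale_left dform_of_poly_X)

lemma lin_theta_mult: "lin_theta w \<star> \<eta> = (\<Sum>i\<in>UNIV. form_scale (w $ i) (theta i \<star> \<eta>))"
  by (simp add: lin_theta_def form_mult_sum_left form_mult_scale_left)

lemma lin_theta_anticommute: "lin_theta w \<star> (lin_theta v \<star> \<omega>) = - (lin_theta v \<star> (lin_theta w \<star> \<omega>))"
proof -
  have "lin_theta w \<star> (lin_theta v \<star> \<omega>)
      = (\<Sum>i\<in>UNIV. \<Sum>j\<in>UNIV. form_scale (w $ i * v $ j) (theta i \<star> (theta j \<star> \<omega>)))" for w v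
    by (subst sum.swap) (simp add: lin_theta_mult form_mult_sum_right form_mult_scale_right
        form_scale_sum form_scale_scale mult.commute)
  note * = this
  have "lin_theta v \<star> (lin_theta w \<star> \<omega>)
      = (\<Sum>i\<in>UNIV. \<Sum>j\<in>UNIV. form_scale (w $ i * v $ j) (theta j \<star> (theta i \<star> \<omega>)))"
    unfolding *[of v w] by (subst sum.swap) (simp add: mult.commute)
  also have "\<dots> = - (lin_theta w \<star> (lin_theta v \<star> \<omega>))"
    unfolding *[of w v] sum_negf[symmetric] form_scale_uminus(2)[symmetric]
    by (intro sum.cong refl arg_cong[where f = "form_scale _"] theta_anticommute)
  finally show ?thesis by simp
qed

lemma lin_theta_square: "lin_theta w \<star> (lin_theta w \<star> \<omega>) = 0"
  by (rule form_eq_neg[OF lin_theta_anticommute])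

lemma iota_anticommute: "iota u (iota v \<omega>) = - iota v (iota u \<omega>)"
proof -
  have "iota u (iota v \<omega>)
      = (\<Sum>i\<in>UNIV. \<Sum>j\<in>UNIV. form_scale (u $ i * v $ j) (dtheta i (dtheta j \<omega>)))" for u v
    by (simp add: iota_def dtheta_sum dtheta_scale form_scale_sum form_scale_scale)
  note * = this
  have "iota v (iota u \<omega>)
      = (\<Sum>i\<in>UNIV. \<Sum>j\<in>UNIV. form_scale (u $ i * v $ j) (dtheta j (dtheta i \<omega>)))"
    unfolding *[of v u] by (subst sum.swap) (simp add: mult.commute)
  also have "\<dots> = - (iota u (iota v \<omega>))"
    unfolding *[of u v] sum_negf[symmetric] form_scale_uminus(2)[symmetric]
    by (intro sum.cong refl arg_cong[where f = "form_scale _"] dtheta_anticommute)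
  finally show ?thesis by simp
qed

lemma iota_add: "iota u (\<omega> + \<eta>) = iota u \<omega> + iota u \<eta>"
  and iota_0 [simp]: "iota u 0 = 0"
  and iota_scale: "iota u (form_scale c \<omega>) = form_scale c (iota u \<omega>)"
  and iota_uminus: "iota u (- \<omega>) = - iota u \<omega>"
  by (simp_all add: iota_def dtheta_add dtheta_scale dtheta_uminus form_scale_add sum.distrib
     form_scale_sum form_scale_scale mult.commute form_scale_uminus sum_negf)

lemma iota_vec: "iota (u + v) \<omega> = iota u \<omega> + iota v \<omega>" "iota (c *s u) \<omega> = form_scale c (iota u \<omega>)"
  "iota 0 \<omega> = 0"
  by (simp_all add: iota_def form_scale_add_left sum.distrib form_scale_sum form_scale_scale)

lemma dirx_vec: "dirx (u + v) \<omega> = dirx u \<omega> + dirx v \<omega>" "dirx (c *s u) \<omega> = form_scale c (dirx u \<omega>)"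
  "dirx 0 \<omega> = 0"
  by (simp_all add: dirx_def form_scale_add_left sum.distrib form_scale_sum form_scale_scale)

lemma iota_axis: "iota (axis i 1) \<omega> = dtheta i \<omega>"
  and dirx_axis: "dirx (axis i 1) \<omega> = dx i \<omega>"
proof -
  have "(\<Sum>j\<in>UNIV. form_scale ((axis i 1 :: 'a cvec) $ j) (F j)) = F i" for F :: "'a \<Rightarrow> 'a form"
  proof -
    have "(\<Sum>j\<in>UNIV. form_scale ((axis i 1 :: 'a cvec) $ j) (F j)) = (\<Sum>j\<in>UNIV. if j = i then F i else 0)"
      by (intro sum.cong) (auto simp: axis_def)
    then show ?thesis by simp
  qed
  then show "iota (axis i 1) \<omega> = dtheta i \<omega>" "dirx (axis i 1) \<omega> = dx i \<omega>"
    by (simp_all add: iota_def dirx_def)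
qed

lemma iota_lin_theta:
  "iota u (lin_theta w \<star> \<omega>) = form_scale (dot u w) \<omega> - lin_theta w \<star> iota u \<omega>"
proof -
  have "iota u (lin_theta w \<star> \<omega>)
      = (\<Sum>i\<in>UNIV. \<Sum>j\<in>UNIV. form_scale (u $ i * w $ j) ((if i = j then \<omega> else 0) - theta j \<star> dtheta i \<omega>))"
    by (simp add: iota_def lin_theta_mult dtheta_sum dtheta_scale dtheta_theta form_scale_sum form_scale_scale)
  also have "\<dots> = (\<Sum>i\<in>UNIV. \<Sum>j\<in>UNIV. if j = i then form_scale (u $ i * w $ i) \<omega> else 0)
      - (\<Sum>i\<in>UNIV. \<Sum>j\<in>UNIV. form_scale (u $ i * w $ j) (theta j \<star> dtheta i \<omega>))"
    unfolding sum_subtractf[symmetric]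
    by (intro sum.cong refl) (auto simp: vec_eq_iff right_diff_distrib)
  also have "(\<Sum>i\<in>UNIV. \<Sum>j\<in>UNIV. if j = i then form_scale (u $ i * w $ i) \<omega> else 0) = form_scale (dot u w) \<omega>"
    by (simp add: dot_def form_scale_sum_left)
  also have "(\<Sum>i\<in>UNIV. \<Sum>j\<in>UNIV. form_scale (u $ i * w $ j) (theta j \<star> dtheta i \<omega>)) = lin_theta w \<star> iota u \<omega>"
    by (simp add: lin_theta_mult iota_def form_mult_sum_right form_mult_scale_right
        form_scale_sum form_scale_scale mult.commute)
  finally show ?thesis .
qed

section \<open>The action of matrices on forms\<close>

lemma act_theta_eq: "act_theta s j = lin_theta (\<chi> i. cnj (s $ i $ j))"
  by (simp add: act_theta_def lin_theta_def)

lemma iota_smult: "iota u (p *s \<omega>) = p *s iota u \<omega>"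
  by (simp add: iota_def dtheta_smult form_scale_def vec_eq_iff sum_distrib_left mult_ac)

lemma dx_smult: "dx i (p *s \<omega>) = pdx i p *s \<omega> + p *s dx i \<omega>"
  by (simp add: vec_eq_iff pdx_mult)

lemma dx_lin_theta: "dx i (lin_theta w \<star> \<omega>) = lin_theta w \<star> dx i \<omega>"
  by (simp add: lin_theta_mult dx_sum dx_scale dx_theta)

lemma dform_of_poly_lin_theta:
  "dform (of_poly p) (lin_theta w \<star> \<omega>) = lin_theta w \<star> dform (of_poly p) \<omega>"
  by (simp add: lin_theta_mult dform_sum_right dform_scale_right dform_of_poly_theta)

definition act_Theta :: "'n cmat \<Rightarrow> 'n::{finite,linorder} list \<Rightarrow> 'n form" where
  "act_Theta s l = foldr (\<star>) (map (act_theta s) l) (of_poly 1)"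

lemma act_Theta_simps: "act_Theta s [] = of_poly 1" "act_Theta s (i # l) = act_theta s i \<star> act_Theta s l"
  by (simp_all add: act_Theta_def)

lemma act_eq: "act s \<omega> = (\<Sum>I\<in>UNIV. act_poly s (\<omega> $ I) *s act_Theta s (sorted_list_of_set I))"
  by (simp add: act_def act_Theta_def)

lemma act_add: "act s (\<omega> + \<eta>) = act s \<omega> + act s \<eta>"
  by (simp add: act_eq act_poly_add sum.distrib vector_sadd_rdistrib)

lemma act_smult: "act s (p *s \<omega>) = act_poly s p *s act s \<omega>"
  by (simp add: act_eq act_poly_mult vec_eq_iff sum_distrib_left mult.assoc)

lemma act_0 [simp]: "act s 0 = 0"
  by (simp add: act_eq vec_eq_iff)

lemma act_scale: "act s (form_scale c \<omega>) = form_scale c (act s \<omega>)"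
  by (simp add: form_scale_def act_smult)

lemma act_uminus: "act s (- \<omega>) = - act s \<omega>"
  using act_scale[of s "- 1" \<omega>] by (simp add: form_scale_minus_one)

lemma act_diff: "act s (\<omega> - \<eta>) = act s \<omega> - act s \<eta>"
  using act_add[of s \<omega> "- \<eta>"] by (simp add: act_uminus)

lemma act_sum: "act s (sum f A) = (\<Sum>i\<in>A. act s (f i))"
  by (induction A rule: infinite_finite_induct) (simp_all add: act_add)

lemma act_Theta_sorted:
  assumes "sorted l" "distinct l"
  shows "act s (Theta l) = act_Theta s l"
proof -
  have "act s (Theta l) = (\<Sum>I\<in>UNIV. if I = set l then act_Theta s l else 0)"
    unfolding act_eq
  proof (intro sum.cong refl)
    fix I
    show "act_poly s (Theta l $ I) *s act_Theta s (sorted_list_of_set I) = (if I = set l then act_Theta s l else 0)"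
      using assms by (auto simp: Theta_sorted sorted_list_of_set.idem_if_sorted_distinct vec_eq_iff)
  qed
  then show ?thesis by simp
qed

lemma act_of_poly: "act s (of_poly p) = of_poly (act_poly s p)"
proof -
  have "of_poly p = p *s Theta []" by (simp add: vec_eq_iff Theta_simps of_poly_component)
  then have "act s (of_poly p) = act_poly s p *s act_Theta s []"
    by (simp add: act_smult act_Theta_sorted)
  then show ?thesis by (simp add: vec_eq_iff act_Theta_simps of_poly_component)
qed

text \<open>The definition of the action sorts the factors \<open>\<theta>\<^sub>i\<close>, so that multiplicativity is first
  visible for a factor that precedes all others.\<close>

lemma act_theta_mult_first:
  assumes "\<And>L j. \<omega> $ L \<noteq> 0 \<Longrightarrow> j \<in> L \<Longrightarrow> i < j"
  shows "act s (theta i \<star> \<omega>) = act_theta s i \<star> act s \<omega>"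
proof -
  have "act s (theta i \<star> (\<omega> $ I *s Theta (sorted_list_of_set I)))
      = act_theta s i \<star> act s (\<omega> $ I *s Theta (sorted_list_of_set I))" for I
  proof (cases "\<omega> $ I = 0")
    case False
    then have srt: "sorted (i # sorted_list_of_set I)" "distinct (i # sorted_list_of_set I)"
      using assms[OF False] by (auto simp: order.order_iff_strict)
    have "act s (theta i \<star> (\<omega> $ I *s Theta (sorted_list_of_set I)))
      = act_poly s (\<omega> $ I) *s act s (Theta (i # sorted_list_of_set I))"
      by (simp add: form_mult_smult_right act_smult Theta_simps)
    also have "\<dots> = act_poly s (\<omega> $ I) *s (act_theta s i \<star> act s (Theta (sorted_list_of_set I)))"
      using srt by (simp add: act_Theta_sorted act_Theta_simps)
    finally show ?thesis by (simp add: form_mult_smult_right act_smult)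
  qed simp
  then show ?thesis
    by (subst (1 2) form_as_sum) (simp add: form_mult_sum_right act_sum)
qed

lemma act_theta_mult: "act s (theta k \<star> \<omega>) = act_theta s k \<star> act s \<omega>"
proof -
  have mon: "act s (theta k \<star> Theta l) = act_theta s k \<star> act s (Theta l)" if "sorted l" "distinct l" for l
    using that
  proof (induction l)
    case Nil
    then show ?case by (intro act_theta_mult_first) (auto simp: Theta_simps of_poly_component split: if_splits)
  next
    case (Cons i l)
    have i: "i < j" if "j \<in> set l" for j
      using Cons.prems that by (auto simp: order.order_iff_strict)
    have first: "act s (theta i \<star> Theta l) = act_theta s i \<star> act s (Theta l)"
      by (rule act_theta_mult_first) (use Cons.prems i in \<open>auto simp: Theta_sorted split: if_splits\<close>)
    consider "k < i" | "k = i" | "i < k" by fastforce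
    then show ?case
    proof cases
      case 1
      show ?thesis
        by (rule act_theta_mult_first)
          (use Cons.prems i 1 in \<open>auto simp: Theta_sorted split: if_splits intro: less_trans\<close>)
    next
      case 2
      have "theta i \<star> (theta i \<star> Theta l) = 0" by (rule form_eq_neg[OF theta_anticommute])
      then show ?thesis by (simp add: 2 Theta_simps first act_theta_eq lin_theta_square)
    next
      case 3
      have "act s (theta i \<star> (theta k \<star> Theta l)) = act_theta s i \<star> act s (theta k \<star> Theta l)"
      proof (rule act_theta_mult_first)
        fix L j assume "(theta k \<star> Theta l) $ L \<noteq> 0" "j \<in> L"
        then have "k \<in> L" "L - {k} = set l" "j \<in> L"
          using Cons.prems by (auto simp: theta_mult_component Theta_sorted split: if_splits)
        then show "i < j" using 3 i by (cases "j = k") auto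
      qed
      then have "act s (theta k \<star> Theta (i # l)) = - (act_theta s i \<star> (act_theta s k \<star> act s (Theta l)))"
        using Cons by (simp add: Theta_simps theta_anticommute[of k i] act_uminus)
      also have "\<dots> = act_theta s k \<star> (act_theta s i \<star> act s (Theta l))"
        unfolding act_theta_eq by (simp add: lin_theta_anticommute[of _ "\<chi> ia. cnj (s $ ia $ k)"])
      finally show ?thesis by (simp add: Theta_simps first)
    qed
  qed
  have "act s (theta k \<star> (\<omega> $ I *s Theta (sorted_list_of_set I)))
      = act_theta s k \<star> act s (\<omega> $ I *s Theta (sorted_list_of_set I))" for I
    by (simp add: form_mult_smult_right act_smult mon)
  then show ?thesis
    by (subst (1 2) form_as_sum) (simp add: form_mult_sum_right act_sum)
qed

lemma act_lin_theta_mult: "act s (lin_theta w \<star> \<omega>) = lin_theta (\<chi> i. \<Sum>j\<in>UNIV. cnj (s $ i $ j) * w $ j) \<star> act s \<omega>"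
proof -
  have "act s (lin_theta w \<star> \<omega>) = (\<Sum>j\<in>UNIV. \<Sum>i\<in>UNIV. form_scale (cnj (s $ i $ j) * w $ j) (theta i \<star> act s \<omega>))"
    by (simp add: lin_theta_mult act_sum act_scale act_theta_mult act_theta_eq form_scale_sum form_scale_scale mult.commute)
  also have "\<dots> = (\<Sum>i\<in>UNIV. \<Sum>j\<in>UNIV. form_scale (cnj (s $ i $ j) * w $ j) (theta i \<star> act s \<omega>))"
    by (rule sum.swap)
  finally show ?thesis by (simp add: lin_theta_mult form_scale_sum_left)
qed

lemma act_compose: "act s (act t \<omega>) = act (s ** t) \<omega>"
proof (induction \<omega> rule: form_induct)
  case (theta k \<omega>)
  have "(\<chi> i. \<Sum>j\<in>UNIV. cnj (s $ i $ j) * cnj (t $ j $ k)) = (\<chi> i. cnj ((s ** t) $ i $ k))"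
    by (simp add: matrix_matrix_mult_def)
  then show ?case using theta by (simp add: act_theta_mult act_theta_eq act_lin_theta_mult)
qed (simp_all add: act_of_poly act_smult act_add act_poly_compose)

lemma act_mat_1 [simp]: "act (mat 1) \<omega> = \<omega>"
proof (induction \<omega> rule: form_induct)
  case (theta k \<omega>)
  have "(\<chi> i. cnj (mat 1 $ i $ k)) = axis k (1 :: complex)"
    by (auto simp: vec_eq_iff mat_def axis_def)
  moreover have "lin_theta (axis k 1) \<star> \<omega> = (\<Sum>i\<in>UNIV. if i = k then theta k \<star> \<omega> else 0)"
    unfolding lin_theta_mult by (intro sum.cong) (auto simp: axis_def)
  ultimately show ?case using theta by (simp add: act_theta_mult act_theta_eq)
qed (simp_all add: act_of_poly act_smult act_add)

lemma dx_of_poly: "dx i (of_poly p) = of_poly (pdx i p)"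
  by (simp add: vec_eq_iff of_poly_component)

lemma dtheta_of_poly [simp]: "dtheta i (of_poly p) = 0"
  by (simp add: vec_eq_iff dtheta_component of_poly_component)

lemma iota_of_poly [simp]: "iota u (of_poly p) = 0"
  by (simp add: iota_def)

lemma act_dx:
  assumes "unitary_matrix s"
  shows "act s (dx k \<omega>) = dirx (column k s) (act s \<omega>)"
proof (induction \<omega> rule: form_induct)
  case one
  then show ?case by (simp add: dx_of_poly act_of_poly dirx_def)
next
  case (smult p \<omega>)
  have "dirx (column k s) (act s (p *s \<omega>))
      = act_poly s (pdx k p) *s act s \<omega> + act_poly s p *s dirx (column k s) (act s \<omega>)"
    by (simp add: dirx_def act_smult dx_smult act_poly_pdx[OF assms] column_def form_scale_def vec_eq_iff
        distrib_left sum.distrib sum_distrib_left sum_distrib_right mult_ac)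
  then show ?case by (simp add: smult dx_smult act_add act_smult)
next
  case (theta i \<omega>)
  then show ?case
    by (simp add: dx_theta act_theta_mult act_theta_eq dirx_def dx_lin_theta form_mult_sum_right form_mult_scale_right)
next
  case (add \<omega> \<eta>)
  then show ?case by (simp add: dx_add act_add dirx_def form_scale_add sum.distrib)
qed

lemma act_dtheta:
  assumes "unitary_matrix s"
  shows "act s (dtheta k \<omega>) = iota (column k s) (act s \<omega>)"
proof (induction \<omega> rule: form_induct)
  case one
  then show ?case by (simp add: act_of_poly)
next
  case (smult p \<omega>)
  then show ?case by (simp add: dtheta_smult act_smult iota_smult)
next
  case (theta i \<omega>)
  have "dot (column k s) (\<chi> l. cnj (s $ l $ i)) = (if k = i then 1 else 0)"
    using unitary_columns[OF assms, of k i] by (simp add: dot_def column_def)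
  then show ?case
    using theta by (simp add: dtheta_theta act_theta_mult act_theta_eq act_diff iota_lin_theta)
next
  case (add \<omega> \<eta>)
  then show ?case by (simp add: dtheta_add act_add iota_add)
qed

lemma act_dform_of_poly:
  assumes "unitary_matrix s"
  shows "act s (dform (of_poly p) \<eta>) = dform (of_poly (act_poly s p)) (act s \<eta>)"
proof (induction p arbitrary: \<eta> rule: mpoly_induct_gen)
  case (Const c)
  have "dform (of_poly (Const c)) \<eta> = form_scale (cnj c) \<eta>" for \<eta> :: "'a form"
    by (simp add: vec_eq_iff pdop_Const)
  then show ?case by (simp add: act_scale)
next
  case (X k)
  have "act_poly s (X k) = lin_poly (vcnj (column k s))"
    by (simp add: act_poly_X lin_poly_def column_def)
  then show ?case by (simp add: dform_of_poly_X act_dx[OF assms] dform_lin_poly)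
next
  case (add p q)
  then show ?case by (simp add: dform_of_poly_add act_poly_add act_add)
next
  case (mult p q)
  then show ?case by (simp add: dform_of_poly_mult act_poly_mult)
qed

lemma act_dform:
  assumes "unitary_matrix s"
  shows "act s (dform \<omega> \<eta>) = dform (act s \<omega>) (act s \<eta>)"
proof (induction \<omega> arbitrary: \<eta> rule: form_induct)
  case one
  then show ?case by (simp add: act_of_poly)
next
  case (smult p \<omega>)
  then show ?case by (simp add: dform_smult act_smult act_dform_of_poly[OF assms])
next
  case (theta k \<omega>)
  have "vcnj (\<chi> i. cnj (s $ i $ k)) = column k s" by (simp add: vec_eq_iff column_def)
  then show ?case
    by (simp add: theta dform_mult dform_theta act_theta_mult act_theta_eq dform_lin_theta act_dtheta[OF assms])
next
  case (add \<omega> \<omega>')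
  then show ?case by (simp add: dform_add_left act_add)
qed


subsection \<open>Bihomogeneous components\<close>

definition bicomp :: "nat \<Rightarrow> nat \<Rightarrow> 'n::finite form \<Rightarrow> 'n form" where
  "bicomp a b \<omega> = (\<chi> I. if card I = b then hcomp a (\<omega> $ I) else 0)"

lemma bicomp_component: "bicomp a b \<omega> $ I = (if card I = b then hcomp a (\<omega> $ I) else 0)"
  by (simp add: bicomp_def)

lemma bihomog_bicomp [simp]: "bihomog a b (bicomp a b \<omega>)"
  by (auto simp: bihomog_def bicomp_component split: if_splits)

lemma bihomog_0 [simp]: "bihomog a b 0"
  by (simp add: bihomog_def)

lemma bihomog_add: "bihomog a b \<omega> \<Longrightarrow> bihomog a b \<eta> \<Longrightarrow> bihomog a b (\<omega> + \<eta>)"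
  unfolding bihomog_def vector_add_component
  by (metis (no_types) add.left_neutral add.right_neutral homog_add)

lemma bihomog_sum: "(\<And>i. i \<in> A \<Longrightarrow> bihomog a b (f i)) \<Longrightarrow> bihomog a b (sum f A)"
  by (induction A rule: infinite_finite_induct) (auto intro: bihomog_add)

lemma bihomog_scale: "bihomog a b \<omega> \<Longrightarrow> bihomog a b (form_scale c \<omega>)"
  unfolding bihomog_def form_scale_component by (metis homog_Const_mult mult_zero_right)

lemma bihomog_uminus: "bihomog a b \<omega> \<Longrightarrow> bihomog a b (- \<omega>)"
  using bihomog_scale[of a b \<omega> "- 1"] by (simp add: form_scale_minus_one)

lemma bihomog_diff: "bihomog a b \<omega> \<Longrightarrow> bihomog a b \<eta> \<Longrightarrow> bihomog a b (\<omega> - \<eta>)"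
  using bihomog_add[of a b \<omega> "- \<eta>"] by (simp add: bihomog_uminus)

lemma bihomog_smult: "homog c p \<Longrightarrow> bihomog a b \<omega> \<Longrightarrow> bihomog (c + a) b (p *s \<omega>)"
  unfolding bihomog_def vector_smult_component by (metis homog_mult mult_zero_right)

lemma homog_theta_sign: "homog a p \<Longrightarrow> homog a (theta_sign I J * p)"
  by (simp add: theta_sign_as_Const homog_Const_mult)

lemma bihomog_theta_mult:
  assumes "bihomog a b \<omega>"
  shows "bihomog a (Suc b) (theta i \<star> \<omega>)"
  unfolding bihomog_def
proof (intro allI impI)
  fix I assume "(theta i \<star> \<omega>) $ I \<noteq> 0"
  then have i: "i \<in> I" and "\<omega> $ (I - {i}) \<noteq> 0" by (auto simp: theta_mult_component split: if_splits)
  then have "homog a (\<omega> $ (I - {i}))" "card (I - {i}) = b"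
    using assms unfolding bihomog_def by blast+
  then show "homog a ((theta i \<star> \<omega>) $ I) \<and> card I = Suc b"
    using i card_Suc_Diff1[OF finite i] by (simp add: theta_mult_component homog_theta_sign)
qed

lemma bihomog_lin_theta: "bihomog a b \<omega> \<Longrightarrow> bihomog a (Suc b) (lin_theta w \<star> \<omega>)"
  by (simp add: lin_theta_mult bihomog_sum bihomog_scale bihomog_theta_mult)

lemma bihomog_of_poly: "homog a p \<Longrightarrow> bihomog a 0 (of_poly p)"
  by (simp add: bihomog_def of_poly_component)

lemma bihomog_Theta: "bihomog 0 (length l) (Theta l)"
  by (induction l) (simp_all add: Theta_simps bihomog_of_poly bihomog_theta_mult)

lemma bihomog_dtheta:
  assumes "bihomog a (Suc b) \<omega>"
  shows "bihomog a b (dtheta i \<omega>)"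
  unfolding bihomog_def
proof (intro allI impI)
  fix I assume "dtheta i \<omega> $ I \<noteq> 0"
  then have i: "i \<notin> I" and "\<omega> $ (insert i I) \<noteq> 0" by (auto simp: dtheta_component split: if_splits)
  then have "homog a (\<omega> $ (insert i I))" "card (insert i I) = Suc b"
    using assms unfolding bihomog_def by blast+
  then show "homog a (dtheta i \<omega> $ I) \<and> card I = b"
    using i by (simp add: dtheta_component homog_theta_sign)
qed

lemma bihomog_dtheta_0: "bihomog a 0 \<omega> \<Longrightarrow> dtheta i \<omega> = 0"
  unfolding bihomog_def vec_eq_iff dtheta_component
  by (metis card_0_eq finite insert_not_empty mult_zero_right zero_index)

lemma bihomog_dx: "bihomog (Suc a) b \<omega> \<Longrightarrow> bihomog a b (dx i \<omega>)"
  unfolding bihomog_def dx_component by (metis homog_pdx pdx_0)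

lemma bihomog_act:
  assumes "bihomog a b \<omega>"
  shows "bihomog a b (act s \<omega>)"
  unfolding act_eq
proof (intro bihomog_sum)
  fix I
  have "bihomog 0 (length l) (act_Theta s l)" for l
    by (induction l) (simp_all add: act_Theta_simps bihomog_of_poly bihomog_lin_theta act_theta_eq)
  from this[of "sorted_list_of_set I"] have *: "bihomog 0 (card I) (act_Theta s (sorted_list_of_set I))"
    by simp
  show "bihomog a b (act_poly s (\<omega> $ I) *s act_Theta s (sorted_list_of_set I))"
  proof (cases "\<omega> $ I = 0")
    case False
    then have "homog a (\<omega> $ I)" "card I = b" using assms by (auto simp: bihomog_def)
    then show ?thesis using bihomog_smult[OF homog_act_poly *, of a] by simp
  qed (simp add: vec_eq_iff bihomog_def)
qed

lemma bicomp_bihomog: "bihomog a b \<omega> \<Longrightarrow> bicomp x y \<omega> = (if x = a \<and> y = b then \<omega> else 0)"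
proof (rule vec_eq_iff[THEN iffD2], rule allI)
  fix I assume "bihomog a b \<omega>"
  then show "bicomp x y \<omega> $ I = (if x = a \<and> y = b then \<omega> else 0) $ I"
    by (cases "\<omega> $ I = 0") (auto simp: bihomog_def bicomp_component hcomp_simps hcomp_homog)
qed

lemma bicomp_add: "bicomp a b (\<omega> + \<eta>) = bicomp a b \<omega> + bicomp a b \<eta>"
  and bicomp_0 [simp]: "bicomp a b 0 = 0"
  and bicomp_scale: "bicomp a b (form_scale c \<omega>) = form_scale c (bicomp a b \<omega>)"
  by (auto simp: vec_eq_iff bicomp_component hcomp_simps)

definition form_bound :: "'n::finite form \<Rightarrow> nat" where
  "form_bound \<omega> = Max (range (\<lambda>I. deg_bound (\<omega> $ I)))"

lemma sum_bicomp:
  fixes \<omega> :: "'n::finite form"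
  assumes "form_bound \<omega> \<le> N"
  shows "(\<Sum>a\<le>N. \<Sum>b\<le>CARD('n). bicomp a b \<omega>) = \<omega>"
proof (rule vec_eq_iff[THEN iffD2], rule allI)
  fix I
  have "deg_bound (\<omega> $ I) \<le> form_bound \<omega>"
    unfolding form_bound_def by (rule Max_ge) auto
  then have N: "deg_bound (\<omega> $ I) \<le> N" using assms by simp
  have "(\<Sum>a\<le>N. \<Sum>b\<le>CARD('n). bicomp a b \<omega>) $ I = (\<Sum>a\<le>N. \<Sum>b\<le>CARD('n). if b = card I then hcomp a (\<omega> $ I) else 0)"
    unfolding sum_component bicomp_component by (intro sum.cong) auto
  also have "\<dots> = (\<Sum>a\<le>N. hcomp a (\<omega> $ I))"
    by (simp add: card_mono)
  finally show "(\<Sum>a\<le>N. \<Sum>b\<le>CARD('n). bicomp a b \<omega>) $ I = \<omega> $ I"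
    by (simp add: sum_hcomp[OF N])
qed

lemma dform_bicomp:
  assumes "bihomog a b \<omega>"
  shows "dform \<omega> (bicomp (x + a) (y + b) \<eta>) = bicomp x y (dform \<omega> \<eta>)"
proof (rule vec_eq_iff[THEN iffD2], rule allI)
  fix J
  have "theta_sign I J * pdop (\<omega> $ I) (bicomp (x + a) (y + b) \<eta> $ (I \<union> J))
      = (if card J = y then hcomp x (theta_sign I J * pdop (\<omega> $ I) (\<eta> $ (I \<union> J))) else 0)"
    if "I \<in> Pow (- J)" for I
  proof (cases "\<omega> $ I = 0")
    case False
    then have I: "homog a (\<omega> $ I)" "card I = b" using assms by (auto simp: bihomog_def)
    have "card (I \<union> J) = card I + card J" using that by (intro card_Un_disjoint) auto
    then show ?thesis using I
      by (auto simp: bicomp_component pdop_hcomp theta_sign_as_Const hcomp_simps)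
  qed (simp add: hcomp_simps)
  then have "dform \<omega> (bicomp (x + a) (y + b) \<eta>) $ J
     = (\<Sum>I\<in>Pow (- J). if card J = y then hcomp x (theta_sign I J * pdop (\<omega> $ I) (\<eta> $ (I \<union> J))) else 0)"
    unfolding dform_component by (intro sum.cong refl)
  then show "dform \<omega> (bicomp (x + a) (y + b) \<eta>) $ J = bicomp x y (dform \<omega> \<eta>) $ J"
    by (simp add: bicomp_component dform_component hcomp_sum)
qed

lemma dform_bicomp_small:
  assumes "bihomog a b \<omega>" "x < a \<or> y < b"
  shows "dform \<omega> (bicomp x y \<eta>) = 0"
proof (rule vec_eq_iff[THEN iffD2], rule allI)
  fix J
  have "theta_sign I J * pdop (\<omega> $ I) (bicomp x y \<eta> $ (I \<union> J)) = 0" if "I \<in> Pow (- J)" for I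
  proof (cases "\<omega> $ I = 0")
    case False
    then have I: "homog a (\<omega> $ I)" "card I = b" using assms by (auto simp: bihomog_def)
    have "card I \<le> card (I \<union> J)" by (rule card_mono) auto
    then show ?thesis using I assms(2)
      by (auto simp: bicomp_component pdop_hcomp_small)
  qed simp
  then show "dform \<omega> (bicomp x y \<eta>) $ J = 0 $ J"
    unfolding dform_component zero_index by (intro sum.neutral ballI)
qed

lemma dform_bihomog:
  assumes "bihomog a b \<omega>" "bihomog x y \<eta>"
  shows "bihomog (x - a) (y - b) (dform \<omega> \<eta>)"
proof (cases "a \<le> x \<and> b \<le> y")
  case True
  then have "dform \<omega> \<eta> = bicomp (x - a) (y - b) (dform \<omega> \<eta>)"
    using dform_bicomp[OF assms(1), of "x - a" "y - b" \<eta>] bicomp_bihomog[OF assms(2)] by simp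
  then show ?thesis by (metis bihomog_bicomp)
next
  case False
  then have "dform \<omega> (bicomp x y \<eta>) = 0"
    by (intro dform_bicomp_small[OF assms(1)]) auto
  then show ?thesis by (simp add: bicomp_bihomog[OF assms(2)])
qed


subsection \<open>Forms over the subfield\<close>

context subfield_conj
begin

lemma K_forms_0 [simp, intro]: "0 \<in> K_forms K"
  and K_forms_add [intro]: "\<omega> \<in> K_forms K \<Longrightarrow> \<eta> \<in> K_forms K \<Longrightarrow> \<omega> + \<eta> \<in> K_forms K"
  and K_forms_uminus [intro]: "\<omega> \<in> K_forms K \<Longrightarrow> - \<omega> \<in> K_forms K"
  and K_forms_diff [intro]: "\<omega> \<in> K_forms K \<Longrightarrow> \<eta> \<in> K_forms K \<Longrightarrow> \<omega> - \<eta> \<in> K_forms K"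
  and K_forms_smult [intro]: "p \<in> K_polys K \<Longrightarrow> \<omega> \<in> K_forms K \<Longrightarrow> p *s \<omega> \<in> K_forms K"
  and K_forms_of_poly [intro]: "p \<in> K_polys K \<Longrightarrow> of_poly p \<in> K_forms K"
  and K_forms_theta [simp, intro]: "theta i \<in> K_forms K"
  and K_forms_bicomp [intro]: "\<omega> \<in> K_forms K \<Longrightarrow> bicomp a b \<omega> \<in> K_forms K"
  and K_forms_par [intro]: "\<omega> \<in> K_forms K \<Longrightarrow> par \<omega> \<in> K_forms K"
  by (auto simp: K_forms_def of_poly_component theta_def bicomp_component par_def)

lemma K_forms_component: "\<omega> \<in> K_forms K \<Longrightarrow> \<omega> $ I \<in> K_polys K"
  by (simp add: K_forms_def)

lemma K_forms_scale [intro]: "c \<in> K \<Longrightarrow> \<omega> \<in> K_forms K \<Longrightarrow> form_scale c \<omega> \<in> K_forms K"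
  by (auto simp: form_scale_def)

lemma K_forms_sum [intro]: "(\<And>i. i \<in> A \<Longrightarrow> f i \<in> K_forms K) \<Longrightarrow> sum f A \<in> K_forms K"
  by (induction A rule: infinite_finite_induct) auto

lemma K_polys_theta_sign [simp, intro]: "theta_sign I J \<in> K_polys K"
  unfolding theta_sign_def by auto

lemma K_forms_mult [intro]: "\<omega> \<in> K_forms K \<Longrightarrow> \<eta> \<in> K_forms K \<Longrightarrow> \<omega> \<star> \<eta> \<in> K_forms K"
  unfolding K_forms_def form_mult_component mem_Collect_eq
  by (intro allI K_polys_sum K_polys_mult K_polys_theta_sign) auto

lemma K_forms_dform [intro]: "\<omega> \<in> K_forms K \<Longrightarrow> \<eta> \<in> K_forms K \<Longrightarrow> dform \<omega> \<eta> \<in> K_forms K"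
  unfolding K_forms_def dform_component mem_Collect_eq
  by (intro allI K_polys_sum K_polys_mult K_polys_theta_sign K_polys_pdop) auto

lemma K_forms_dtheta [intro]: "\<omega> \<in> K_forms K \<Longrightarrow> dtheta i \<omega> \<in> K_forms K"
  using K_forms_dform[of "theta i" \<omega>] by (simp add: dform_theta)

lemma K_forms_dx [intro]: "\<omega> \<in> K_forms K \<Longrightarrow> dx i \<omega> \<in> K_forms K"
  by (auto simp: K_forms_def)

lemma K_forms_lin_theta [intro]:
  assumes "\<And>i. w $ i \<in> K" shows "lin_theta w \<in> K_forms K"
  unfolding lin_theta_def using assms by (intro K_forms_sum K_forms_scale K_forms_theta)

lemma K_forms_act [intro]:
  assumes "\<And>i j. s $ i $ j \<in> K" and "\<omega> \<in> K_forms K"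
  shows "act s \<omega> \<in> K_forms K"
proof -
  have 1: "act_theta s i \<in> K_forms K" for i
    unfolding act_theta_eq using assms(1) by (intro K_forms_lin_theta) auto
  have 2: "of_poly 1 \<in> K_forms K" by auto
  have "act_Theta s l \<in> K_forms K" for l
    using 1 2 by (induction l) (auto simp: act_Theta_simps)
  then show ?thesis
    unfolding act_eq using assms
    by (intro K_forms_sum K_forms_smult K_polys_act_poly K_forms_component) auto
qed

end

section \<open>Linear algebra over the subfield\<close>

locale K_module = subfield_conj K + vector_space scl
  for K and scl :: "complex \<Rightarrow> 'v \<Rightarrow> 'v::ab_group_add"
begin

abbreviation "spanK \<equiv> K_span scl K"

definition K_subspace :: "'v set \<Rightarrow> bool" where
  "K_subspace W \<longleftrightarrow> 0 \<in> W \<and> (\<forall>v\<in>W. \<forall>w\<in>W. v + w \<in> W) \<and> (\<forall>c\<in>K. \<forall>v\<in>W. scl c v \<in> W)"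

lemma K_subspaceD:
  assumes "K_subspace W"
  shows "0 \<in> W" "v \<in> W \<Longrightarrow> w \<in> W \<Longrightarrow> v + w \<in> W" "c \<in> K \<Longrightarrow> v \<in> W \<Longrightarrow> scl c v \<in> W"
    "v \<in> W \<Longrightarrow> w \<in> W \<Longrightarrow> v - w \<in> W"
proof -
  show 1: "0 \<in> W" "v \<in> W \<Longrightarrow> w \<in> W \<Longrightarrow> v + w \<in> W" "c \<in> K \<Longrightarrow> v \<in> W \<Longrightarrow> scl c v \<in> W" for v w c
    using assms by (auto simp: K_subspace_def)
  show "v \<in> W \<Longrightarrow> w \<in> W \<Longrightarrow> v - w \<in> W"
    using 1(2)[of v "scl (- 1) w"] 1(3)[of "- 1" w] by (simp add: K_uminus)
qed

lemma K_subspace_sum: "K_subspace W \<Longrightarrow> (\<And>i. i \<in> A \<Longrightarrow> f i \<in> W) \<Longrightarrow> sum f A \<in> W"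
  by (induction A rule: infinite_finite_induct) (auto intro: K_subspaceD)

lemma spanK_base: "v \<in> S \<Longrightarrow> v \<in> spanK S"
  unfolding K_span_def by (rule CollectI, rule exI[of _ "{v}"], rule exI[of _ "\<lambda>_. 1"]) auto

lemma K_subspace_spanK: "K_subspace (spanK S)"
  unfolding K_subspace_def
proof (intro conjI ballI)
  show "0 \<in> spanK S"
    unfolding K_span_def by (rule CollectI, rule exI[of _ "{}"]) auto
next
  fix v w assume "v \<in> spanK S" "w \<in> spanK S"
  then obtain T c U d where v: "v = (\<Sum>x\<in>T. scl (c x) x)" "finite T" "T \<subseteq> S" "c ` T \<subseteq> K"
    and w: "w = (\<Sum>x\<in>U. scl (d x) x)" "finite U" "U \<subseteq> S" "d ` U \<subseteq> K"
    unfolding K_span_def by blast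
  let ?c = "\<lambda>x. if x \<in> T then c x else 0" and ?d = "\<lambda>x. if x \<in> U then d x else 0"
  have "v = (\<Sum>x\<in>T \<union> U. scl (?c x) x)"
    unfolding v(1) by (rule sum.mono_neutral_cong_left) (use v w in auto)
  moreover have "w = (\<Sum>x\<in>T \<union> U. scl (?d x) x)"
    unfolding w(1) by (rule sum.mono_neutral_cong_left) (use v w in auto)
  ultimately have "v + w = (\<Sum>x\<in>T \<union> U. scl (?c x + ?d x) x)"
    by (simp add: scale_left_distrib sum.distrib)
  moreover have "(\<lambda>x. ?c x + ?d x) ` (T \<union> U) \<subseteq> K"
  proof (rule image_subsetI)
    fix x
    have "?c x \<in> K" "?d x \<in> K" using v(4) w(4) by auto
    then show "?c x + ?d x \<in> K" by (rule K_add)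
  qed
  ultimately show "v + w \<in> spanK S"
    unfolding K_span_def using v w
    by (intro CollectI exI[of _ "T \<union> U"] exI[of _ "\<lambda>x. ?c x + ?d x"]) auto
next
  fix a v assume "a \<in> K" "v \<in> spanK S"
  then obtain T c where v: "v = (\<Sum>x\<in>T. scl (c x) x)" "finite T" "T \<subseteq> S" "c ` T \<subseteq> K"
    unfolding K_span_def by blast
  then have "scl a v = (\<Sum>x\<in>T. scl (a * c x) x)"
    by (simp add: scale_sum_right)
  moreover have "(\<lambda>x. a * c x) ` T \<subseteq> K" using v(4) \<open>a \<in> K\<close> by auto
  ultimately show "scl a v \<in> spanK S"
    unfolding K_span_def using v(2,3) by (intro CollectI exI[of _ T] exI[of _ "\<lambda>x. a * c x"]) auto
qed

lemmas spanK_0 = K_subspaceD(1)[OF K_subspace_spanK]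
  and spanK_add = K_subspaceD(2)[OF K_subspace_spanK]
  and spanK_scale = K_subspaceD(3)[OF K_subspace_spanK]
  and spanK_diff = K_subspaceD(4)[OF K_subspace_spanK]
  and spanK_sum = K_subspace_sum[OF K_subspace_spanK]

lemma spanK_minimal:
  assumes "K_subspace W" "S \<subseteq> W"
  shows "spanK S \<subseteq> W"
  using assms unfolding K_span_def
  by (auto intro!: K_subspace_sum[OF assms(1)] K_subspaceD(3)[OF assms(1)])

text \<open>Orthogonal projections for a Hermitian form that is definite on a \<open>K\<close>-subspace \<open>V\<close>. No square
  roots are taken, so that the projection is defined over \<open>K\<close>. The functionals \<open>\<phi>\<close> separate the
  points of \<open>W\<close>, which bounds its dimension; the induction removes one of them at a time.\<close>

lemma orth_projection:
  fixes B :: "'v \<Rightarrow> 'v \<Rightarrow> complex" and \<phi> :: "'m \<Rightarrow> 'v \<Rightarrow> complex"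
  assumes V: "K_subspace V"
    and B_add: "\<And>u v w. B u (v + w) = B u v + B u w" and B_scale: "\<And>u v c. B u (scl c v) = c * B u v"
    and B_sym: "\<And>u v. B v u = cnj (B u v)" and B_K: "\<And>u v. u \<in> V \<Longrightarrow> v \<in> V \<Longrightarrow> B u v \<in> K"
    and B_def: "\<And>v. v \<in> V \<Longrightarrow> B v v = 0 \<Longrightarrow> v = 0"
    and \<phi>_add: "\<And>m v w. \<phi> m (v + w) = \<phi> m v + \<phi> m w" and \<phi>_scale: "\<And>m v c. \<phi> m (scl c v) = c * \<phi> m v"
    and \<phi>_K: "\<And>m v. v \<in> V \<Longrightarrow> \<phi> m v \<in> K"
    and "finite M" "K_subspace W" "W \<subseteq> V"
    and "\<And>w. w \<in> W \<Longrightarrow> (\<And>m. m \<in> M \<Longrightarrow> \<phi> m w = 0) \<Longrightarrow> w = 0"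
    and "v \<in> V"
  shows "\<exists>w\<in>W. \<forall>t\<in>W. B t (v - w) = 0"
  using assms(10-)
proof (induction M arbitrary: W v rule: finite_induct)
  case empty
  then have "w = 0" if "w \<in> W" for w using that by auto
  moreover have "B 0 u = 0" for u
    using B_sym[of u 0] B_scale[of u 0 0] by simp
  ultimately show ?case using empty K_subspaceD(1)[of W] by (intro bexI[of _ 0]) auto
next
  case (insert m M)
  have B_diff: "B u (v - w) = B u v - B u w" for u v w
    using B_add[of u "v - w" w] by simp
  have B_add_left: "B (v + w) u = B v u + B w u" for u v w
    by (metis B_add B_sym complex_cnj_add)
  have B_scale_left: "B (scl c v) u = cnj c * B v u" for u v c
    by (metis B_scale B_sym complex_cnj_mult)
  define W0 where "W0 = {w \<in> W. \<phi> m w = 0}"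
  have \<phi>0: "\<phi> m 0 = 0" using \<phi>_scale[of m 0 0] by simp
  have \<phi>_diff: "\<phi> m (v - w) = \<phi> m v - \<phi> m w" for v w using \<phi>_add[of m "v - w" w] by simp
  have W0: "K_subspace W0" "W0 \<subseteq> V"
    using insert.prems(1,2) by (auto simp: W0_def K_subspace_def \<phi>0 \<phi>_add \<phi>_scale)
  have IH: "\<exists>w\<in>W0. \<forall>t\<in>W0. B t (v - w) = 0" if "v \<in> V" for v
    by (rule insert.IH[OF W0 _ that]) (use insert.prems(3) in \<open>auto simp: W0_def\<close>)
  show ?case
  proof (cases "W0 = W")
    case True
    then show ?thesis using IH[OF insert.prems(4)] by simp
  next
    case False
    then obtain w1 where w1: "w1 \<in> W" "\<phi> m w1 \<noteq> 0" by (auto simp: W0_def)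
    then obtain p where p: "p \<in> W0" "\<And>t. t \<in> W0 \<Longrightarrow> B t (w1 - p) = 0"
      using IH[of w1] insert.prems(2) by blast
    \<comment> \<open>the orthogonal complement of \<open>W0\<close> in \<open>W\<close> is the line through \<open>e\<close>\<close>
    define e where "e = w1 - p"
    have e: "e \<in> W" "e \<in> V" using w1 p insert.prems(1,2) K_subspaceD(4) by (auto simp: e_def W0_def)
    have \<phi>e: "\<phi> m e \<noteq> 0" using w1 p by (simp add: e_def \<phi>_diff W0_def)
    have eB: "B t e = 0" "B e t = 0" if "t \<in> W0" for t
      using p(2)[OF that] B_sym[of e t] B_sym[of t e] by (simp_all add: e_def)
    have Bee: "B e e \<noteq> 0" using B_def[OF e(2)] \<phi>e \<phi>0 by auto
    obtain v1 where v1: "v1 \<in> W0" "\<And>t. t \<in> W0 \<Longrightarrow> B t (v - v1) = 0"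
      using IH[OF insert.prems(4)] by blast
    define k where "k = B e v / B e e"
    have kK: "k \<in> K" using B_K[OF e(2)] e(2) insert.prems(4) by (auto simp: k_def)
    define w where "w = v1 + scl k e"
    have "w \<in> W"
      using v1 e kK insert.prems(1) K_subspaceD(2,3) by (auto simp: w_def W0_def)
    moreover have "B t (v - w) = 0" if t: "t \<in> W" for t
    proof -
      define c where "c = \<phi> m t / \<phi> m e"
      have cK: "c \<in> K" using \<phi>_K insert.prems(2) t e by (auto simp: c_def)
      define t0 where "t0 = t - scl c e"
      have "t0 \<in> W0"
        using t e cK insert.prems(1) K_subspaceD(3,4) \<phi>e
        by (auto simp: W0_def t0_def \<phi>_diff \<phi>_scale c_def)
      moreover have "t = t0 + scl c e" by (simp add: t0_def)
      ultimately have "B t (v - w) = B t0 (v - v1) + cnj c * (B e v - B e v1 - k * B e e)"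
        by (simp add: B_add_left B_scale_left w_def B_diff B_add B_scale eB algebra_simps)
      also have "\<dots> = 0"
        using v1(2)[OF \<open>t0 \<in> W0\<close>] eB(2)[OF v1(1)] Bee by (simp add: k_def)
      finally show ?thesis .
    qed
    ultimately show ?thesis by blast
  qed
qed

end

sublocale subfield_conj \<subseteq> forms: K_module K form_scale
  by (intro K_module.intro subfield_conj_axioms vector_space_form)

sublocale subfield_conj \<subseteq> polys: K_module K "\<lambda>c p. Const c * p"
  by (intro K_module.intro subfield_conj_axioms, unfold_locales)
    (simp_all add: Const_add Const_mult algebra_simps)

sublocale subfield_conj \<subseteq> vecs: K_module K "(*s)"
  by (intro K_module.intro subfield_conj_axioms) (rule vec.vector_space_axioms)

definition hdot :: "'n::finite cvec \<Rightarrow> 'n cvec \<Rightarrow> complex" where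
  "hdot u v = (\<Sum>i\<in>UNIV. cnj (u $ i) * v $ i)"

lemma hdot_self_eq_0: "hdot v v = 0 \<Longrightarrow> v = 0"
proof -
  assume "hdot v v = 0"
  moreover have "hdot v v = of_real (\<Sum>i\<in>UNIV. (cmod (v $ i))\<^sup>2)"
    unfolding hdot_def of_real_sum
    by (intro sum.cong refl) (simp only: complex_norm_square mult.commute)
  ultimately have "(\<Sum>i\<in>UNIV. (cmod (v $ i))\<^sup>2) = 0" by (simp only: of_real_eq_0_iff)
  then show "v = 0" by (simp add: sum_nonneg_eq_0_iff vec_eq_iff)
qed

context subfield_conj
begin

lemma K_subspace_vectors: "vecs.K_subspace (K_vectors K)"
  by (auto simp: vecs.K_subspace_def K_vectors_def)

lemma spanK_subset_span: "K_span (*s) K S \<subseteq> vec.span (S :: 'n::finite cvec set)"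
proof
  fix v assume "v \<in> K_span (*s) K S"
  then obtain T c where "v = (\<Sum>x\<in>T. c x *s x)" "T \<subseteq> S" unfolding K_span_def by blast
  then show "v \<in> vec.span S"
    by (auto intro: vec.span_sum vec.span_scale vec.span_base)
qed

lemma span_imp_spanK:
  fixes S :: "'n::finite cvec set"
  assumes S: "S \<subseteq> K_vectors K" and v: "v \<in> K_vectors K" "v \<in> vec.span S"
  shows "v \<in> K_span (*s) K S"
proof -
  let ?W = "K_span (*s) K S"
  have W: "?W \<subseteq> K_vectors K" using vecs.spanK_minimal[OF K_subspace_vectors S] .
  have "\<exists>w\<in>?W. \<forall>t\<in>?W. hdot t (v - w) = 0"
  proof (rule vecs.orth_projection[of "K_vectors K" hdot "\<lambda>i v. v $ i" UNIV])
    show "vecs.K_subspace ?W" by (rule vecs.K_subspace_spanK)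
    fix u v w :: "'n cvec" and c
    show "hdot v u = cnj (hdot u v)" by (simp add: hdot_def mult.commute)
    show "hdot u (v + w) = hdot u v + hdot u w" by (simp add: hdot_def distrib_left sum.distrib)
    show "hdot u (c *s v) = c * hdot u v" by (simp add: hdot_def sum_distrib_left mult.left_commute)
    show "v = 0" if "hdot v v = 0" using that by (rule hdot_self_eq_0)
    show "hdot u v \<in> K" if "u \<in> K_vectors K" "v \<in> K_vectors K"
      using that unfolding hdot_def by (intro K_sum K_mult K_cnj) (auto simp: K_vectors_def)
  qed (use W v K_subspace_vectors in \<open>auto simp: vec_eq_iff K_vectors_def\<close>)
  then obtain w where w: "w \<in> ?W" "\<And>t. t \<in> ?W \<Longrightarrow> hdot t (v - w) = 0" by blast
  have "vec.subspace {t. hdot t (v - w) = 0}"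
    by (auto simp: vec.subspace_def hdot_def distrib_right sum.distrib mult.assoc simp flip: sum_distrib_left)
  then have sub: "vec.span S \<subseteq> {t. hdot t (v - w) = 0}"
    by (intro vec.span_minimal) (use w(2) vecs.spanK_base in auto)
  have "?W \<subseteq> vec.span S" by (rule spanK_subset_span)
  then have "v - w \<in> vec.span S" using v(2) w(1) by (auto intro: vec.span_diff)
  then have "hdot (v - w) (v - w) = 0" using sub by auto
  then have "v - w = 0" by (rule hdot_self_eq_0)
  then show ?thesis using w(1) by simp
qed

text \<open>Vectors over \<open>K\<close> that are independent over \<open>K\<close> remain independent over the complex numbers: by the orthogonal
  projection over \<open>K\<close>, a vector over \<open>K\<close> in the complex span of such vectors lies in their span over \<open>K\<close>.\<close>

lemma K_dim_eq_dim:
  fixes W :: "'n::finite cvec set"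
  assumes W: "vecs.K_subspace W" "W \<subseteq> K_vectors K"
  shows "K_dim K W = vec.dim W"
proof -
  let ?P = "\<lambda>k. \<exists>B. finite B \<and> card B = k \<and> K_basis (*s) K B id W"
  obtain B where B: "B \<subseteq> W" "vec.independent B" "W \<subseteq> vec.span B" "card B = vec.dim W"
    using vec.basis_exists by blast
  have fin: "finite B" using B(2) vec.independent_bound_general by blast
  have "K_basis (*s) K B id W"
    unfolding K_basis_def
  proof
    show "K_independent_family (*s) K B id"
      unfolding K_independent_family_def
    proof (intro allI impI ballI)
      fix T and c :: "'n cvec \<Rightarrow> complex" and i
      assume "finite T \<and> T \<subseteq> B \<and> c ` T \<subseteq> K \<and> (\<Sum>i\<in>T. c i *s id i) = 0" "i \<in> T"
      then show "c i = 0"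
        using vec.independentD[of B T c i] B(2) by simp
    qed
    have "W \<subseteq> K_span (*s) K B"
      using B(1,3) W(2) by (auto intro!: span_imp_spanK)
    moreover have "K_span (*s) K B \<subseteq> W"
      by (rule vecs.spanK_minimal[OF W(1) B(1)])
    ultimately show "K_span (*s) K (id ` B) = W" by simp
  qed
  then have ex: "?P (vec.dim W)" using B(4) fin by blast
  have uniq: "k = vec.dim W" if k: "?P k" for k
  proof -
    obtain C where "finite C \<and> card C = k \<and> K_basis (*s) K C id W" using k ..
    then have C: "finite C" "card C = k" "K_basis (*s) K C id W" by auto
    have ind: "K_independent_family (*s) K C id" and sp: "K_span (*s) K C = W"
      using C(3) by (auto simp: K_basis_def)
    have CW: "C \<subseteq> W" using sp vecs.spanK_base by blast
    then have CK: "C \<subseteq> K_vectors K" using W by blast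
    obtain B' where B': "B' \<subseteq> C" "vec.independent B'" "C \<subseteq> vec.span B'"
      using vec.maximal_independent_subset[of C] by blast
    have "B' = C"
    proof (rule ccontr)
      assume "B' \<noteq> C"
      then obtain b where b: "b \<in> C" "b \<notin> B'" using B' by blast
      then have "b \<in> K_span (*s) K B'"
        using B' CK by (intro span_imp_spanK) auto
      then obtain T c where T: "b = (\<Sum>x\<in>T. c x *s x)" "finite T" "T \<subseteq> B'" "c ` T \<subseteq> K"
        unfolding K_span_def by blast
      define c' where "c' = c(b := - 1)"
      have "(\<Sum>x\<in>insert b T. c' x *s x) = 0"
      proof -
        have "b \<notin> T" using b T by auto
        then have "(\<Sum>x\<in>insert b T. c' x *s x) = - 1 *s b + (\<Sum>x\<in>T. c' x *s x)"
          using T(2) by (simp add: c'_def)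
        also have "(\<Sum>x\<in>T. c' x *s x) = (\<Sum>x\<in>T. c x *s x)"
          using \<open>b \<notin> T\<close> by (intro sum.cong) (auto simp: c'_def)
        also have "\<dots> = b" by (simp flip: T(1))
        finally show ?thesis by (simp add: vec_eq_iff)
      qed
      moreover have "finite (insert b T)" "insert b T \<subseteq> C" using T b B' by auto
      moreover have "c' ` insert b T \<subseteq> K"
        using T(4) K_uminus[OF K_1] by (auto simp: c'_def)
      ultimately have "finite (insert b T) \<and> insert b T \<subseteq> C \<and> c' ` insert b T \<subseteq> K \<and>
          (\<Sum>x\<in>insert b T. c' x *s id x) = 0"
        unfolding id_apply by (intro conjI)
      then have "\<forall>i\<in>insert b T. c' i = 0"
        by (rule ind[unfolded K_independent_family_def, THEN spec, THEN spec, THEN mp])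
      then have "c' b = 0" by simp
      then show False by (simp add: c'_def)
    qed
    then have "vec.independent C" using B' by simp
    moreover have "W \<subseteq> vec.span C"
      using spanK_subset_span[of C] by (simp add: sp)
    ultimately have "vec.dim W = card C"
      using CW by (intro vec.dim_unique) auto
    then show ?thesis using C by simp
  qed
  show ?thesis
    unfolding K_dim_def by (rule the_equality[of ?P, OF ex]) (rule uniq)
qed

lemma K_dim_vectors: "K_dim K (K_vectors K :: 'n::finite cvec set) = CARD('n)"
proof -
  have "vec.span (K_vectors K :: 'n cvec set) = UNIV"
  proof -
    have "axis i 1 \<in> (K_vectors K :: 'n cvec set)" for i
      by (auto simp: K_vectors_def axis_def)
    then have "(\<Sum>i\<in>UNIV. x $ i *s axis i 1) \<in> vec.span (K_vectors K)" for x :: "'n cvec"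
      by (intro vec.span_sum vec.span_scale vec.span_base)
    then show ?thesis by (auto simp: basis_expansion)
  qed
  then have "vec.dim (K_vectors K :: 'n cvec set) = CARD('n)"
    using vec.dim_span[of "K_vectors K :: 'n cvec set"] vec.dim_UNIV
    by (simp add: vec.dimension_def card_cart_basis)
  then show ?thesis by (simp add: K_dim_eq_dim K_subspace_vectors)
qed

end

section \<open>Super harmonics of a pseudo-reflection group\<close>

lemma det_conj_transpose: "det (conj_transpose s) = cnj (det s)"
proof -
  have "conj_transpose s = transpose (\<chi> i j. cnj (s $ i $ j))"
    by (simp add: conj_transpose_def transpose_def)
  moreover have "det (\<chi> i j. cnj (s $ i $ j)) = cnj (det s)"
    by (simp add: det_def)
  ultimately show ?thesis by (simp add: det_transpose)
qed

lemma theta_mult_one: "theta i \<star> of_poly 1 = theta i"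
proof -
  have "theta_sign {i} {i} = 1"
    using theta_sign_remove(2)[of i "{}"] by simp
  then show ?thesis
    unfolding vec_eq_iff theta_mult_component of_poly_component by (auto simp: theta_def)
qed

lemma lin_theta_mult_one: "lin_theta w \<star> of_poly 1 = lin_theta w"
  by (simp only: lin_theta_mult theta_mult_one) (simp only: lin_theta_def)

lemma act_lin_theta: "act s (lin_theta w) = lin_theta (\<chi> i. \<Sum>j\<in>UNIV. cnj (s $ i $ j) * w $ j)"
  using act_lin_theta_mult[of s w "of_poly 1"] by (simp add: lin_theta_mult_one act_of_poly)

lemma act_lin_poly: "act_poly s (lin_poly w) = lin_poly (\<chi> i. \<Sum>j\<in>UNIV. cnj (s $ i $ j) * w $ j)"
proof -
  have "act_poly s (lin_poly w) = (\<Sum>j\<in>UNIV. \<Sum>i\<in>UNIV. Const (cnj (s $ i $ j) * w $ j) * X i)"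
    by (simp add: lin_poly_def act_poly_sum act_poly_mult act_poly_X sum_distrib_left Const_mult mult_ac)
  also have "\<dots> = (\<Sum>i\<in>UNIV. \<Sum>j\<in>UNIV. Const (cnj (s $ i $ j) * w $ j) * X i)"
    by (rule sum.swap)
  finally show ?thesis by (simp add: lin_poly_def Const_sum sum_distrib_right)
qed

lemma bihomog_lin_theta_one: "bihomog 0 1 (lin_theta (w :: 'n::{finite,linorder} cvec))"
  using bihomog_lin_theta[OF bihomog_of_poly[OF homog_1], of w] by (simp add: lin_theta_mult_one)

lemma homog_lin_poly: "homog 1 (lin_poly w)"
  unfolding lin_poly_def by (intro homog_sum homog_Const_mult homog_X)

lemma par_bihomog: "bihomog a b \<omega> \<Longrightarrow> par \<omega> = form_scale ((- 1) ^ b) \<omega>"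
proof (rule vec_eq_iff[THEN iffD2], rule allI)
  fix I assume "bihomog a b \<omega>"
  then show "par \<omega> $ I = form_scale ((- 1) ^ b) \<omega> $ I"
    by (cases "\<omega> $ I = 0") (auto simp: bihomog_def Const_power Const_uminus)
qed

definition ext_d :: "'n::{finite,linorder} form \<Rightarrow> 'n form" where
  "ext_d \<eta> = (\<Sum>j\<in>UNIV. theta j \<star> dx j \<eta>)"

lemma ext_d_add: "ext_d (\<omega> + \<eta>) = ext_d \<omega> + ext_d \<eta>"
  and ext_d_scale: "ext_d (form_scale c \<omega>) = form_scale c (ext_d \<omega>)"
  and ext_d_0 [simp]: "ext_d 0 = 0"
  by (simp_all add: ext_d_def dx_add dx_scale form_mult_add_right form_mult_scale_right sum.distrib form_scale_sum)

lemma ext_d_uminus: "ext_d (- \<omega>) = - ext_d \<omega>"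
  using ext_d_scale[of "- 1" \<omega>] by (simp add: form_scale_minus_one)

lemma ext_d_diff: "ext_d (\<omega> - \<eta>) = ext_d \<omega> - ext_d \<eta>"
  using ext_d_add[of \<omega> "- \<eta>"] by (simp add: ext_d_uminus)

lemma ext_d_sum: "ext_d (sum f A) = (\<Sum>i\<in>A. ext_d (f i))"
  by (induction A rule: infinite_finite_induct) (simp_all add: ext_d_add)

lemma ext_d_dform_of_poly: "ext_d (dform (of_poly g) \<eta>) = dform (of_poly g) (ext_d \<eta>)"
proof -
  have "dx j (dform (of_poly g) \<eta>) = dform (of_poly g) (dx j \<eta>)" for j
    by (simp add: vec_eq_iff pdop_pdx)
  then show ?thesis by (simp add: ext_d_def dform_sum_right dform_of_poly_theta)
qed

lemma bihomog_ext_d: "bihomog (Suc a) b \<omega> \<Longrightarrow> bihomog a (Suc b) (ext_d \<omega>)"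
  unfolding ext_d_def by (intro bihomog_sum bihomog_theta_mult bihomog_dx)

lemma dx_homog_0: "bihomog 0 b \<omega> \<Longrightarrow> dx i (\<omega> :: 'n::{finite,linorder} form) = 0"
  unfolding vec_eq_iff dx_component
proof
  fix I assume "bihomog 0 b \<omega>"
  then have "homog 0 (\<omega> $ I)" by (cases "\<omega> $ I = 0") (auto simp: bihomog_def)
  then show "pdx i (\<omega> $ I) = 0 $ I"
    using pdop_homog(2)[OF homog_X, of 0 "\<omega> $ I" i] by (simp add: pdop_X)
qed

lemma bihomog_ext_d': "bihomog a b \<omega> \<Longrightarrow> bihomog (a - 1) (Suc b) (ext_d \<omega>)"
  by (cases a) (auto simp: bihomog_ext_d, simp add: ext_d_def dx_homog_0)

lemma dtheta_all_zero:
  assumes "bihomog a (Suc b) \<omega>" "\<And>k. dtheta k \<omega> = 0"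
  shows "\<omega> = 0"
proof (rule vec_eq_iff[THEN iffD2], rule allI, rule ccontr)
  fix I assume "\<omega> $ I \<noteq> 0 $ I"
  then have "card I = Suc b" using assms(1) by (auto simp: bihomog_def)
  then obtain k where k: "k \<in> I" by fastforce
  have "dtheta k \<omega> $ (I - {k}) = 0" using assms(2) by simp
  then have "theta_sign {k} (I - {k}) * \<omega> $ I = 0"
    using k by (simp add: dtheta_component insert_absorb)
  then have "\<omega> $ I = 0" by (metis mult_zero_right theta_sign_sq(2))
  then show False using \<open>\<omega> $ I \<noteq> 0 $ I\<close> by simp
qed

lemma unitary_rows:
  assumes "unitary_matrix s"
  shows "(\<Sum>j\<in>UNIV. s $ k $ j * cnj (s $ i $ j)) = (if k = i then 1 else 0)"
proof -
  have "(\<Sum>j\<in>UNIV. s $ k $ j * cnj (s $ i $ j)) = (s ** conj_transpose s) $ k $ i"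
    by (simp add: matrix_matrix_mult_def conj_transpose_def)
  then show ?thesis using assms by (simp add: unitary_matrix_def mat_def)
qed

lemma X_equivariant:
  assumes "unitary_matrix s"
  shows "X k = (\<Sum>j\<in>UNIV. Const (s $ k $ j) * act_poly s (X j))"
proof -
  have "(\<Sum>j\<in>UNIV. Const (s $ k $ j) * act_poly s (X j))
      = (\<Sum>j\<in>UNIV. \<Sum>i\<in>UNIV. Const (s $ k $ j * cnj (s $ i $ j)) * X i)"
    by (simp add: act_poly_X sum_distrib_left Const_mult mult.assoc)
  also have "\<dots> = (\<Sum>i\<in>UNIV. Const (\<Sum>j\<in>UNIV. s $ k $ j * cnj (s $ i $ j)) * X i)"
    by (subst sum.swap) (simp add: sum_distrib_right Const_sum)
  also have "\<dots> = (\<Sum>i\<in>UNIV. if i = k then X k else 0)"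
    unfolding unitary_rows[OF assms] by (intro sum.cong) auto
  finally show ?thesis by simp
qed

locale refl_group = subfield_conj K for K +
  fixes G :: "'n::{finite,linorder} cmat set"
  assumes G: "pseudo_reflection_group K G"
begin

lemma G_subgroup: "subgroup G (GL K)" and finite_G [simp]: "finite G"
  and G_unitary: "s \<in> G \<Longrightarrow> unitary_matrix s"
  and G_generate: "G = generate (GL K) {s \<in> G. pseudo_reflection K s}"
  using G unfolding pseudo_reflection_group_def by auto

lemma G_carrier: "s \<in> G \<Longrightarrow> s \<in> carrier (GL K)"
  using subgroup.subset[OF G_subgroup] by auto

lemma G_entries: "s \<in> G \<Longrightarrow> s $ i $ j \<in> K"
  using G_carrier by (auto simp: GL_def)

lemma G_mult: "s \<in> G \<Longrightarrow> t \<in> G \<Longrightarrow> s ** t \<in> G"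
  using subgroup.m_closed[OF G_subgroup, of s t] by (simp add: GL_def)

lemma G_one: "mat 1 \<in> G"
  using subgroup.one_closed[OF G_subgroup] by (simp add: GL_def)

lemma unitary_inverse:
  assumes "unitary_matrix s"
  shows "s ** conj_transpose s = mat 1" "conj_transpose s ** s = mat 1"
    "conj_transpose s ** (s ** t) = t" "s ** (conj_transpose s ** t) = t"
  using assms by (simp_all add: unitary_matrix_def matrix_mul_assoc)

lemma GL_inverse:
  assumes "s \<in> G"
  shows "inv\<^bsub>GL K\<^esub> s = conj_transpose s"
  unfolding m_inv_def
proof (rule the_equality)
  note U = unitary_inverse[OF G_unitary[OF assms]]
  have "invertible (conj_transpose s)" unfolding invertible_def using U by blast
  then show "conj_transpose s \<in> carrier (GL K) \<and> s \<otimes>\<^bsub>GL K\<^esub> conj_transpose s = \<one>\<^bsub>GL K\<^esub> \<and>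
    conj_transpose s \<otimes>\<^bsub>GL K\<^esub> s = \<one>\<^bsub>GL K\<^esub>"
    using U G_entries[OF assms] by (auto simp: GL_def conj_transpose_def)
  fix y assume "y \<in> carrier (GL K) \<and> s \<otimes>\<^bsub>GL K\<^esub> y = \<one>\<^bsub>GL K\<^esub> \<and> y \<otimes>\<^bsub>GL K\<^esub> s = \<one>\<^bsub>GL K\<^esub>"
  then have "s ** y = mat 1" by (simp add: GL_def)
  then show "y = conj_transpose s" using U(3)[of y] by simp
qed

lemma G_inv: "s \<in> G \<Longrightarrow> conj_transpose s \<in> G"
  using subgroup.m_inv_closed[OF G_subgroup, of s] by (simp add: GL_inverse)

lemma G_induct [consumes 1, case_names reflection one mult inverse]:
  assumes "s \<in> G" and "\<And>s. s \<in> G \<Longrightarrow> pseudo_reflection K s \<Longrightarrow> P s" and "P (mat 1)"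
    and "\<And>s t. s \<in> G \<Longrightarrow> t \<in> G \<Longrightarrow> P s \<Longrightarrow> P t \<Longrightarrow> P (s ** t)"
    and "\<And>s. s \<in> G \<Longrightarrow> P s \<Longrightarrow> P (conj_transpose s)"
  shows "P s"
proof -
  have "s \<in> generate (GL K) {s \<in> G. pseudo_reflection K s}"
    using assms(1) G_generate by simp
  then have "P s \<and> s \<in> G"
  proof (induction rule: generate.induct)
    case one
    then show ?case using assms(3) G_one by (simp add: GL_def)
  next
    case (incl h)
    then show ?case using assms(2) by simp
  next
    case (inv h)
    then show ?case using assms(2,5) G_inv by (simp add: GL_inverse)
  next
    case (eng h1 h2)
    then show ?case using assms(4) G_mult by (simp add: GL_def)
  qed
  then show ?thesis ..
qed

lemma det_unit: "s \<in> G \<Longrightarrow> det s * cnj (det s) = 1" "s \<in> G \<Longrightarrow> cnj (det s) * det s = 1"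
proof -
  assume "s \<in> G"
  then have "det (s ** conj_transpose s) = 1"
    using unitary_inverse(1)[OF G_unitary] by simp
  then show "det s * cnj (det s) = 1" by (simp add: det_mul det_conj_transpose)
  then show "cnj (det s) * det s = 1" by (simp add: mult.commute)
qed

lemma det_in_K: "s \<in> G \<Longrightarrow> det s \<in> K"
proof -
  assume s: "s \<in> G"
  have "of_int (sign p) \<in> K" for p :: "'n \<Rightarrow> 'n"
    by (cases "sign p = 1") (auto simp: sign_def)
  then show ?thesis unfolding det_def using G_entries[OF s] by (intro K_sum K_mult K_prod) auto
qed

lemma sum_G_left:
  assumes "t \<in> G"
  shows "(\<Sum>s\<in>G. f (t ** s)) = (\<Sum>s\<in>G. f s)"
  using assms
  by (intro sum.reindex_bij_witness[of _ "\<lambda>s. conj_transpose t ** s" "\<lambda>s. t ** s"])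
    (auto simp: unitary_inverse[OF G_unitary] G_mult G_inv)

lemma card_G: "of_nat (card G) \<noteq> (0 :: complex)"
  using G_one by auto

lemma card_G_K: "inverse (of_nat (card G)) \<in> K"
  by (intro K_inverse K_of_nat)

definition avg :: "'n form \<Rightarrow> 'n form" where
  "avg \<omega> = form_scale (inverse (of_nat (card G))) (\<Sum>s\<in>G. act s \<omega>)"

lemma act_avg: "t \<in> G \<Longrightarrow> act t (avg \<omega>) = avg \<omega>"
  using sum_G_left[of t "\<lambda>s. act s \<omega>"] by (simp add: avg_def act_scale act_sum act_compose)

lemma avg_invariant:
  assumes "\<And>s. s \<in> G \<Longrightarrow> act s \<omega> = \<omega>"
  shows "avg \<omega> = \<omega>"
proof -
  have "avg \<omega> = form_scale (inverse (of_nat (card G))) (\<Sum>s\<in>G. form_scale 1 \<omega>)"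
    unfolding avg_def using assms by (intro arg_cong[where f = "form_scale _"] sum.cong) auto
  also have "\<dots> = form_scale (inverse (of_nat (card G)) * (\<Sum>s\<in>G. 1)) \<omega>"
    by (simp only: form_scale_sum_left[symmetric] form_scale_scale)
  finally show ?thesis using card_G by simp
qed

lemma avg_add: "avg (\<omega> + \<eta>) = avg \<omega> + avg \<eta>"
  and avg_scale: "avg (form_scale c \<omega>) = form_scale c (avg \<omega>)"
  and avg_0 [simp]: "avg 0 = 0"
  by (simp_all add: avg_def act_add act_scale sum.distrib form_scale_add form_scale_scale mult.commute
      flip: form_scale_sum)

lemma avg_sum: "avg (sum f A) = (\<Sum>i\<in>A. avg (f i))"
  by (induction A rule: infinite_finite_induct) (simp_all add: avg_add)

lemma avg_K_forms: "\<omega> \<in> K_forms K \<Longrightarrow> avg \<omega> \<in> K_forms K"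
  unfolding avg_def by (intro K_forms_scale card_G_K K_forms_sum K_forms_act G_entries)

lemma bihomog_avg: "bihomog a b \<omega> \<Longrightarrow> bihomog a b (avg \<omega>)"
  unfolding avg_def by (intro bihomog_scale bihomog_sum bihomog_act)

definition inv_forms :: "'n form set" where
  "inv_forms = {\<omega> \<in> K_forms K. (\<forall>s\<in>G. act s \<omega> = \<omega>) \<and> (\<exists>a b. a + b > 0 \<and> bihomog a b \<omega>)}"

lemma inv_formsI:
  "\<omega> \<in> K_forms K \<Longrightarrow> (\<And>s. s \<in> G \<Longrightarrow> act s \<omega> = \<omega>) \<Longrightarrow> bihomog a b \<omega> \<Longrightarrow> a + b > 0 \<Longrightarrow> \<omega> \<in> inv_forms"
  by (auto simp: inv_forms_def)

text \<open>The common kernel of the operators of the generators is already stable under all operators, because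
  these supercommute; so it is the space of super harmonics.\<close>

lemma SH_iff: "\<eta> \<in> SH K G \<longleftrightarrow> \<eta> \<in> K_forms K \<and> (\<forall>\<omega>\<in>inv_forms. dform \<omega> \<eta> = 0)"
proof
  assume "\<eta> \<in> SH K G"
  then show "\<eta> \<in> K_forms K \<and> (\<forall>\<omega>\<in>inv_forms. dform \<omega> \<eta> = 0)"
    unfolding SH_def J_ideal_def inv_forms_def by (auto intro: super_ideal.gen)
next
  define N where "N = {\<eta> \<in> K_forms K. \<forall>\<omega>\<in>inv_forms. dform \<omega> \<eta> = 0}"
  assume "\<eta> \<in> K_forms K \<and> (\<forall>\<omega>\<in>inv_forms. dform \<omega> \<eta> = 0)"
  then have "\<eta> \<in> N" by (simp add: N_def)
  have N_dtheta: "dtheta i \<eta> \<in> N" if "\<eta> \<in> N" for i \<eta>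
  proof -
    have "dform \<omega> (dtheta i \<eta>) = 0" if "\<omega> \<in> inv_forms" for \<omega>
    proof -
      obtain a b where "bihomog a b \<omega>" using \<open>\<omega> \<in> inv_forms\<close> by (auto simp: inv_forms_def)
      then show ?thesis
        using \<open>\<eta> \<in> N\<close> \<open>\<omega> \<in> inv_forms\<close> by (simp add: dform_dtheta par_bihomog dform_scale_left N_def)
    qed
    then show ?thesis using that by (auto simp: N_def)
  qed
  have N_poly: "dform (of_poly p) \<eta> \<in> N" if "\<eta> \<in> N" "p \<in> K_polys K" for p \<eta>
    using that by (auto simp: N_def simp flip: dform_of_poly_commute)
  have N_Theta: "dform (Theta l) \<eta> \<in> N" if "\<eta> \<in> N" for l \<eta>
    using that by (induction l arbitrary: \<eta>) (auto simp: Theta_simps dform_mult dform_theta N_dtheta)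
  have N_sum: "sum f A \<in> N" if "\<And>i. i \<in> A \<Longrightarrow> f i \<in> N" for f and A :: "'n set set"
    using that by (auto simp: N_def dform_sum_right intro!: sum.neutral)
  have N_dform: "dform \<zeta> \<eta> \<in> N" if "\<eta> \<in> N" "\<zeta> \<in> K_forms K" for \<zeta> \<eta>
    by (subst form_as_sum[of \<zeta>])
      (use that in \<open>auto simp: dform_sum_left dform_smult intro!: N_sum N_Theta N_poly K_forms_component\<close>)
  have "\<forall>\<eta>\<in>N. dform \<omega> \<eta> = 0" if "\<omega> \<in> super_ideal K inv_forms" for \<omega>
    using that
  proof induction
    case (gen \<omega>)
    then show ?case by (simp add: N_def)
  qed (auto simp: dform_add_left dform_mult N_dform)
  then show "\<eta> \<in> SH K G"
    using \<open>\<eta> \<in> N\<close> unfolding SH_def J_ideal_def inv_forms_def[symmetric] by (auto simp: N_def)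
qed

lemma SH_K_forms: "\<eta> \<in> SH K G \<Longrightarrow> \<eta> \<in> K_forms K"
  by (simp add: SH_iff)

lemma SH_kill: "\<eta> \<in> SH K G \<Longrightarrow> \<omega> \<in> inv_forms \<Longrightarrow> dform \<omega> \<eta> = 0"
  by (simp add: SH_iff)

lemma SH_subspace: "forms.K_subspace (SH K G)"
  by (auto simp: forms.K_subspace_def SH_iff dform_add_right dform_scale_right)

lemmas SH_0 = forms.K_subspaceD(1)[OF SH_subspace]
  and SH_add = forms.K_subspaceD(2)[OF SH_subspace]
  and SH_scale = forms.K_subspaceD(3)[OF SH_subspace]
  and SH_diff = forms.K_subspaceD(4)[OF SH_subspace]
  and SH_sum = forms.K_subspace_sum[OF SH_subspace]

lemma SH_dform_of_poly: "\<eta> \<in> SH K G \<Longrightarrow> g \<in> K_polys K \<Longrightarrow> dform (of_poly g) \<eta> \<in> SH K G"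
  by (auto simp: SH_iff simp flip: dform_of_poly_commute)

lemma SH_bicomp:
  assumes "\<eta> \<in> SH K G"
  shows "bicomp x y \<eta> \<in> SH K G"
  unfolding SH_iff
proof (intro conjI ballI)
  show "bicomp x y \<eta> \<in> K_forms K" using SH_K_forms[OF assms] by auto
  fix \<omega> assume \<omega>: "\<omega> \<in> inv_forms"
  then obtain a b where ab: "bihomog a b \<omega>" by (auto simp: inv_forms_def)
  show "dform \<omega> (bicomp x y \<eta>) = 0"
  proof (cases "a \<le> x \<and> b \<le> y")
    case True
    then show ?thesis
      using dform_bicomp[OF ab, of "x - a" "y - b" \<eta>] SH_kill[OF assms \<omega>] by simp
  next
    case False
    then show ?thesis by (intro dform_bicomp_small[OF ab]) auto
  qed
qed

lemma SH_subset_bihomog: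
  assumes "forms.K_subspace M" and "\<And>a b \<eta>. \<eta> \<in> SH K G \<Longrightarrow> bihomog a b \<eta> \<Longrightarrow> \<eta> \<in> M"
  shows "SH K G \<subseteq> M"
proof
  fix \<eta> assume "\<eta> \<in> SH K G"
  then have "(\<Sum>a\<le>form_bound \<eta>. \<Sum>b\<le>CARD('n). bicomp a b \<eta>) \<in> M"
    by (intro forms.K_subspace_sum[OF assms(1)] assms(2)[OF SH_bicomp bihomog_bicomp])
  then show "\<eta> \<in> M" by (simp add: sum_bicomp)
qed

lemma SH_act:
  assumes "s \<in> G" "\<eta> \<in> SH K G"
  shows "act s \<eta> \<in> SH K G"
  unfolding SH_iff
proof (intro conjI ballI)
  show "act s \<eta> \<in> K_forms K" using G_entries[OF assms(1)] SH_K_forms[OF assms(2)] by auto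
  fix \<omega> assume \<omega>: "\<omega> \<in> inv_forms"
  then have "dform \<omega> (act s \<eta>) = dform (act s \<omega>) (act s \<eta>)" using assms by (simp add: inv_forms_def)
  also have "\<dots> = act s (dform \<omega> \<eta>)" by (simp add: act_dform[OF G_unitary[OF assms(1)]])
  also have "\<dots> = 0" by (simp add: SH_kill[OF assms(2) \<omega>])
  finally show "dform \<omega> (act s \<eta>) = 0" .
qed

text \<open>Super harmonics are also killed by the invariants with complex coefficients: the averages of the
  monomials are invariants over \<open>K\<close>, and span all invariants.\<close>

lemma SH_kill_complex:
  assumes \<eta>: "\<eta> \<in> SH K G" and inv: "\<And>s. s \<in> G \<Longrightarrow> act s \<omega> = \<omega>" and "bihomog a b \<omega>" "a + b > 0"
  shows "dform \<omega> \<eta> = 0"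
proof -
  let ?m = "\<lambda>I \<alpha>. monomial \<alpha> 1 *s Theta (sorted_list_of_set I)"
  have "\<omega> $ I *s Theta (sorted_list_of_set I)
      = (\<Sum>\<alpha>\<in>Poly_Mapping.keys (\<omega> $ I). form_scale (coeff (\<omega> $ I) \<alpha>) (?m I \<alpha>))" for I
  proof -
    have "(\<Sum>\<alpha>\<in>Poly_Mapping.keys (\<omega> $ I). form_scale (coeff (\<omega> $ I) \<alpha>) (?m I \<alpha>))
       = (\<Sum>\<alpha>\<in>Poly_Mapping.keys (\<omega> $ I). monomial \<alpha> (coeff (\<omega> $ I) \<alpha>)) *s Theta (sorted_list_of_set I)"
      by (simp add: vec_eq_iff sum_distrib_right mult.assoc[symmetric] monomial_mult_Const)
    then show ?thesis by (simp flip: mpoly_as_sum)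
  qed
  then have "\<omega> = (\<Sum>I\<in>UNIV. \<Sum>\<alpha>\<in>Poly_Mapping.keys (\<omega> $ I). form_scale (coeff (\<omega> $ I) \<alpha>) (?m I \<alpha>))"
    by (metis (no_types, lifting) form_as_sum sum.cong)
  then have "avg \<omega> = (\<Sum>I\<in>UNIV. \<Sum>\<alpha>\<in>Poly_Mapping.keys (\<omega> $ I). form_scale (coeff (\<omega> $ I) \<alpha>) (avg (?m I \<alpha>)))"
    by (metis (no_types, lifting) avg_sum avg_scale sum.cong)
  then have "dform (avg \<omega>) \<eta> = (\<Sum>I\<in>UNIV. \<Sum>\<alpha>\<in>Poly_Mapping.keys (\<omega> $ I).
      form_scale (cnj (coeff (\<omega> $ I) \<alpha>)) (dform (avg (?m I \<alpha>)) \<eta>))"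
    by (simp add: dform_sum_left dform_scale_left)
  also have "\<dots> = 0"
  proof (intro sum.neutral ballI)
    fix I \<alpha> assume \<alpha>: "\<alpha> \<in> Poly_Mapping.keys (\<omega> $ I)"
    then have "\<omega> $ I \<noteq> 0" by auto
    then have deg: "homog a (\<omega> $ I)" "card I = b" using assms(3) by (auto simp: bihomog_def)
    then have "mdeg \<alpha> = a" using \<alpha> by (auto simp: homog_def)
    then have bh: "bihomog a b (?m I \<alpha>)"
      using bihomog_smult[OF homog_monomial[of \<alpha> a 1] bihomog_Theta[of "sorted_list_of_set I"]] deg by simp
    have "?m I \<alpha> \<in> K_forms K"
      unfolding K_forms_def by (auto simp: Theta_sorted)
    then have "avg (?m I \<alpha>) \<in> inv_forms"
      by (intro inv_formsI[OF avg_K_forms act_avg bihomog_avg[OF bh] assms(4)])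
    then show "form_scale (cnj (coeff (\<omega> $ I) \<alpha>)) (dform (avg (?m I \<alpha>)) \<eta>) = 0"
      by (simp add: SH_kill[OF \<eta>])
  qed
  finally show ?thesis by (simp add: avg_invariant[OF inv])
qed

text \<open>A fixed vector \<open>f\<close> gives two invariant linear forms, one in the \<open>x\<^sub>i\<close> and one in the \<open>\<theta>\<^sub>i\<close>. They may have
  coefficients outside of \<open>K\<close>.\<close>

lemma SH_fixed_direction:
  assumes "\<eta> \<in> SH K G" and f: "\<And>s. s \<in> G \<Longrightarrow> s *v f = f"
  shows "iota f \<eta> = 0" "dirx f \<eta> = 0"
proof -
  have fx: "(\<chi> i. \<Sum>j\<in>UNIV. cnj (s $ i $ j) * vcnj f $ j) = vcnj f" if "s \<in> G" for s
  proof -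
    have "(\<Sum>j\<in>UNIV. cnj (s $ i $ j) * vcnj f $ j) = cnj ((s *v f) $ i)" for i
      by (simp add: matrix_vector_mult_def)
    then show ?thesis by (simp add: f[OF that] vec_eq_iff)
  qed
  have "dform (lin_theta (vcnj f)) \<eta> = 0"
    using fx by (intro SH_kill_complex[OF assms(1) _ bihomog_lin_theta_one]) (auto simp: act_lin_theta)
  then show "iota f \<eta> = 0" by (simp add: dform_lin_theta)
  have "dform (of_poly (lin_poly (vcnj f))) \<eta> = 0"
    using fx by (intro SH_kill_complex[OF assms(1) _ bihomog_of_poly[OF homog_lin_poly]])
      (auto simp: act_of_poly act_lin_poly)
  then show "dirx f \<eta> = 0" by (simp add: dform_lin_poly)
qed


subsection \<open>Equivariant first order operators\<close>

text \<open>The operator \<open>\<Sum>\<^sub>j \<theta>\<^sub>j \<partial>\<^sub>g\<^sub>j\<close> preserves super harmonics. Its supercommutator with \<open>\<partial>\<^sub>\<omega>\<close> is the operator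
  of the contraction \<open>\<Sum>\<^sub>j g\<^sub>j \<partial>\<^sub>\<theta>\<^sub>j \<omega>\<close>, which is again invariant; its total degree is positive since \<open>e > 0\<close>.\<close>

lemma SH_exterior_op:
  assumes g: "\<And>j. g j \<in> K_polys K" "\<And>j. homog e (g j)" "e > 0"
    and equiv: "\<And>s k. s \<in> G \<Longrightarrow> g k = (\<Sum>j\<in>UNIV. Const (s $ k $ j) * act_poly s (g j))"
    and \<eta>: "\<eta> \<in> SH K G"
  shows "(\<Sum>j\<in>UNIV. theta j \<star> dform (of_poly (g j)) \<eta>) \<in> SH K G"
  unfolding SH_iff
proof (intro conjI ballI)
  show "(\<Sum>j\<in>UNIV. theta j \<star> dform (of_poly (g j)) \<eta>) \<in> K_forms K"
    by (intro K_forms_sum K_forms_mult K_forms_theta K_forms_dform K_forms_of_poly g(1) SH_K_forms[OF \<eta>])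
  fix \<omega> assume \<omega>: "\<omega> \<in> inv_forms"
  then obtain a b where ab: "bihomog a b \<omega>" "a + b > 0" by (auto simp: inv_forms_def)
  define \<omega>' where "\<omega>' = (\<Sum>j\<in>UNIV. g j *s dtheta j \<omega>)"
  have "dform (par \<omega>) (dform (of_poly (g j)) \<eta>) = 0" for j
    by (simp add: par_bihomog[OF ab(1)] dform_scale_left SH_kill[OF \<eta> \<omega>] flip: dform_of_poly_commute)
  then have "dform \<omega> (\<Sum>j\<in>UNIV. theta j \<star> dform (of_poly (g j)) \<eta>) = dform \<omega>' \<eta>"
    by (simp add: \<omega>'_def dform_sum_right dform_sum_left dform_theta_mult dform_smult)
  also have "\<dots> = 0"
  proof (cases b)
    case 0
    then have "dtheta j \<omega> = 0" for j using ab bihomog_dtheta_0 by blast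
    then show ?thesis by (simp add: \<omega>'_def)
  next
    case (Suc c)
    have "\<omega>' \<in> inv_forms"
    proof (rule inv_formsI)
      show "\<omega>' \<in> K_forms K" using g(1) \<omega> by (auto simp: \<omega>'_def inv_forms_def)
      show "bihomog (e + a) c \<omega>'"
        unfolding \<omega>'_def using ab Suc g(2) by (intro bihomog_sum bihomog_smult bihomog_dtheta) auto
      show "e + a + c > 0" using g(3) by simp
      fix s assume s: "s \<in> G"
      then have inv: "act s \<omega> = \<omega>" using \<omega> by (simp add: inv_forms_def)
      have "act s \<omega>' = (\<Sum>j\<in>UNIV. \<Sum>k\<in>UNIV. (Const (s $ k $ j) * act_poly s (g j)) *s dtheta k \<omega>)"
        unfolding \<omega>'_def act_sum act_smult act_dtheta[OF G_unitary[OF s]] inv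
        by (intro sum.cong refl)
          (simp add: iota_def column_def form_scale_def vec_eq_iff sum_distrib_left mult_ac)
      also have "\<dots> = (\<Sum>k\<in>UNIV. \<Sum>j\<in>UNIV. (Const (s $ k $ j) * act_poly s (g j)) *s dtheta k \<omega>)"
        by (rule sum.swap)
      also have "\<dots> = \<omega>'"
        unfolding \<omega>'_def by (subst equiv[OF s]) (simp add: vec_eq_iff sum_distrib_right)
      finally show "act s \<omega>' = \<omega>'" .
    qed
    then show ?thesis by (rule SH_kill[OF \<eta>])
  qed
  finally show "dform \<omega> (\<Sum>j\<in>UNIV. theta j \<star> dform (of_poly (g j)) \<eta>) = 0" .
qed

lemma SH_ext_d:
  assumes "\<eta> \<in> SH K G"
  shows "ext_d \<eta> \<in> SH K G"
proof -
  have "(\<Sum>j\<in>UNIV. theta j \<star> dform (of_poly (X j)) \<eta>) \<in> SH K G"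
  proof (rule SH_exterior_op[where g = X and e = 1])
    fix s k assume "s \<in> G"
    then show "X k = (\<Sum>j\<in>UNIV. Const (s $ k $ j) * act_poly s (X j))"
      by (rule X_equivariant[OF G_unitary])
  qed (rule K_polys_X homog_X zero_less_one assms)+
  then show ?thesis by (simp only: ext_d_def dform_of_poly_X)
qed

lemma act_ext_d:
  assumes "unitary_matrix s"
  shows "act s (ext_d \<eta>) = ext_d (act s \<eta>)"
proof -
  have "act s (ext_d \<eta>) = (\<Sum>j\<in>UNIV. \<Sum>k\<in>UNIV. \<Sum>i\<in>UNIV. form_scale (s $ k $ j * cnj (s $ i $ j)) (theta i \<star> dx k (act s \<eta>)))"
    by (simp add: ext_d_def act_sum act_theta_mult act_dx[OF assms] act_theta_eq lin_theta_mult dirx_def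
        column_def form_mult_sum_right form_mult_scale_right form_scale_sum form_scale_scale mult.commute)
  also have "\<dots> = (\<Sum>k\<in>UNIV. \<Sum>j\<in>UNIV. \<Sum>i\<in>UNIV. form_scale (s $ k $ j * cnj (s $ i $ j)) (theta i \<star> dx k (act s \<eta>)))"
    by (rule sum.swap)
  also have "\<dots> = (\<Sum>k\<in>UNIV. \<Sum>i\<in>UNIV. \<Sum>j\<in>UNIV. form_scale (s $ k $ j * cnj (s $ i $ j)) (theta i \<star> dx k (act s \<eta>)))"
    by (intro sum.cong refl sum.swap)
  also have "\<dots> = (\<Sum>k\<in>UNIV. \<Sum>i\<in>UNIV. form_scale (\<Sum>j\<in>UNIV. s $ k $ j * cnj (s $ i $ j)) (theta i \<star> dx k (act s \<eta>)))"
    unfolding form_scale_sum_left ..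
  also have "\<dots> = (\<Sum>k\<in>UNIV. \<Sum>i\<in>UNIV. if i = k then theta k \<star> dx k (act s \<eta>) else 0)"
    unfolding unitary_rows[OF assms] by (intro sum.cong) auto
  finally show ?thesis by (simp add: ext_d_def)
qed


subsection \<open>The determinantal component\<close>

lemma SH_detD: "\<eta> \<in> SH_det K G \<Longrightarrow> \<eta> \<in> SH K G" "\<eta> \<in> SH_det K G \<Longrightarrow> s \<in> G \<Longrightarrow> act s \<eta> = form_scale (det s) \<eta>"
  by (auto simp: SH_det_def)

lemma SH_det_ext_d: "\<eta> \<in> SH_det K G \<Longrightarrow> ext_d \<eta> \<in> SH_det K G"
  by (auto simp: SH_det_def SH_ext_d act_ext_d[OF G_unitary] ext_d_scale)

text \<open>The isotypic projection for the character \<open>det\<close>.\<close>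

definition det_proj :: "'n form \<Rightarrow> 'n form" where
  "det_proj \<eta> = form_scale (inverse (of_nat (card G))) (\<Sum>s\<in>G. form_scale (cnj (det s)) (act s \<eta>))"

lemma det_proj_SH_det:
  assumes "\<eta> \<in> SH K G"
  shows "det_proj \<eta> \<in> SH_det K G"
  unfolding SH_det_def
proof (intro CollectI conjI ballI)
  show "det_proj \<eta> \<in> SH K G"
    unfolding det_proj_def using assms
    by (intro SH_scale card_G_K SH_sum SH_act K_cnj det_in_K)
  fix t assume t: "t \<in> G"
  have "form_scale (cnj (det s)) (act t (act s \<eta>)) = form_scale (det t) (form_scale (cnj (det (t ** s))) (act (t ** s) \<eta>))"
    for s
    using det_unit(1)[OF t] by (simp add: act_compose form_scale_scale det_mul mult.assoc[symmetric])
  then have "act t (det_proj \<eta>) = form_scale (inverse (of_nat (card G)))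
      (\<Sum>s\<in>G. form_scale (det t) (form_scale (cnj (det (t ** s))) (act (t ** s) \<eta>)))"
    by (simp add: det_proj_def act_scale act_sum)
  also have "\<dots> = form_scale (det t) (det_proj \<eta>)"
    unfolding sum_G_left[OF t, of "\<lambda>s. form_scale (det t) (form_scale (cnj (det s)) (act s \<eta>))"]
    by (simp add: det_proj_def form_scale_sum form_scale_scale mult_ac)
  finally show "act t (det_proj \<eta>) = form_scale (det t) (det_proj \<eta>)" .
qed

lemma det_proj_eq:
  assumes "\<And>s. s \<in> G \<Longrightarrow> act s \<eta> = form_scale (det s) \<eta>"
  shows "det_proj \<eta> = \<eta>"
proof -
  have "det_proj \<eta> = form_scale (inverse (of_nat (card G))) (\<Sum>s\<in>G. form_scale 1 \<eta>)"
    unfolding det_proj_def using assms det_unit(2)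
    by (intro arg_cong[where f = "form_scale _"] sum.cong) (auto simp: form_scale_scale)
  also have "\<dots> = form_scale (inverse (of_nat (card G)) * (\<Sum>s\<in>G. 1)) \<eta>"
    by (simp only: form_scale_sum_left[symmetric] form_scale_scale)
  finally show ?thesis using card_G by simp
qed

abbreviation det_span :: "'n form set" where
  "det_span \<equiv> K_span form_scale K {dform (of_poly g) \<eta> | g \<eta>. g \<in> K_polys K \<and> \<eta> \<in> SH_det K G}"

lemma det_span_subset_SH: "det_span \<subseteq> SH K G"
  by (rule forms.spanK_minimal[OF SH_subspace]) (auto intro: SH_dform_of_poly SH_detD)

lemma SH_det_subset_span: "\<eta> \<in> SH_det K G \<Longrightarrow> \<eta> \<in> det_span"
  by (rule forms.spanK_base, rule CollectI, rule exI[of _ 1], rule exI[of _ \<eta>]) auto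

lemma det_span_dform_of_poly:
  assumes "g \<in> K_polys K" "\<eta> \<in> det_span"
  shows "dform (of_poly g) \<eta> \<in> det_span"
proof -
  let ?M = "{\<eta>. dform (of_poly g) \<eta> \<in> det_span}"
  have "det_span \<subseteq> ?M"
  proof (rule forms.spanK_minimal)
    show "forms.K_subspace ?M"
      by (auto simp: forms.K_subspace_def dform_add_right dform_scale_right
          intro: forms.spanK_0 forms.spanK_add forms.spanK_scale)
    show "{dform (of_poly g) \<eta> | g \<eta>. g \<in> K_polys K \<and> \<eta> \<in> SH_det K G} \<subseteq> ?M"
    proof clarify
      fix h :: "'n mpoly" and \<eta> assume "h \<in> K_polys K" "\<eta> \<in> SH_det K G"
      then show "dform (of_poly g) (dform (of_poly h) \<eta>) \<in> det_span"
        using assms(1) by (intro forms.spanK_base) (auto simp flip: dform_of_poly_mult)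
    qed
  qed
  then show ?thesis using assms(2) by auto
qed


subsection \<open>Rank at most two\<close>

definition fixed_killed :: "'n form \<Rightarrow> bool" where
  "fixed_killed \<omega> \<longleftrightarrow> (\<forall>f\<in>fixed_vectors K G. iota f \<omega> = 0)"

lemma SH_fixed_killed: "\<eta> \<in> SH K G \<Longrightarrow> fixed_killed \<eta>"
  by (auto simp: fixed_killed_def fixed_vectors_def intro: SH_fixed_direction)

lemma fixed_vectors_subspace: "vecs.K_subspace (fixed_vectors K G)"
  by (auto simp: vecs.K_subspace_def fixed_vectors_def K_vectors_def matrix_vector_right_distrib
      matrix_vector_mult_0_right vector_scalar_commute)

lemma group_rank_eq: "group_rank K G = CARD('n) - vec.dim (fixed_vectors K G)"
  unfolding group_rank_def K_dim_vectors
  by (subst K_dim_eq_dim[OF fixed_vectors_subspace]) (auto simp: fixed_vectors_def)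

lemma rank_two_complement:
  assumes "group_rank K G \<le> 2"
  obtains u1 u2 where "\<And>v. \<exists>f\<in>vec.span (fixed_vectors K G). \<exists>c d. v = f + c *s u1 + d *s u2"
proof -
  let ?F = "fixed_vectors K G"
  obtain B where B: "B \<subseteq> ?F" "vec.independent B" "?F \<subseteq> vec.span B" "card B = vec.dim ?F"
    using vec.basis_exists by blast
  obtain C where C: "B \<subseteq> C" "vec.independent C" "UNIV \<subseteq> vec.span C"
    using vec.maximal_independent_subset_extend[OF subset_UNIV B(2)] by auto
  have fin: "finite C" using C(2) vec.independent_bound_general by blast
  have "card C = CARD('n)"
    using vec.dim_unique[of C UNIV] C vec.dim_UNIV by (simp add: vec.dimension_def card_cart_basis)
  then have "card (C - B) \<le> 2"
    using assms B(4) card_Diff_subset[OF finite_subset[OF C(1) fin] C(1)] by (simp add: group_rank_eq)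
  then consider "card (C - B) = 0" | "card (C - B) = 1" | "card (C - B) = 2" by linarith
  then have "\<exists>u1 u2. C - B \<subseteq> {u1, u2}"
  proof cases
    case 1
    then have "C - B = {}" using fin by simp
    then show ?thesis by auto
  next
    case 2
    then obtain u where "C - B = {u}" by (elim card_1_singletonE)
    then show ?thesis by blast
  next
    case 3
    then obtain u v where "C - B = {u, v}" by (auto simp: card_2_iff)
    then show ?thesis by blast
  qed
  then obtain u1 u2 where u: "C - B \<subseteq> {u1, u2}" by blast
  have "\<exists>f\<in>vec.span ?F. \<exists>c d. v = f + c *s u1 + d *s u2" for v
  proof -
    have "C \<subseteq> insert u2 (insert u1 ?F)" using u B(1) by auto
    then have "v \<in> vec.span (insert u2 (insert u1 ?F))" using C(3) vec.span_mono by blast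
    then obtain d where "v - d *s u2 \<in> vec.span (insert u1 ?F)" by (auto simp: vec.span_insert)
    then obtain c where "v - d *s u2 - c *s u1 \<in> vec.span ?F" by (auto simp: vec.span_insert)
    then show ?thesis
      by (intro bexI[of _ "v - d *s u2 - c *s u1"] exI[of _ c] exI[of _ d]) auto
  qed
  then show thesis by (rule that)
qed

text \<open>An alternating form in three arguments vanishes on a space of dimension two.\<close>

lemma three_form_zero:
  assumes "group_rank K G \<le> 2" and bh: "bihomog a b \<omega>" "b \<ge> 3" and "fixed_killed \<omega>"
  shows "\<omega> = 0"
proof -
  obtain u1 u2 where u: "\<And>v. \<exists>f\<in>vec.span (fixed_vectors K G). \<exists>c d. v = f + c *s u1 + d *s u2"
    using rank_two_complement[OF assms(1)] by blast
  have comb: "\<exists>c d. \<forall>\<zeta>. fixed_killed \<zeta> \<longrightarrow> iota v \<zeta> = form_scale c (iota u1 \<zeta>) + form_scale d (iota u2 \<zeta>)" for v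
  proof -
    obtain f c d where f: "f \<in> vec.span (fixed_vectors K G)" "v = f + c *s u1 + d *s u2" using u by blast
    have "iota f \<zeta> = 0" if "fixed_killed \<zeta>" for \<zeta>
    proof -
      have "vec.subspace {f. iota f \<zeta> = 0}" by (auto simp: vec.subspace_def iota_vec)
      then have "vec.span (fixed_vectors K G) \<subseteq> {f. iota f \<zeta> = 0}"
        by (intro vec.span_minimal) (use that in \<open>auto simp: fixed_killed_def\<close>)
      then show ?thesis using f by auto
    qed
    then show ?thesis
      by (intro exI[of _ c] exI[of _ d]) (simp add: f(2) iota_vec)
  qed
  have kil: "fixed_killed (iota v \<zeta>)" if "fixed_killed \<zeta>" for v \<zeta>
    using that by (auto simp: fixed_killed_def iota_anticommute[of _ v])
  have sq: "iota u (iota u \<zeta>) = 0" for u and \<zeta> :: "'n form" by (rule form_eq_neg[OF iota_anticommute])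
  have sq': "iota u (iota v (iota u \<zeta>)) = 0" for u v and \<zeta> :: "'n form"
    by (simp add: iota_anticommute[of v u] iota_uminus sq)
  have red: "T (iota v \<zeta>) = 0"
    if T: "fixed_killed \<zeta>" "T (iota u1 \<zeta>) = 0" "T (iota u2 \<zeta>) = 0"
      "\<And>x y. T (x + y) = T x + T y" "\<And>c x. T (form_scale c x) = form_scale c (T x)"
    for T :: "'n form \<Rightarrow> 'n form" and v \<zeta>
  proof -
    obtain c d where "iota v \<zeta> = form_scale c (iota u1 \<zeta>) + form_scale d (iota u2 \<zeta>)"
      using comb[of v] T(1) by blast
    then show ?thesis by (simp add: T)
  qed
  \<comment> \<open>once all three directions are \<open>u1\<close> or \<open>u2\<close>, two of them coincide\<close>
  have 1: "iota x (iota y (iota z \<omega>)) = 0" if "y \<in> {u1, u2}" "z \<in> {u1, u2}" for x y z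
    by (rule red[of _ "\<lambda>x. x"]) (use that kil assms(4) in \<open>auto simp: sq sq'\<close>)
  have 2: "iota x (iota y (iota z \<omega>)) = 0" if "z \<in> {u1, u2}" for x y z
    by (rule red[of _ "iota x"]) (use that kil assms(4) in \<open>auto simp: 1 iota_add iota_scale\<close>)
  have 3: "iota x (iota y (iota z \<omega>)) = 0" for x y z
    by (rule red[of _ "\<lambda>\<zeta>. iota x (iota y \<zeta>)"]) (use assms(4) in \<open>auto simp: 2 iota_add iota_scale\<close>)
  obtain c where c: "b = Suc (Suc (Suc c))" using that[of "b - 3"] bh(2) by linarith
  have d3: "dtheta i (dtheta j (dtheta k \<omega>)) = 0" for i j k
    using 3[of "axis i 1" "axis j 1" "axis k 1"] by (simp add: iota_axis)
  note bh' = bh(1)[unfolded c]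
  have d2: "dtheta j (dtheta k \<omega>) = 0" for j k
    by (rule dtheta_all_zero[OF bihomog_dtheta[OF bihomog_dtheta[OF bh']] d3])
  have d1: "dtheta k \<omega> = 0" for k
    by (rule dtheta_all_zero[OF bihomog_dtheta[OF bh'] d2])
  show ?thesis by (rule dtheta_all_zero[OF bh' d1])
qed

end

section \<open>Reflections\<close>

lemma det_one_row:
  fixes a u :: "'n::finite cvec"
  assumes "k \<notin> T" "finite T"
  shows "det (\<chi> i. if i = k then a else if i \<in> T then axis i 1 + u $ i *s a else axis i 1) = a $ k"
  using assms(2,1)
proof (induction T rule: finite_induct)
  case empty
  have "(\<Sum>i\<in>UNIV. a $ i *s row i (mat 1)) = a"
    by (simp add: vec_eq_iff row_def mat_def if_distrib[where f = "(*) _"] cong: if_cong)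
  moreover have row: "row i (mat 1 :: 'n cmat) = axis i 1" for i
    by (auto simp: vec_eq_iff row_def mat_def axis_def)
  ultimately have "(\<Sum>i\<in>UNIV. a $ i *s axis i 1) = a" by simp
  then show ?case
    using cramer_lemma_transpose[of k a "mat 1"] by (simp only: row empty_iff if_False det_I mult_1_right)
next
  case (insert t T)
  let ?c = "\<lambda>i. if i = k then a else if i \<in> T then axis i 1 + u $ i *s a else axis i 1"
  have "det (\<chi> i. if i = k then a else if i \<in> insert t T then axis i 1 + u $ i *s a else axis i 1)
      = det (\<chi> i. if i = t then axis t 1 + u $ t *s a else ?c i)"
    by (rule arg_cong[where f = det]) (use insert in \<open>auto simp: vec_eq_iff\<close>)
  also have "\<dots> = det (\<chi> i. if i = t then axis t 1 else ?c i) + u $ t * det (\<chi> i. if i = t then a else ?c i)"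
    using det_row_add[of t "\<lambda>_. axis t 1" "\<lambda>_. u $ t *s a" ?c] det_row_mul[of t "u $ t" "\<lambda>_. a" ?c] by simp
  also have "det (\<chi> i. if i = t then a else ?c i) = 0"
    by (rule det_identical_rows[of t k]) (use insert in \<open>auto simp: row_def vec_eq_iff\<close>)
  also have "det (\<chi> i. if i = t then axis t 1 else ?c i) = det (\<chi> i. ?c i)"
    by (rule arg_cong[where f = det]) (use insert in \<open>auto simp: vec_eq_iff\<close>)
  finally show ?case using insert by simp
qed

text \<open>The matrix determinant lemma, adding the rank one matrix row by row.\<close>

lemma det_rank_one_update:
  fixes a u :: "'n::finite cvec"
  shows "det (\<chi> i j. (if i = j then 1 else 0) + u $ i * a $ j) = 1 + dot a u"
proof -
  have "det (\<chi> i. if i \<in> T then axis i 1 + u $ i *s a else axis i 1) = 1 + (\<Sum>i\<in>T. a $ i * u $ i)"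
    if "finite T" for T
    using that
  proof (induction T)
    case empty
    have "(\<chi> i. axis i 1) = (mat 1 :: 'n cmat)" by (auto simp: vec_eq_iff mat_def axis_def)
    then show ?case by simp
  next
    case (insert t T)
    let ?c = "\<lambda>i. if i \<in> T then axis i 1 + u $ i *s a else axis i 1"
    have "det (\<chi> i. if i \<in> insert t T then axis i 1 + u $ i *s a else axis i 1)
        = det (\<chi> i. if i = t then axis t 1 + u $ t *s a else ?c i)"
      by (rule arg_cong[where f = det]) (auto simp: vec_eq_iff)
    also have "\<dots> = det (\<chi> i. if i = t then axis t 1 else ?c i) + u $ t * det (\<chi> i. if i = t then a else ?c i)"
      using det_row_add[of t "\<lambda>_. axis t 1" "\<lambda>_. u $ t *s a" ?c] det_row_mul[of t "u $ t" "\<lambda>_. a" ?c] by simp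
    also have "det (\<chi> i. if i = t then axis t 1 else ?c i) = det (\<chi> i. ?c i)"
      by (rule arg_cong[where f = det]) (use insert in \<open>auto simp: vec_eq_iff\<close>)
    finally show ?case using insert det_one_row[OF insert(2,1), of a u] by (simp add: algebra_simps)
  qed
  from this[of UNIV] have "det (\<chi> i. axis i 1 + u $ i *s a) = 1 + dot a u" by (simp add: dot_def)
  moreover have "(\<chi> i. axis i 1 + u $ i *s a) = (\<chi> i j. (if i = j then 1 else 0) + u $ i * a $ j)"
    by (auto simp: vec_eq_iff axis_def)
  ultimately show ?thesis by simp
qed

text \<open>The matrix \<open>1 + u a\<^sup>T\<close>, the shape of every pseudo-reflection; the root of the reflection is \<open>u\<close>.\<close>

definition rank_one_update :: "'n::finite cvec \<Rightarrow> 'n cvec \<Rightarrow> 'n cmat \<Rightarrow> bool" where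
  "rank_one_update u a s \<longleftrightarrow> (\<forall>i j. s $ i $ j = (if i = j then 1 else 0) + u $ i * a $ j)"

lemma rank_one_update_det:
  assumes "rank_one_update u a s"
  shows "det s = 1 + dot a u"
proof -
  have "s = (\<chi> i j. (if i = j then 1 else 0) + u $ i * a $ j)"
    using assms by (simp add: rank_one_update_def vec_eq_iff)
  then show ?thesis using det_rank_one_update[of u a] by (simp only:)
qed

lemma rank_one_update_apply:
  assumes "rank_one_update u a s"
  shows "s *v v = v + dot a v *s u"
proof -
  have "(\<Sum>j\<in>UNIV. s $ i $ j * v $ j) = v $ i + dot a v * u $ i" for i
  proof -
    have "(\<Sum>j\<in>UNIV. s $ i $ j * v $ j) = (\<Sum>j\<in>UNIV. (if j = i then v $ i else 0) + a $ j * v $ j * u $ i)"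
      using assms unfolding rank_one_update_def by (intro sum.cong) (auto simp: algebra_simps)
    then show ?thesis by (simp add: sum.distrib dot_def sum_distrib_right)
  qed
  then show ?thesis by (simp add: vec_eq_iff matrix_vector_mult_def)
qed

lemma act_vcnj: "(\<chi> i. \<Sum>j\<in>UNIV. cnj (s $ i $ j) * vcnj v $ j) = vcnj (s *v v)"
  by (simp add: vec_eq_iff matrix_vector_mult_def)

lemma lin_poly_scale: "lin_poly (c *s w) = Const c * lin_poly w"
  by (simp add: lin_poly_def sum_distrib_left Const_mult mult.assoc)

lemma rank_one_update_root:
  fixes s :: "'n::{finite,linorder} cmat"
  assumes "rank_one_update u a s"
  shows "act_poly s (lin_poly (vcnj u)) = Const (cnj (det s)) * lin_poly (vcnj u)"
proof -
  have "vcnj (s *v u) = cnj (det s) *s vcnj u"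
    unfolding rank_one_update_apply[OF assms] rank_one_update_det[OF assms]
    by (simp add: vec_eq_iff algebra_simps)
  then show ?thesis by (simp only: act_lin_poly act_vcnj lin_poly_scale)
qed

lemma rank_one_update_X:
  fixes s :: "'n::{finite,linorder} cmat"
  assumes "rank_one_update u a s"
  shows "X j - act_poly s (X j) = lin_poly (vcnj u) * Const (- cnj (a $ j))"
proof -
  have "act_poly s (X j) = (\<Sum>i\<in>UNIV. (if i = j then X j else 0) + Const (cnj (a $ j)) * (Const (cnj (u $ i)) * X i))"
    unfolding act_poly_X using assms unfolding rank_one_update_def
    by (intro sum.cong) (auto simp: Const_add Const_mult algebra_simps)
  also have "\<dots> = X j + Const (cnj (a $ j)) * lin_poly (vcnj u)"
    by (simp add: sum.distrib lin_poly_def sum_distrib_left)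
  finally show ?thesis by (simp add: Const_uminus algebra_simps)
qed

lemma lin_poly_eq_0:
  assumes "lin_poly w = 0"
  shows "w = 0"
proof -
  have "coeff (lin_poly w) (unit_expo i) = w $ i" for i
  proof -
    have inj: "unit_expo j = unit_expo i \<longleftrightarrow> j = i" for j :: 'a
      by (metis lookup_single_eq lookup_single_not_eq zero_neq_one)
    have "coeff (lin_poly w) (unit_expo i) = (\<Sum>j\<in>UNIV. if j = i then w $ i else 0)"
      unfolding lin_poly_def lookup_sum coeff_Const_mult X_def
      by (intro sum.cong) (auto simp: lookup_single when_def inj[unfolded One_nat_def] inj)
    then show ?thesis by simp
  qed
  then show ?thesis using assms by (simp add: vec_eq_iff)
qed

text \<open>A form with constant coefficients is moved by \<open>\<alpha> \<star> \<iota>\<^sub>a\<close>, because \<open>1 + \<alpha> \<star> \<iota>\<^sub>a\<close> is multiplicative: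
  \<open>\<alpha> \<star> \<alpha> = 0\<close>.\<close>

lemma rank_one_update_const:
  fixes s :: "'n::{finite,linorder} cmat"
  assumes "rank_one_update u a s" and const: "bihomog 0 b \<omega>"
  shows "act s \<omega> = \<omega> + lin_theta (vcnj u) \<star> iota (vcnj a) \<omega>"
proof -
  let ?\<alpha> = "lin_theta (vcnj u)"
  have th: "act_theta s k \<star> \<eta> = theta k \<star> \<eta> + form_scale (cnj (a $ k)) (?\<alpha> \<star> \<eta>)" for k \<eta>
  proof -
    have "act_theta s k \<star> \<eta> = (\<Sum>i\<in>UNIV. (if i = k then theta k \<star> \<eta> else 0) +
        form_scale (cnj (a $ k)) (form_scale (vcnj u $ i) (theta i \<star> \<eta>)))"
      unfolding act_theta_eq lin_theta_mult using assms(1) unfolding rank_one_update_def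
      by (intro sum.cong) (auto simp: form_scale_add_left form_scale_scale mult.commute)
    then show ?thesis by (simp add: sum.distrib lin_theta_mult form_scale_sum)
  qed
  have lin: "lin_theta w \<star> (theta k \<star> \<eta>) = - (theta k \<star> (lin_theta w \<star> \<eta>))" for w :: "'n cvec" and k \<eta>
  proof -
    have "lin_theta (axis k 1) \<star> \<zeta> = theta k \<star> \<zeta>" for \<zeta> :: "'n form"
    proof -
      have "lin_theta (axis k 1) \<star> \<zeta> = (\<Sum>i\<in>UNIV. if i = k then theta k \<star> \<zeta> else 0)"
        unfolding lin_theta_mult by (intro sum.cong) (auto simp: axis_def)
      then show ?thesis by simp
    qed
    then show ?thesis using lin_theta_anticommute[of w "axis k 1" \<eta>] by simp
  qed
  have io: "iota w (theta k \<star> \<eta>) = form_scale (w $ k) \<eta> - theta k \<star> iota w \<eta>" for w :: "'n cvec" and k \<eta>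
  proof -
    have "iota w (theta k \<star> \<eta>) = (\<Sum>i\<in>UNIV. (if i = k then form_scale (w $ k) \<eta> else 0) - form_scale (w $ i) (theta k \<star> dtheta i \<eta>))"
      unfolding iota_def by (intro sum.cong) (auto simp: dtheta_theta vec_eq_iff right_diff_distrib)
    then show ?thesis by (simp add: sum_subtractf iota_def form_mult_sum_right form_mult_scale_right)
  qed
  have Th: "act s (Theta l) = Theta l + ?\<alpha> \<star> iota (vcnj a) (Theta l)" for l
  proof (induction l)
    case (Cons k l)
    let ?T = "Theta l" and ?A = "iota (vcnj a)"
    have "act s (Theta (k # l)) = theta k \<star> ?T + theta k \<star> (?\<alpha> \<star> ?A ?T)
        + form_scale (cnj (a $ k)) (?\<alpha> \<star> ?T)"
      by (simp add: Theta_simps act_theta_mult Cons th form_mult_add_right form_scale_add lin_theta_square)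
    also have "\<dots> = theta k \<star> ?T + ?\<alpha> \<star> ?A (theta k \<star> ?T)"
      using form_mult_add_right[of ?\<alpha> "form_scale (cnj (a $ k)) ?T" "- (theta k \<star> ?A ?T)"]
      by (simp add: io form_mult_uminus_right lin form_mult_scale_right)
    finally show ?case by (simp add: Theta_simps)
  qed (simp add: Theta_simps act_of_poly)
  have cst: "act_poly s (\<omega> $ I) = \<omega> $ I" for I
  proof -
    have "homog 0 (\<omega> $ I)" using const by (cases "\<omega> $ I = 0") (auto simp: bihomog_def)
    then have "\<omega> $ I = Const (coeff (\<omega> $ I) 0)"
      by (intro poly_mapping_eqI) (auto simp: homog_iff Const_def lookup_single when_def mdeg_eq_0_iff)
    then show ?thesis by (metis act_poly_Const)
  qed
  have "act s \<omega> = (\<Sum>I\<in>UNIV. \<omega> $ I *s Theta (sorted_list_of_set I)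
      + ?\<alpha> \<star> iota (vcnj a) (\<omega> $ I *s Theta (sorted_list_of_set I)))"
    by (subst form_as_sum)
      (simp add: act_sum act_smult cst Th iota_smult form_mult_smult_right vector_add_ldistrib)
  also have "\<dots> = \<omega> + ?\<alpha> \<star> iota (vcnj a) \<omega>"
  proof -
    have "iota (vcnj a) (sum f UNIV) = (\<Sum>I\<in>UNIV. iota (vcnj a) (f I))" for f :: "'n set \<Rightarrow> 'n form"
      using sum_comp_morphism[of "iota (vcnj a)" f UNIV] by (simp add: iota_add o_def)
    then have "?\<alpha> \<star> iota (vcnj a) \<omega> = (\<Sum>I\<in>UNIV. ?\<alpha> \<star> iota (vcnj a) (\<omega> $ I *s Theta (sorted_list_of_set I)))"
      by (subst form_as_sum[of \<omega>]) (simp only: form_mult_sum_right)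
    then show ?thesis by (simp add: sum.distrib flip: form_as_sum)
  qed
  finally show ?thesis .
qed

lemma bihomog_gt_card:
  assumes "bihomog a b (\<omega> :: 'n::finite form)" "b > CARD('n)"
  shows "\<omega> = 0"
proof (rule vec_eq_iff[THEN iffD2], rule allI, rule ccontr)
  fix I assume "\<omega> $ I \<noteq> 0 $ I"
  then have "card I = b" using assms(1) by (auto simp: bihomog_def)
  moreover have "card I \<le> CARD('n)" by (rule card_mono) auto
  ultimately show False using assms(2) by simp
qed

lemma (in subfield_conj) pseudo_reflection_update:
  assumes "pseudo_reflection K s"
  obtains u a where "u \<in> K_vectors K" "a \<in> K_vectors K" "u \<noteq> 0" "a \<noteq> 0" "rank_one_update u a s"
proof -
  obtain a where a: "a \<in> K_vectors K" "a \<noteq> 0"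
    and fixd: "\<And>v. v \<in> K_vectors K \<Longrightarrow> dot a v = 0 \<Longrightarrow> s *v v = v"
    using assms unfolding pseudo_reflection_def dot_def by blast
  have sK: "s $ i $ j \<in> K" for i j using assms by (auto simp: pseudo_reflection_def GL_def)
  obtain k where k: "a $ k \<noteq> 0" using a(2) by (auto simp: vec_eq_iff)
  define u where "u = inverse (a $ k) *s (column k s - axis k 1)"
  have upd: "s $ i $ j = (if i = j then 1 else 0) + u $ i * a $ j" for i j
  proof -
    define v where "v = axis j 1 - (a $ j / a $ k) *s axis k (1 :: complex)"
    have axisK: "axis i (1 :: complex) $ j \<in> K" for i j :: 'a by (simp add: axis_def)
    have vK: "v \<in> K_vectors K"
      unfolding K_vectors_def v_def using a(1) axisK
      by (auto simp: K_vectors_def intro!: K_diff K_mult K_divide simp del: axis_eq_axis)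
    have dax: "dot a (axis i 1) = a $ i" for i
    proof -
      have "dot a (axis i 1) = (\<Sum>j\<in>UNIV. if j = i then a $ i else 0)"
        unfolding dot_def by (intro sum.cong) (auto simp: axis_def)
      then show ?thesis by simp
    qed
    have "dot a v = dot a (axis j 1) - (a $ j / a $ k) * dot a (axis k 1)"
      unfolding v_def by (simp add: dot_def sum_subtractf sum_distrib_left right_diff_distrib mult.left_commute)
    then have "dot a v = 0" using k by (simp add: dax)
    then have "s *v v = v" using fixd[OF vK] by blast
    moreover have "s *v axis i 1 = column i s" for i
      by (simp add: vec_eq_iff matrix_vector_mult_def column_def axis_def if_distrib[where f = "(*) _"] cong: if_cong)
    then have "s *v v = column j s - (a $ j / a $ k) *s column k s"
      by (simp add: v_def matrix_vector_mult_diff_distrib vector_scalar_commute)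
    ultimately have eq: "column j s - (a $ j / a $ k) *s column k s = v" by metis
    have "column j s $ i - (a $ j / a $ k) * column k s $ i = axis j 1 $ i - (a $ j / a $ k) * axis k 1 $ i"
      using arg_cong[OF eq, of "\<lambda>x. x $ i"] by (simp add: v_def)
    moreover have "x - y = z - w \<Longrightarrow> x = z + (y - w)" for x y z w :: complex
      by (simp add: algebra_simps)
    ultimately have "column j s $ i = axis j 1 $ i + (a $ j / a $ k) * (column k s $ i - axis k 1 $ i)"
      unfolding right_diff_distrib by blast
    then have "s $ i $ j = (if i = j then 1 else 0) + (a $ j / a $ k) * (column k s $ i - axis k 1 $ i)"
      by (simp add: column_def axis_def)
    then show ?thesis by (simp add: u_def divide_inverse mult_ac right_diff_distrib)
  qed
  have "u \<in> K_vectors K"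
  proof -
    have "a $ k \<in> K" using a(1) by (auto simp: K_vectors_def)
    moreover have "column k s $ i \<in> K" "axis k (1 :: complex) $ i \<in> K" for i
      using sK by (auto simp: column_def axis_def)
    ultimately show ?thesis
      unfolding u_def K_vectors_def mem_Collect_eq vector_smult_component vector_minus_component
      by (intro allI K_mult K_inverse K_diff)
  qed
  moreover have "u \<noteq> 0"
  proof
    assume "u = 0"
    then have "s = mat 1" using upd by (simp add: vec_eq_iff mat_def)
    then show False using assms by (simp add: pseudo_reflection_def)
  qed
  ultimately show thesis using that[of u a] a upd by (auto simp: rank_one_update_def)
qed

context refl_group
begin

lemma unitary_update_orth:
  assumes s: "s \<in> G" "rank_one_update u a s" "a \<noteq> 0" and f: "s *v f = f"
  shows "dot f (vcnj u) = 0"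
proof -
  have "conj_transpose s *v (s *v f) = (conj_transpose s ** s) *v f"
    by (simp add: matrix_vector_mul_assoc)
  then have "conj_transpose s *v f = f"
    using f unitary_inverse(2)[OF G_unitary[OF s(1)]] by simp
  moreover have "rank_one_update (vcnj a) (vcnj u) (conj_transpose s)"
    using s(2) by (auto simp: rank_one_update_def conj_transpose_def)
  ultimately have "dot (vcnj u) f *s vcnj a = 0"
    using rank_one_update_apply[of "vcnj a" "vcnj u" "conj_transpose s" f] by simp
  moreover obtain k where "a $ k \<noteq> 0" using s(3) by (auto simp: vec_eq_iff)
  ultimately have "dot (vcnj u) f = 0" by (auto simp: vec_eq_iff)
  then show ?thesis by (simp add: dot_commute)
qed

text \<open>A reflection acts on forms with constant coefficients by \<open>1 + \<alpha> \<star> \<iota>\<^sub>a\<close>. If \<open>\<alpha> \<star> \<omega> = 0\<close>, then \<open>\<alpha> \<star> \<iota>\<^sub>a \<omega>\<close> is a multiple of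
  \<open>\<omega>\<close>, and the reflection scales \<open>\<omega>\<close> by the conjugate of its determinant. Both sides are multiplicative in \<open>s\<close>,
  and the reflections generate the group.\<close>

lemma const_form_det:
  assumes const: "bihomog 0 b \<omega>"
    and refl: "\<And>s u a. s \<in> G \<Longrightarrow> rank_one_update u a s \<Longrightarrow> a \<noteq> 0 \<Longrightarrow> lin_theta (vcnj u) \<star> \<omega> = 0"
    and "s \<in> G"
  shows "act s \<omega> = form_scale (cnj (det s)) \<omega>"
  using assms(3)
proof (induction rule: G_induct)
  case (reflection s)
  then obtain u a where ua: "a \<noteq> 0" "rank_one_update u a s"
    using pseudo_reflection_update by blast
  have "0 = form_scale (dot (vcnj a) (vcnj u)) \<omega> - lin_theta (vcnj u) \<star> iota (vcnj a) \<omega>"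
    using iota_lin_theta[of "vcnj a" "vcnj u" \<omega>] refl[OF reflection(1) ua(2,1)] by simp
  then have "lin_theta (vcnj u) \<star> iota (vcnj a) \<omega> = form_scale (dot (vcnj a) (vcnj u)) \<omega>" by simp
  moreover have "dot (vcnj a) (vcnj u) = cnj (dot a u)" by (simp add: dot_def)
  ultimately show ?case
    using rank_one_update_const[OF ua(2) const] rank_one_update_det[OF ua(2)]
    by (simp add: form_scale_add_left)
next
  case (mult s t)
  have "act (s ** t) \<omega> = act s (act t \<omega>)" by (simp add: act_compose)
  also have "\<dots> = form_scale (cnj (det (s ** t))) \<omega>"
    by (simp add: mult act_scale form_scale_scale det_mul mult.commute)
  finally show ?case .
next
  case (inverse s)
  have "act (conj_transpose s) (act s \<omega>) = \<omega>"
    by (simp add: act_compose unitary_inverse[OF G_unitary[OF inverse(1)]])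
  then have "form_scale (cnj (det s)) (act (conj_transpose s) \<omega>) = \<omega>"
    by (simp only: inverse.IH act_scale)
  then have "form_scale (det s) \<omega> = form_scale (det s * cnj (det s)) (act (conj_transpose s) \<omega>)"
    by (metis form_scale_scale)
  then show ?case by (simp add: det_unit[OF inverse(1)] det_conj_transpose)
qed simp

lemma top_form_det:
  assumes "bihomog 0 CARD('n) \<omega>" "s \<in> G"
  shows "act s \<omega> = form_scale (cnj (det s)) \<omega>"
proof (rule const_form_det[OF assms(1) _ assms(2)])
  fix u
  show "lin_theta (vcnj u) \<star> \<omega> = 0"
    by (rule bihomog_gt_card[OF bihomog_lin_theta[OF assms(1)]]) simp
qed

lemma two_form_det:
  assumes "group_rank K G \<le> 2" "bihomog 0 2 \<omega>" "fixed_killed \<omega>" "s \<in> G"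
  shows "act s \<omega> = form_scale (cnj (det s)) \<omega>"
proof (rule const_form_det[OF assms(2) _ assms(4)])
  fix s u a assume s: "s \<in> G" "rank_one_update u a s" "a \<noteq> 0"
  show "lin_theta (vcnj u) \<star> \<omega> = 0"
  proof (rule three_form_zero[OF assms(1) bihomog_lin_theta[OF assms(2)]])
    show "fixed_killed (lin_theta (vcnj u) \<star> \<omega>)"
      unfolding fixed_killed_def
    proof
      fix f assume f: "f \<in> fixed_vectors K G"
      then have "dot f (vcnj u) = 0" using unitary_update_orth[OF s] s(1) by (auto simp: fixed_vectors_def)
      moreover have "iota f \<omega> = 0" using assms(3) f by (auto simp: fixed_killed_def)
      ultimately show "iota f (lin_theta (vcnj u) \<star> \<omega>) = 0" by (simp add: iota_lin_theta)
    qed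
  qed simp
qed


section \<open>Harmonic polynomials\<close>

text \<open>Forms of positive \<open>\<theta>\<close>-degree kill all polynomials, so that only the polynomial generators impose conditions.\<close>

lemma harmonic_iff:
  "p \<in> harmonic_polys K G \<longleftrightarrow> p \<in> K_polys K \<and>
     (\<forall>f a. f \<in> K_polys K \<longrightarrow> homog a f \<longrightarrow> a > 0 \<longrightarrow> (\<forall>s\<in>G. act_poly s f = f) \<longrightarrow> pdop f p = 0)"
  (is "_ \<longleftrightarrow> ?R p")
proof
  assume "p \<in> harmonic_polys K G"
  then have p: "of_poly p \<in> SH K G" by (simp add: harmonic_polys_def)
  have "p \<in> K_polys K" using K_forms_component[OF SH_K_forms[OF p], of "{}"] by (simp add: of_poly_component)
  moreover have "pdop f p = 0" if "f \<in> K_polys K" "homog a f" "a > 0" "\<forall>s\<in>G. act_poly s f = f" for f a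
  proof -
    have "of_poly f \<in> inv_forms"
      using that by (intro inv_formsI[OF _ _ bihomog_of_poly[OF that(2)]]) (auto simp: act_of_poly)
    from SH_kill[OF p this] show ?thesis by (simp add: dform_of_poly_of_poly of_poly_eq_iff flip: of_poly_0)
  qed
  ultimately show "?R p" by blast
next
  assume R: "?R p"
  have "dform \<omega> (of_poly p) = 0" if \<omega>: "\<omega> \<in> inv_forms" for \<omega>
  proof -
    obtain a b where ab: "bihomog a b \<omega>" "a + b > 0" using \<omega> by (auto simp: inv_forms_def)
    have cmp: "dform \<omega> (of_poly p) $ J = (if J = {} then pdop (\<omega> $ {}) p else 0)" for J
    proof -
      have "dform \<omega> (of_poly p) $ J = (\<Sum>I\<in>Pow (- J). if I = {} then (if J = {} then pdop (\<omega> $ {}) p else 0) else 0)"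
        unfolding dform_component by (intro sum.cong refl) (auto simp: of_poly_component)
      then show ?thesis by simp
    qed
    have "pdop (\<omega> $ {}) p = 0"
    proof (cases "\<omega> $ {} = 0")
      case False
      then have b: "b = 0" and hom: "homog a (\<omega> $ {})" using ab by (auto simp: bihomog_def)
      have eq: "of_poly (\<omega> $ {}) = \<omega>"
        using ab(1) b by (auto simp: vec_eq_iff of_poly_component bihomog_def)
      have "act_poly s (\<omega> $ {}) = \<omega> $ {}" if "s \<in> G" for s
      proof -
        have "of_poly (act_poly s (\<omega> $ {})) = act s \<omega>" by (simp only: act_of_poly[symmetric] eq)
        also have "\<dots> = of_poly (\<omega> $ {})" using \<omega> that by (simp add: eq inv_forms_def)
        finally show ?thesis by (simp only: of_poly_eq_iff)
      qed
      then show ?thesis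
        using R hom ab(2) b K_forms_component[of \<omega> "{}"] \<omega> by (auto simp: inv_forms_def)
    qed simp
    then show ?thesis by (simp add: vec_eq_iff cmp)
  qed
  then show "p \<in> harmonic_polys K G"
    using R by (auto simp: harmonic_polys_def SH_iff)
qed

lemma harmonic_subspace: "polys.K_subspace (harmonic_polys K G)"
  unfolding polys.K_subspace_def harmonic_polys_def mem_Collect_eq of_poly_add of_poly_Const of_poly_0
  by (blast intro: SH_0 SH_add SH_scale)

lemma harmonic_pdop: "p \<in> harmonic_polys K G \<Longrightarrow> g \<in> K_polys K \<Longrightarrow> pdop g p \<in> harmonic_polys K G"
  using SH_dform_of_poly[of "of_poly p" g] by (simp add: harmonic_polys_def dform_of_poly_of_poly)

lemma harmonic_act: "p \<in> harmonic_polys K G \<Longrightarrow> s \<in> G \<Longrightarrow> act_poly s p \<in> harmonic_polys K G"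
  using SH_act[of s "of_poly p"] by (simp add: harmonic_polys_def act_of_poly)

lemma harmonic_K_polys: "p \<in> harmonic_polys K G \<Longrightarrow> p \<in> K_polys K"
  by (simp add: harmonic_iff)

text \<open>The ideal of the polynomials over \<open>K\<close> generated by the homogeneous invariants of positive degree; one multiple of a
  generator at a time is added, which gives inductions over the generators.\<close>

inductive_set coinv_ideal :: "'n mpoly set" where
  zero: "0 \<in> coinv_ideal"
| step: "p \<in> coinv_ideal \<Longrightarrow> g \<in> K_polys K \<Longrightarrow> f \<in> K_polys K \<Longrightarrow> homog a f \<Longrightarrow> a > 0 \<Longrightarrow>
    (\<And>s. s \<in> G \<Longrightarrow> act_poly s f = f) \<Longrightarrow> p + g * f \<in> coinv_ideal"

lemma coinv_K_polys: "p \<in> coinv_ideal \<Longrightarrow> p \<in> K_polys K"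
  by (induction rule: coinv_ideal.induct) auto

lemma coinv_add: "q \<in> coinv_ideal \<Longrightarrow> p \<in> coinv_ideal \<Longrightarrow> p + q \<in> coinv_ideal"
  by (induction arbitrary: p rule: coinv_ideal.induct)
    (auto simp: add.assoc[symmetric] intro: coinv_ideal.step)

lemma coinv_mult: "p \<in> coinv_ideal \<Longrightarrow> h \<in> K_polys K \<Longrightarrow> h * p \<in> coinv_ideal"
proof (induction rule: coinv_ideal.induct)
  case (step p g f a)
  then have "h * p + (h * g) * f \<in> coinv_ideal" by (intro coinv_ideal.step[of _ _ f a]) auto
  then show ?case by (simp add: distrib_left mult.assoc)
qed (auto intro: coinv_ideal.zero)

lemma coinv_sum: "(\<And>i. i \<in> A \<Longrightarrow> f i \<in> coinv_ideal) \<Longrightarrow> sum f A \<in> coinv_ideal"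
  by (induction A rule: infinite_finite_induct) (auto intro: coinv_ideal.zero coinv_add)

lemma coinv_gen:
  assumes "g \<in> K_polys K" "f \<in> K_polys K" "homog a f" "a > 0" "\<And>s. s \<in> G \<Longrightarrow> act_poly s f = f"
  shows "g * f \<in> coinv_ideal"
  using coinv_ideal.step[OF coinv_ideal.zero assms] by simp

lemma coinv_subspace: "polys.K_subspace coinv_ideal"
  by (auto simp: polys.K_subspace_def intro: coinv_ideal.zero coinv_add coinv_mult)

lemma coinv_kills_harmonic: "p \<in> coinv_ideal \<Longrightarrow> h \<in> harmonic_polys K G \<Longrightarrow> pdop p h = 0"
proof (induction rule: coinv_ideal.induct)
  case (step p g f a)
  then have "pdop f h = 0" by (auto simp: harmonic_iff)
  then show ?case using step by (simp add: pdop_add_left pdop_mult)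
qed simp

lemma coinv_harmonic_zero:
  assumes "p \<in> coinv_ideal" "p \<in> harmonic_polys K G"
  shows "p = 0"
proof -
  have "ppair p p = 0" using coinv_kills_harmonic[OF assms] by (simp add: ppair_def)
  then show ?thesis by (intro ppair_self_eq_0) simp
qed

text \<open>Each variable is integral over the invariants: \<open>x\<^sub>i\<close> is a root of \<open>\<Prod>\<^sub>s (T - s x\<^sub>i)\<close>.\<close>

lemma X_power_coinv: "X i ^ card G \<in> coinv_ideal"
proof -
  let ?f = "\<lambda>s. - act_poly s (X i)"
  define E where "E j = (\<Sum>B\<in>{B \<in> Pow G. card B = j}. \<Prod>s\<in>G - B. ?f s)" for j
  have fK: "?f s \<in> K_polys K" if "s \<in> G" for s
    using G_entries[OF that] by (intro K_polys_uminus K_polys_act_poly) auto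
  have E_inv: "act_poly t (E j) = E j" if t: "t \<in> G" for t j
  proof -
    have bij: "(\<lambda>s. conj_transpose t ** s) ` (\<lambda>s. t ** s) ` B = B" "(\<lambda>s. t ** s) ` (\<lambda>s. conj_transpose t ** s) ` B = B" for B
      by (auto simp: image_image unitary_inverse[OF G_unitary[OF t]])
    have inj: "inj_on (\<lambda>s. t ** s) B" "inj_on (\<lambda>s. conj_transpose t ** s) B" for B
      by (rule inj_on_inverseI[of _ "\<lambda>s. conj_transpose t ** s"], simp add: unitary_inverse[OF G_unitary[OF t]])
        (rule inj_on_inverseI[of _ "\<lambda>s. t ** s"], simp add: unitary_inverse[OF G_unitary[OF t]])
    have "act_poly t (E j) = (\<Sum>B\<in>{B \<in> Pow G. card B = j}. \<Prod>s\<in>G - B. ?f (t ** s))"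
      by (simp add: E_def act_poly_sum act_poly_prod act_poly_uminus act_poly_compose)
    also have "\<dots> = E j"
      unfolding E_def
    proof (rule sum.reindex_bij_witness[where i = "\<lambda>B. (\<lambda>s. conj_transpose t ** s) ` B" and j = "\<lambda>B. (\<lambda>s. t ** s) ` B"])
      fix B assume B: "B \<in> {B \<in> Pow G. card B = j}"
      show "(\<lambda>s. conj_transpose t ** s) ` (\<lambda>s. t ** s) ` B = B" by (rule bij)
      show "(\<lambda>s. t ** s) ` B \<in> {B \<in> Pow G. card B = j}"
        using B t by (auto simp: G_mult card_image[OF inj(1)])
      have "(\<lambda>s. t ** s) ` (G - B) = G - (\<lambda>s. t ** s) ` B"
      proof -
        have "(\<lambda>s. t ** s) ` G = G"
        proof
          show "(\<lambda>s. t ** s) ` G \<subseteq> G" using t by (auto intro: G_mult)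
          show "G \<subseteq> (\<lambda>s. t ** s) ` G"
          proof
            fix s assume "s \<in> G"
            then show "s \<in> (\<lambda>s. t ** s) ` G"
              using t by (intro image_eqI[of _ _ "conj_transpose t ** s"])
                (auto simp: G_mult G_inv unitary_inverse[OF G_unitary[OF t]])
          qed
        qed
        then show ?thesis using image_set_diff[of "\<lambda>s. t ** s" G B] inj(1)[of UNIV] by simp
      qed
      then have "(\<Prod>s\<in>G - (\<lambda>s. t ** s) ` B. ?f s) = (\<Prod>s\<in>(\<lambda>s. t ** s) ` (G - B). ?f s)" by simp
      also have "\<dots> = (\<Prod>s\<in>G - B. ?f (t ** s))"
        by (subst prod.reindex[OF inj(1)]) simp
      finally show "(\<Prod>s\<in>G - (\<lambda>s. t ** s) ` B. ?f s) = (\<Prod>s\<in>G - B. ?f (t ** s))" .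
    next
      fix B assume B: "B \<in> {B \<in> Pow G. card B = j}"
      show "(\<lambda>s. t ** s) ` (\<lambda>s. conj_transpose t ** s) ` B = B" by (rule bij)
      show "(\<lambda>s. conj_transpose t ** s) ` B \<in> {B \<in> Pow G. card B = j}"
        using B G_inv[OF t] by (auto simp: G_mult card_image[OF inj(2)])
    qed
    finally show ?thesis .
  qed
  have E_hom: "homog (card G - j) (E j)" for j
    unfolding E_def
  proof (rule homog_sum)
    fix B assume B: "B \<in> {B \<in> Pow G. card B = j}"
    have "homog 1 (?f s)" for s
      using homog_diff[OF homog_0 homog_act_poly[OF homog_X], of s i] by simp
    then have "homog (\<Sum>s\<in>G - B. 1) (\<Prod>s\<in>G - B. ?f s)" by (intro homog_prod)
    then show "homog (card G - j) (\<Prod>s\<in>G - B. ?f s)"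
      using B card_Diff_subset[OF finite_subset[OF _ finite_G], of B] by simp
  qed
  have E_K: "E j \<in> K_polys K" for j
    unfolding E_def using fK by (intro K_polys_sum K_polys_prod) auto
  have "0 = (\<Prod>s\<in>G. X i + ?f s)"
    using G_one by (intro prod_zero[symmetric]) (auto intro!: bexI[of _ "mat 1"])
  also have "\<dots> = (\<Sum>B\<in>Pow G. (\<Prod>s\<in>B. X i) * (\<Prod>s\<in>G - B. ?f s))"
    by (rule prod_add) simp
  also have "\<dots> = (\<Sum>j\<le>card G. \<Sum>B\<in>{B \<in> Pow G. card B = j}. (\<Prod>s\<in>B. X i) * (\<Prod>s\<in>G - B. ?f s))"
    by (rule sum.group[symmetric]) (auto intro: card_mono)
  also have "\<dots> = (\<Sum>j\<le>card G. X i ^ j * E j)"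
    by (intro sum.cong refl) (auto simp: E_def sum_distrib_left)
  also have "\<dots> = (\<Sum>j<card G. X i ^ j * E j) + X i ^ card G * E (card G)"
    by (simp add: lessThan_Suc_atMost[symmetric])
  also have "E (card G) = 1"
  proof -
    have "{B \<in> Pow G. card B = card G} = {G}" using card_subset_eq[OF finite_G] by auto
    then show ?thesis by (simp add: E_def)
  qed
  finally have "X i ^ card G = (\<Sum>j<card G. (- (X i ^ j)) * E j)"
    by (simp add: sum_negf eq_neg_iff_add_eq_0 add.commute)
  moreover have "(- (X i ^ j)) * E j \<in> coinv_ideal" if "j < card G" for j
    by (rule coinv_gen[OF _ E_K E_hom _ E_inv]) (use that in auto)
  ultimately show ?thesis by (auto intro: coinv_sum)
qed

text \<open>The ideal contains a power of each variable, so that the exponents are bounded.\<close>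

lemma harmonic_bounded:
  assumes p: "p \<in> harmonic_polys K G" "homog d p" and d: "d \<ge> CARD('n) * card G"
  shows "p = 0"
proof (rule poly_mapping_eqI, rule ccontr)
  fix \<alpha> assume "coeff p \<alpha> \<noteq> coeff 0 \<alpha>"
  then have nz: "coeff p \<alpha> \<noteq> 0" by simp
  then have deg: "mdeg \<alpha> = d" using p(2) by (auto simp: homog_iff)
  have "expo \<alpha> i < card G" for i
    by (rule expo_lt_of_pdop_X_power[OF coinv_kills_harmonic[OF X_power_coinv p(1)] nz])
  then have "mdeg \<alpha> < (\<Sum>i\<in>(UNIV :: 'n set). card G)"
    unfolding mdeg_def by (intro sum_strict_mono) auto
  then show False using deg d by simp
qed


subsection \<open>Divided differences\<close>

lemma divided_difference:
  assumes u: "u \<in> K_vectors K" "rank_one_update u a s" "a \<in> K_vectors K" and s: "s \<in> G" and "p \<in> K_polys K"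
  shows "\<exists>q\<in>K_polys K. p - act_poly s p = lin_poly (vcnj u) * q"
  using assms(5)
proof (induction rule: K_polys_induct)
  case (Const c)
  then show ?case by (intro bexI[of _ 0]) auto
next
  case (X i)
  have "- cnj (a $ i) \<in> K" using u(3) by (auto simp: K_vectors_def)
  then show ?case using rank_one_update_X[OF u(2), of i] by blast
next
  case (add p q)
  then obtain p' q' where "p' \<in> K_polys K" "q' \<in> K_polys K" "p - act_poly s p = lin_poly (vcnj u) * p'"
    "q - act_poly s q = lin_poly (vcnj u) * q'" by blast
  then show ?case by (intro bexI[of _ "p' + q'"]) (auto simp: act_poly_add algebra_simps)
next
  case (mult p q)
  then obtain p' q' where pq: "p' \<in> K_polys K" "q' \<in> K_polys K" "p - act_poly s p = lin_poly (vcnj u) * p'"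
    "q - act_poly s q = lin_poly (vcnj u) * q'" by blast
  have sq: "act_poly s q \<in> K_polys K" using mult(2) G_entries[OF s] by auto
  have "p * q - act_poly s (p * q) = p * (q - act_poly s q) + (p - act_poly s p) * act_poly s q"
    by (simp add: act_poly_mult algebra_simps)
  also have "\<dots> = lin_poly (vcnj u) * (p * q' + p' * act_poly s q)"
    by (simp add: pq algebra_simps)
  finally show ?case using mult(1) pq sq by blast
qed

text \<open>Divided differences are linear over the invariants, so they preserve the coinvariant ideal.\<close>

lemma divided_difference_coinv:
  assumes u: "u \<in> K_vectors K" "rank_one_update u a s" "a \<in> K_vectors K" and s: "s \<in> G" and "p \<in> coinv_ideal"
  shows "\<exists>q\<in>coinv_ideal. p - act_poly s p = lin_poly (vcnj u) * q"
  using assms(5)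
proof (induction rule: coinv_ideal.induct)
  case zero
  then show ?case by (intro bexI[of _ 0]) (auto intro: coinv_ideal.zero)
next
  case (step p g f b)
  then obtain p' where p': "p' \<in> coinv_ideal" "p - act_poly s p = lin_poly (vcnj u) * p'" by blast
  obtain g' where g': "g' \<in> K_polys K" "g - act_poly s g = lin_poly (vcnj u) * g'"
    using divided_difference[OF u s step(2)] by blast
  have "p + g * f - act_poly s (p + g * f) = (p - act_poly s p) + (g - act_poly s g) * f"
    using step(6)[OF s] by (simp add: act_poly_add act_poly_mult algebra_simps)
  also have "\<dots> = lin_poly (vcnj u) * (p' + g' * f)" by (simp add: p' g' algebra_simps)
  finally show ?case using coinv_ideal.step[OF p'(1) g'(1) step(3-6)] by blast
qed

text \<open>A harmonic polynomial that lies in the socle of the coinvariant algebra is determinantal: the divided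
  difference of \<open>\<alpha> p\<close> is \<open>p - \<lambda> s p\<close> with \<open>s \<alpha> = \<lambda> \<alpha>\<close>, and it lies in the coinvariant ideal.\<close>

lemma socle_det:
  assumes p: "p \<in> harmonic_polys K G" and soc: "\<And>i. X i * p \<in> coinv_ideal" and "s \<in> G"
  shows "act_poly s p = Const (det s) * p"
  using assms(3)
proof (induction rule: G_induct)
  case (reflection s)
  obtain u a where u: "u \<in> K_vectors K" "a \<in> K_vectors K" "u \<noteq> 0" "rank_one_update u a s"
    using pseudo_reflection_update[OF reflection(2)] by blast
  let ?\<alpha> = "lin_poly (vcnj u)" and ?l = "cnj (det s)"
  have "?\<alpha> * p = (\<Sum>i\<in>UNIV. Const (cnj (u $ i)) * (X i * p))"
    by (simp add: lin_poly_def sum_distrib_right mult.assoc)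
  also have "\<dots> \<in> coinv_ideal"
    using u(1) by (intro coinv_sum coinv_mult[OF soc]) (auto simp: K_vectors_def)
  finally obtain q where q: "q \<in> coinv_ideal" "?\<alpha> * p - act_poly s (?\<alpha> * p) = ?\<alpha> * q"
    using divided_difference_coinv[OF u(1,4,2) reflection(1)] by blast
  have "?\<alpha> * (p - Const ?l * act_poly s p) = ?\<alpha> * q"
    using q(2) by (simp add: act_poly_mult rank_one_update_root[OF u(4)] algebra_simps)
  moreover have "?\<alpha> \<noteq> 0"
  proof
    assume "?\<alpha> = 0"
    then have "vcnj u = 0" by (rule lin_poly_eq_0)
    then show False using u(3) by (simp add: vec_eq_iff)
  qed
  ultimately have eq: "p - Const ?l * act_poly s p = q" by simp
  have "q \<in> harmonic_polys K G"
    unfolding eq[symmetric]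
    by (intro polys.K_subspaceD(3,4)[OF harmonic_subspace] harmonic_act reflection p K_cnj det_in_K)
  then have "q = 0" by (rule coinv_harmonic_zero[OF q(1)])
  then have "Const (det s) * p = Const (det s) * (Const ?l * act_poly s p)" using eq by simp
  also have "\<dots> = Const (det s * ?l) * act_poly s p" by simp
  finally show ?case by (simp add: det_unit[OF reflection(1)])
next
  case (mult s t)
  have "act_poly (s ** t) p = act_poly s (act_poly t p)" by (simp add: act_poly_compose)
  also have "\<dots> = Const (det t) * (Const (det s) * p)"
    by (simp only: mult.IH act_poly_mult act_poly_Const)
  also have "\<dots> = Const (det (s ** t)) * p" by (simp add: det_mul mult.commute[of "det s"])
  finally show ?case .
next
  case (inverse s)
  have "act_poly (conj_transpose s) (act_poly s p) = p"
    by (simp add: act_poly_compose unitary_inverse[OF G_unitary[OF inverse(1)]])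
  then have "Const (det s) * act_poly (conj_transpose s) p = p" by (simp only: inverse.IH act_poly_mult act_poly_Const)
  then have "Const (cnj (det s)) * p = Const (cnj (det s)) * (Const (det s) * act_poly (conj_transpose s) p)" by simp
  also have "\<dots> = Const (cnj (det s) * det s) * act_poly (conj_transpose s) p" by simp
  finally show ?case by (simp add: det_unit[OF inverse(1)] det_conj_transpose)
qed simp

lemma finite_mdeg: "finite {\<alpha> :: 'n \<Rightarrow>\<^sub>0 nat. mdeg \<alpha> = d}"
proof (rule finite_imageD)
  have "expo \<alpha> i \<le> mdeg \<alpha>" for \<alpha> :: "'n \<Rightarrow>\<^sub>0 nat" and i
    unfolding mdeg_def by (rule member_le_sum) auto
  then have "Poly_Mapping.lookup ` {\<alpha> :: 'n \<Rightarrow>\<^sub>0 nat. mdeg \<alpha> = d} \<subseteq> PiE UNIV (\<lambda>_. {..d})"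
    by auto
  then show "finite (Poly_Mapping.lookup ` {\<alpha> :: 'n \<Rightarrow>\<^sub>0 nat. mdeg \<alpha> = d})"
    by (rule finite_subset) (rule finite_PiE; simp)
  show "inj_on Poly_Mapping.lookup {\<alpha> :: 'n \<Rightarrow>\<^sub>0 nat. mdeg \<alpha> = d}"
    by (intro inj_onI poly_mapping.lookup_inject[THEN iffD1])
qed

text \<open>In each degree the space of polynomials is finite-dimensional, its coefficients being the separating functionals.\<close>

lemma poly_projection:
  fixes v :: "'n mpoly"
  assumes W: "polys.K_subspace W" "W \<subseteq> {p \<in> K_polys K. homog d p}" and v: "v \<in> K_polys K" "homog d v"
  shows "\<exists>w\<in>W. \<forall>t\<in>W. ppair t (v - w) = 0"
proof (rule polys.orth_projection[of "{p \<in> K_polys K. homog d p}" ppair "\<lambda>\<alpha> p. coeff p \<alpha>" "{\<alpha>. mdeg \<alpha> = d}"])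
  show "polys.K_subspace {p \<in> K_polys K. homog d p}"
    by (auto simp: polys.K_subspace_def intro: homog_add homog_Const_mult)
  fix p q :: "'n mpoly"
  show "ppair q p = cnj (ppair p q)" by (rule ppair_cnj)
  show "ppair p q \<in> K" if "p \<in> {p \<in> K_polys K. homog d p}" "q \<in> {p \<in> K_polys K. homog d p}"
    using that unfolding ppair_def by (intro K_polys_coeff K_polys_pdop) auto
  show "p = 0" if "ppair p p = 0" using that by (intro ppair_self_eq_0) simp
next
  fix w assume "w \<in> W" and z: "\<And>\<alpha>. \<alpha> \<in> {\<alpha>. mdeg \<alpha> = d} \<Longrightarrow> coeff w \<alpha> = 0"
  then have "homog d w" using W(2) by auto
  then show "w = 0" using z by (intro poly_mapping_eqI) (auto simp: homog_iff)
qed (use assms finite_mdeg in \<open>auto simp: ppair_add_right ppair_Const_right lookup_add intro: K_polys_coeff\<close>)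

text \<open>The harmonic polynomials are the orthogonal complement of the coinvariant ideal, since \<open>\<partial>\<^sub>f\<close> is adjoint to the
  multiplication by \<open>f\<close>.\<close>

lemma perp_coinv_harmonic:
  assumes p: "p \<in> K_polys K" "homog d p" and perp: "\<And>t. t \<in> coinv_ideal \<Longrightarrow> homog d t \<Longrightarrow> ppair t p = 0"
  shows "p \<in> harmonic_polys K G"
  unfolding harmonic_iff
proof (intro conjI allI impI)
  fix f a assume f: "f \<in> K_polys K" "homog a f" "a > 0" "\<forall>s\<in>G. act_poly s f = f"
  show "pdop f p = 0"
  proof (cases "a \<le> d")
    case True
    show ?thesis
    proof (rule poly_mapping_eqI, rule ccontr)
      fix \<beta> assume nz: "coeff (pdop f p) \<beta> \<noteq> coeff 0 \<beta>"
      then have "mdeg \<beta> = d - a" using pdop_homog(1)[OF f(2) p(2)] by (auto simp: homog_iff)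
      then have "homog d (monomial \<beta> 1 * f)" using homog_mult[OF homog_monomial f(2), of \<beta> "d - a" 1] True by simp
      then have "ppair (monomial \<beta> 1 * f) p = 0"
        using f by (intro perp coinv_gen[of _ f a]) auto
      then have "ppair (monomial \<beta> 1) (pdop f p) = 0" by (simp add: ppair_mult[symmetric] mult.commute)
      then show False using nz by (simp add: ppair_eq)
    qed
  next
    case False
    then show ?thesis using pdop_homog(2)[OF f(2) p(2)] by simp
  qed
qed (rule p(1))

text \<open>Downward induction on the degree. The part of a harmonic polynomial orthogonal to the span of the
  derivatives of determinantal ones lies in the socle of the coinvariant algebra.\<close>

lemma harmonic_det_span_homog: "p \<in> harmonic_polys K G \<Longrightarrow> homog d p \<Longrightarrow> of_poly p \<in> det_span"
proof (induction "CARD('n) * card G - d" arbitrary: d p)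
  case 0
  then have "p = 0" by (intro harmonic_bounded[of p d]) auto
  then show ?case by (simp add: forms.spanK_0)
next
  case (Suc m)
  define W where "W = {q \<in> harmonic_polys K G. homog d q \<and> of_poly q \<in> det_span}"
  have W: "polys.K_subspace W" "W \<subseteq> {p \<in> K_polys K. homog d p}"
    unfolding W_def polys.K_subspace_def
    by (auto simp: of_poly_add of_poly_Const forms.spanK_0 forms.spanK_add forms.spanK_scale
        homog_add homog_Const_mult harmonic_K_polys intro: polys.K_subspaceD[OF harmonic_subspace])
  obtain w where w: "w \<in> W" "\<And>t. t \<in> W \<Longrightarrow> ppair t (p - w) = 0"
    using poly_projection[OF W harmonic_K_polys[OF Suc(3)] Suc(4)] by blast
  define q where "q = p - w"
  have q: "q \<in> harmonic_polys K G" "homog d q"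
    using w(1) Suc(3,4) unfolding q_def W_def
    by (auto intro: polys.K_subspaceD[OF harmonic_subspace] homog_diff)
  have soc: "X i * q \<in> coinv_ideal" for i
  proof -
    let ?I = "{t \<in> coinv_ideal. homog (Suc d) t}"
    have I: "polys.K_subspace ?I" "?I \<subseteq> {p \<in> K_polys K. homog (Suc d) p}"
      using coinv_subspace coinv_K_polys by (auto simp: polys.K_subspace_def homog_add homog_Const_mult)
    have v: "X i * q \<in> K_polys K" "homog (Suc d) (X i * q)"
      using harmonic_K_polys[OF q(1)] homog_mult[OF homog_X q(2), of i] by auto
    obtain A where A: "A \<in> ?I" "\<And>t. t \<in> ?I \<Longrightarrow> ppair t (X i * q - A) = 0"
      using poly_projection[OF I v] by blast
    \<comment> \<open>\<open>B\<close> is the harmonic part of \<open>x\<^sub>i q\<close>; its norm is the inner product of \<open>q\<close> with \<open>\<partial>\<^sub>x\<^sub>i B\<close>, hence zero\<close>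
    define B where "B = X i * q - A"
    have B: "B \<in> K_polys K" "homog (Suc d) B"
      using v A(1) coinv_K_polys unfolding B_def by (auto intro: homog_diff)
    have BH: "B \<in> harmonic_polys K G"
      by (rule perp_coinv_harmonic[OF B]) (use A(2) in \<open>auto simp: B_def\<close>)
    have "of_poly B \<in> det_span"
      by (rule Suc(1)[OF _ BH B(2)]) (use Suc(2) in simp)
    then have "of_poly (pdx i B) \<in> det_span"
      using det_span_dform_of_poly[of "X i" "of_poly B"] by (simp add: dform_of_poly_of_poly pdop_X)
    then have "pdx i B \<in> W"
      using harmonic_pdop[OF BH, of "X i"] homog_pdx[OF B(2)] by (auto simp: W_def pdop_X)
    then have "ppair (pdx i B) q = 0" using w(2) by (simp add: q_def)
    moreover have "ppair (X i * q) B = ppair q (pdx i B)" by (simp add: ppair_mult pdop_X)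
    ultimately have "ppair (X i * q) B = 0" using ppair_cnj[of q "pdx i B"] by simp
    moreover have "ppair A B = 0" using A by (simp add: B_def)
    moreover have "ppair B B = ppair (X i * q) B - ppair A B"
      using ppair_add_left[of B A B] by (simp add: B_def)
    ultimately have "B = 0" by (intro ppair_self_eq_0) simp
    then show ?thesis using A(1) by (simp add: B_def)
  qed
  have "of_poly q \<in> SH_det K G"
    using q(1) socle_det[OF q(1) soc] by (auto simp: SH_det_def harmonic_polys_def act_of_poly of_poly_Const)
  then have "of_poly q \<in> det_span" by (rule SH_det_subset_span)
  then have "of_poly (w + q) \<in> det_span"
    using w(1) by (simp add: of_poly_add W_def forms.spanK_add)
  then show ?case by (simp add: q_def)
qed

lemma harmonic_hcomp: "p \<in> harmonic_polys K G \<Longrightarrow> hcomp a p \<in> harmonic_polys K G"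
proof -
  assume "p \<in> harmonic_polys K G"
  moreover have "bicomp a 0 (of_poly p) = of_poly (hcomp a p)"
    by (auto simp: vec_eq_iff bicomp_component of_poly_component hcomp_simps)
  ultimately show ?thesis using SH_bicomp[of "of_poly p" a 0] by (simp add: harmonic_polys_def)
qed

lemma harmonic_det_span: "p \<in> harmonic_polys K G \<Longrightarrow> of_poly p \<in> det_span"
proof -
  assume "p \<in> harmonic_polys K G"
  then have "hcomp a p \<in> harmonic_polys K G" for a by (rule harmonic_hcomp)
  then have "of_poly (\<Sum>a\<le>deg_bound p. hcomp a p) \<in> det_span"
    unfolding of_poly_sum by (intro forms.spanK_sum harmonic_det_span_homog[OF _ homog_hcomp])
  then show ?thesis by (simp add: sum_hcomp)
qed

end

section \<open>Closed one-forms\<close>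

text \<open>The Koszul differential, that is the contraction with the Euler vector field.\<close>

definition euler :: "'n::{finite,linorder} form \<Rightarrow> 'n form" where
  "euler \<eta> = (\<Sum>j\<in>UNIV. X j *s dtheta j \<eta>)"

lemma bihomog_euler: "bihomog a (Suc b) \<omega> \<Longrightarrow> bihomog (Suc a) b (euler \<omega>)"
  unfolding euler_def using bihomog_smult[OF homog_X bihomog_dtheta, of a b \<omega>]
  by (intro bihomog_sum) simp

lemma Const_of_nat: "Const (of_nat k) = of_nat k"
  by (induction k) (simp_all add: Const_add)

text \<open>Cartan's formula for the Euler vector field.\<close>

lemma euler_ext_d:
  assumes "bihomog a b \<eta>"
  shows "ext_d (euler \<eta>) + euler (ext_d \<eta>) = form_scale (of_nat (a + b)) \<eta>"
proof -
  let ?S = "\<Sum>i\<in>UNIV. \<Sum>j\<in>UNIV. X j *s (theta i \<star> dtheta j (dx i \<eta>))"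
  have "ext_d (euler \<eta>) = (\<Sum>i\<in>UNIV. \<Sum>j\<in>UNIV. (if j = i then theta i \<star> dtheta i \<eta> else 0)
      + X j *s (theta i \<star> dtheta j (dx i \<eta>)))"
    unfolding ext_d_def euler_def dx_sum form_mult_sum_right
    by (intro sum.cong refl) (auto simp: dx_smult pdx_X form_mult_add_right form_mult_smult_right dx_dtheta vec_eq_iff)
  then have 1: "ext_d (euler \<eta>) = (\<Sum>i\<in>UNIV. theta i \<star> dtheta i \<eta>) + ?S"
    by (simp add: sum.distrib)
  have "euler (ext_d \<eta>) = (\<Sum>j\<in>UNIV. \<Sum>i\<in>UNIV. (if i = j then X j *s dx j \<eta> else 0)
      - X j *s (theta i \<star> dtheta j (dx i \<eta>)))"
  proof -
    have "X j *s dtheta j (\<Sum>i\<in>UNIV. theta i \<star> dx i \<eta>)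
        = (\<Sum>i\<in>UNIV. (if i = j then X j *s dx j \<eta> else 0) - X j *s (theta i \<star> dtheta j (dx i \<eta>)))" for j
      unfolding dtheta_sum dtheta_theta
      by (auto simp: vec_eq_iff sum_distrib_left right_diff_distrib intro!: sum.cong)
    then show ?thesis unfolding ext_d_def euler_def by simp
  qed
  also have "\<dots> = (\<Sum>j\<in>UNIV. X j *s dx j \<eta>) - (\<Sum>j\<in>UNIV. \<Sum>i\<in>UNIV. X j *s (theta i \<star> dtheta j (dx i \<eta>)))"
    by (simp add: sum_subtractf)
  also have "(\<Sum>j\<in>UNIV. \<Sum>i\<in>UNIV. X j *s (theta i \<star> dtheta j (dx i \<eta>))) = ?S"
    by (rule sum.swap)
  finally have 2: "euler (ext_d \<eta>) = (\<Sum>j\<in>UNIV. X j *s dx j \<eta>) - ?S" .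
  have "(\<Sum>i\<in>UNIV. theta i \<star> dtheta i \<eta>) $ L + (\<Sum>j\<in>UNIV. X j *s dx j \<eta>) $ L = form_scale (of_nat (a + b)) \<eta> $ L" for L
  proof (cases "\<eta> $ L = 0")
    case False
    then have L: "homog a (\<eta> $ L)" "card L = b" using assms by (auto simp: bihomog_def)
    have "(\<Sum>i\<in>UNIV. theta i \<star> dtheta i \<eta>) $ L = (\<Sum>i\<in>UNIV. if i \<in> L then \<eta> $ L else 0)"
      unfolding sum_component
      by (intro sum.cong refl)
        (auto simp: theta_mult_component dtheta_component theta_sign_remove theta_sign_sq insert_absorb)
    also have "\<dots> = of_nat b * \<eta> $ L" by (simp add: sum.If_cases L(2))
    finally show ?thesis
      using euler_identity[OF L(1)] by (simp add: Const_add distrib_right Const_of_nat)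
  next
    case True
    then have "(\<Sum>i\<in>UNIV. theta i \<star> dtheta i \<eta>) $ L = 0"
      unfolding sum_component
      by (intro sum.neutral) (auto simp: theta_mult_component dtheta_component theta_sign_remove insert_absorb)
    then show ?thesis using True by simp
  qed
  then show ?thesis unfolding 1 2 by (simp add: vec_eq_iff)
qed

lemma dtheta_ext_d_of_poly: "dtheta i (ext_d (of_poly p)) = of_poly (pdx i p)"
proof -
  have "dtheta i (ext_d (of_poly p)) = (\<Sum>j\<in>UNIV. if j = i then of_poly (pdx i p) else 0)"
    unfolding ext_d_def dtheta_sum dtheta_theta by (intro sum.cong) (auto simp: dx_of_poly)
  then show ?thesis by simp
qed

context refl_group
begin

lemma ext_d_det_span:
  assumes "\<eta> \<in> det_span"
  shows "ext_d \<eta> \<in> det_span"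
proof -
  have "det_span \<subseteq> {\<eta>. ext_d \<eta> \<in> det_span}"
  proof (rule forms.spanK_minimal)
    show "forms.K_subspace {\<eta>. ext_d \<eta> \<in> det_span}"
      by (auto simp: forms.K_subspace_def ext_d_add ext_d_scale
          intro: forms.spanK_0 forms.spanK_add forms.spanK_scale)
    show "{dform (of_poly g) \<eta> | g \<eta>. g \<in> K_polys K \<and> \<eta> \<in> SH_det K G} \<subseteq> {\<eta>. ext_d \<eta> \<in> det_span}"
    proof clarify
      fix h :: "'n mpoly" and \<eta> assume "h \<in> K_polys K" "\<eta> \<in> SH_det K G"
      then have "dform (of_poly h) (ext_d \<eta>) \<in> det_span"
        by (intro det_span_dform_of_poly SH_det_subset_span SH_det_ext_d)
      then show "ext_d (dform (of_poly h) \<eta>) \<in> det_span" by (simp add: ext_d_dform_of_poly)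
    qed
  qed
  then show ?thesis using assms by auto
qed

text \<open>A closed super harmonic one-form is the differential of its Euler contraction \<open>u\<close>, up to a factor.
  That \<open>u\<close> is harmonic follows from \<open>\<partial>\<^sub>d\<^sub>f d u = deg f \<cdot> \<partial>\<^sub>f u\<close>.\<close>

lemma closed_one_form:
  assumes \<omega>: "\<omega> \<in> SH K G" "bihomog a 1 \<omega>" and closed: "ext_d \<omega> = 0"
  shows "\<omega> \<in> det_span"
proof -
  define u where "u = euler \<omega> $ {}"
  have "bihomog (Suc a) 0 (euler \<omega>)" using bihomog_euler \<omega>(2) by simp
  then have u: "of_poly u = euler \<omega>"
    by (auto simp: vec_eq_iff of_poly_component u_def bihomog_def)
  have "euler (ext_d \<omega>) = 0" by (simp add: closed euler_def)
  then have du: "ext_d (of_poly u) = form_scale (of_nat (Suc a)) \<omega>"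
    using euler_ext_d[OF \<omega>(2)] by (simp add: u)
  have "euler \<omega> \<in> K_forms K"
    unfolding euler_def using SH_K_forms[OF \<omega>(1)] by (intro K_forms_sum K_forms_smult K_polys_X K_forms_dtheta)
  then have uK: "u \<in> K_polys K" unfolding u_def by (rule K_forms_component)
  have "pdop f u = 0" if f: "f \<in> K_polys K" "homog k f" "k > 0" "\<forall>s\<in>G. act_poly s f = f" for f k
  proof -
    have "ext_d (of_poly f) \<in> inv_forms"
    proof (rule inv_formsI)
      show "ext_d (of_poly f) \<in> K_forms K"
        unfolding ext_d_def using f(1) by (intro K_forms_sum K_forms_mult K_forms_theta K_forms_dx K_forms_of_poly)
      show "bihomog (k - 1) (Suc 0) (ext_d (of_poly f))"
        by (rule bihomog_ext_d'[OF bihomog_of_poly[OF f(2)]])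
      show "act s (ext_d (of_poly f)) = ext_d (of_poly f)" if "s \<in> G" for s
        using that f(4) by (simp add: act_ext_d[OF G_unitary] act_of_poly)
    qed simp
    then have "dform (ext_d (of_poly f)) (ext_d (of_poly u)) = 0"
      by (simp add: du dform_scale_right SH_kill[OF \<omega>(1)])
    moreover have "dform (ext_d (of_poly f)) (ext_d (of_poly u))
        = (\<Sum>i\<in>UNIV. dform (of_poly (pdx i f)) (of_poly (pdx i u)))"
      by (simp add: ext_d_def[of "of_poly f"] dform_sum_left dform_mult dform_theta dtheta_ext_d_of_poly dx_of_poly)
    also have "\<dots> = of_poly (pdop (\<Sum>i\<in>UNIV. X i * pdx i f) u)"
      by (simp add: dform_of_poly_of_poly of_poly_sum pdop_sum_left pdop_mult pdop_X pdop_pdx)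
    also have "\<dots> = of_poly (Const (of_nat k) * pdop f u)"
      by (simp only: euler_identity[OF f(2)] pdop_Const_left complex_cnj_of_nat)
    ultimately have "of_poly (Const (of_nat k) * pdop f u) = of_poly 0" by simp
    then have "Const (of_nat k) * pdop f u = 0" by (simp only: of_poly_eq_iff)
    then show ?thesis using f(3) by simp
  qed
  then have "u \<in> harmonic_polys K G" using uK by (auto simp: harmonic_iff)
  then have "ext_d (of_poly u) \<in> det_span" by (intro ext_d_det_span harmonic_det_span)
  then have "form_scale (inverse (of_nat (Suc a))) (ext_d (of_poly u)) \<in> det_span"
    by (intro forms.spanK_scale K_inverse K_of_nat)
  moreover have "form_scale (inverse (of_nat (Suc a))) (ext_d (of_poly u)) = \<omega>"
  proof -
    have "inverse (of_nat (Suc a)) * of_nat (Suc a) = (1 :: complex)"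
      by (rule left_inverse) (simp del: of_nat_Suc)
    then show ?thesis by (simp only: du form_scale_scale form_scale_simps)
  qed
  ultimately show ?thesis by simp
qed

text \<open>In rank at most two, only \<open>\<theta>\<close>-degrees at most two occur, and a one-form is determined up to closed forms by
  its differential, which is a super harmonic two-form.\<close>

lemma SH_eq_det_spanI:
  assumes rank: "group_rank K G \<le> 2"
    and two: "\<And>a \<omega>. \<omega> \<in> SH K G \<Longrightarrow> bihomog a 2 \<omega> \<Longrightarrow> \<omega> \<in> det_span"
    and one: "\<And>a \<omega>. \<omega> \<in> SH K G \<Longrightarrow> bihomog a 1 \<omega> \<Longrightarrow>
      \<exists>\<nu>\<in>det_span. bihomog a 1 \<nu> \<and> ext_d \<nu> = ext_d \<omega>"
  shows "SH K G = det_span"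
proof
  show "det_span \<subseteq> SH K G" by (rule det_span_subset_SH)
  show "SH K G \<subseteq> det_span"
  proof (rule SH_subset_bihomog[OF forms.K_subspace_spanK])
    fix a b \<omega> assume \<omega>: "\<omega> \<in> SH K G" "bihomog a b \<omega>"
    consider "b = 0" | "b = 1" | "b = 2" | "b \<ge> 3" by linarith
    then show "\<omega> \<in> det_span"
    proof cases
      case 1
      then have "of_poly (\<omega> $ {}) = \<omega>"
        using \<omega>(2) by (auto simp: vec_eq_iff of_poly_component bihomog_def)
      then show ?thesis using harmonic_det_span[of "\<omega> $ {}"] \<omega>(1) by (simp add: harmonic_polys_def)
    next
      case 2
      then obtain \<nu> where \<nu>: "\<nu> \<in> det_span" "bihomog a 1 \<nu>" "ext_d \<nu> = ext_d \<omega>"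
        using one \<omega> by blast
      have "\<nu> \<in> SH K G" using \<nu>(1) det_span_subset_SH by blast
      then have "\<omega> - \<nu> \<in> det_span"
        using \<omega> \<nu> 2 by (intro closed_one_form[of _ a] SH_diff bihomog_diff) (auto simp: ext_d_diff)
      then have "\<omega> - \<nu> + \<nu> \<in> det_span" using \<nu>(1) by (rule forms.spanK_add)
      then show ?thesis by simp
    next
      case 3
      then show ?thesis using two \<omega> by blast
    next
      case 4
      then have "\<omega> = 0" by (rule three_form_zero[OF rank \<omega>(2) _ SH_fixed_killed[OF \<omega>(1)]])
      then show ?thesis by (simp add: forms.spanK_0)
    qed
  qed
qed


section \<open>Real groups\<close>

lemma ext_d_det_proj: "ext_d (det_proj \<omega>) = det_proj (ext_d \<omega>)"
  by (simp add: det_proj_def ext_d_scale ext_d_sum act_ext_d[OF G_unitary])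

lemma bihomog_det_proj: "bihomog a b \<omega> \<Longrightarrow> bihomog a b (det_proj \<omega>)"
  unfolding det_proj_def by (intro bihomog_scale bihomog_sum bihomog_act)

end

definition mat_cnj :: "'n::finite cmat \<Rightarrow> 'n cmat" where
  "mat_cnj A = (\<chi> i j. cnj (A $ i $ j))"

lemma mat_cnj_mult: "mat_cnj (A ** B) = mat_cnj A ** mat_cnj B"
  by (simp add: mat_cnj_def matrix_matrix_mult_def vec_eq_iff)

lemma mat_cnj_simps:
  "transpose (mat_cnj A) = conj_transpose A" "mat_cnj (transpose A) = conj_transpose A"
  "mat_cnj (conj_transpose A) = transpose A" "mat_cnj (mat_cnj A) = A" "mat_cnj (mat 1) = mat 1"
  by (auto simp: mat_cnj_def conj_transpose_def transpose_def vec_eq_iff mat_def)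

lemma lin_theta_vec: "lin_theta (v + w) = lin_theta v + lin_theta w" "lin_theta (c *s v) = form_scale c (lin_theta v)"
  "lin_theta 0 = 0"
  by (simp_all add: lin_theta_def form_scale_add_left sum.distrib form_scale_sum form_scale_scale)

lemma lin_theta_sum: "lin_theta (sum f A) = (\<Sum>i\<in>A. lin_theta (f i))"
  by (induction A rule: infinite_finite_induct) (simp_all add: lin_theta_vec)

text \<open>The differential of a quadratic form, without the factor two.\<close>

definition quad_form :: "'n::{finite,linorder} cmat \<Rightarrow> 'n form" where
  "quad_form S = (\<Sum>i\<in>UNIV. X i *s lin_theta (row i S))"

lemma bihomog_quad_form: "bihomog 1 1 (quad_form S)"
  unfolding quad_form_def
  using bihomog_smult[OF homog_X bihomog_lin_theta_one] by (intro bihomog_sum) simp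

lemma act_quad_form:
  assumes "mat_cnj s ** S ** conj_transpose s = S"
  shows "act s (quad_form S) = quad_form S"
proof -
  have eq: "(\<Sum>i\<in>UNIV. cnj (s $ k $ i) *s (\<chi> l. \<Sum>j\<in>UNIV. cnj (s $ l $ j) * row i S $ j)) = row k S" for k
  proof -
    have "(\<Sum>i\<in>UNIV. cnj (s $ k $ i) * (\<Sum>j\<in>UNIV. cnj (s $ l $ j) * S $ i $ j)) = (mat_cnj s ** S ** conj_transpose s) $ k $ l" for l
    proof -
      have "(mat_cnj s ** S ** conj_transpose s) $ k $ l
          = (\<Sum>j\<in>UNIV. \<Sum>i\<in>UNIV. cnj (s $ k $ i) * S $ i $ j * cnj (s $ l $ j))"
        by (simp add: matrix_matrix_mult_def mat_cnj_def conj_transpose_def sum_distrib_right)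
      also have "\<dots> = (\<Sum>i\<in>UNIV. \<Sum>j\<in>UNIV. cnj (s $ k $ i) * S $ i $ j * cnj (s $ l $ j))"
        by (rule sum.swap)
      finally show ?thesis by (simp add: sum_distrib_left mult_ac)
    qed
    then show ?thesis by (simp add: assms vec_eq_iff row_def)
  qed
  have "act s (quad_form S) = (\<Sum>i\<in>UNIV. \<Sum>k\<in>UNIV. X k *s lin_theta (cnj (s $ k $ i) *s (\<chi> l. \<Sum>j\<in>UNIV. cnj (s $ l $ j) * row i S $ j)))"
    unfolding quad_form_def act_sum act_smult act_lin_theta act_poly_X
    by (intro sum.cong refl)
      (simp add: lin_theta_vec form_scale_def vec_eq_iff sum_distrib_right mult_ac)
  also have "\<dots> = (\<Sum>k\<in>UNIV. X k *s lin_theta (\<Sum>i\<in>UNIV. cnj (s $ k $ i) *s (\<chi> l. \<Sum>j\<in>UNIV. cnj (s $ l $ j) * row i S $ j)))"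
    by (subst sum.swap) (simp add: lin_theta_sum vec_eq_iff sum_distrib_left)
  finally show ?thesis by (simp only: eq quad_form_def)
qed

lemma dform_quad_form: "dform (quad_form S) \<eta> = (\<Sum>i\<in>UNIV. iota (vcnj (row i S)) (dx i \<eta>))"
  by (simp add: quad_form_def dform_sum_left dform_smult dform_lin_theta dform_of_poly_X)

lemma dform_quad_form_lin_theta:
  "dform (quad_form S) (lin_theta w \<star> \<omega>) = dirx (mat_cnj S *v w) \<omega> - lin_theta w \<star> dform (quad_form S) \<omega>"
proof -
  have "dot (vcnj (row i S)) w = (mat_cnj S *v w) $ i" for i
    by (simp add: dot_def row_def mat_cnj_def matrix_vector_mult_def)
  then show ?thesis
    by (simp add: dform_quad_form dx_lin_theta iota_lin_theta sum_subtractf dirx_def form_mult_sum_right)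
qed

lemma bihomog_const_or_zero:
  fixes \<omega> :: "'n::{finite,linorder} form"
  assumes "bihomog a b \<omega>" "\<And>i. dx i \<omega> = 0"
  shows "bihomog 0 b \<omega>"
proof (cases a)
  case (Suc c)
  have "\<omega> $ I = 0" for I
  proof (rule ccontr)
    assume nz: "\<omega> $ I \<noteq> 0"
    then have "homog a (\<omega> $ I)" using assms(1) by (auto simp: bihomog_def)
    moreover have "pdx i (\<omega> $ I) = 0" for i using assms(2)[of i] by (simp add: vec_eq_iff)
    ultimately have "Const (of_nat a) * \<omega> $ I = 0" using euler_identity[of a "\<omega> $ I"] by simp
    then show False using nz Suc by (simp del: of_nat_Suc)
  qed
  then show ?thesis by (simp add: bihomog_def)
qed (use assms in simp)

context refl_group
begin

text \<open>If the unitary matrix \<open>U\<close> makes the group real, then \<open>S = U\<^sup>T U\<close> is the matrix of the standard bilinear form in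
  the real coordinates.\<close>

lemma real_group_form:
  assumes "real_group G"
  obtains S where "mat_cnj S ** S = mat 1" "\<And>s. s \<in> G \<Longrightarrow> mat_cnj s ** S = S ** s"
    "\<And>s. s \<in> G \<Longrightarrow> cnj (det s) = det s"
proof -
  obtain U where U: "unitary_matrix U"
    and re: "\<And>s i j. s \<in> G \<Longrightarrow> (U ** s ** conj_transpose U) $ i $ j \<in> \<real>"
    using assms unfolding real_group_def by blast
  have UU: "U ** conj_transpose U = mat 1" "conj_transpose U ** U = mat 1"
    using U by (auto simp: unitary_matrix_def)
  have UU': "mat_cnj U ** transpose U = mat 1"
    using arg_cong[OF UU(1), of mat_cnj] by (simp add: mat_cnj_mult mat_cnj_simps)
  have real: "mat_cnj (U ** s ** conj_transpose U) = U ** s ** conj_transpose U" if "s \<in> G" for s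
    using re[OF that] by (simp add: mat_cnj_def vec_eq_iff Reals_cnj_iff)
  define S where "S = transpose U ** U"
  have "mat_cnj S ** S = conj_transpose U ** (mat_cnj U ** transpose U) ** U"
    by (simp add: S_def mat_cnj_mult mat_cnj_simps matrix_mul_assoc)
  then have 1: "mat_cnj S ** S = mat 1" by (simp add: UU UU')
  have 2: "mat_cnj s ** S = S ** s" if "s \<in> G" for s
  proof -
    let ?t = "U ** s ** conj_transpose U"
    have "s = (conj_transpose U ** U) ** s ** (conj_transpose U ** U)" by (simp add: UU)
    then have s: "s = conj_transpose U ** ?t ** U" by (simp add: matrix_mul_assoc)
    have "mat_cnj s = transpose U ** ?t ** mat_cnj U"
      by (subst s) (simp only: mat_cnj_mult[of _ U] mat_cnj_mult[of "conj_transpose U"] real[OF that] mat_cnj_simps)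
    then have "mat_cnj s ** S = transpose U ** ?t ** (mat_cnj U ** transpose U) ** U"
      by (simp add: S_def matrix_mul_assoc)
    also have "\<dots> = transpose U ** U ** s ** (conj_transpose U ** U)"
      by (simp only: UU' matrix_mul_rid matrix_mul_assoc)
    also have "\<dots> = S ** s" by (simp add: UU S_def)
    finally show ?thesis .
  qed
  have 3: "cnj (det s) = det s" if "s \<in> G" for s
  proof -
    let ?t = "U ** s ** conj_transpose U"
    have "det U * det (conj_transpose U) = 1" using arg_cong[OF UU(1), of det] by (simp add: det_mul)
    then have "det ?t = det s" by (simp add: det_mul mult.left_commute mult.commute)
    moreover have "det (mat_cnj ?t) = cnj (det ?t)" by (simp add: mat_cnj_def det_def)
    ultimately show ?thesis using real[OF that] by simp
  qed
  show thesis by (rule that[OF 1 2 3])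
qed

text \<open>Let \<open>w\<close> annihilate the fixed vectors. Then \<open>\<theta>\<^sub>w \<star> \<omega> = 0\<close>, for this is a three-form on the quotient by the fixed
  vectors, of dimension at most two. The operator of the invariant quadratic form kills \<open>\<omega>\<close>, and its value at
  \<open>\<theta>\<^sub>w \<star> \<omega>\<close> is therefore the derivative of \<open>\<omega>\<close> in the direction that corresponds to \<open>w\<close>. These directions and the fixed ones span the space, so that
  all derivatives of \<open>\<omega>\<close> vanish.\<close>

lemma real_two_form_const:
  assumes rank: "group_rank K G \<le> 2" and S: "mat_cnj S ** S = mat 1" "\<And>s. s \<in> G \<Longrightarrow> mat_cnj s ** S = S ** s"
    and \<omega>: "\<omega> \<in> SH K G" "bihomog a 2 \<omega>"
  shows "bihomog 0 2 \<omega>"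
proof (rule bihomog_const_or_zero[OF \<omega>(2)])
  fix i
  have kill: "dform (quad_form S) \<omega> = 0"
  proof (rule SH_kill_complex[OF \<omega>(1) act_quad_form bihomog_quad_form])
    fix s assume s: "s \<in> G"
    have "mat_cnj s ** S ** conj_transpose s = S ** (s ** conj_transpose s)"
      by (simp add: S(2)[OF s] matrix_mul_assoc)
    then show "mat_cnj s ** S ** conj_transpose s = S"
      by (simp add: unitary_inverse(1)[OF G_unitary[OF s]])
  qed simp
  have ann: "dirx (mat_cnj S *v w) \<omega> = 0" if w: "\<And>f. f \<in> fixed_vectors K G \<Longrightarrow> dot f w = 0" for w
  proof -
    have "lin_theta w \<star> \<omega> = 0"
    proof (rule three_form_zero[OF rank bihomog_lin_theta[OF \<omega>(2)]])
      show "fixed_killed (lin_theta w \<star> \<omega>)"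
        using SH_fixed_killed[OF \<omega>(1)] w by (auto simp: fixed_killed_def iota_lin_theta)
    qed simp
    then show ?thesis using dform_quad_form_lin_theta[of S w \<omega>] kill by simp
  qed
  define v where "v = (axis i 1 :: 'n cvec)"
  \<comment> \<open>the projection of \<open>v\<close> to the fixed vectors\<close>
  define pv where "pv = inverse (of_nat (card G)) *s (\<Sum>s\<in>G. s *v v)"
  have pv_fixed: "t *v pv = pv" if "t \<in> G" for t
  proof -
    have "t *v (\<Sum>s\<in>G. s *v v) = (\<Sum>s\<in>G. (t ** s) *v v)"
    proof -
      have "t *v (sum h B) = (\<Sum>s\<in>B. t *v h s)" for B and h :: "'n cmat \<Rightarrow> 'n cvec"
        by (induction B rule: infinite_finite_induct) (simp_all add: matrix_vector_right_distrib)
      then show ?thesis by (simp add: matrix_vector_mul_assoc)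
    qed
    then show ?thesis
      using sum_G_left[OF that, of "\<lambda>s. s *v v"] by (simp add: pv_def vector_scalar_commute)
  qed
  define w where "w = S *v (v - pv)"
  have "dot f w = 0" if f: "f \<in> fixed_vectors K G" for f
  proof -
    have dot_mv: "dot f (A *v x) = dot (transpose A *v f) x" for A :: "'n cmat" and x
    proof -
      have "dot f (A *v x) = (\<Sum>k\<in>UNIV. \<Sum>l\<in>UNIV. f $ k * (A $ k $ l * x $ l))"
        by (simp add: dot_def matrix_vector_mult_def sum_distrib_left)
      also have "\<dots> = (\<Sum>l\<in>UNIV. \<Sum>k\<in>UNIV. f $ k * (A $ k $ l * x $ l))" by (rule sum.swap)
      finally show ?thesis
        by (simp add: dot_def matrix_vector_mult_def transpose_def sum_distrib_left sum_distrib_right mult_ac)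
    qed
    have sf: "conj_transpose s *v f = f" if s: "s \<in> G" for s
    proof -
      have "conj_transpose s *v (s *v f) = f"
        using unitary_inverse(2)[OF G_unitary[OF s]] by (simp add: matrix_vector_mul_assoc)
      then show ?thesis using f s by (simp add: fixed_vectors_def)
    qed
    have each: "dot f (S *v (s *v v)) = dot f (S *v v)" if s: "s \<in> G" for s
    proof -
      have "S *v (s *v v) = mat_cnj s *v (S *v v)"
        by (simp add: matrix_vector_mul_assoc S(2)[OF s])
      then have "dot f (S *v (s *v v)) = dot (transpose (mat_cnj s) *v f) (S *v v)" by (simp add: dot_mv)
      then show ?thesis by (simp add: mat_cnj_simps sf[OF s])
    qed
    have "dot f (S *v pv) = inverse (of_nat (card G)) * (\<Sum>s\<in>G. dot f (S *v (s *v v)))"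
    proof -
      have "dot f (S *v x) = dot (transpose S *v f) x" for x by (rule dot_mv)
      moreover have "dot g (inverse c *s (\<Sum>s\<in>G. h s)) = inverse c * (\<Sum>s\<in>G. dot g (h s))" for g c and h :: "_ \<Rightarrow> 'n cvec"
      proof -
        have "dot g (sum h B) = (\<Sum>s\<in>B. dot g (h s))" for B
          by (induction B rule: infinite_finite_induct) (auto simp: dot_def distrib_left sum.distrib)
        moreover have "dot g (c *s x) = c * dot g x" for c x
          by (simp add: dot_def sum_distrib_left mult.left_commute)
        ultimately show ?thesis by simp
      qed
      ultimately show ?thesis by (simp add: pv_def)
    qed
    also have "\<dots> = dot f (S *v v)" using card_G by (simp add: each)
    finally show ?thesis
      by (simp add: w_def matrix_vector_mult_diff_distrib) (simp add: dot_def right_diff_distrib sum_subtractf)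
  qed
  then have "dirx (mat_cnj S *v w) \<omega> = 0" by (rule ann)
  moreover have "mat_cnj S *v w = v - pv" by (simp add: w_def matrix_vector_mul_assoc S(1))
  moreover have "dirx pv \<omega> = 0" by (rule SH_fixed_direction(2)[OF \<omega>(1) pv_fixed])
  ultimately have "dirx v \<omega> = 0" using dirx_vec(1)[of "v - pv" pv \<omega>] by simp
  then show "dx i \<omega> = 0" by (simp add: v_def dirx_axis)
qed

text \<open>A super harmonic two-form has constant coefficients, hence it is scaled by the conjugate of \<open>det\<close>, which is real. A one-form \<open>\<omega>\<close> has the same differential as its determinantal part, because
  the projection commutes with \<open>d\<close> and fixes the two-form \<open>d \<omega>\<close>.\<close>

lemma real_SH_eq_det_span:
  assumes rank: "group_rank K G \<le> 2" and "real_group G"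
  shows "SH K G = det_span"
proof -
  obtain S where S: "mat_cnj S ** S = mat 1" "\<And>s. s \<in> G \<Longrightarrow> mat_cnj s ** S = S ** s"
    and det: "\<And>s. s \<in> G \<Longrightarrow> cnj (det s) = det s"
    using real_group_form[OF assms(2)] by blast
  have two: "act s \<omega> = form_scale (det s) \<omega>" if "\<omega> \<in> SH K G" "bihomog a 2 \<omega>" "s \<in> G" for a \<omega> s
    using two_form_det[OF rank real_two_form_const[OF rank S that(1,2)] SH_fixed_killed[OF that(1)] that(3)]
      det[OF that(3)] by simp
  show ?thesis
  proof (rule SH_eq_det_spanI[OF rank])
    fix a \<omega> assume "\<omega> \<in> SH K G" "bihomog a 2 \<omega>"
    then show "\<omega> \<in> det_span"
      using two by (intro SH_det_subset_span) (auto simp: SH_det_def)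
  next
    fix a \<omega> assume \<omega>: "\<omega> \<in> SH K G" "bihomog a 1 \<omega>"
    have "bihomog (a - 1) 2 (ext_d \<omega>)" using bihomog_ext_d'[OF \<omega>(2)] by (simp add: numeral_2_eq_2)
    then have "det_proj (ext_d \<omega>) = ext_d \<omega>"
      by (intro det_proj_eq two[OF SH_ext_d[OF \<omega>(1)]])
    then show "\<exists>\<nu>\<in>det_span. bihomog a 1 \<nu> \<and> ext_d \<nu> = ext_d \<omega>"
      using \<omega> by (intro bexI[of _ "det_proj \<omega>"])
        (auto simp: ext_d_det_proj bihomog_det_proj intro: SH_det_subset_span det_proj_SH_det)
  qed
qed

end

section \<open>Full monomial groups\<close>

lemma pdop_monomial_monomial:
  "pdop (monomial \<delta> 1) (monomial (\<delta> + \<beta>) 1) = monomial \<beta> (mfact (\<delta> + \<beta>) / mfact \<beta>)"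
  by (rule mpoly_eqI_mfact) (simp add: coeff_pdop_monomial lookup_single when_def)

text \<open>The matrix sends the \<open>j\<close>th basis vector to \<open>z j\<close> times the \<open>\<pi> j\<close>th one.\<close>

definition monomial_matrix :: "('n \<Rightarrow> 'n) \<Rightarrow> ('n \<Rightarrow> complex) \<Rightarrow> 'n::finite cmat \<Rightarrow> bool" where
  "monomial_matrix \<pi> z s \<longleftrightarrow> bij \<pi> \<and> (\<forall>i j. s $ i $ j = (if i = \<pi> j then z j else 0))"

lemma Gmpn_monomial:
  assumes s: "s \<in> Gmpn m 1"
  obtains \<pi> z where "monomial_matrix \<pi> z s" "\<And>j. z j ^ m = 1"
proof -
  have rows: "\<exists>!j. s $ i $ j \<noteq> 0" and cols: "\<exists>!i. s $ i $ j \<noteq> 0"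
    and roots: "s $ i $ j \<noteq> 0 \<Longrightarrow> (s $ i $ j) ^ m = 1" for i j
    using s by (auto simp: Gmpn_def)
  define \<pi> where "\<pi> j = (THE i. s $ i $ j \<noteq> 0)" for j
  have \<pi>: "s $ \<pi> j $ j \<noteq> 0" for j unfolding \<pi>_def by (rule theI'[OF cols])
  have \<pi>_unique: "s $ i $ j \<noteq> 0 \<Longrightarrow> i = \<pi> j" for i j using cols[of j] \<pi>[of j] by blast
  have "inj \<pi>"
  proof (rule injI)
    fix j k assume "\<pi> j = \<pi> k"
    then show "j = k" using rows[of "\<pi> j"] \<pi>[of j] \<pi>[of k] by metis
  qed
  then have "bij \<pi>" by (simp add: bij_def finite_UNIV_inj_surj)
  then have "monomial_matrix \<pi> (\<lambda>j. s $ \<pi> j $ j) s"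
    using \<pi>_unique by (auto simp: monomial_matrix_def)
  then show thesis using that roots \<pi> by blast
qed

lemma monomial_Gmpn:
  assumes "monomial_matrix \<pi> z s" "\<And>j. z j ^ m = 1" "m \<ge> 1"
  shows "s \<in> Gmpn m 1"
proof -
  have s: "s $ i $ j = (if i = \<pi> j then z j else 0)" and bij: "bij \<pi>" for i j
    using assms(1) by (auto simp: monomial_matrix_def)
  have z: "z j \<noteq> 0" for j using assms(2)[of j] assms(3) by (auto simp: power_0_left)
  have roots: "s $ i $ j \<noteq> 0 \<Longrightarrow> (s $ i $ j) ^ m = 1" for i j using assms(2) by (auto simp: s)
  have "\<exists>!j. s $ i $ j \<noteq> 0" for i
  proof -
    obtain j where j: "\<pi> j = i" using bij_is_surj[OF bij] by (metis surjD)
    show ?thesis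
    proof (rule ex1I[of _ j])
      fix k assume "s $ i $ k \<noteq> 0"
      then have "\<pi> k = \<pi> j" using j by (simp add: s split: if_splits)
      then show "k = j" using bij_is_inj[OF bij] by (simp add: inj_eq)
    qed (use z j in \<open>simp add: s\<close>)
  qed
  moreover have "\<exists>!i. s $ i $ j \<noteq> 0" for j using z by (auto simp: s)
  moreover have "(\<Prod>(i, j)\<in>{(i, j). s $ i $ j \<noteq> 0}. s $ i $ j) ^ (m div 1) = 1"
    unfolding div_by_1 prod_power_distrib by (rule prod.neutral) (auto simp: roots)
  ultimately show ?thesis using roots by (auto simp: Gmpn_def)
qed

lemma monomial_act_X:
  assumes "monomial_matrix \<pi> z s"
  shows "act_poly s (X j) = Const (cnj (z j)) * X (\<pi> j)"
proof -
  have "act_poly s (X j) = (\<Sum>i\<in>UNIV. if i = \<pi> j then Const (cnj (z j)) * X (\<pi> j) else 0)"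
    unfolding act_poly_X using assms by (intro sum.cong) (auto simp: monomial_matrix_def)
  then show ?thesis by simp
qed

lemma monomial_act_theta_mult:
  assumes "monomial_matrix \<pi> z s"
  shows "act_theta s j \<star> \<eta> = form_scale (cnj (z j)) (theta (\<pi> j) \<star> \<eta>)"
proof -
  have "act_theta s j \<star> \<eta> = (\<Sum>i\<in>UNIV. if i = \<pi> j then form_scale (cnj (z j)) (theta (\<pi> j) \<star> \<eta>) else 0)"
    unfolding act_theta_eq lin_theta_mult using assms by (intro sum.cong) (auto simp: monomial_matrix_def)
  then show ?thesis by simp
qed

definition diag_at :: "'n \<Rightarrow> complex \<Rightarrow> 'n::finite cmat" where
  "diag_at i z = (\<chi> k l. if k = l then if l = i then z else 1 else 0)"

lemma diag_at_monomial: "monomial_matrix id (\<lambda>l. if l = i then z else 1) (diag_at i z)"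
  by (simp add: monomial_matrix_def diag_at_def)

lemma diag_at_Gmpn: "z ^ m = 1 \<Longrightarrow> m \<ge> 1 \<Longrightarrow> diag_at i z \<in> Gmpn m 1"
  by (rule monomial_Gmpn[OF diag_at_monomial]) auto

lemma det_diag_at: "det (diag_at i z) = z"
proof -
  have "rank_one_update ((z - 1) *s axis i 1) (axis i 1) (diag_at i z)"
    by (auto simp: rank_one_update_def diag_at_def axis_def)
  from rank_one_update_det[OF this] have "det (diag_at i z) = 1 + dot (axis i 1) ((z - 1) *s axis i 1)" .
  also have "dot (axis i 1) ((z - 1) *s axis i 1) = (\<Sum>k\<in>UNIV. if k = i then z - 1 else 0)"
    unfolding dot_def by (intro sum.cong) (auto simp: axis_def)
  finally show ?thesis by simp
qed

lemma coeff_act_diag_at: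
  fixes p :: "'n::{finite,linorder} mpoly"
  shows "coeff (act_poly (diag_at i z) p) \<alpha> = cnj z ^ expo \<alpha> i * coeff p \<alpha>"
proof (induction p rule: mpoly_induct)
  case (monomial \<beta> c)
  have "act_poly (diag_at i z) (monomial \<beta> c) = Const c * (\<Prod>j\<in>UNIV. Const (if j = i then cnj z ^ expo \<beta> i else 1) * X j ^ expo \<beta> j)"
    unfolding monomial_eq_Const_prod act_poly_mult act_poly_prod act_poly_power monomial_act_X[OF diag_at_monomial]
      act_poly_Const
    by (intro arg_cong2[where f = "(*)"] prod.cong refl) (auto simp: power_mult_distrib Const_power)
  also have "\<dots> = Const (cnj z ^ expo \<beta> i) * monomial \<beta> c"
  proof -
    have "(\<Prod>j\<in>UNIV. Const (if j = i then cnj z ^ expo \<beta> i else 1)) = (Const (cnj z ^ expo \<beta> i) :: 'n mpoly)"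
    proof -
      have "(\<Prod>j\<in>UNIV. Const (if j = i then cnj z ^ expo \<beta> i else 1))
          = (\<Prod>j\<in>UNIV. if j = i then Const (cnj z ^ expo \<beta> i) else 1 :: 'n mpoly)"
        by (intro prod.cong) auto
      then show ?thesis by simp
    qed
    then show ?thesis by (simp add: monomial_eq_Const_prod[of \<beta> c] prod.distrib mult_ac)
  qed
  finally show ?case by (auto simp: lookup_single when_def)
qed (simp add: act_poly_add lookup_add distrib_left)

lemma coeff_act_form_diag_at:
  "coeff (act (diag_at i z) \<omega> $ I) \<alpha> = cnj z ^ (expo \<alpha> i + (if i \<in> I then 1 else 0)) * coeff (\<omega> $ I) \<alpha>"
proof -
  have Th: "act_Theta (diag_at i z) l = form_scale (if i \<in> set l then cnj z else 1) (Theta l)" if "distinct l" for l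
    using that
    by (induction l) (auto simp: act_Theta_simps Theta_simps monomial_act_theta_mult[OF diag_at_monomial]
        form_mult_scale_right form_scale_scale)
  have "act (diag_at i z) \<omega> $ I = (\<Sum>J\<in>UNIV. if J = I then Const (if i \<in> I then cnj z else 1) * act_poly (diag_at i z) (\<omega> $ I) else 0)"
    unfolding act_eq sum_component vector_smult_component
    by (intro sum.cong refl) (auto simp: Th Theta_sorted)
  then show ?thesis by (simp add: coeff_act_diag_at)
qed

lemma root_of_unity_dvd:
  assumes m: "m \<ge> 1" and "\<And>z :: complex. z ^ m = 1 \<Longrightarrow> z ^ k = 1"
  shows "m dvd k"
proof -
  define \<zeta> where "\<zeta> = exp (2 * of_real pi * \<i> * of_nat 1 / of_nat m)"
  have pow: "\<zeta> ^ j = exp (2 * of_real pi * \<i> * of_nat j / of_nat m)" for j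
    by (simp add: \<zeta>_def exp_of_nat_mult[symmetric] mult_ac)
  have "\<zeta> ^ m = 1" using complex_root_unity_eq_1[OF m, of m] by (simp add: pow)
  then have "\<zeta> ^ k = 1" by (rule assms(2))
  then show ?thesis using complex_root_unity_eq_1[OF m, of k] by (simp add: pow)
qed

context refl_group
begin

text \<open>A diagonal matrix scales each monomial form, so that every monomial of an invariant form is itself invariant
  under the diagonal matrices.\<close>

lemma mono_inv_dvd:
  assumes G: "G = Gmpn m 1" "m \<ge> 1" and \<omega>: "\<omega> \<in> inv_forms" "coeff (\<omega> $ I) \<alpha> \<noteq> 0"
  shows "m dvd expo \<alpha> i + (if i \<in> I then 1 else 0)"
proof (rule root_of_unity_dvd[OF G(2)])
  fix z :: complex assume z: "z ^ m = 1"
  have "diag_at i (cnj z) \<in> G"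
    unfolding G(1) by (rule diag_at_Gmpn) (use z G(2) in \<open>auto simp flip: complex_cnj_power\<close>)
  then have "act (diag_at i (cnj z)) \<omega> = \<omega>" using \<omega>(1) by (simp add: inv_forms_def)
  then show "z ^ (expo \<alpha> i + (if i \<in> I then 1 else 0)) = 1"
    using coeff_act_form_diag_at[of i "cnj z" \<omega> I \<alpha>] \<omega>(2) by simp
qed

text \<open>By divisibility, each monomial of an invariant contains \<open>x\<^sub>i\<^sup>m\<close> or \<open>x\<^sub>i\<^sup>m\<^sup>-\<^sup>1 \<theta>\<^sub>i\<close> for some \<open>i\<close>, whose operator kills
  the forms with small exponents.\<close>

lemma mono_SH:
  assumes G: "G = Gmpn m 1" "m \<ge> 1" and \<eta>: "\<eta> \<in> K_forms K"
    and supp: "\<And>J \<beta> i. coeff (\<eta> $ J) \<beta> \<noteq> 0 \<Longrightarrow> expo \<beta> i + (if i \<in> J then 1 else 0) < m"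
  shows "\<eta> \<in> SH K G"
  unfolding SH_iff
proof (intro conjI ballI)
  fix \<omega> assume \<omega>: "\<omega> \<in> inv_forms"
  obtain a b where ab: "bihomog a b \<omega>" "a + b > 0" using \<omega> by (auto simp: inv_forms_def)
  have "pdop (\<omega> $ I) (\<eta> $ (I \<union> J)) = 0" for I J
  proof (rule mpoly_eqI_mfact)
    fix \<beta>
    have "coeff (\<eta> $ (I \<union> J)) (\<alpha> + \<beta>) = 0" if \<alpha>: "\<alpha> \<in> Poly_Mapping.keys (\<omega> $ I)" for \<alpha>
    proof (rule ccontr)
      assume nz: "coeff (\<eta> $ (I \<union> J)) (\<alpha> + \<beta>) \<noteq> 0"
      have \<alpha>0: "coeff (\<omega> $ I) \<alpha> \<noteq> 0" using \<alpha> by (simp add: in_keys_iff)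
      then have "\<omega> $ I \<noteq> 0" by auto
      then have "mdeg \<alpha> = a" "card I = b" using ab(1) \<alpha>0 by (auto simp: bihomog_def homog_iff)
      then have "mdeg \<alpha> \<noteq> 0 \<or> I \<noteq> {}" using ab(2) by auto
      then have "\<exists>i. expo \<alpha> i + (if i \<in> I then 1 else 0) > 0"
      proof
        assume "mdeg \<alpha> \<noteq> 0"
        then have "\<exists>i. expo \<alpha> i \<noteq> 0" by (auto simp: mdeg_def)
        then show ?thesis by auto
      next
        assume "I \<noteq> {}"
        then obtain i where "i \<in> I" by auto
        then show ?thesis by (intro exI[of _ i]) simp
      qed
      then obtain i where i: "expo \<alpha> i + (if i \<in> I then 1 else 0) > 0" ..
      have "m \<le> expo \<alpha> i + (if i \<in> I then 1 else 0)"
        by (rule dvd_imp_le[OF mono_inv_dvd[OF G \<omega> \<alpha>0] i])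
      then show False using supp[OF nz, of i] by (auto simp: lookup_add split: if_splits)
    qed
    then show "mfact \<beta> * coeff (pdop (\<omega> $ I) (\<eta> $ (I \<union> J))) \<beta> = mfact \<beta> * coeff 0 \<beta>"
      by (simp add: coeff_pdop)
  qed
  then show "dform \<omega> \<eta> = 0" by (simp add: vec_eq_iff dform_component)
qed (rule \<eta>)

lemma mono_rank:
  assumes G: "G = Gmpn m 1" "m \<ge> 2"
  shows "group_rank K G = CARD('n)"
proof -
  have "f = 0" if f: "f \<in> fixed_vectors K G" for f
  proof -
    have "f $ i = 0" for i
    proof (rule ccontr)
      assume nz: "f $ i \<noteq> 0"
      have "z ^ 1 = 1" if z: "z ^ m = 1" for z :: complex
      proof -
        have "diag_at i z \<in> G" unfolding G(1) by (rule diag_at_Gmpn[OF z]) (use G(2) in simp)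
        then have "(diag_at i z *v f) $ i = f $ i" using f by (auto simp: fixed_vectors_def)
        moreover have "(diag_at i z *v f) $ i = (\<Sum>j\<in>UNIV. if j = i then z * f $ i else 0)"
        proof -
          have "(diag_at i z *v f) $ i = (\<Sum>j\<in>UNIV. diag_at i z $ i $ j * f $ j)"
            by (simp add: matrix_vector_mult_def)
          also have "\<dots> = (\<Sum>j\<in>UNIV. if j = i then z * f $ i else 0)"
            by (intro sum.cong) (auto simp: diag_at_def)
          finally show ?thesis .
        qed
        ultimately show ?thesis using nz by simp
      qed
      then have "m dvd 1" using G(2) by (intro root_of_unity_dvd) auto
      then show False using G(2) by simp
    qed
    then show ?thesis by (simp add: vec_eq_iff)
  qed
  then have "fixed_vectors K G \<subseteq> {0}" by blast
  then have "vec.dim (fixed_vectors K G) \<le> vec.dim {0 :: 'n cvec}" by (rule vec.dim_subset)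
  moreover have "vec.dim {0 :: 'n cvec} = 0"
    by (rule vec.dim_unique[of "{}"]) (auto simp: vec.independent_empty)
  ultimately have "vec.dim (fixed_vectors K G) = 0" by linarith
  then show ?thesis by (simp only: group_rank_eq diff_zero)
qed

lemma act_euler:
  assumes "unitary_matrix s"
  shows "act s (euler \<eta>) = euler (act s \<eta>)"
proof -
  have "act s (euler \<eta>) = (\<Sum>j\<in>UNIV. \<Sum>k\<in>UNIV. (Const (s $ k $ j) * act_poly s (X j)) *s dtheta k (act s \<eta>))"
    unfolding euler_def act_sum act_smult act_dtheta[OF assms]
    by (intro sum.cong refl) (simp add: iota_def column_def form_scale_def vec_eq_iff sum_distrib_left mult_ac)
  also have "\<dots> = (\<Sum>k\<in>UNIV. \<Sum>j\<in>UNIV. (Const (s $ k $ j) * act_poly s (X j)) *s dtheta k (act s \<eta>))"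
    by (rule sum.swap)
  also have "\<dots> = euler (act s \<eta>)"
    unfolding euler_def by (subst X_equivariant[OF assms]) (simp add: vec_eq_iff sum_distrib_right)
  finally show ?thesis .
qed

end

text \<open>The groups \<open>G(m,1,2)\<close>; the order of the two indices fixes the sign of \<open>\<theta>\<^sub>p \<theta>\<^sub>q\<close>.\<close>

locale mono_two = refl_group K G for K and G :: "'n::{finite,linorder} cmat set" +
  fixes m :: nat and p q :: 'n
  assumes G_eq: "G = Gmpn m 1" and m: "m \<ge> 2" and UNIV_eq: "UNIV = {p, q}" and pq: "p < q"
begin

lemma card_two: "CARD('n) = 2"
  using pq by (simp add: UNIV_eq)

lemma index_cases: "i = p \<or> i = q"
  using UNIV_eq by blast

lemma sum_two: "(\<Sum>i\<in>UNIV. F i) = F p + (F q :: 'z::comm_monoid_add)"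
  using pq by (simp add: UNIV_eq)

definition vol :: "'n form" where
  "vol = Theta [p, q]"

lemma vol_component: "vol $ L = (if L = UNIV then 1 else 0)"
  using Theta_sorted[of "[p, q]" L] pq by (simp add: vol_def UNIV_eq)

lemma bihomog_vol: "bihomog 0 2 vol"
  using bihomog_Theta[of "[p, q]"] by (simp add: vol_def numeral_2_eq_2)

lemma two_form_eq:
  assumes "bihomog a 2 \<omega>"
  shows "\<omega> = \<omega> $ UNIV *s vol"
proof (rule vec_eq_iff[THEN iffD2], rule allI)
  fix L
  show "\<omega> $ L = (\<omega> $ UNIV *s vol) $ L"
  proof (cases "L = UNIV")
    case False
    then have "card L \<noteq> 2" using card_subset_eq[of UNIV L] card_two by auto
    then show ?thesis using assms False by (auto simp: bihomog_def vol_component)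
  qed (simp add: vol_component)
qed

definition \<gamma> :: "'n \<Rightarrow>\<^sub>0 nat" where
  "\<gamma> = Poly_Mapping.single p (m - 2) + Poly_Mapping.single q (m - 2)"

lemma expo_\<gamma>: "expo \<gamma> i = m - 2"
  using index_cases[of i] pq by (auto simp: \<gamma>_def lookup_add lookup_single when_def)

lemma mdeg_\<gamma>: "mdeg \<gamma> = 2 * (m - 2)"
  by (simp add: \<gamma>_def mdeg_add)

text \<open>The form \<open>(x\<^sub>p x\<^sub>q)\<^sup>m\<^sup>-\<^sup>2 \<theta>\<^sub>p \<theta>\<^sub>q\<close>, from which all super harmonic two-forms arise by differentiation.\<close>

definition top_form :: "'n form" where
  "top_form = monomial \<gamma> 1 *s vol"

lemma top_form_component: "top_form $ L = (if L = UNIV then monomial \<gamma> 1 else 0)"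
  by (simp add: top_form_def vol_component)

lemma bihomog_top_form: "bihomog (2 * (m - 2)) 2 top_form"
  using bihomog_smult[OF homog_monomial[OF mdeg_\<gamma>] bihomog_vol] by (simp add: top_form_def)

lemma top_form_K: "top_form \<in> K_forms K"
  by (auto simp: K_forms_def top_form_component)

lemma top_form_SH: "top_form \<in> SH K G"
  by (rule mono_SH[OF G_eq _ top_form_K])
    (use m in \<open>auto simp: top_form_component expo_\<gamma> lookup_single when_def split: if_splits\<close>)

lemma top_form_det:
  assumes s: "s \<in> G"
  shows "act s top_form = form_scale (det s) top_form"
proof -
  obtain \<pi> z where mon: "monomial_matrix \<pi> z s" and z: "\<And>j. z j ^ m = 1"
    using Gmpn_monomial s G_eq by metis
  \<comment> \<open>\<open>e = \<plusminus>det s\<close> is an \<open>m\<close>th root of unity, so that \<open>e\<^sup>-\<^sup>(\<^sup>m\<^sup>-\<^sup>2\<^sup>) = e\<^sup>2 = (det s)\<^sup>2\<close>\<close>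
  define e where "e = z p * z q"
  have "bij \<pi>" using mon by (simp add: monomial_matrix_def)
  then have "\<pi> p \<noteq> \<pi> q" using pq by (auto dest: bij_is_inj injD)
  then consider "\<pi> p = p" "\<pi> q = q" | "\<pi> p = q" "\<pi> q = p"
    using index_cases by metis
  note \<pi> = this
  have "act s vol = form_scale (cnj e) (theta (\<pi> p) \<star> (theta (\<pi> q) \<star> of_poly 1))"
    by (simp add: vol_def Theta_simps act_theta_mult act_of_poly monomial_act_theta_mult[OF mon]
        form_mult_scale_right form_scale_scale e_def)
  then have "act s vol = form_scale (cnj e) vol \<or> act s vol = form_scale (- cnj e) vol"
    by (cases rule: \<pi>)
      (simp_all add: vol_def Theta_simps theta_anticommute[of q p] form_scale_uminus)
  moreover have "act s vol = form_scale (cnj (det s)) vol"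
    by (rule top_form_det) (use bihomog_vol s card_two in auto)
  ultimately have "form_scale (cnj (det s)) vol $ UNIV = form_scale (cnj e) vol $ UNIV \<or>
      form_scale (cnj (det s)) vol $ UNIV = form_scale (- cnj e) vol $ UNIV" by metis
  then have "Const (cnj (det s) - cnj e) = (0 :: 'n mpoly) \<or> Const (cnj (det s) - (- cnj e)) = (0 :: 'n mpoly)"
    by (auto simp: vol_component Const_diff Const_add Const_uminus)
  then have "cnj (det s) - cnj e = 0 \<or> cnj (det s) - (- cnj e) = 0" by (simp only: Const_eq_0_iff)
  then have "cnj (det s) = cnj e \<or> cnj (det s) = cnj (- e)"
    by (auto simp: eq_neg_iff_add_eq_0)
  then have de: "det s = e \<or> det s = - e" by (metis complex_cnj_cancel_iff)
  have ecnj: "e * cnj e = 1" using det_unit(1)[OF s] de by auto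
  have "cnj e ^ (m - 2) * cnj e ^ 2 = cnj (e ^ m)"
  proof -
    have "m - 2 + 2 = m" using m by simp
    then show ?thesis by (simp only: power_add[symmetric] complex_cnj_power)
  qed
  also have "e ^ m = 1" by (simp add: e_def power_mult_distrib z)
  finally have h: "cnj e ^ (m - 2) * cnj e ^ 2 = 1" by simp
  have "cnj e ^ (m - 2) = cnj e ^ (m - 2) * (e * cnj e) ^ 2"
    by (simp only: ecnj power_one mult_1_right)
  also have "\<dots> = cnj e ^ (m - 2) * cnj e ^ 2 * e ^ 2" by (simp only: power_mult_distrib mult_ac)
  finally have e2: "cnj e ^ (m - 2) = e ^ 2" by (simp only: h mult_1_left)
  have pow: "cnj e ^ (m - 2) = det s * det s" unfolding e2 using de by (auto simp: power2_eq_square)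
  have mon0: "monomial \<gamma> 1 = (X p * X q) ^ (m - 2)"
    by (simp add: \<gamma>_def power_mult_distrib X_power mult_single)
  have "act_poly s (monomial \<gamma> 1) = (Const (cnj e) * (X (\<pi> p) * X (\<pi> q))) ^ (m - 2)"
    unfolding mon0 act_poly_power act_poly_mult monomial_act_X[OF mon]
    by (simp only: e_def complex_cnj_mult Const_mult mult_ac)
  also have "\<dots> = Const (cnj e ^ (m - 2)) * monomial \<gamma> 1"
    by (cases rule: \<pi>) (simp_all add: mon0 power_mult_distrib Const_power mult_ac)
  finally have "act s top_form = form_scale (cnj e ^ (m - 2) * cnj (det s)) top_form"
    using \<open>act s vol = form_scale (cnj (det s)) vol\<close>
    by (simp add: top_form_def act_smult vec_eq_iff Const_mult mult_ac)
  also have "cnj e ^ (m - 2) * cnj (det s) = det s"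
    unfolding pow using det_unit(1)[OF s] by (simp add: mult.assoc)
  finally show ?thesis .
qed

lemma top_form_SH_det: "top_form \<in> SH_det K G"
  using top_form_SH top_form_det by (simp add: SH_det_def)

lemma euler_top_form_SH_det: "euler top_form \<in> SH_det K G"
proof -
  have "euler top_form \<in> SH K G"
  proof (rule mono_SH[OF G_eq])
    show "euler top_form \<in> K_forms K"
      unfolding euler_def by (intro K_forms_sum K_forms_smult K_polys_X K_forms_dtheta top_form_K)
    fix J \<beta> i assume "coeff (euler top_form $ J) \<beta> \<noteq> 0"
    then have "(\<Sum>j\<in>UNIV. coeff (X j * dtheta j top_form $ J) \<beta>) \<noteq> 0"
      by (simp add: euler_def lookup_sum)
    then obtain j where j: "coeff (X j * dtheta j top_form $ J) \<beta> \<noteq> 0" by (meson sum.not_neutral_contains_not_neutral)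
    then have J: "j \<notin> J" "insert j J = UNIV"
      by (auto simp: dtheta_component top_form_component split: if_splits)
    then have "X j * dtheta j top_form $ J = theta_sign {j} J * monomial (unit_expo j + \<gamma>) 1"
      by (simp add: dtheta_component top_form_component X_def mult_single mult.left_commute)
    then have "\<beta> = unit_expo j + \<gamma>"
      using j by (auto simp: theta_sign_as_Const lookup_single when_def split: if_splits)
    then have "expo \<beta> i = (if i = j then 1 else 0) + (m - 2)"
      by (simp add: lookup_add expo_\<gamma> lookup_single when_def)
    moreover have "i \<in> J \<longleftrightarrow> i \<noteq> j" using J by auto
    ultimately show "expo \<beta> i + (if i \<in> J then 1 else 0) < m" using m by auto
  qed (use m in simp)
  moreover have "act s (euler top_form) = form_scale (det s) (euler top_form)" if "s \<in> G" for s
  proof -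
    have "euler (form_scale c \<eta>) = form_scale c (euler \<eta>)" for c and \<eta> :: "'n form"
      unfolding euler_def dtheta_scale form_scale_sum by (simp add: vec_eq_iff mult_ac)
    then show ?thesis by (simp add: act_euler[OF G_unitary[OF that]] top_form_det[OF that])
  qed
  ultimately show ?thesis by (simp add: SH_det_def)
qed

lemma ext_d_euler_top_form: "ext_d (euler top_form) = form_scale (of_nat (2 * (m - 2) + 2)) top_form"
proof -
  have "ext_d top_form = 0"
    by (rule bihomog_gt_card[OF bihomog_ext_d'[OF bihomog_top_form]]) (simp add: card_two)
  then show ?thesis using euler_ext_d[OF bihomog_top_form] by (simp add: euler_def)
qed

text \<open>The form \<open>\<rho> = \<Sum>\<^sub>i x\<^sub>i\<^sup>m\<^sup>-\<^sup>1 \<theta>\<^sub>i\<close> is invariant. Its operator kills \<open>\<omega>\<close> and, trivially, the three-form \<open>\<theta>\<^sub>k \<star> \<omega>\<close>; the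
  anticommutator of \<open>\<partial>\<^sub>\<rho>\<close> with \<open>\<theta>\<^sub>k\<close> is the derivative of order \<open>m - 1\<close> by \<open>x\<^sub>k\<close>.\<close>

lemma two_form_expo:
  assumes \<omega>: "\<omega> \<in> SH K G" "bihomog a 2 \<omega>" and nz: "coeff (\<omega> $ UNIV) \<beta> \<noteq> 0"
  shows "expo \<beta> k \<le> m - 2"
proof -
  define \<rho> where "\<rho> = (\<Sum>i\<in>UNIV. X i ^ (m - 1) *s (theta i :: 'n form))"
  have th1: "bihomog 0 1 (theta i :: 'n form)" for i
    using bihomog_theta_mult[OF bihomog_of_poly[OF homog_1]] by (simp add: theta_mult_one)
  have "\<rho> \<in> inv_forms"
  proof (rule inv_formsI)
    show "\<rho> \<in> K_forms K" unfolding \<rho>_def by (intro K_forms_sum K_forms_smult K_polys_power K_polys_X K_forms_theta)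
    show "bihomog (m - 1) 1 \<rho>"
      unfolding \<rho>_def using bihomog_smult[OF homog_power[OF homog_X, of "m - 1"] th1] by (intro bihomog_sum) simp
    fix s assume "s \<in> G"
    then obtain \<pi> z where mon: "monomial_matrix \<pi> z s" and z: "\<And>j. z j ^ m = 1"
      using Gmpn_monomial G_eq by metis
    have "act s (X i ^ (m - 1) *s theta i) = X (\<pi> i) ^ (m - 1) *s theta (\<pi> i)" for i
    proof -
      have "act s (theta i) = form_scale (cnj (z i)) (theta (\<pi> i))"
        using act_theta_mult[of s i "of_poly 1"]
        by (simp add: theta_mult_one act_of_poly monomial_act_theta_mult[OF mon])
      moreover have "cnj (z i) ^ (m - 1) * cnj (z i) = 1"
      proof -
        have "cnj (z i) ^ (m - 1) * cnj (z i) = cnj (z i ^ m)"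
        proof -
          have "Suc (m - 1) = m" using m by simp
          then show ?thesis by (simp only: power_Suc2[symmetric] complex_cnj_power)
        qed
        then show ?thesis by (simp add: z)
      qed
      ultimately show ?thesis
        by (simp add: act_smult act_poly_power monomial_act_X[OF mon] power_mult_distrib vec_eq_iff
            mult_ac flip: Const_power)
          (simp add: mult.assoc[symmetric] flip: Const_mult)
    qed
    then have "act s \<rho> = (\<Sum>i\<in>UNIV. X (\<pi> i) ^ (m - 1) *s theta (\<pi> i))" by (simp add: \<rho>_def act_sum)
    also have "\<dots> = \<rho>"
      unfolding \<rho>_def using mon by (intro sum.reindex_bij_betw) (simp add: monomial_matrix_def)
    finally show "act s \<rho> = \<rho>" .
  qed (use m in simp)
  then have "dform \<rho> \<omega> = 0" by (rule SH_kill[OF \<omega>(1)])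
  moreover have "theta k \<star> \<omega> = 0"
    by (rule bihomog_gt_card[OF bihomog_theta_mult[OF \<omega>(2)]]) (simp add: card_two)
  moreover have "dform \<rho> (theta k \<star> \<omega>) = dform (of_poly (X k ^ (m - 1))) \<omega> - theta k \<star> dform \<rho> \<omega>"
  proof -
    have "dform \<rho> (theta k \<star> \<omega>) = (\<Sum>i\<in>UNIV. (if i = k then dform (of_poly (X k ^ (m - 1))) \<omega> else 0)
        - theta k \<star> dtheta i (dform (of_poly (X i ^ (m - 1))) \<omega>))"
      unfolding \<rho>_def dform_sum_left dform_smult dform_theta dform_of_poly_theta dtheta_theta
      by (intro sum.cong) auto
    then show ?thesis
      by (simp add: sum_subtractf \<rho>_def dform_sum_left dform_smult dform_theta form_mult_sum_right)
  qed
  ultimately have "dform (of_poly (X k ^ (m - 1))) \<omega> = 0" by simp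
  then have "dform (of_poly (X k ^ (m - 1))) \<omega> $ UNIV = 0" by simp
  then have "pdop (X k ^ (m - 1)) (\<omega> $ UNIV) = 0" by (simp only: dform_of_poly_component)
  then have "expo \<beta> k < m - 1" using expo_lt_of_pdop_X_power nz by blast
  then show ?thesis by simp
qed

text \<open>By the bound on the exponents, every monomial of the coefficient divides that of the top form.\<close>

lemma two_form_top_form:
  assumes \<omega>: "\<omega> \<in> SH K G" "bihomog a 2 \<omega>"
  obtains B c where "finite B" "\<And>\<beta>. \<beta> \<in> B \<Longrightarrow> c \<beta> \<in> K" "\<And>\<beta>. \<beta> \<in> B \<Longrightarrow> mdeg (\<gamma> - \<beta>) + a = 2 * (m - 2)"
    "\<omega> = (\<Sum>\<beta>\<in>B. form_scale (c \<beta>) (dform (of_poly (monomial (\<gamma> - \<beta>) 1)) top_form))"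
proof -
  define h where "h = \<omega> $ UNIV"
  have hK: "h \<in> K_polys K" unfolding h_def by (rule K_forms_component[OF SH_K_forms[OF \<omega>(1)]])
  have homh: "h = 0 \<or> homog a h" using \<omega>(2) by (auto simp: bihomog_def h_def)
  \<comment> \<open>the operator of \<open>x\<^sup>\<gamma>\<^sup>-\<^sup>\<beta>\<close> takes \<open>x\<^sup>\<gamma>\<close> to \<open>\<gamma>! / \<beta>!\<close> times \<open>x\<^sup>\<beta>\<close>\<close>
  define c where "c \<beta> = coeff h \<beta> * mfact \<beta> / mfact \<gamma>" for \<beta>
  have split: "\<gamma> - \<beta> + \<beta> = \<gamma>" if "\<beta> \<in> Poly_Mapping.keys h" for \<beta>
  proof -
    have "expo \<beta> k \<le> m - 2" for k
      by (rule two_form_expo[OF \<omega>]) (use that in \<open>simp add: h_def in_keys_iff\<close>)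
    then show ?thesis
      by (intro poly_mapping_eqI) (simp only: lookup_add lookup_minus expo_\<gamma> le_add_diff_inverse2)
  qed
  have mon: "form_scale (c \<beta>) (dform (of_poly (monomial (\<gamma> - \<beta>) 1)) top_form) = monomial \<beta> (coeff h \<beta>) *s vol"
    if "\<beta> \<in> Poly_Mapping.keys h" for \<beta>
  proof -
    have "pdop (monomial (\<gamma> - \<beta>) 1) (monomial \<gamma> 1) = monomial \<beta> (mfact \<gamma> / mfact \<beta>)"
      using pdop_monomial_monomial[of "\<gamma> - \<beta>" \<beta>] by (simp add: split[OF that])
    moreover have "c \<beta> * (mfact \<gamma> / mfact \<beta>) = coeff h \<beta>" by (simp add: c_def)
    ultimately show ?thesis
      by (simp add: vec_eq_iff top_form_component vol_component monomial_mult_Const)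
  qed
  have "\<omega> = (\<Sum>\<beta>\<in>Poly_Mapping.keys h. monomial \<beta> (coeff h \<beta>)) *s vol"
    using two_form_eq[OF \<omega>(2)] by (simp flip: mpoly_as_sum h_def)
  also have "\<dots> = (\<Sum>\<beta>\<in>Poly_Mapping.keys h. form_scale (c \<beta>) (dform (of_poly (monomial (\<gamma> - \<beta>) 1)) top_form))"
    by (simp add: mon) (simp add: vec_eq_iff sum_distrib_right)
  finally show thesis
  proof (rule that[rotated 3])
    fix \<beta> assume \<beta>: "\<beta> \<in> Poly_Mapping.keys h"
    show "c \<beta> \<in> K" unfolding c_def using K_polys_coeff[OF hK] by auto
    have "mdeg \<beta> = a" using homh \<beta> by (auto simp: homog_def)
    then show "mdeg (\<gamma> - \<beta>) + a = 2 * (m - 2)"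
      using arg_cong[OF split[OF \<beta>], of mdeg] by (simp add: mdeg_add mdeg_\<gamma>)
  qed simp
qed

text \<open>The differential of a one-form \<open>\<omega>\<close> is a combination of derivatives of the top form; as the top form is, up to a factor,
  the differential of its Euler contraction, the same combination of derivatives of the contraction is a
  determinantal one-form with the differential \<open>d \<omega>\<close>.\<close>

lemma mono_two_SH_eq_det_span: "SH K G = det_span"
proof (rule SH_eq_det_spanI)
  show "group_rank K G \<le> 2" using mono_rank[OF G_eq m] by (simp add: card_two)
  fix a \<omega> assume \<omega>: "\<omega> \<in> SH K G" "bihomog a 2 \<omega>"
  obtain B c where B: "finite B" "\<And>\<beta>. \<beta> \<in> B \<Longrightarrow> c \<beta> \<in> K"
    "\<omega> = (\<Sum>\<beta>\<in>B. form_scale (c \<beta>) (dform (of_poly (monomial (\<gamma> - \<beta>) 1)) top_form))"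
    using two_form_top_form[OF \<omega>] by blast
  show "\<omega> \<in> det_span"
    unfolding B(3) using B(2)
    by (intro forms.spanK_sum forms.spanK_scale det_span_dform_of_poly SH_det_subset_span top_form_SH_det) auto
next
  fix a \<omega> assume \<omega>: "\<omega> \<in> SH K G" "bihomog a 1 \<omega>"
  show "\<exists>\<nu>\<in>det_span. bihomog a 1 \<nu> \<and> ext_d \<nu> = ext_d \<omega>"
  proof (cases a)
    case 0
    then have "ext_d \<omega> = 0" using \<omega>(2) by (simp add: ext_d_def dx_homog_0)
    then show ?thesis by (intro bexI[of _ 0]) (auto simp: forms.spanK_0)
  next
    case (Suc a')
    then have "bihomog a' 2 (ext_d \<omega>)" using bihomog_ext_d'[OF \<omega>(2)] by (simp add: numeral_2_eq_2)
    then obtain B c where B: "finite B" "\<And>\<beta>. \<beta> \<in> B \<Longrightarrow> c \<beta> \<in> K"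
      "\<And>\<beta>. \<beta> \<in> B \<Longrightarrow> mdeg (\<gamma> - \<beta>) + a' = 2 * (m - 2)"
      "ext_d \<omega> = (\<Sum>\<beta>\<in>B. form_scale (c \<beta>) (dform (of_poly (monomial (\<gamma> - \<beta>) 1)) top_form))"
      using two_form_top_form[OF SH_ext_d[OF \<omega>(1)]] by blast
    let ?N = "of_nat (2 * (m - 2) + 2) :: complex"
    define \<nu> where "\<nu> = (\<Sum>\<beta>\<in>B. form_scale (c \<beta> * inverse ?N) (dform (of_poly (monomial (\<gamma> - \<beta>) 1)) (euler top_form)))"
    have N: "?N \<noteq> 0" by (simp only: of_nat_eq_0_iff)
    have "\<nu> \<in> det_span"
      unfolding \<nu>_def using B(2)
      by (intro forms.spanK_sum forms.spanK_scale det_span_dform_of_poly SH_det_subset_span euler_top_form_SH_det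
          K_mult K_inverse K_of_nat) auto
    moreover have "bihomog a 1 \<nu>"
      unfolding \<nu>_def
    proof (intro bihomog_sum bihomog_scale)
      fix \<beta> assume \<beta>: "\<beta> \<in> B"
      have "bihomog (2 * (m - 2)) (Suc 1) top_form" using bihomog_top_form by (simp add: numeral_2_eq_2)
      then have "bihomog (Suc (2 * (m - 2)) - mdeg (\<gamma> - \<beta>)) (1 - 0) (dform (of_poly (monomial (\<gamma> - \<beta>) 1)) (euler top_form))"
        by (intro dform_bihomog[OF bihomog_of_poly[OF homog_monomial]] bihomog_euler) auto
      moreover have "Suc (2 * (m - 2)) - mdeg (\<gamma> - \<beta>) = a" using B(3)[OF \<beta>] Suc by simp
      ultimately show "bihomog a 1 (dform (of_poly (monomial (\<gamma> - \<beta>) 1)) (euler top_form))" by simp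
    qed
    moreover have "ext_d \<nu> = ext_d \<omega>"
    proof -
      have each: "c \<beta> * inverse ?N * ?N = c \<beta>" for \<beta> by (simp only: mult.assoc left_inverse[OF N] mult_1_right)
      show ?thesis
        unfolding \<nu>_def B(4) ext_d_sum ext_d_scale ext_d_dform_of_poly ext_d_euler_top_form dform_scale_right
          form_scale_scale each ..
    qed
    ultimately show ?thesis by blast
  qed
qed

end

context refl_group
begin

text \<open>On a line all one-forms are closed, and there are no two-forms.\<close>

lemma mono_one_SH_eq_det_span:
  assumes "CARD('n) = 1"
  shows "SH K G = det_span"
proof (rule SH_eq_det_spanI)
  show "group_rank K G \<le> 2" using assms by (simp add: group_rank_eq)
  fix a and \<omega> :: "'n form" assume "bihomog a 2 \<omega>"
  then have "\<omega> = 0" by (rule bihomog_gt_card) (simp add: assms)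
  then show "\<omega> \<in> det_span" by (simp add: forms.spanK_0)
next
  fix a \<omega> assume \<omega>: "bihomog a 1 (\<omega> :: 'n form)"
  have "ext_d \<omega> = 0" by (rule bihomog_gt_card[OF bihomog_ext_d'[OF \<omega>]]) (simp add: assms)
  then show "\<exists>\<nu>\<in>det_span. bihomog a 1 \<nu> \<and> ext_d \<nu> = ext_d \<omega>"
    by (intro bexI[of _ 0]) (auto simp: forms.spanK_0)
qed

text \<open>For \<open>m = 1\<close> the group consists of permutation matrices, which are real, and for \<open>m \<ge> 2\<close> the rank is \<open>n\<close>.\<close>

lemma mono_cases:
  assumes G: "G = Gmpn m 1" "m \<ge> 1" and rank: "group_rank K G \<le> 2"
  obtains (real) "real_group G" | (one) "m \<ge> 2" "CARD('n) = 1" | (two) p q where "mono_two K G m p q"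
proof -
  consider "m = 1" | "m \<ge> 2" using G(2) by linarith
  then show thesis
  proof cases
    case 1
    have "s $ i $ j \<in> \<real>" if "s \<in> G" for s i j
    proof (cases "s $ i $ j = 0")
      case False
      have "s \<in> Gmpn m 1" using that G(1) by simp
      then have "(s $ i $ j) ^ m = 1" using False unfolding Gmpn_def mem_Collect_eq by metis
      then show ?thesis using 1 by simp
    qed simp
    moreover have "conj_transpose (mat 1) = (mat 1 :: 'n cmat)"
      by (auto simp: conj_transpose_def vec_eq_iff mat_def)
    ultimately have "real_group G"
      unfolding real_group_def by (intro exI[of _ "mat 1"]) (simp add: unitary_matrix_def)
    then show thesis by (rule real)
  next
    case 2
    then have "CARD('n) \<le> 2" using mono_rank[OF G(1)] rank by simp
    moreover have "CARD('n) \<ge> 1" by (simp add: Suc_le_eq)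
    ultimately consider "CARD('n) = 1" | "CARD('n) = 2" by linarith
    then show thesis
    proof cases
      case 1
      then show thesis using one 2 by blast
    next
      case two2: 2
      then obtain x y where xy: "(UNIV :: 'n set) = {x, y}" "x \<noteq> y" by (auto simp: card_2_iff)
      have "\<exists>p q. (UNIV :: 'n set) = {p, q} \<and> p < q"
      proof (cases "x < y")
        case False
        then have "(UNIV :: 'n set) = {y, x} \<and> y < x" using xy by (simp add: insert_commute)
        then show ?thesis by blast
      qed (use xy in blast)
      then obtain p q where "(UNIV :: 'n set) = {p, q}" "p < q" by blast
      then have "mono_two K G m p q"
        using G(1) \<open>m \<ge> 2\<close> by unfold_locales
      then show thesis by (rule two)
    qed
  qed
qed

lemma SH_eq_det_span:
  assumes rank: "group_rank K G \<le> 2" and "(\<exists>m\<ge>1. G = Gmpn m 1) \<or> real_group G"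
  shows "SH K G = det_span"
  using assms(2)
proof
  assume "\<exists>m\<ge>1. G = Gmpn m 1"
  then obtain m where m: "G = Gmpn m 1" "m \<ge> 1" by blast
  show ?thesis
  proof (rule mono_cases[OF m rank])
    show "real_group G \<Longrightarrow> SH K G = det_span" by (rule real_SH_eq_det_span[OF rank])
    show "CARD('n) = 1 \<Longrightarrow> SH K G = det_span" by (rule mono_one_SH_eq_det_span)
    show "mono_two K G m p q \<Longrightarrow> SH K G = det_span" for p q by (rule mono_two.mono_two_SH_eq_det_span)
  qed
qed (rule real_SH_eq_det_span[OF rank])

end

section \<open>Determinantal harmonic polynomials\<close>

text \<open>If one coefficient already separates the determinantal harmonic polynomials from \<open>0\<close>, they form a line.\<close>

lemma (in refl_group) det_poly_unique_of_coeff: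
  assumes zero: "\<And>R. R \<in> harmonic_polys K G \<Longrightarrow> (\<And>s. s \<in> G \<Longrightarrow> act_poly s R = Const (det s) * R) \<Longrightarrow>
      coeff R \<beta> = 0 \<Longrightarrow> R = 0"
    and P: "P \<in> harmonic_polys K G" "\<And>s. s \<in> G \<Longrightarrow> act_poly s P = Const (det s) * P"
    and Q: "Q \<in> harmonic_polys K G" "\<And>s. s \<in> G \<Longrightarrow> act_poly s Q = Const (det s) * Q" "Q \<noteq> 0"
  shows "\<exists>c\<in>K. P = Const c * Q"
proof -
  have nz: "coeff Q \<beta> \<noteq> 0" using zero[OF Q(1,2)] Q(3) by blast
  define c where "c = coeff P \<beta> / coeff Q \<beta>"
  have cK: "c \<in> K"
    unfolding c_def using harmonic_K_polys[OF P(1)] harmonic_K_polys[OF Q(1)] by (intro K_divide K_polys_coeff)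
  have "P - Const c * Q = 0"
  proof (rule zero)
    show "P - Const c * Q \<in> harmonic_polys K G"
      by (intro polys.K_subspaceD(3,4)[OF harmonic_subspace] P Q cK)
    show "act_poly s (P - Const c * Q) = Const (det s) * (P - Const c * Q)" if "s \<in> G" for s
      unfolding act_poly_diff act_poly_mult act_poly_Const P(2)[OF that] Q(2)[OF that]
      by (simp only: right_diff_distrib mult.left_commute)
    show "coeff (P - Const c * Q) \<beta> = 0" using nz by (simp add: lookup_minus c_def)
  qed
  then show ?thesis using cK by (intro bexI[of _ c]) simp_all
qed

context refl_group
begin

lemma mono_det_dvd:
  assumes G: "G = Gmpn m 1" "m \<ge> 1" and P: "\<And>s. s \<in> G \<Longrightarrow> act_poly s P = Const (det s) * P"
    and nz: "coeff P \<alpha> \<noteq> 0"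
  shows "m dvd expo \<alpha> i + 1"
proof (rule root_of_unity_dvd[OF G(2)])
  fix w :: complex assume w: "w ^ m = 1"
  have D: "diag_at i (cnj w) \<in> G"
    unfolding G(1) by (rule diag_at_Gmpn) (use w G(2) in \<open>auto simp flip: complex_cnj_power\<close>)
  have "w ^ expo \<alpha> i * coeff P \<alpha> = cnj w * coeff P \<alpha>"
    using arg_cong[OF P[OF D], of "\<lambda>p. coeff p \<alpha>"] by (simp add: coeff_act_diag_at det_diag_at)
  then have "w ^ expo \<alpha> i = cnj w" using nz by simp
  moreover have "cnj w * w = 1" using det_unit(1)[OF D] by (simp add: det_diag_at)
  ultimately show "w ^ (expo \<alpha> i + 1) = 1" by (simp add: mult.commute)
qed

lemma mono_invariants:
  assumes G: "G = Gmpn m 1" "m \<ge> 1" and P: "P \<in> harmonic_polys K G"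
  shows "pdop (\<Sum>i\<in>UNIV. X i ^ m) P = 0" "pdop (\<Prod>i\<in>UNIV. X i ^ m) P = 0"
proof -
  have act: "\<exists>\<pi>. bij \<pi> \<and> (\<forall>i. act_poly s (X i ^ m) = X (\<pi> i) ^ m)" if s: "s \<in> G" for s
  proof -
    obtain \<pi> z where mon: "monomial_matrix \<pi> z s" and z: "\<And>j. z j ^ m = 1"
      using Gmpn_monomial s G(1) by metis
    have "cnj (z i) ^ m = 1" for i using z[of i] by (simp flip: complex_cnj_power)
    then have "act_poly s (X i ^ m) = X (\<pi> i) ^ m" for i
      by (simp add: act_poly_power monomial_act_X[OF mon] power_mult_distrib flip: Const_power)
    then show ?thesis using mon by (auto simp: monomial_matrix_def)
  qed
  have hom: "homog m (X i ^ m)" for i :: 'n using homog_power[OF homog_X, of m i] by simp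
  have "act_poly s (\<Sum>i\<in>UNIV. X i ^ m) = (\<Sum>i\<in>UNIV. X i ^ m)" if "s \<in> G" for s
  proof -
    obtain \<pi> where \<pi>: "bij \<pi>" "\<And>i. act_poly s (X i ^ m) = X (\<pi> i) ^ m" using act[OF \<open>s \<in> G\<close>] by blast
    then show ?thesis by (simp add: act_poly_sum sum.reindex_bij_betw[OF \<pi>(1), of "\<lambda>i. X i ^ m"])
  qed
  moreover have "homog m (\<Sum>i\<in>(UNIV :: 'n set). X i ^ m)" by (intro homog_sum hom)
  moreover have "m > 0" using G(2) by simp
  moreover have "(\<Sum>i\<in>UNIV. X i ^ m) \<in> K_polys K" by (intro K_polys_sum K_polys_power K_polys_X)
  ultimately show "pdop (\<Sum>i\<in>UNIV. X i ^ m) P = 0"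
    using P unfolding harmonic_iff by blast
  have "act_poly s (\<Prod>i\<in>UNIV. X i ^ m) = (\<Prod>i\<in>UNIV. X i ^ m)" if "s \<in> G" for s
  proof -
    obtain \<pi> where \<pi>: "bij \<pi>" "\<And>i. act_poly s (X i ^ m) = X (\<pi> i) ^ m" using act[OF \<open>s \<in> G\<close>] by blast
    then show ?thesis by (simp add: act_poly_prod prod.reindex_bij_betw[OF \<pi>(1), of "\<lambda>i. X i ^ m"])
  qed
  moreover have "homog (\<Sum>i\<in>(UNIV :: 'n set). m) (\<Prod>i\<in>(UNIV :: 'n set). X i ^ m)"
    by (rule homog_prod[of UNIV "\<lambda>_. m" "\<lambda>i. X i ^ m"]) (rule hom)
  moreover have "(\<Sum>i\<in>(UNIV :: 'n set). m) > 0" using G(2) by simp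
  moreover have "(\<Prod>i\<in>UNIV. X i ^ m) \<in> K_polys K" by (intro K_polys_prod K_polys_power K_polys_X)
  ultimately show "pdop (\<Prod>i\<in>UNIV. X i ^ m) P = 0"
    using P unfolding harmonic_iff by blast
qed

lemma dvd_Suc_lt:
  assumes "m dvd k + 1" "k < m"
  shows "k = m - (1 :: nat)"
proof -
  have "m \<le> k + 1" using assms(1) by (rule dvd_imp_le) simp
  then show ?thesis using assms(2) by simp
qed

lemma mono_one_det_zero:
  assumes G: "G = Gmpn m 1" "m \<ge> 1" and p: "(UNIV :: 'n set) = {p}"
    and P: "P \<in> harmonic_polys K G" "\<And>s. s \<in> G \<Longrightarrow> act_poly s P = Const (det s) * P"
    and zero: "coeff P (Poly_Mapping.single p (m - 1)) = 0"
  shows "P = 0"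
proof (rule poly_mapping_eqI, rule ccontr)
  fix \<alpha> assume "coeff P \<alpha> \<noteq> coeff 0 \<alpha>"
  then have nz: "coeff P \<alpha> \<noteq> 0" by simp
  have "pdop (X p ^ m) P = 0" using mono_invariants(1)[OF G P(1)] by (simp add: p)
  then have "expo \<alpha> p < m" using expo_lt_of_pdop_X_power nz by blast
  then have "expo \<alpha> p = m - 1" using mono_det_dvd[OF G P(2) nz] dvd_Suc_lt by blast
  then have "\<alpha> = Poly_Mapping.single p (m - 1)"
    using p by (intro poly_mapping_eqI) (auto simp: lookup_single when_def)
  then show False using nz zero by simp
qed

end

context mono_two
begin

lemma expo_eqI: "expo \<alpha> p = expo \<beta> p \<Longrightarrow> expo \<alpha> q = expo \<beta> q \<Longrightarrow> \<alpha> = \<beta>"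
proof (rule poly_mapping_eqI)
  fix i assume "expo \<alpha> p = expo \<beta> p" "expo \<alpha> q = expo \<beta> q"
  then show "expo \<alpha> i = expo \<beta> i" using index_cases[of i] by auto
qed

abbreviation pt :: "nat \<Rightarrow> nat \<Rightarrow> ('n \<Rightarrow>\<^sub>0 nat)" where
  "pt a b \<equiv> Poly_Mapping.single p a + Poly_Mapping.single q b"

lemma expo_pt: "expo (pt a b) p = a" "expo (pt a b) q = b"
  using pq by (auto simp: lookup_add lookup_single when_def)

definition swap :: "'n cmat" where
  "swap = (\<chi> i j. if i = j then 0 else 1)"

lemma swap_monomial: "monomial_matrix (\<lambda>i. if i = p then q else p) (\<lambda>_. 1) swap"
proof -
  have "bij (\<lambda>i. if i = p then q else p)"
    by (rule o_bij[of "\<lambda>i. if i = p then q else p"]) (use index_cases pq in \<open>auto simp: fun_eq_iff\<close>)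
  moreover have "swap $ i $ j = (if i = (if j = p then q else p) then 1 else 0)" for i j
    using index_cases[of i] index_cases[of j] pq by (auto simp: swap_def)
  ultimately show ?thesis by (simp add: monomial_matrix_def)
qed

lemma swap_in_G: "swap \<in> G"
  unfolding G_eq by (rule monomial_Gmpn[OF swap_monomial]) (use m in auto)

lemma det_swap: "det swap = - 1"
proof -
  have "rank_one_update (axis p 1 - axis q 1) (axis q 1 - axis p 1) swap"
    unfolding rank_one_update_def
  proof (intro allI)
    fix i j
    show "swap $ i $ j = (if i = j then 1 else 0) + (axis p 1 - axis q 1) $ i * (axis q 1 - axis p 1) $ j"
      using index_cases[of i] index_cases[of j] pq by (auto simp: swap_def axis_def)
  qed
  from rank_one_update_det[OF this] show ?thesis
    using pq by (simp add: dot_def sum_two axis_def)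
qed

lemma coeff_act_swap: "coeff (act_poly swap P) (pt a a) = coeff P (pt a a)"
proof (induction P rule: mpoly_induct)
  case (monomial \<alpha> c)
  have "act_poly swap (monomial \<alpha> c) = Const c * (X q ^ expo \<alpha> p * X p ^ expo \<alpha> q)"
    unfolding monomial_eq_Const_prod act_poly_mult act_poly_prod act_poly_power monomial_act_X[OF swap_monomial]
      act_poly_Const
    using pq by (simp add: UNIV_eq)
  also have "\<dots> = monomial (pt (expo \<alpha> q) (expo \<alpha> p)) c"
    by (simp add: X_power mult_single monomial_mult_Const add.commute)
  finally have "act_poly swap (monomial \<alpha> c) = monomial (pt (expo \<alpha> q) (expo \<alpha> p)) c" .
  moreover have "pt (expo \<alpha> q) (expo \<alpha> p) = pt a a \<longleftrightarrow> \<alpha> = pt a a"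
  proof
    assume "pt (expo \<alpha> q) (expo \<alpha> p) = pt a a"
    from arg_cong[OF this, of "\<lambda>\<beta>. expo \<beta> p"] arg_cong[OF this, of "\<lambda>\<beta>. expo \<beta> q"]
    have "expo \<alpha> q = a" "expo \<alpha> p = a" unfolding expo_pt by auto
    then show "\<alpha> = pt a a" by (intro expo_eqI) (simp_all only: expo_pt)
  next
    assume "\<alpha> = pt a a"
    then have "expo \<alpha> q = a" "expo \<alpha> p = a" by (simp_all only: expo_pt)
    then show "pt (expo \<alpha> q) (expo \<alpha> p) = pt a a" by (simp only:)
  qed
  ultimately show ?case by (simp add: lookup_single when_def)
qed (simp add: act_poly_add lookup_add)

text \<open>The diagonal matrices restrict both exponents to \<open>-1\<close> modulo \<open>m\<close>. The invariants \<open>x\<^sub>p\<^sup>m + x\<^sub>q\<^sup>m\<close> and \<open>x\<^sub>p\<^sup>m x\<^sub>q\<^sup>m\<close> leave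
  of these only \<open>(2m-1, m-1)\<close>, \<open>(m-1, 2m-1)\<close> and \<open>(m-1, m-1)\<close>, and make the coefficients of the first two
  proportional. The last one is symmetric, and is excluded by the swap, of determinant \<open>-1\<close>.\<close>

lemma mono_two_det_zero:
  assumes P: "P \<in> harmonic_polys K G" "\<And>s. s \<in> G \<Longrightarrow> act_poly s P = Const (det s) * P"
    and zero: "coeff P (pt (m - 1 + m) (m - 1)) = 0"
  shows "P = 0"
proof -
  have m1: "m \<ge> 1" using m by simp
  define h where "h \<alpha> = mfact \<alpha> * coeff P \<alpha>" for \<alpha>
  have r1: "h (pt m 0 + \<beta>) + h (pt 0 m + \<beta>) = 0" for \<beta>
  proof -
    have "mfact \<beta> * coeff (pdop (X p ^ m + X q ^ m) P) \<beta> = 0"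
      using mono_invariants(1)[OF G_eq m1 P(1)] by (simp add: sum_two)
    then show ?thesis
      unfolding pdop_add_left X_power lookup_add distrib_left coeff_pdop_monomial by (simp add: h_def)
  qed
  have r2: "h (pt m m + \<beta>) = 0" for \<beta>
  proof -
    have "(\<Prod>i\<in>UNIV. X i ^ m) = monomial (pt m m) 1"
      using pq by (simp add: UNIV_eq X_power mult_single)
    then have "mfact \<beta> * coeff (pdop (monomial (pt m m) 1) P) \<beta> = 0"
      using mono_invariants(2)[OF G_eq m1 P(1)] by simp
    then show ?thesis unfolding coeff_pdop_monomial by (simp add: h_def)
  qed
  have hz: "h \<alpha> = 0 \<longleftrightarrow> coeff P \<alpha> = 0" for \<alpha> by (simp add: h_def)
  have h2: "h \<alpha> = 0" if "expo \<alpha> p \<ge> m" "expo \<alpha> q \<ge> m" for \<alpha>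
  proof -
    have "\<alpha> = pt m m + pt (expo \<alpha> p - m) (expo \<alpha> q - m)"
      by (rule expo_eqI) (use that pq in \<open>auto simp: lookup_add lookup_single when_def\<close>)
    then show ?thesis using r2 by metis
  qed
  have hp: "h \<alpha> = 0" if "expo \<alpha> p \<ge> m + m" for \<alpha>
  proof -
    let ?b = "pt (expo \<alpha> p - m) (expo \<alpha> q)"
    have "\<alpha> = pt m 0 + ?b"
      by (rule expo_eqI) (use that pq in \<open>auto simp: lookup_add lookup_single when_def\<close>)
    moreover have "h (pt 0 m + ?b) = 0"
      by (rule h2) (use that pq in \<open>auto simp: lookup_add lookup_single when_def\<close>)
    ultimately show ?thesis using r1[of ?b] by simp
  qed
  have hq: "h \<alpha> = 0" if "expo \<alpha> q \<ge> m + m" for \<alpha>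
  proof -
    let ?b = "pt (expo \<alpha> p) (expo \<alpha> q - m)"
    have "\<alpha> = pt 0 m + ?b"
      by (rule expo_eqI) (use that pq in \<open>auto simp: lookup_add lookup_single when_def\<close>)
    moreover have "h (pt m 0 + ?b) = 0"
      by (rule h2) (use that pq in \<open>auto simp: lookup_add lookup_single when_def\<close>)
    ultimately show ?thesis using r1[of ?b] by simp
  qed
  have hA: "h (pt (m - 1) (m - 1)) = 0"
  proof -
    have "coeff P (pt (m - 1) (m - 1)) = - coeff P (pt (m - 1) (m - 1))"
      using arg_cong[OF P(2)[OF swap_in_G], of "\<lambda>r. coeff r (pt (m - 1) (m - 1))"]
      by (simp add: coeff_act_swap det_swap)
    then show ?thesis by (simp add: h_def)
  qed
  have hB: "h (pt (m - 1 + m) (m - 1)) = 0" using zero by (simp add: h_def)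
  have hC: "h (pt (m - 1) (m - 1 + m)) = 0"
  proof -
    have "pt m 0 + pt (m - 1) (m - 1) = pt (m - 1 + m) (m - 1)"
      "pt 0 m + pt (m - 1) (m - 1) = pt (m - 1) (m - 1 + m)"
      by (rule expo_eqI; use pq in \<open>auto simp: lookup_add lookup_single when_def\<close>)+
    then show ?thesis using r1[of "pt (m - 1) (m - 1)"] hB by simp
  qed
  have small: "k = m - 1 \<or> k = m - 1 + m" if "m dvd k + 1" "k < m + m" for k :: nat
  proof (cases "k < m")
    case True
    then show ?thesis using dvd_Suc_lt that(1) by blast
  next
    case False
    have "m dvd (k + 1) - m" by (rule dvd_diff_nat) (use that(1) in auto)
    moreover have "(k + 1) - m = (k - m) + 1" using False by simp
    ultimately have "m dvd (k - m) + 1" by (simp only:)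
    then have "k - m = m - 1" using that(2) False by (intro dvd_Suc_lt) auto
    then show ?thesis using False by auto
  qed
  show ?thesis
  proof (rule poly_mapping_eqI, rule ccontr)
    fix \<alpha> assume "coeff P \<alpha> \<noteq> coeff 0 \<alpha>"
    then have nz: "coeff P \<alpha> \<noteq> 0" by simp
    then have nh: "h \<alpha> \<noteq> 0" by (simp add: h_def)
    have "expo \<alpha> p = m - 1 \<or> expo \<alpha> p = m - 1 + m" "expo \<alpha> q = m - 1 \<or> expo \<alpha> q = m - 1 + m"
      by (rule small; use nh hp[of \<alpha>] hq[of \<alpha>] mono_det_dvd[OF G_eq m1 P(2) nz] in force)+
    moreover have "\<not> (expo \<alpha> p \<ge> m \<and> expo \<alpha> q \<ge> m)" using h2 nh by blast
    ultimately consider "expo \<alpha> p = m - 1" "expo \<alpha> q = m - 1"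
      | "expo \<alpha> p = m - 1 + m" "expo \<alpha> q = m - 1" | "expo \<alpha> p = m - 1" "expo \<alpha> q = m - 1 + m"
      by fastforce
    then have "\<alpha> = pt (m - 1) (m - 1) \<or> \<alpha> = pt (m - 1 + m) (m - 1) \<or> \<alpha> = pt (m - 1) (m - 1 + m)"
      by cases (auto intro!: expo_eqI simp: expo_pt)
    then show False using nh hA hB hC by auto
  qed
qed

end


section \<open>Constant coefficient differential operators on forms\<close>

lemma pair_eqI:
  assumes "\<And>\<eta>. pair \<omega> \<eta> = pair \<zeta> \<eta>"
  shows "\<omega> = \<zeta>"
proof -
  have "pair (\<omega> - \<zeta>) (\<omega> - \<zeta>) = 0"
    using assms[of "\<omega> - \<zeta>"] by (simp add: pair_def dform_diff_left lookup_minus)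
  then have "\<omega> - \<zeta> = 0" by (rule pair_self_eq_0)
  then show ?thesis by simp
qed

lemma form_mult_assoc: "(\<omega> \<star> \<zeta>) \<star> \<xi> = \<omega> \<star> (\<zeta> \<star> \<xi>)"
  by (rule pair_eqI) (simp add: pair_mult dform_mult)

lemma act_mult: "act s (\<omega> \<star> \<zeta>) = act s \<omega> \<star> act s \<zeta>"
  by (induction \<omega> rule: form_induct)
    (simp_all add: of_poly_mult act_smult act_of_poly form_mult_smult_left form_mult_assoc
      act_theta_mult form_mult_add_left act_add flip: vector_smult_lid)

definition basis_form :: "'n set \<Rightarrow> 'n::finite form" where
  "basis_form I = (\<chi> L. if L = I then 1 else 0)"

lemma basis_form_component [simp]: "basis_form I $ L = (if L = I then 1 else 0)"
  by (simp add: basis_form_def)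

lemma basis_form_eq_Theta: "basis_form I = Theta (sorted_list_of_set I)"
  by (simp add: vec_eq_iff Theta_sorted)

lemma basis_form_empty: "basis_form {} = of_poly 1"
  by (auto simp: vec_eq_iff of_poly_component)

lemma basis_form_singleton: "basis_form {j} = theta j"
  by (simp add: vec_eq_iff theta_def)

lemma basis_form_mult_component:
  "(basis_form I \<star> \<eta>) $ L = (if I \<subseteq> L then theta_sign I (L - I) * \<eta> $ (L - I) else 0)"
proof -
  have "(basis_form I \<star> \<eta>) $ L = (\<Sum>J\<in>Pow L. if J = I then theta_sign I (L - I) * \<eta> $ (L - I) else 0)"
    unfolding form_mult_component by (intro sum.cong) auto
  then show ?thesis by simp
qed

lemma basis_form_of_poly: "basis_form I \<star> of_poly q = q *s basis_form I"
  by (auto simp: vec_eq_iff basis_form_mult_component of_poly_component)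

lemma dform_of_poly_basis: "dform (of_poly p) (basis_form I \<star> \<eta>) = basis_form I \<star> dform (of_poly p) \<eta>"
  by (simp add: vec_eq_iff basis_form_mult_component pdop_theta_sign)

lemma basis_form_mult:
  fixes I J :: "'n::{finite,linorder} set"
  shows "\<exists>c\<in>{0, 1, - 1}. basis_form I \<star> basis_form J = form_scale c (basis_form (I \<union> J))"
proof (cases "I \<inter> J = {}")
  case True
  obtain k where k: "theta_sign I J = Const ((- 1) ^ k)" using theta_sign_as_Const by blast
  have "basis_form I \<star> basis_form J = form_scale ((- 1) ^ k) (basis_form (I \<union> J))"
  proof (rule vec_eq_iff[THEN iffD2], rule allI)
    fix L
    have "I \<subseteq> L \<and> L - I = J \<longleftrightarrow> L = I \<union> J" using True by auto
    then show "(basis_form I \<star> basis_form J) $ L = form_scale ((- 1) ^ k) (basis_form (I \<union> J)) $ L"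
      using True by (auto simp: basis_form_mult_component k[symmetric] Un_Diff Diff_triv)
  qed
  moreover have "(- 1 :: complex) ^ k \<in> {0, 1, - 1}" by (cases "even k") auto
  ultimately show ?thesis by blast
next
  case False
  have "basis_form I \<star> basis_form J = form_scale 0 (basis_form (I \<union> J))"
    using False by (auto simp: vec_eq_iff basis_form_mult_component)
  then show ?thesis by blast
qed

lemma op_plus_apply: "(D + E) \<eta> = D \<eta> + E \<eta>" for D E :: "'n::finite form \<Rightarrow> 'n form"
  by (simp add: plus_fun_def)

lemma vector_space_op: "vector_space (op_scale :: complex \<Rightarrow> ('n::finite form \<Rightarrow> 'n form) \<Rightarrow> _)"
  by standard (auto simp: op_scale_def fun_eq_iff form_scale_add form_scale_add_left form_scale_scale)

sublocale subfield_conj \<subseteq> ops: K_module K op_scale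
  by (intro K_module.intro subfield_conj_axioms vector_space_op)

context subfield_conj
begin

lemma diff_ops_linear:
  assumes "D \<in> diff_ops K"
  shows "D (\<omega> + \<eta>) = D \<omega> + D \<eta>" "D (form_scale c \<omega>) = form_scale c (D \<omega>)"
  using assms
  by (induction arbitrary: \<omega> \<eta> rule: diff_ops.induct)
    (simp_all add: form_scale_add dx_add form_mult_add_right form_scale_scale mult.commute
      dx_scale form_mult_scale_right add_ac)

lemma diff_ops_0: "D \<in> diff_ops K \<Longrightarrow> D 0 = 0"
  using diff_ops_linear(2)[of D 0 0] by simp

lemma diff_ops_commute:
  assumes "D \<in> diff_ops K"
  shows "D (dform (of_poly p) \<eta>) = dform (of_poly p) (D \<eta>)"
  using assms
  by (induction arbitrary: \<eta> rule: diff_ops.induct)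
    (simp_all add: dform_scale_right dform_of_poly_theta dform_add_right,
      simp_all add: vec_eq_iff pdop_pdx)

lemma diff_ops_K_forms:
  assumes "D \<in> diff_ops K" "\<eta> \<in> K_forms K"
  shows "D \<eta> \<in> K_forms K"
  using assms by (induction arbitrary: \<eta> rule: diff_ops.induct) auto

lemma diff_ops_zero: "(\<lambda>\<eta> :: 'n::{finite,linorder} form. 0) \<in> diff_ops K"
proof -
  have "form_scale 0 = (\<lambda>\<eta> :: 'n form. 0)" by (simp add: fun_eq_iff)
  moreover have "(form_scale 0 :: 'n form \<Rightarrow> 'n form) \<in> diff_ops K" by (rule diff_ops.scalar[OF K_0])
  ultimately show ?thesis by (simp only:)
qed

lemma diff_ops_sum:
  assumes "\<And>i. i \<in> A \<Longrightarrow> D i \<in> diff_ops K"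
  shows "(\<lambda>\<eta>. \<Sum>i\<in>A. D i \<eta>) \<in> diff_ops K"
  using assms
proof (induction A rule: infinite_finite_induct)
  case (insert i A)
  then have "D i + (\<lambda>\<eta>. \<Sum>i\<in>A. D i \<eta>) \<in> diff_ops K" by (intro diff_ops.add) auto
  moreover have "D i + (\<lambda>\<eta>. \<Sum>i\<in>A. D i \<eta>) = (\<lambda>\<eta>. \<Sum>i\<in>insert i A. D i \<eta>)"
    using insert by (simp add: fun_eq_iff)
  ultimately show ?case by simp
qed (simp_all add: diff_ops_zero)

lemma diff_ops_scale:
  assumes "D \<in> diff_ops K" "c \<in> K"
  shows "(\<lambda>\<eta>. form_scale c (D \<eta>)) \<in> diff_ops K"
  using diff_ops.comp[OF diff_ops.scalar[OF assms(2)] assms(1)] by (simp add: o_def)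

lemma diff_ops_poly:
  fixes p :: "'n::{finite,linorder} mpoly"
  assumes "p \<in> K_polys K"
  shows "dform (of_poly p) \<in> diff_ops K"
  using assms
proof (induction rule: K_polys_induct)
  case (Const c)
  have "dform (of_poly (Const c)) = (form_scale (cnj c) :: 'n form \<Rightarrow> 'n form)"
    by (simp add: fun_eq_iff vec_eq_iff pdop_Const)
  then show ?case using diff_ops.scalar[OF K_cnj[OF Const]] by (simp only:)
next
  case (X i)
  have "dform (of_poly (X i)) = (dx i :: 'n form \<Rightarrow> 'n form)" by (simp add: fun_eq_iff dform_of_poly_X)
  then show ?case using diff_ops.dx by (simp only:)
next
  case (add p q)
  have "dform (of_poly (p + q)) = (dform (of_poly p) + dform (of_poly q) :: 'n form \<Rightarrow> 'n form)"
    by (simp add: fun_eq_iff dform_of_poly_add)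
  then show ?case using diff_ops.add[OF add.IH] by (simp only:)
next
  case (mult p q)
  have "dform (of_poly (p * q)) = (dform (of_poly p) \<circ> dform (of_poly q) :: 'n form \<Rightarrow> 'n form)"
    by (simp add: fun_eq_iff dform_of_poly_mult)
  then show ?case using diff_ops.comp[OF mult.IH] by (simp only:)
qed

lemma diff_ops_basis_form:
  fixes I :: "'n::{finite,linorder} set"
  shows "(\<star>) (basis_form I) \<in> diff_ops K"
proof -
  have "(\<star>) (Theta l) \<in> diff_ops K" for l :: "'n list"
  proof (induction l)
    case Nil
    have "(\<star>) (Theta []) = (form_scale 1 :: 'n form \<Rightarrow> 'n form)"
      by (simp add: fun_eq_iff Theta_simps of_poly_mult)
    then show ?case using diff_ops.scalar[OF K_1] by (simp only:)
  next
    case (Cons i l)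
    have "(\<star>) (Theta (i # l)) = (\<star>) (theta i) \<circ> (\<star>) (Theta l)"
      by (simp add: fun_eq_iff Theta_simps form_mult_assoc)
    then show ?case using diff_ops.comp[OF diff_ops.theta[of i] Cons] by (simp only:)
  qed
  then show ?thesis by (simp add: basis_form_eq_Theta)
qed

text \<open>The derivatives commute with the multiplications by the \<open>\<theta>\<^sub>i\<close>, so that all differentiations can be moved to the
  right.\<close>

definition normal_op :: "('n set \<Rightarrow> 'n mpoly) \<Rightarrow> 'n::{finite,linorder} form \<Rightarrow> 'n form" where
  "normal_op g \<eta> = (\<Sum>I\<in>UNIV. basis_form I \<star> dform (of_poly (g I)) \<eta>)"

definition has_normal_form :: "('n::{finite,linorder} form \<Rightarrow> 'n form) \<Rightarrow> bool" where
  "has_normal_form D \<longleftrightarrow> (\<exists>g. (\<forall>I. g I \<in> K_polys K) \<and> D = normal_op g)"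

lemma normal_form_single:
  assumes "c \<in> K" "p \<in> K_polys K"
  shows "has_normal_form (\<lambda>\<eta>. form_scale c (basis_form L \<star> dform (of_poly p) \<eta>))"
proof -
  define g where "g I = (if I = L then Const (cnj c) * p else 0)" for I
  have "normal_op g \<eta> = form_scale c (basis_form L \<star> dform (of_poly p) \<eta>)" for \<eta>
  proof -
    have "normal_op g \<eta> = (\<Sum>I\<in>UNIV. if I = L then form_scale c (basis_form L \<star> dform (of_poly p) \<eta>) else 0)"
      unfolding normal_op_def
      by (intro sum.cong) (auto simp: g_def of_poly_Const dform_scale_left form_mult_scale_right)
    then show ?thesis by simp
  qed
  moreover have "g I \<in> K_polys K" for I using assms by (auto simp: g_def)
  ultimately show ?thesis unfolding has_normal_form_def by (intro exI[of _ g]) (auto simp: fun_eq_iff)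
qed

lemma normal_form_add:
  assumes "has_normal_form D" "has_normal_form E"
  shows "has_normal_form (\<lambda>\<eta>. D \<eta> + E \<eta>)"
proof -
  obtain g h where gh: "\<And>I. g I \<in> K_polys K" "D = normal_op g" "\<And>I. h I \<in> K_polys K" "E = normal_op h"
    using assms unfolding has_normal_form_def by blast
  have "D \<eta> + E \<eta> = normal_op (\<lambda>I. g I + h I) \<eta>" for \<eta>
    by (simp only: gh(2,4) normal_op_def dform_of_poly_add form_mult_add_right sum.distrib)
  then have "(\<lambda>\<eta>. D \<eta> + E \<eta>) = normal_op (\<lambda>I. g I + h I)" by (rule ext)
  moreover have "\<forall>I. g I + h I \<in> K_polys K" using gh(1,3) by (simp add: K_polys_add)
  ultimately show ?thesis
    unfolding has_normal_form_def by (intro exI[of _ "\<lambda>I. g I + h I"] conjI)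
qed

lemma normal_form_zero: "has_normal_form (\<lambda>\<eta>. 0)"
  using normal_form_single[OF K_0 K_polys_0, of "{}"] by simp

lemma normal_form_sum: "(\<And>i. i \<in> A \<Longrightarrow> has_normal_form (D i)) \<Longrightarrow> has_normal_form (\<lambda>\<eta>. \<Sum>i\<in>A. D i \<eta>)"
  by (induction A rule: infinite_finite_induct) (auto simp: normal_form_zero intro: normal_form_add)

lemma normal_form_comp:
  assumes "has_normal_form D" "has_normal_form E"
  shows "has_normal_form (D \<circ> E)"
proof -
  obtain g h where gh: "\<And>I. g I \<in> K_polys K" "D = normal_op g" "\<And>I. h I \<in> K_polys K" "E = normal_op h"
    using assms unfolding has_normal_form_def by blast
  have "(D \<circ> E) \<eta> = (\<Sum>I\<in>UNIV. \<Sum>J\<in>UNIV. (basis_form I \<star> basis_form J) \<star> dform (of_poly (g I * h J)) \<eta>)" for \<eta>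
    by (simp only: gh(2,4) normal_op_def o_def dform_sum_right form_mult_sum_right dform_of_poly_basis
        form_mult_assoc dform_of_poly_mult)
  then have "D \<circ> E = (\<lambda>\<eta>. \<Sum>I\<in>UNIV. \<Sum>J\<in>UNIV. (basis_form I \<star> basis_form J) \<star> dform (of_poly (g I * h J)) \<eta>)"
    by (rule ext)
  moreover have "has_normal_form (\<lambda>\<eta>. (basis_form I \<star> basis_form J) \<star> dform (of_poly (g I * h J)) \<eta>)" for I J
  proof -
    obtain c where c: "c \<in> {0, 1, - 1}" "basis_form I \<star> basis_form J = form_scale c (basis_form (I \<union> J))"
      using basis_form_mult by blast
    then have "c \<in> K" by auto
    from normal_form_single[OF this K_polys_mult[OF gh(1) gh(3)], of "I \<union> J" I J] show ?thesis
      by (simp only: c(2) form_mult_scale_left)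
  qed
  then have "has_normal_form (\<lambda>\<eta>. \<Sum>I\<in>UNIV. \<Sum>J\<in>UNIV. (basis_form I \<star> basis_form J) \<star> dform (of_poly (g I * h J)) \<eta>)"
    by (intro normal_form_sum)
  ultimately show ?thesis by (simp only:)
qed

lemma diff_ops_normal_form:
  fixes D :: "'n::{finite,linorder} form \<Rightarrow> 'n form"
  assumes "D \<in> diff_ops K"
  shows "has_normal_form D"
  using assms
proof (induction rule: diff_ops.induct)
  case (scalar c)
  have "(\<lambda>\<eta> :: 'n form. form_scale c (basis_form {} \<star> dform (of_poly 1) \<eta>)) = form_scale c"
    by (simp add: fun_eq_iff basis_form_empty of_poly_mult)
  from back_subst[of has_normal_form, OF normal_form_single[OF scalar K_polys_1, of "{}"] this]
  show ?case .
next
  case (dx i)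
  have "(\<lambda>\<eta> :: 'n form. form_scale 1 (basis_form {} \<star> dform (of_poly (X i)) \<eta>)) = dx i"
    by (simp add: fun_eq_iff basis_form_empty of_poly_mult dform_of_poly_X)
  from back_subst[of has_normal_form, OF normal_form_single[OF K_1 K_polys_X, of "{}" i] this]
  show ?case .
next
  case (theta i)
  have "(\<lambda>\<eta> :: 'n form. form_scale 1 (basis_form {i} \<star> dform (of_poly 1) \<eta>)) = (\<star>) (theta i)"
    by (simp add: fun_eq_iff basis_form_singleton)
  from back_subst[of has_normal_form, OF normal_form_single[OF K_1 K_polys_1, of "{i}"] this]
  show ?case .
next
  case (add D E)
  have "(\<lambda>\<eta>. D \<eta> + E \<eta>) = D + E" by (simp add: fun_eq_iff)
  from back_subst[of has_normal_form, OF normal_form_add[OF add.IH] this]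
  show ?case .
next
  case (comp D E)
  then show ?case by (intro normal_form_comp)
qed

lemma normal_op_of_poly: "normal_op g (of_poly q) $ L = pdop (g L) q"
  unfolding normal_op_def dform_of_poly_of_poly basis_form_of_poly sum_component vector_smult_component
  by (simp add: if_distrib[where f = "(*) _"] cong: if_cong)

text \<open>The degrees of the coefficients are read off from the values at the monomials, which have \<open>\<theta>\<close>-degree \<open>0\<close>.\<close>

lemma op_one_form:
  assumes D: "D \<in> diff_ops K" and bi: "op_bidegree K e D"
  obtains g where "\<And>j. g j \<in> K_polys K" "\<And>j. homog e (g j)"
    "\<And>\<eta>. D \<eta> = (\<Sum>j\<in>UNIV. theta j \<star> dform (of_poly (g j)) \<eta>)"
proof -
  obtain g where g: "\<And>I. g I \<in> K_polys K" "D = normal_op g"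
    using diff_ops_normal_form[OF D] unfolding has_normal_form_def by blast
  have deg: "e \<le> mdeg \<beta> \<and> card L = 1 \<and> homog (mdeg \<beta> - e) (pdop (g L) (monomial \<beta> 1))"
    if nz: "pdop (g L) (monomial \<beta> 1) \<noteq> 0" for \<beta> L
  proof -
    let ?q = "of_poly (monomial \<beta> 1)"
    have "bihomog (mdeg \<beta>) 0 ?q" "?q \<in> K_forms K" by (auto intro: bihomog_of_poly)
    then have "if e \<le> mdeg \<beta> then bihomog (mdeg \<beta> - e) (0 + 1) (D ?q) else D ?q = 0"
      using bi unfolding op_bidegree_def by blast
    moreover have DL: "D ?q $ L = pdop (g L) (monomial \<beta> 1)" by (simp add: g(2) normal_op_of_poly)
    then have nz': "D ?q $ L \<noteq> 0" using nz by simp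
    ultimately have e: "e \<le> mdeg \<beta>" and "bihomog (mdeg \<beta> - e) 1 (D ?q)" by (auto split: if_splits)
    then have "homog (mdeg \<beta> - e) (D ?q $ L) \<and> card L = 1" using nz' unfolding bihomog_def by blast
    then show ?thesis using e unfolding DL by blast
  qed
  have zero: "g L = 0" if "card L \<noteq> 1" for L
    by (rule pdop_inject) (use deg that in force)
  have hom: "homog e (g L)" for L
    unfolding homog_iff
  proof (intro allI impI)
    fix \<beta> assume "coeff (g L) \<beta> \<noteq> 0"
    then have nz: "coeff (pdop (g L) (monomial \<beta> 1)) 0 \<noteq> 0" by (simp add: coeff_0_pdop_monomial)
    then have "pdop (g L) (monomial \<beta> 1) \<noteq> 0" by auto
    from deg[OF this] have d: "e \<le> mdeg \<beta>" "homog (mdeg \<beta> - e) (pdop (g L) (monomial \<beta> 1))" by auto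
    then have "mdeg \<beta> - e = 0" using nz by (auto simp: homog_iff)
    then show "mdeg \<beta> = e" using d by simp
  qed
  have "D \<eta> = (\<Sum>j\<in>UNIV. theta j \<star> dform (of_poly (g {j})) \<eta>)" for \<eta>
  proof -
    have "D \<eta> = (\<Sum>I\<in>range (\<lambda>j. {j}). basis_form I \<star> dform (of_poly (g I)) \<eta>)"
      unfolding g(2) normal_op_def
    proof (rule sum.mono_neutral_right)
      show "\<forall>I\<in>UNIV - range (\<lambda>j. {j}). basis_form I \<star> dform (of_poly (g I)) \<eta> = 0"
      proof
        fix I :: "'a set" assume "I \<in> UNIV - range (\<lambda>j. {j})"
        then have "card I \<noteq> 1" by (auto simp: card_1_singleton_iff)
        then show "basis_form I \<star> dform (of_poly (g I)) \<eta> = 0" by (simp add: zero)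
      qed
    qed auto
    also have "\<dots> = (\<Sum>j\<in>UNIV. basis_form {j} \<star> dform (of_poly (g {j})) \<eta>)"
      by (subst sum.reindex) (auto simp: inj_on_def)
    finally show ?thesis by (simp add: basis_form_singleton)
  qed
  then show thesis using that[of "\<lambda>j. g {j}"] g(1) hom by blast
qed

end

lemma lin_theta_component: "lin_theta w $ {k} = Const (w $ k)"
proof -
  have "lin_theta w $ {k} = (\<Sum>i\<in>UNIV. if i = k then Const (w $ k) else 0)"
    unfolding lin_theta_def sum_component form_scale_component by (intro sum.cong) (auto simp: theta_def)
  then show ?thesis by simp
qed

context refl_group
begin

text \<open>This is the coefficient of \<open>\<theta>\<^sub>k\<close> in \<open>D (s q) = s (D q)\<close> for polynomials \<open>q\<close>.\<close>

lemma equivariant_coefficients: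
  assumes g: "\<And>j. g j \<in> K_polys K" and D: "\<And>\<eta>. D \<eta> = (\<Sum>j\<in>UNIV. theta j \<star> dform (of_poly (g j)) \<eta>)"
    and equiv: "D \<in> equivariant_ops K G" and s: "s \<in> G"
  shows "g k = (\<Sum>j\<in>UNIV. Const (s $ k $ j) * act_poly s (g j))"
proof (rule pdop_inject)
  fix \<beta>
  let ?q = "act_poly (conj_transpose s) (monomial \<beta> 1)"
  have D_poly: "D (of_poly q) = (\<Sum>j\<in>UNIV. pdop (g j) q *s theta j)" for q
    by (simp add: D dform_of_poly_of_poly flip: basis_form_singleton basis_form_of_poly)
  have "?q \<in> K_polys K"
    using G_entries[OF G_inv[OF s]] by (intro K_polys_act_poly K_polys_monomial) auto
  then have "D (act s (of_poly ?q)) = act s (D (of_poly ?q))"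
    using equiv s by (auto simp: equivariant_ops_def)
  moreover have q: "act_poly s ?q = monomial \<beta> 1"
    by (simp add: act_poly_compose unitary_inverse[OF G_unitary[OF s]])
  ultimately have "(\<Sum>j\<in>UNIV. pdop (g j) (monomial \<beta> 1) *s theta j) $ {k}
      = (\<Sum>j\<in>UNIV. pdop (act_poly s (g j)) (monomial \<beta> 1) *s act_theta s j) $ {k}"
  proof -
    have "act s (theta j) = act_theta s j" for j
      using act_theta_mult[of s j "of_poly 1"]
      by (simp add: theta_mult_one act_of_poly act_theta_eq lin_theta_mult_one)
    then have "act s (D (of_poly ?q)) = (\<Sum>j\<in>UNIV. pdop (act_poly s (g j)) (monomial \<beta> 1) *s act_theta s j)"
      by (simp add: D_poly act_sum act_smult act_poly_pdop[OF G_unitary[OF s]] q)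
    moreover have "D (act s (of_poly ?q)) = (\<Sum>j\<in>UNIV. pdop (g j) (monomial \<beta> 1) *s theta j)"
      by (simp add: act_of_poly q D_poly)
    ultimately show ?thesis using \<open>D (act s (of_poly ?q)) = act s (D (of_poly ?q))\<close> by simp
  qed
  moreover have "(\<Sum>j\<in>UNIV. pdop (g j) (monomial \<beta> 1) *s theta j) $ {k} = pdop (g k) (monomial \<beta> 1)"
  proof -
    have "(\<Sum>j\<in>UNIV. pdop (g j) (monomial \<beta> 1) *s theta j) $ {k} = (\<Sum>j\<in>UNIV. if j = k then pdop (g k) (monomial \<beta> 1) else 0)"
      unfolding sum_component vector_smult_component by (intro sum.cong) (auto simp: theta_def)
    then show ?thesis by simp
  qed
  moreover have "(\<Sum>j\<in>UNIV. pdop (act_poly s (g j)) (monomial \<beta> 1) *s act_theta s j) $ {k}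
      = pdop (\<Sum>j\<in>UNIV. Const (s $ k $ j) * act_poly s (g j)) (monomial \<beta> 1)"
    unfolding sum_component vector_smult_component act_theta_eq lin_theta_component pdop_sum_left pdop_Const_left
    by (intro sum.cong refl) (simp add: mult.commute)
  ultimately show "pdop (g k) (monomial \<beta> 1) = pdop (\<Sum>j\<in>UNIV. Const (s $ k $ j) * act_poly s (g j)) (monomial \<beta> 1)"
    by simp
qed

lemma equivariant_op_SH:
  assumes "D \<in> equivariant_ops K G" "op_bidegree K e D" "e > 0" "\<eta> \<in> SH K G"
  shows "D \<eta> \<in> SH K G"
proof -
  have "D \<in> diff_ops K" using assms(1) by (simp add: equivariant_ops_def)
  then obtain g where g: "\<And>j. g j \<in> K_polys K" "\<And>j. homog e (g j)"
    "\<And>\<eta>. D \<eta> = (\<Sum>j\<in>UNIV. theta j \<star> dform (of_poly (g j)) \<eta>)"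
    using op_one_form[OF _ assms(2)] by blast
  show ?thesis
    unfolding g(3)
    by (rule SH_exterior_op[OF g(1,2) assms(3) equivariant_coefficients[OF g(1,3) assms(1)] assms(4)])
qed

lemma equivariant_op_SH_det:
  assumes "D \<in> equivariant_ops K G" "op_bidegree K e D" "e > 0" "\<eta> \<in> SH_det K G"
  shows "D \<eta> \<in> SH_det K G"
proof -
  have \<eta>: "\<eta> \<in> SH K G" "\<And>s. s \<in> G \<Longrightarrow> act s \<eta> = form_scale (det s) \<eta>" using SH_detD[OF assms(4)] by auto
  have D: "D \<in> diff_ops K" "\<And>s. s \<in> G \<Longrightarrow> act s (D \<eta>) = D (act s \<eta>)"
    using assms(1) SH_K_forms[OF \<eta>(1)] by (auto simp: equivariant_ops_def)
  show ?thesis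
    using equivariant_op_SH[OF assms(1-3) \<eta>(1)] D \<eta>(2)
    by (simp add: SH_det_def diff_ops_linear(2))
qed

end

section \<open>The Vandermondian generates the harmonic polynomials\<close>

lemma act_component_empty: "act s \<omega> $ {} = act_poly s (\<omega> $ {})"
  by (induction \<omega> rule: form_induct)
    (simp_all add: act_of_poly of_poly_component act_smult act_poly_mult act_theta_mult act_theta_eq
      lin_theta_mult sum_component theta_mult_component act_add act_poly_add)

lemma act_poly_hcomp: "act_poly s (hcomp a p) = hcomp a (act_poly s p)"
proof -
  have "hcomp a (act_poly s p) = hcomp a (act_poly s (\<Sum>b\<le>deg_bound p + a. hcomp b p))"
    by (simp add: sum_hcomp)
  also have "\<dots> = (\<Sum>b\<le>deg_bound p + a. if b = a then act_poly s (hcomp a p) else 0)"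
    unfolding act_poly_sum hcomp_sum
    by (intro sum.cong refl) (simp add: hcomp_homog[OF homog_act_poly[OF homog_hcomp]])
  finally show ?thesis by simp
qed

context refl_group
begin

lemma SH_component: "\<eta> \<in> SH K G \<Longrightarrow> \<eta> $ J \<in> harmonic_polys K G"
  unfolding harmonic_iff
proof (intro conjI allI impI)
  assume \<eta>: "\<eta> \<in> SH K G"
  show "\<eta> $ J \<in> K_polys K" using SH_K_forms[OF \<eta>] by (simp add: K_forms_def)
  fix f a assume "f \<in> K_polys K" "homog a f" "0 < a" "\<forall>s\<in>G. act_poly s f = f"
  then have "of_poly f \<in> inv_forms"
    by (intro inv_formsI[of _ a 0] K_forms_of_poly bihomog_of_poly) (simp_all add: act_of_poly)
  from SH_kill[OF \<eta> this] show "pdop f (\<eta> $ J) = 0"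
    by (metis dform_of_poly_component zero_index)
qed


definition det_harmonics :: "'n mpoly set" where
  "det_harmonics = {p \<in> harmonic_polys K G. \<forall>s\<in>G. act_poly s p = Const (det s) * p}"

lemma det_harmonicsD:
  "p \<in> det_harmonics \<Longrightarrow> p \<in> harmonic_polys K G"
  "p \<in> det_harmonics \<Longrightarrow> s \<in> G \<Longrightarrow> act_poly s p = Const (det s) * p"
  by (auto simp: det_harmonics_def)

lemma det_harmonics_subspace: "polys.K_subspace det_harmonics"
  using polys.K_subspaceD[OF harmonic_subspace]
  unfolding polys.K_subspace_def det_harmonics_def
  by (simp add: act_poly_add act_poly_mult act_poly_Const distrib_left mult.left_commute)

lemma SH_det_of_poly: "of_poly p \<in> SH_det K G \<longleftrightarrow> p \<in> det_harmonics"
  by (auto simp: SH_det_def det_harmonics_def harmonic_polys_def act_of_poly of_poly_eq_iff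
      simp flip: of_poly_Const)

lemma SH_det_component: "\<eta> \<in> SH_det K G \<Longrightarrow> \<eta> $ {} \<in> det_harmonics"
  unfolding det_harmonics_def
  using SH_component SH_detD by (auto simp flip: act_component_empty)

text \<open>In top degree, a derivative \<open>\<partial>\<^sub>g p\<close> of a harmonic polynomial retains only the constant term of \<open>g\<close>. As
  the harmonic polynomials are derivatives of determinantal ones, those of top degree are determinantal
  themselves.\<close>

lemma top_harmonic_det:
  assumes p: "p \<in> harmonic_polys K G" "homog N p"
    and top: "\<And>a q. N < a \<Longrightarrow> q \<in> harmonic_polys K G \<Longrightarrow> homog a q \<Longrightarrow> q = 0"
  shows "p \<in> det_harmonics"
proof -
  define M where "M = {\<eta> :: 'n form. hcomp N (\<eta> $ {}) \<in> det_harmonics}"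
  have M: "forms.K_subspace M"
    using polys.K_subspaceD[OF det_harmonics_subspace]
    unfolding forms.K_subspace_def M_def by (simp add: hcomp_simps form_scale_component)
  have gen: "dform (of_poly g) \<eta> \<in> M" if g: "g \<in> K_polys K" and \<eta>: "\<eta> \<in> SH_det K G" for g \<eta>
  proof -
    let ?q = "\<eta> $ {}"
    have q: "?q \<in> det_harmonics" by (rule SH_det_component[OF \<eta>])
    have comp: "hcomp N (pdop (hcomp b g) ?q) = (if b = 0 then hcomp N (pdop (hcomp 0 g) ?q) else 0)" for b
    proof (cases "b = 0")
      case False
      have "hcomp N (pdop (hcomp b g) ?q) = pdop (hcomp b g) (hcomp (N + b) ?q)"
        by (rule pdop_hcomp[OF homog_hcomp, symmetric])
      moreover have "hcomp (N + b) ?q = 0"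
        by (rule top[of "N + b"]) (use False harmonic_hcomp det_harmonicsD(1)[OF q] in auto)
      ultimately show ?thesis using False by simp
    qed simp
    have "hcomp N (pdop g ?q) = hcomp N (pdop (\<Sum>b\<le>deg_bound g. hcomp b g) ?q)" by (simp add: sum_hcomp)
    also have "\<dots> = (\<Sum>b\<le>deg_bound g. if b = 0 then hcomp N (pdop (hcomp 0 g) ?q) else 0)"
      unfolding pdop_sum_left hcomp_sum by (intro sum.cong refl comp)
    also have "\<dots> = hcomp N (pdop (hcomp 0 g) ?q)" by simp
    also have "hcomp 0 g = Const (coeff g 0)"
      by (rule poly_mapping_eqI) (auto simp: coeff_hcomp Const_def lookup_single when_def mdeg_eq_0_iff)
    also have "hcomp N (pdop (Const (coeff g 0)) ?q) = Const (cnj (coeff g 0)) * hcomp N ?q"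
      by (simp add: pdop_Const hcomp_simps)
    finally have "hcomp N (pdop g ?q) = Const (cnj (coeff g 0)) * hcomp N ?q" .
    moreover have "hcomp N ?q \<in> det_harmonics"
      unfolding det_harmonics_def
      using harmonic_hcomp[OF det_harmonicsD(1)[OF q]] det_harmonicsD(2)[OF q]
      by (simp add: act_poly_hcomp hcomp_simps)
    ultimately show ?thesis
      unfolding M_def using polys.K_subspaceD(3)[OF det_harmonics_subspace] K_cnj[OF K_polys_coeff[OF g]] by simp
  qed
  have "det_span \<subseteq> M" by (rule forms.spanK_minimal[OF M]) (use gen in blast)
  then have "of_poly p \<in> M" using harmonic_det_span[OF p(1)] by blast
  then show ?thesis using p(2) by (simp add: M_def of_poly_component hcomp_homog)
qed

lemma vandermondian_det:
  assumes "vandermondian K G \<Delta>"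
  shows "\<Delta> \<in> det_harmonics"
proof -
  obtain N where N: "{p \<in> harmonic_polys K G. homog N p} = {Const c * \<Delta> | c. c \<in> K}"
    "\<And>a. a > N \<Longrightarrow> {p \<in> harmonic_polys K G. homog a p} = {0}"
    using assms unfolding vandermondian_def by blast
  have "\<Delta> = Const 1 * \<Delta>" by simp
  then have "\<Delta> \<in> {p \<in> harmonic_polys K G. homog N p}" unfolding N(1) using K_1 by blast
  moreover have "q = 0" if "N < a" "q \<in> harmonic_polys K G" "homog a q" for a q
    using N(2)[OF that(1)] that(2,3) by blast
  ultimately show ?thesis using top_harmonic_det[of \<Delta> N] by blast
qed

text \<open>If the determinantal harmonic polynomials are the multiples of \<open>\<Delta>\<close>, then the components of the
  determinantal super harmonics are derivatives of \<open>\<Delta>\<close>: they are harmonic, and each harmonic polynomial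
  is a derivative of determinantal ones.\<close>

lemma harmonic_derivative_of:
  assumes unique: "\<And>q. q \<in> det_harmonics \<Longrightarrow> \<exists>c\<in>K. q = Const c * \<Delta>" and p: "p \<in> harmonic_polys K G"
  shows "\<exists>h\<in>K_polys K. p = pdop h \<Delta>"
proof -
  define M where "M = {\<eta> :: 'n form. \<exists>h\<in>K_polys K. \<eta> $ {} = pdop h \<Delta>}"
  have "forms.K_subspace M"
    unfolding forms.K_subspace_def
  proof (intro conjI ballI)
    show "0 \<in> M" unfolding M_def by (intro CollectI bexI[of _ 0]) auto
  next
    fix \<eta> \<zeta> assume "\<eta> \<in> M" "\<zeta> \<in> M"
    then obtain h g where "h \<in> K_polys K" "\<eta> $ {} = pdop h \<Delta>" "g \<in> K_polys K" "\<zeta> $ {} = pdop g \<Delta>"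
      unfolding M_def by blast
    then show "\<eta> + \<zeta> \<in> M"
      unfolding M_def by (intro CollectI bexI[of _ "h + g"]) (auto simp: pdop_add_left)
  next
    fix c \<eta> assume "c \<in> K" "\<eta> \<in> M"
    then obtain h where "h \<in> K_polys K" "\<eta> $ {} = pdop h \<Delta>" unfolding M_def by blast
    then show "form_scale c \<eta> \<in> M"
      unfolding M_def using \<open>c \<in> K\<close>
      by (intro CollectI bexI[of _ "Const (cnj c) * h"]) (auto simp: pdop_Const_left form_scale_component)
  qed
  moreover have "{dform (of_poly g) \<eta> | g \<eta>. g \<in> K_polys K \<and> \<eta> \<in> SH_det K G} \<subseteq> M"
  proof
    fix \<zeta> assume "\<zeta> \<in> {dform (of_poly g) \<eta> | g \<eta>. g \<in> K_polys K \<and> \<eta> \<in> SH_det K G}"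
    then obtain g \<eta> where g: "g \<in> K_polys K" "\<eta> \<in> SH_det K G" "\<zeta> = dform (of_poly g) \<eta>" by blast
    obtain c where c: "c \<in> K" "\<eta> $ {} = Const c * \<Delta>" using unique[OF SH_det_component[OF g(2)]] by blast
    have "\<zeta> $ {} = pdop (Const (cnj c) * g) \<Delta>" by (simp add: g(3) c(2) pdop_Const_right pdop_Const_left)
    moreover have "Const (cnj c) * g \<in> K_polys K" using c(1) g(1) by auto
    ultimately show "\<zeta> \<in> M" unfolding M_def by blast
  qed
  ultimately have "det_span \<subseteq> M" by (rule forms.spanK_minimal)
  then have "of_poly p \<in> M" using harmonic_det_span[OF p] by blast
  then show ?thesis by (simp add: M_def of_poly_component)
qed

end


section \<open>Products of generalized exterior derivatives\<close>

lemma op_product_simps: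
  "op_product d [] = id" "op_product d (i # l) \<eta> = d i (op_product d l \<eta>)"
  "op_product d (l @ l') \<eta> = op_product d l (op_product d l' \<eta>)"
  by (induction l) (simp_all add: op_product_def)

lemma invariant_dop_eq: "invariant_dop f \<alpha> \<eta> = dform (of_poly (\<Prod>i\<in>UNIV. f i ^ \<alpha> i)) \<eta>"
proof -
  have pow: "(dform (of_poly p) ^^ k) \<eta> = dform (of_poly (p ^ k)) \<eta>" for p k and \<eta> :: "'a form"
    by (induction k) (simp_all add: dform_of_poly_mult)
  have "foldr (\<lambda>i. (\<circ>) (dform (of_poly (f i)) ^^ \<alpha> i)) l id \<eta> = dform (of_poly (\<Prod>i\<in>set l. f i ^ \<alpha> i)) \<eta>"
    if "distinct l" for l
    using that by (induction l) (simp_all add: pow dform_of_poly_mult)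
  from this[of "sorted_list_of_set UNIV"] show ?thesis by (simp add: invariant_dop_def)
qed

context refl_group
begin

lemma basic_invariants_prod:
  assumes f: "basic_invariants K G f" and \<alpha>: "\<alpha> \<noteq> (\<lambda>_. 0)"
  obtains a where "a > 0" "homog a (\<Prod>i\<in>UNIV. f i ^ \<alpha> i)" "(\<Prod>i\<in>UNIV. f i ^ \<alpha> i) \<in> K_polys K"
    "\<And>s. s \<in> G \<Longrightarrow> act_poly s (\<Prod>i\<in>UNIV. f i ^ \<alpha> i) = (\<Prod>i\<in>UNIV. f i ^ \<alpha> i)"
proof -
  have fK: "f i \<in> K_polys K" for i using f by (simp add: basic_invariants_def)
  have inv: "act_poly s (f i) = f i" if "s \<in> G" for s i
  proof -
    have "f i = subst f (X i)" by simp
    then have "f i \<in> subst f ` K_polys K" by blast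
    then have "f i \<in> invariant_polys K G" using f unfolding basic_invariants_def by blast
    then show ?thesis using that by (simp add: invariant_polys_def)
  qed
  obtain e where e: "\<And>i. homog (e i) (f i)" using f unfolding basic_invariants_def by metis
  \<comment> \<open>a constant generator would be algebraically dependent\<close>
  have pos: "e i > 0" for i
  proof (rule ccontr)
    assume "\<not> e i > 0"
    then have "homog 0 (f i)" using e[of i] by simp
    then have c: "f i = Const (coeff (f i) 0)"
      by (intro poly_mapping_eqI) (auto simp: homog_iff Const_def lookup_single when_def mdeg_eq_0_iff)
    define p where "p = X i + Const (- 1) * Const (coeff (f i) 0)"
    have "subst f p = f i + Const (- 1) * Const (coeff (f i) 0)"
      by (simp only: p_def subst_add subst_mult subst_X subst_Const)
    also have "\<dots> = 0" by (subst c) (simp flip: Const_add Const_mult)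
    finally have "subst f p = 0" .
    moreover have "p \<in> K_polys K" unfolding p_def
      by (intro K_polys_add K_polys_mult K_polys_Const K_polys_X K_polys_coeff fK) auto
    ultimately have "p = 0" using f unfolding basic_invariants_def by blast
    then have "coeff p (unit_expo i) = 0" by simp
    moreover have "unit_expo i \<noteq> 0"
    proof
      assume "unit_expo i = 0"
      from arg_cong[OF this, of "\<lambda>\<alpha>. expo \<alpha> i"] show False by simp
    qed
    then have "coeff p (unit_expo i) = 1"
      by (simp add: p_def lookup_add X_def Const_def mult_single lookup_single when_def)
    ultimately show False by simp
  qed
  show thesis
  proof
    show "homog (\<Sum>i\<in>UNIV. e i * \<alpha> i) (\<Prod>i\<in>UNIV. f i ^ \<alpha> i)" by (intro homog_prod homog_power e)
    obtain i where "\<alpha> i \<noteq> 0" using \<alpha> by auto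
    then show "(\<Sum>i\<in>UNIV. e i * \<alpha> i) > 0"
      using pos[of i] by (intro sum_pos2[of UNIV i]) auto
    show "(\<Prod>i\<in>UNIV. f i ^ \<alpha> i) \<in> K_polys K" by (intro K_polys_prod K_polys_power fK)
    show "act_poly s (\<Prod>i\<in>UNIV. f i ^ \<alpha> i) = (\<Prod>i\<in>UNIV. f i ^ \<alpha> i)" if "s \<in> G" for s
      by (simp add: act_poly_prod act_poly_power inv[OF that])
  qed
qed

end

locale exterior_derivatives = refl_group K G for K and G :: "'n::{finite,linorder} cmat set" +
  fixes f :: "'n \<Rightarrow> 'n mpoly" and d :: "nat \<Rightarrow> 'n form \<Rightarrow> 'n form"
  assumes f: "basic_invariants K G f" and d: "generalized_exterior_derivatives K G f d"
begin

abbreviation "ext_prod I \<equiv> op_product d (sorted_list_of_set I)"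

lemma d_equivariant: "i \<in> {1..CARD('n)} \<Longrightarrow> d i \<in> equivariant_ops K G"
  using d by (simp add: generalized_exterior_derivatives_def)

lemma d_diff_op: "i \<in> {1..CARD('n)} \<Longrightarrow> d i \<in> diff_ops K"
  using d_equivariant by (simp add: equivariant_ops_def)

lemma d_bidegree:
  assumes "i \<in> {1..CARD('n)}"
  obtains e where "op_bidegree K e (d i)" "i \<le> group_rank K G \<longleftrightarrow> e > 0"
  using d assms unfolding generalized_exterior_derivatives_def by blast

lemma op_product_diff_ops: "set l \<subseteq> {1..CARD('n)} \<Longrightarrow> op_product d l \<in> diff_ops K"
proof (induction l)
  case Nil
  have "op_product d [] = form_scale 1" by (simp add: fun_eq_iff op_product_simps)
  with diff_ops.scalar[OF K_1] show ?case by (simp only:)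
next
  case (Cons i l)
  have "op_product d (i # l) = d i \<circ> op_product d l" by (simp add: fun_eq_iff op_product_simps)
  moreover have "d i \<circ> op_product d l \<in> diff_ops K" using Cons by (intro diff_ops.comp d_diff_op) auto
  ultimately show ?case by (simp only:)
qed

lemma ext_prod_diff_ops: "I \<subseteq> {1..CARD('n)} \<Longrightarrow> ext_prod I \<in> diff_ops K"
  using finite_subset[of I "{1..CARD('n)}"] by (intro op_product_diff_ops) auto

lemma op_product_theta_degree:
  assumes "set l \<subseteq> {1..CARD('n)}" "\<eta> \<in> K_forms K" "bihomog a b \<eta>"
  shows "\<exists>a'. bihomog a' (b + length l) (op_product d l \<eta>)"
  using assms(1)
proof (induction l)
  case Nil
  then show ?case using assms(3) by (auto simp: op_product_simps)
next
  case (Cons i l)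
  have i: "i \<in> {1..CARD('n)}" and l: "set l \<subseteq> {1..CARD('n)}" using Cons.prems by simp_all
  obtain a' where a': "bihomog a' (b + length l) (op_product d l \<eta>)" using Cons.IH[OF l] by blast
  have K: "op_product d l \<eta> \<in> K_forms K"
    by (rule diff_ops_K_forms[OF op_product_diff_ops[OF l] assms(2)])
  obtain e where e: "op_bidegree K e (d i)" by (rule d_bidegree[OF i])
  then have "if e \<le> a' then bihomog (a' - e) (b + length l + 1) (d i (op_product d l \<eta>))
      else d i (op_product d l \<eta>) = 0"
    using a' K unfolding op_bidegree_def by blast
  then have "bihomog (a' - e) (b + length (i # l)) (op_product d (i # l) \<eta>)"
    by (auto simp: op_product_simps split: if_splits)
  then show ?case by blast
qed

lemma equivariant_ops_induct:
  assumes M: "ops.K_subspace M" and D: "D \<in> equivariant_ops K G"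
    and base: "\<And>\<alpha> I. I \<subseteq> {1..CARD('n)} \<Longrightarrow> invariant_dop f \<alpha> \<circ> ext_prod I \<in> M"
  shows "D \<in> M"
proof -
  have "K_span op_scale K ((\<lambda>(\<alpha>, I). invariant_dop f \<alpha> \<circ> ext_prod I) ` (UNIV \<times> Pow {1..CARD('n)})) \<subseteq> M"
    by (rule ops.spanK_minimal[OF M]) (use base in auto)
  then show ?thesis
    using D d unfolding generalized_exterior_derivatives_def K_basis_def by blast
qed


section \<open>Uniqueness of the determinantal harmonic polynomial of a real group\<close>

text \<open>For a real group, \<open>det\<close> takes the values \<open>\<plusminus>1\<close>, so that a determinantal polynomial \<open>P\<close> turns into the
  equivariant operator \<open>\<theta>\<^sub>1 \<cdots> \<theta>\<^sub>n \<partial>\<^sub>P\<close>. Its expansion in the basis exhibits \<open>P\<close> as a multiple of one fixed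
  polynomial, the symbol of \<open>d\<^sub>1 \<cdots> d\<^sub>n\<close>, modulo the ideal of the positive degree invariants.\<close>

lemma real_det_harmonics_symbol:
  assumes "\<And>s. s \<in> G \<Longrightarrow> cnj (det s) = det s"
  obtains g where "\<And>P. P \<in> det_harmonics \<Longrightarrow> \<exists>c\<in>K. \<exists>t\<in>coinv_ideal. P = Const c * g + t"
proof -
  let ?top = "\<lambda>D q. D (of_poly q) $ (UNIV :: 'n set)"
  obtain h where h: "\<And>I. h I \<in> K_polys K" "ext_prod {1..CARD('n)} = normal_op h"
    using diff_ops_normal_form[OF ext_prod_diff_ops[OF order.refl]] unfolding has_normal_form_def by blast
  define g where "g = h UNIV"
  have gK: "g \<in> K_polys K" unfolding g_def by (rule h(1))
  have top_g: "?top (ext_prod {1..CARD('n)}) q = pdop g q" for q by (simp only: h(2) normal_op_of_poly g_def)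
  \<comment> \<open>the operators whose symbol at \<open>\<theta>\<^sub>1 \<cdots> \<theta>\<^sub>n\<close> is a multiple of \<open>g\<close> modulo the ideal\<close>
  define M where "M = {D :: 'n form \<Rightarrow> 'n form. \<exists>c\<in>K. \<exists>t\<in>coinv_ideal. \<forall>\<beta>. ?top D (monomial \<beta> 1) = pdop (Const c * g + t) (monomial \<beta> 1)}"
  have M_I: "D \<in> M" if "c \<in> K" "t \<in> coinv_ideal" "\<And>\<beta>. ?top D (monomial \<beta> 1) = pdop (Const c * g + t) (monomial \<beta> 1)" for D c t
    unfolding M_def mem_Collect_eq by (intro bexI[of _ c] bexI[of _ t] allI) (use that in blast)+
  have M_0: "D \<in> M" if "\<And>\<beta>. ?top D (monomial \<beta> 1) = 0" for D
    by (rule M_I[OF K_0 coinv_ideal.zero]) (simp add: that)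
  have "ops.K_subspace M"
    unfolding ops.K_subspace_def
  proof (intro conjI ballI)
    show "0 \<in> M" by (rule M_0) simp
  next
    fix D E assume "D \<in> M" "E \<in> M"
    then obtain c t c' t' where c: "c \<in> K" "t \<in> coinv_ideal" "\<And>\<beta>. ?top D (monomial \<beta> 1) = pdop (Const c * g + t) (monomial \<beta> 1)"
      and c': "c' \<in> K" "t' \<in> coinv_ideal" "\<And>\<beta>. ?top E (monomial \<beta> 1) = pdop (Const c' * g + t') (monomial \<beta> 1)"
      unfolding M_def by blast
    have "Const (c + c') * g + (t + t') = (Const c * g + t) + (Const c' * g + t')"
      by (simp only: Const_add distrib_right add_ac)
    then have "?top (D + E) (monomial \<beta> 1) = pdop (Const (c + c') * g + (t + t')) (monomial \<beta> 1)" for \<beta>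
      by (simp only: op_plus_apply vector_add_component c(3) c'(3) pdop_add_left)
    then show "D + E \<in> M" by (intro M_I[OF K_add[OF c(1) c'(1)] coinv_add[OF c'(2) c(2)]])
  next
    fix a D assume a: "a \<in> K" and "D \<in> M"
    then obtain c t where c: "c \<in> K" "t \<in> coinv_ideal" "\<And>\<beta>. ?top D (monomial \<beta> 1) = pdop (Const c * g + t) (monomial \<beta> 1)"
      unfolding M_def by blast
    have "Const (cnj a * c) * g + Const (cnj a) * t = Const (cnj a) * (Const c * g + t)"
      by (simp only: distrib_left Const_mult mult.assoc)
    then have "?top (op_scale a D) (monomial \<beta> 1) = pdop (Const (cnj a * c) * g + Const (cnj a) * t) (monomial \<beta> 1)" for \<beta>
      by (simp only: op_scale_def form_scale_component c(3) pdop_Const_left complex_cnj_cnj)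
    then show "op_scale a D \<in> M"
      by (intro M_I[OF K_mult[OF K_cnj[OF a] c(1)] coinv_mult[OF c(2) K_polys_Const[OF K_cnj[OF a]]]])
  qed
  moreover have "invariant_dop f \<alpha> \<circ> ext_prod I \<in> M" if I: "I \<subseteq> {1..CARD('n)}" for \<alpha> I
  proof -
    define F where "F = (\<Prod>i\<in>UNIV. f i ^ \<alpha> i)"
    have top: "?top (invariant_dop f \<alpha> \<circ> ext_prod I) q = pdop F (?top (ext_prod I) q)" for q
      by (simp add: invariant_dop_eq F_def)
    consider "I \<noteq> {1..CARD('n)}" | "I = {1..CARD('n)}" "\<alpha> = (\<lambda>_. 0)" | "I = {1..CARD('n)}" "\<alpha> \<noteq> (\<lambda>_. 0)" by blast
    then show ?thesis
    proof cases
      case 1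
      have "?top (ext_prod I) (monomial \<beta> 1) = 0" for \<beta>
      proof -
        have fin: "finite I" using I finite_subset by blast
        have "\<exists>a'. bihomog a' (0 + length (sorted_list_of_set I)) (ext_prod I (of_poly (monomial \<beta> 1)))"
          by (rule op_product_theta_degree[where a = "mdeg \<beta>"]) (use I fin in \<open>auto intro: bihomog_of_poly\<close>)
        moreover have "card I < card {1..CARD('n)}" by (rule psubset_card_mono) (use 1 I in auto)
        ultimately show ?thesis by (auto simp: bihomog_def)
      qed
      then show ?thesis by (intro M_0) (simp only: top pdop_0_right)
    next
      case 2
      have "?top (invariant_dop f \<alpha> \<circ> ext_prod I) q = pdop (Const 1 * g + 0) q" for q
        by (simp only: top, simp only: 2(1) top_g) (simp add: F_def 2(2))
      then show ?thesis by (intro M_I[OF K_1 coinv_ideal.zero])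
    next
      case 3
      obtain a where a: "a > 0" "homog a F" "F \<in> K_polys K" "\<And>s. s \<in> G \<Longrightarrow> act_poly s F = F"
        using basic_invariants_prod[OF f 3(2)] unfolding F_def by blast
      have "?top (invariant_dop f \<alpha> \<circ> ext_prod I) q = pdop (Const 0 * g + g * F) q" for q
        by (simp only: top, simp only: 3(1) top_g) (simp add: pdop_mult pdop_commute[of F])
      then show ?thesis by (intro M_I[OF K_0 coinv_gen[OF gK a(3,2,1,4)]])
    qed
  qed
  ultimately have all: "D \<in> M" if "D \<in> equivariant_ops K G" for D
    using equivariant_ops_induct[OF _ that] by blast
  have "\<exists>c\<in>K. \<exists>t\<in>coinv_ideal. P = Const c * g + t" if P: "P \<in> det_harmonics" for P
  proof -
    define D where "D \<eta> = basis_form UNIV \<star> dform (of_poly P) \<eta>" for \<eta> :: "'n form"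
    have PK: "P \<in> K_polys K" by (rule harmonic_K_polys[OF det_harmonicsD(1)[OF P]])
    have "D = (\<star>) (basis_form UNIV) \<circ> dform (of_poly P)" by (simp add: fun_eq_iff D_def)
    then have "D \<in> diff_ops K" using diff_ops.comp[OF diff_ops_basis_form diff_ops_poly[OF PK]] by simp
    moreover have "D (act s \<eta>) = act s (D \<eta>)" if s: "s \<in> G" for s \<eta>
    proof -
      have "bihomog 0 CARD('n) (basis_form (UNIV :: 'n set))" by (simp add: bihomog_def)
      from top_form_det[OF this s] have "act s (basis_form UNIV) = form_scale (cnj (det s)) (basis_form UNIV)" .
      then have "act s (D \<eta>) = form_scale (cnj (det s) * cnj (det s)) (D (act s \<eta>))"
        by (simp add: D_def act_mult act_dform_of_poly[OF G_unitary[OF s]] det_harmonicsD(2)[OF P s]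
            of_poly_Const dform_scale_left form_mult_scale_left form_mult_scale_right form_scale_scale)
      moreover have "cnj (det s) * cnj (det s) = 1" using det_unit(1)[OF s] assms[OF s] by simp
      ultimately show ?thesis by simp
    qed
    ultimately have "D \<in> M" by (intro all) (simp add: equivariant_ops_def)
    moreover have "?top D q = pdop P q" for q
      by (simp add: D_def dform_of_poly_of_poly basis_form_of_poly)
    ultimately obtain c t where "c \<in> K" "t \<in> coinv_ideal" "\<And>\<beta>. pdop P (monomial \<beta> 1) = pdop (Const c * g + t) (monomial \<beta> 1)"
      unfolding M_def by auto
    then show ?thesis using pdop_inject[of P "Const c * g + t"] by blast
  qed
  then show thesis using that by blast
qed

lemma real_det_harmonics_unique:
  assumes real: "\<And>s. s \<in> G \<Longrightarrow> cnj (det s) = det s"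
    and P: "P \<in> det_harmonics" and Q: "Q \<in> det_harmonics" "Q \<noteq> 0"
  shows "\<exists>c\<in>K. P = Const c * Q"
proof -
  obtain g where g: "\<And>P. P \<in> det_harmonics \<Longrightarrow> \<exists>c\<in>K. \<exists>t\<in>coinv_ideal. P = Const c * g + t"
    using real_det_harmonics_symbol real by blast
  obtain c t where c: "c \<in> K" "t \<in> coinv_ideal" "P = Const c * g + t" using g[OF P] by blast
  obtain c' t' where c': "c' \<in> K" "t' \<in> coinv_ideal" "Q = Const c' * g + t'" using g[OF Q(1)] by blast
  have "c' \<noteq> 0"
  proof
    assume "c' = 0"
    then have "Q = t'" using c'(3) by simp
    then show False using coinv_harmonic_zero[of Q] c'(2) det_harmonicsD(1)[OF Q(1)] Q(2) by simp
  qed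
  define b where "b = c / c'"
  have bK: "b \<in> K" unfolding b_def by (intro K_divide c c')
  have "Const b * Q = Const c * g + Const b * t'"
    using \<open>c' \<noteq> 0\<close> unfolding c'(3) distrib_left mult.assoc[symmetric] Const_mult[symmetric] by (simp add: b_def)
  then have "P - Const b * Q = t - Const b * t'" by (simp add: c(3))
  moreover have "t - Const b * t' \<in> coinv_ideal"
    by (intro polys.K_subspaceD(3,4)[OF coinv_subspace] c c' bK)
  moreover have "P - Const b * Q \<in> harmonic_polys K G"
    by (intro polys.K_subspaceD(3,4)[OF harmonic_subspace] bK det_harmonicsD(1) P Q)
  ultimately have "P - Const b * Q = 0" using coinv_harmonic_zero[of "P - Const b * Q"] by simp
  then show ?thesis using bK by (intro bexI[of _ b]) simp_all
qed

end


section \<open>Determinantal super harmonics from the Vandermondian\<close>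

lemma conj_transpose_mult: "conj_transpose (A ** B) = conj_transpose B ** conj_transpose A"
  by (simp add: vec_eq_iff conj_transpose_def matrix_matrix_mult_def mult.commute)

context refl_group
begin

text \<open>Conjugation takes the generators \<open>\<partial>\<^sub>x\<^sub>i\<close> and \<open>\<theta>\<^sub>i\<close> to combinations of generators over \<open>K\<close>.\<close>

lemma diff_ops_conjugate:
  assumes "D \<in> diff_ops K" and s: "s \<in> G"
  shows "(\<lambda>\<eta>. act s (D (act (conj_transpose s) \<eta>))) \<in> diff_ops K"
  using assms(1)
proof (induction rule: diff_ops.induct)
  note inverse = act_compose unitary_inverse[OF G_unitary[OF s]]
  {
    case (scalar c)
    have "(\<lambda>\<eta>. act s (form_scale c (act (conj_transpose s) \<eta>))) = form_scale c"
      by (simp add: fun_eq_iff act_scale inverse)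
    with diff_ops.scalar[OF scalar] show ?case by (simp only:)
  next
    case (dx i)
    have "(\<lambda>\<eta>. act s (dx i (act (conj_transpose s) \<eta>))) = (\<lambda>\<eta>. \<Sum>j\<in>UNIV. form_scale (s $ j $ i) (dx j \<eta>))"
      by (simp add: fun_eq_iff act_dx[OF G_unitary[OF s]] inverse dirx_def column_def)
    moreover have "(\<lambda>\<eta> :: 'n form. \<Sum>j\<in>UNIV. form_scale (s $ j $ i) (dx j \<eta>)) \<in> diff_ops K"
      by (intro diff_ops_sum diff_ops_scale diff_ops.dx G_entries[OF s])
    ultimately show ?case by (simp only:)
  next
    case (theta i)
    have "(\<lambda>\<eta>. act s (theta i \<star> act (conj_transpose s) \<eta>)) = (\<lambda>\<eta>. \<Sum>j\<in>UNIV. form_scale (cnj (s $ j $ i)) (theta j \<star> \<eta>))"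
      by (simp add: fun_eq_iff act_theta_mult inverse act_theta_eq lin_theta_mult)
    moreover have "(\<lambda>\<eta> :: 'n form. \<Sum>j\<in>UNIV. form_scale (cnj (s $ j $ i)) (theta j \<star> \<eta>)) \<in> diff_ops K"
      by (intro diff_ops_sum diff_ops_scale diff_ops.theta K_cnj G_entries[OF s])
    ultimately show ?case by (simp only:)
  next
    case (add D E)
    have "(\<lambda>\<eta>. act s ((D + E) (act (conj_transpose s) \<eta>)))
        = (\<lambda>\<eta>. act s (D (act (conj_transpose s) \<eta>))) + (\<lambda>\<eta>. act s (E (act (conj_transpose s) \<eta>)))"
      by (simp add: fun_eq_iff act_add)
    with diff_ops.add[OF add.IH] show ?case by (simp only:)
  next
    case (comp D E)
    have "(\<lambda>\<eta>. act s ((D \<circ> E) (act (conj_transpose s) \<eta>)))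
        = (\<lambda>\<eta>. act s (D (act (conj_transpose s) \<eta>))) \<circ> (\<lambda>\<eta>. act s (E (act (conj_transpose s) \<eta>)))"
      by (simp add: fun_eq_iff inverse)
    with diff_ops.comp[OF comp.IH] show ?case by (simp only:)
  }
qed

text \<open>An operator taking \<open>\<Delta>\<close> to a determinantal form can be averaged over the group without changing its value at
  \<open>\<Delta>\<close>.\<close>

lemma equivariant_average:
  assumes D: "D \<in> diff_ops K" and \<zeta>: "\<And>s. s \<in> G \<Longrightarrow> act s \<zeta> = form_scale (det s) \<zeta>"
    and \<eta>: "\<And>s. s \<in> G \<Longrightarrow> act s (D \<zeta>) = form_scale (det s) (D \<zeta>)"
  obtains E where "E \<in> equivariant_ops K G" "E \<zeta> = D \<zeta>"
proof -
  define C where "C s \<eta> = act s (D (act (conj_transpose s) \<eta>))" for s \<eta>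
  define E where "E \<eta> = form_scale (inverse (of_nat (card G))) (\<Sum>s\<in>G. C s \<eta>)" for \<eta>
  have C_ops: "C s \<in> diff_ops K" if "s \<in> G" for s
    using diff_ops_conjugate[OF D that] unfolding C_def .
  have E_ops: "E \<in> diff_ops K"
    unfolding E_def using C_ops by (intro diff_ops_scale diff_ops_sum card_G_K)
  have "E (act t \<eta>) = act t (E \<eta>)" if t: "t \<in> G" for t \<eta>
  proof -
    have "C (t ** s) (act t \<eta>) = act t (C s \<eta>)" for s
      by (simp add: C_def act_compose conj_transpose_mult matrix_mul_assoc[symmetric]
          unitary_inverse[OF G_unitary[OF t]])
    then have "(\<Sum>s\<in>G. C s (act t \<eta>)) = (\<Sum>s\<in>G. act t (C s \<eta>))"
      using sum_G_left[OF t, of "\<lambda>s. C s (act t \<eta>)"] by simp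
    then show ?thesis by (simp add: E_def act_scale act_sum)
  qed
  then have "E \<in> equivariant_ops K G" using E_ops by (simp add: equivariant_ops_def)
  moreover have "E \<zeta> = D \<zeta>"
  proof -
    have "C s \<zeta> = D \<zeta>" if s: "s \<in> G" for s
      using det_unit(2)[OF s]
      by (simp add: C_def \<zeta>[OF G_inv[OF s]] diff_ops_linear(2)[OF D] act_scale \<eta>[OF s] form_scale_scale det_conj_transpose)
    then have "(\<Sum>s\<in>G. C s \<zeta>) = (\<Sum>s\<in>G. form_scale 1 (D \<zeta>))" by (intro sum.cong) auto
    also have "\<dots> = form_scale (of_nat (card G)) (D \<zeta>)" by (simp only: form_scale_sum_left[symmetric] sum_constant mult_1_right)
    finally show ?thesis using card_G by (simp add: E_def form_scale_scale)
  qed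
  ultimately show thesis using that by blast
qed

end

context exterior_derivatives
begin

text \<open>The components of \<open>\<eta>\<close> are derivatives of \<open>\<Delta>\<close>, so that \<open>\<eta> = D \<Delta>\<close> for some operator \<open>D\<close>, which may be taken
  equivariant. In its expansion in the basis, the terms with an invariant of positive degree kill the harmonic
  polynomial \<open>\<Delta>\<close>.\<close>

lemma SH_det_ext_prod_span:
  assumes \<Delta>: "\<Delta> \<in> det_harmonics" and unique: "\<And>q. q \<in> det_harmonics \<Longrightarrow> \<exists>c\<in>K. q = Const c * \<Delta>"
    and \<eta>: "\<eta> \<in> SH_det K G"
  shows "\<eta> \<in> K_span form_scale K {ext_prod I (of_poly \<Delta>) | I. I \<subseteq> {1..CARD('n)}}" (is "_ \<in> ?W")
proof -
  have "\<exists>h\<in>K_polys K. \<eta> $ J = pdop h \<Delta>" for J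
    by (rule harmonic_derivative_of[OF unique]) (use SH_component SH_detD(1)[OF \<eta>] in auto)
  then obtain h where h: "\<And>J. h J \<in> K_polys K" "\<And>J. \<eta> $ J = pdop (h J) \<Delta>" by metis
  define D where "D = normal_op h"
  have D\<Delta>: "D (of_poly \<Delta>) = \<eta>" by (simp add: vec_eq_iff D_def normal_op_of_poly h(2))
  have "D = (\<lambda>\<eta>. \<Sum>I\<in>UNIV. ((\<star>) (basis_form I) \<circ> dform (of_poly (h I))) \<eta>)"
    by (simp add: fun_eq_iff D_def normal_op_def)
  moreover have "(\<lambda>\<eta>. \<Sum>I\<in>UNIV. ((\<star>) (basis_form I) \<circ> dform (of_poly (h I))) \<eta>) \<in> diff_ops K"
    by (intro diff_ops_sum diff_ops.comp diff_ops_basis_form diff_ops_poly h(1))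
  ultimately have "D \<in> diff_ops K" by (simp only:)
  moreover have \<Delta>_det: "of_poly \<Delta> \<in> SH_det K G" using \<Delta> by (simp add: SH_det_of_poly)
  ultimately obtain E where E: "E \<in> equivariant_ops K G" "E (of_poly \<Delta>) = \<eta>"
    using equivariant_average[of D "of_poly \<Delta>"] SH_detD(2) \<eta> unfolding D\<Delta> by blast
  define M where "M = {D. D (of_poly \<Delta>) \<in> ?W}"
  have "ops.K_subspace M"
    unfolding ops.K_subspace_def M_def
    by (auto simp: op_scale_def op_plus_apply intro: forms.spanK_0 forms.spanK_add forms.spanK_scale)
  then have "E \<in> M" using E(1)
  proof (rule equivariant_ops_induct)
    fix \<alpha> I assume I: "I \<subseteq> {1..CARD('n)}"
    define F where "F = (\<Prod>i\<in>UNIV. f i ^ \<alpha> i)"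
    have F: "(invariant_dop f \<alpha> \<circ> ext_prod I) (of_poly \<Delta>) = ext_prod I (dform (of_poly F) (of_poly \<Delta>))"
      by (simp add: invariant_dop_eq F_def diff_ops_commute[OF ext_prod_diff_ops[OF I]])
    show "invariant_dop f \<alpha> \<circ> ext_prod I \<in> M"
    proof (cases "\<alpha> = (\<lambda>_. 0)")
      case True
      then have "F = 1" by (simp add: F_def)
      have "(invariant_dop f \<alpha> \<circ> ext_prod I) (of_poly \<Delta>) = ext_prod I (of_poly \<Delta>)"
        unfolding F \<open>F = 1\<close> by simp
      moreover have "ext_prod I (of_poly \<Delta>) \<in> ?W" using I by (intro forms.spanK_base) blast
      ultimately show ?thesis unfolding M_def mem_Collect_eq by (simp only:)
    next
      case False
      then obtain a where a: "a > 0" "homog a F" "F \<in> K_polys K" "\<And>s. s \<in> G \<Longrightarrow> act_poly s F = F"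
        using basic_invariants_prod[OF f False] unfolding F_def by blast
      have "of_poly F \<in> inv_forms"
        by (rule inv_formsI[of _ a 0]) (use a in \<open>auto simp: act_of_poly intro: bihomog_of_poly\<close>)
      then have "dform (of_poly F) (of_poly \<Delta>) = 0" using SH_kill SH_detD(1)[OF \<Delta>_det] by blast
      then show ?thesis
        unfolding M_def mem_Collect_eq F by (simp only: diff_ops_0[OF ext_prod_diff_ops[OF I]] forms.spanK_0)
    qed
  qed
  then show ?thesis using E(2) by (simp add: M_def)
qed

text \<open>A generalized exterior derivative that does not lower the \<open>x\<close>-degree is the multiplication by an invariant
  one-form with constant coefficients, and this multiplication is adjoint to an operator that
  annihilates the super harmonics.\<close>

lemma d_constant:
  assumes "k \<in> {1..CARD('n)}" "k > group_rank K G"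
  obtains w where "\<And>\<eta>. d k \<eta> = lin_theta w \<star> \<eta>" "lin_theta w \<in> inv_forms"
proof -
  obtain e where e: "op_bidegree K e (d k)" "k \<le> group_rank K G \<longleftrightarrow> e > 0" using d_bidegree[OF assms(1)] by blast
  have bi: "op_bidegree K 0 (d k)" using e assms(2) by simp
  obtain g where g: "\<And>j. g j \<in> K_polys K" "\<And>j. homog 0 (g j)"
    "\<And>\<eta>. d k \<eta> = (\<Sum>j\<in>UNIV. theta j \<star> dform (of_poly (g j)) \<eta>)"
    using op_one_form[OF d_diff_op[OF assms(1)] bi] by blast
  define c where "c j = coeff (g j) 0" for j
  have c: "g j = Const (c j)" for j
    using g(2)[of j] unfolding c_def
    by (intro poly_mapping_eqI) (auto simp: homog_iff Const_def lookup_single when_def mdeg_eq_0_iff)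
  define w where "w = (\<chi> j. cnj (c j))"
  have const: "dform (of_poly (Const a)) \<eta> = form_scale (cnj a) \<eta>" for a and \<eta> :: "'n form"
    by (simp add: vec_eq_iff pdop_Const form_scale_component)
  have dk: "d k \<eta> = lin_theta w \<star> \<eta>" for \<eta>
    unfolding g(3) lin_theta_mult w_def vec_lambda_beta
    by (intro sum.cong refl) (simp only: c const form_mult_scale_right)
  have one: "d k (of_poly 1) = lin_theta w" by (rule trans[OF dk lin_theta_mult_one])
  have lK: "lin_theta w \<in> K_forms K"
    using diff_ops_K_forms[OF d_diff_op[OF assms(1)] K_forms_of_poly[OF K_polys_1]] by (simp only: one)
  have equiv: "\<forall>s\<in>G. \<forall>\<eta>\<in>K_forms K. d k (act s \<eta>) = act s (d k \<eta>)"
    using d_equivariant[OF assms(1)] unfolding equivariant_ops_def mem_Collect_eq by (rule conjunct2)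
  have inv: "act s (lin_theta w) = lin_theta w" if "s \<in> G" for s
    using bspec[OF bspec[OF equiv \<open>s \<in> G\<close>] K_forms_of_poly[OF K_polys_1]]
    by (simp only: act_of_poly act_poly_1 one)
  have "lin_theta w \<in> inv_forms"
    by (rule inv_formsI[OF lK inv bihomog_lin_theta_one]) simp_all
  with dk show thesis by (rule that)
qed

text \<open>Multiplications by one-forms with constant coefficients anticommute with the generalized exterior derivatives.\<close>

lemma op_product_lin_theta:
  assumes "set l \<subseteq> {1..CARD('n)}"
  shows "\<exists>\<xi>. op_product d l (lin_theta w \<star> \<eta>) = lin_theta w \<star> \<xi>"
  using assms
proof (induction l)
  case Nil
  then show ?case by (auto simp: op_product_simps)
next
  case (Cons i l)
  then obtain \<xi> where \<xi>: "op_product d l (lin_theta w \<star> \<eta>) = lin_theta w \<star> \<xi>" by auto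
  have i: "i \<in> {1..CARD('n)}" using Cons.prems by simp
  obtain e where e: "op_bidegree K e (d i)" by (rule d_bidegree[OF i])
  obtain g where "\<And>j. g j \<in> K_polys K" "\<And>j. homog e (g j)"
    and g: "\<And>\<eta>. d i \<eta> = (\<Sum>j\<in>UNIV. theta j \<star> dform (of_poly (g j)) \<eta>)"
    using op_one_form[OF d_diff_op[OF i] e] by blast

  have anti: "theta j \<star> (lin_theta w \<star> \<zeta>) = lin_theta w \<star> (- (theta j \<star> \<zeta>))" for j \<zeta>
    by (simp add: lin_theta_mult form_mult_sum_right form_mult_scale_right theta_anticommute[of j] form_mult_uminus_right sum_negf)
  have "d i (lin_theta w \<star> \<xi>) = lin_theta w \<star> (\<Sum>j\<in>UNIV. - (theta j \<star> dform (of_poly (g j)) \<xi>))"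
    by (simp only: g dform_of_poly_lin_theta anti form_mult_sum_right)
  then show ?case unfolding op_product_simps \<xi> by blast
qed

text \<open>The largest index belongs to the innermost factor, the multiplication by an invariant one-form \<open>\<lambda>\<close>. Moving it to the
  front presents the product as a multiple of \<open>\<lambda>\<close>, and \<open>\<partial>\<^sub>\<lambda>\<close> kills \<open>\<zeta>\<close>.\<close>

lemma ext_prod_orthogonal:
  assumes I: "I \<subseteq> {1..CARD('n)}" "\<not> I \<subseteq> {1..group_rank K G}" and \<zeta>: "\<zeta> \<in> SH K G"
  shows "pair (ext_prod I \<eta>) \<zeta> = 0"
proof -
  have fin: "finite I" using I(1) finite_subset by blast
  obtain j where j: "j \<in> I" "j > group_rank K G" using I by force
  define k where "k = Max I"
  have k: "k \<in> I" unfolding k_def using j(1) by (intro Max_in[OF fin]) auto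
  have k_gt: "k > group_rank K G" unfolding k_def using j(2) Max_ge[OF fin j(1)] by simp
  have "sorted_list_of_set I = sorted_list_of_set (I - {k}) @ [k]"
  proof (rule sorted_distinct_set_unique)
    show "sorted (sorted_list_of_set (I - {k}) @ [k])"
      using fin Max_ge[of I] by (auto simp: sorted_append k_def)
  qed (use fin k in auto)
  moreover obtain w where w: "\<And>\<eta>. d k \<eta> = lin_theta w \<star> \<eta>" "lin_theta w \<in> inv_forms"
    using d_constant[of k] k k_gt I(1) by blast
  moreover obtain \<xi> where "op_product d (sorted_list_of_set (I - {k})) (lin_theta w \<star> \<eta>) = lin_theta w \<star> \<xi>"
    using op_product_lin_theta[of "sorted_list_of_set (I - {k})" w \<eta>] I(1) fin by auto
  ultimately have "ext_prod I \<eta> = lin_theta w \<star> \<xi>" by (simp add: op_product_simps)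
  then have "pair (ext_prod I \<eta>) \<zeta> = pair \<xi> 0" using SH_kill[OF \<zeta> w(2)] by (simp only: pair_mult)
  then show ?thesis by (simp add: pair_def)
qed

lemma rank_le_card: "group_rank K G \<le> CARD('n)"
  by (simp add: group_rank_eq)

lemma op_product_SH_det:
  assumes "\<eta> \<in> SH_det K G" "set l \<subseteq> {1..group_rank K G}"
  shows "op_product d l \<eta> \<in> SH_det K G"
  using assms(2)
proof (induction l)
  case Nil
  then show ?case using assms(1) by (simp add: op_product_simps)
next
  case (Cons i l)
  then have i: "i \<in> {1..CARD('n)}" "i \<le> group_rank K G" using rank_le_card by auto
  obtain e where "op_bidegree K e (d i)" "i \<le> group_rank K G \<longleftrightarrow> e > 0" using d_bidegree[OF i(1)] by blast
  then show ?case
    using Cons i by (auto simp: op_product_simps intro: equivariant_op_SH_det[OF d_equivariant[OF i(1)]])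
qed

text \<open>Let \<open>\<rho>\<close> be the part of \<open>\<eta>\<close> that involves derivatives with an index beyond the rank. It is orthogonal to all super
  harmonics, and is itself one, as the difference of two super harmonics. So \<open>\<rho>\<close> is orthogonal to itself.\<close>

lemma SH_det_rank_span:
  assumes \<Delta>: "\<Delta> \<in> det_harmonics" and unique: "\<And>q. q \<in> det_harmonics \<Longrightarrow> \<exists>c\<in>K. q = Const c * \<Delta>"
    and \<eta>: "\<eta> \<in> SH_det K G"
  shows "\<eta> \<in> K_span form_scale K {ext_prod I (of_poly \<Delta>) | I. I \<subseteq> {1..group_rank K G}}" (is "_ \<in> ?W")
proof -
  define N where "N = {\<sigma>. \<forall>\<zeta>\<in>SH K G. pair \<sigma> \<zeta> = 0}"
  have N: "forms.K_subspace N"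
    by (auto simp: forms.K_subspace_def N_def pair_add_left pair_scale_left)
  define M where "M = {\<eta> + \<sigma> | \<eta> \<sigma>. \<eta> \<in> ?W \<and> \<sigma> \<in> N}"
  have "forms.K_subspace M"
    unfolding forms.K_subspace_def
  proof (intro conjI ballI)
    show "0 \<in> M" unfolding M_def using forms.spanK_0 forms.K_subspaceD(1)[OF N] by force
  next
    fix \<omega> \<xi> assume "\<omega> \<in> M" "\<xi> \<in> M"
    then obtain a b a' b' where ab: "a \<in> ?W" "b \<in> N" "\<omega> = a + b" "a' \<in> ?W" "b' \<in> N" "\<xi> = a' + b'" unfolding M_def by blast
    have "\<omega> + \<xi> = (a + a') + (b + b')" by (simp add: ab)
    then show "\<omega> + \<xi> \<in> M" unfolding M_def using forms.spanK_add[OF ab(1,4)] forms.K_subspaceD(2)[OF N ab(2,5)] by blast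
  next
    fix c \<omega> assume c: "c \<in> K" and "\<omega> \<in> M"
    then obtain a b where ab: "a \<in> ?W" "b \<in> N" "\<omega> = a + b" unfolding M_def by blast
    have "form_scale c \<omega> = form_scale c a + form_scale c b" by (simp add: ab form_scale_add)
    then show "form_scale c \<omega> \<in> M"
      unfolding M_def using forms.spanK_scale[OF c ab(1)] forms.K_subspaceD(3)[OF N c ab(2)] by blast
  qed
  moreover have "{ext_prod I (of_poly \<Delta>) | I. I \<subseteq> {1..CARD('n)}} \<subseteq> M"
  proof
    fix \<omega> assume "\<omega> \<in> {ext_prod I (of_poly \<Delta>) | I. I \<subseteq> {1..CARD('n)}}"
    then obtain I where I: "\<omega> = ext_prod I (of_poly \<Delta>)" "I \<subseteq> {1..CARD('n)}" by blast
    show "\<omega> \<in> M"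
    proof (cases "I \<subseteq> {1..group_rank K G}")
      case True
      then have "\<omega> \<in> ?W" unfolding I(1) by (intro forms.spanK_base) blast
      moreover have "\<omega> = \<omega> + 0" by simp
      ultimately show ?thesis unfolding M_def using forms.K_subspaceD(1)[OF N] by blast
    next
      case False
      then have "\<omega> \<in> N" unfolding I(1) N_def using ext_prod_orthogonal[OF I(2) False] by blast
      moreover have "\<omega> = 0 + \<omega>" by simp
      ultimately show ?thesis unfolding M_def using forms.spanK_0 by blast
    qed
  qed
  ultimately have "K_span form_scale K {ext_prod I (of_poly \<Delta>) | I. I \<subseteq> {1..CARD('n)}} \<subseteq> M" by (rule forms.spanK_minimal)
  then have "\<eta> \<in> M" using SH_det_ext_prod_span[OF \<Delta> unique \<eta>] by blast
  then obtain a \<rho> where a: "a \<in> ?W" and \<rho>: "\<rho> \<in> N" and sum: "\<eta> = a + \<rho>" unfolding M_def by blast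
  have "?W \<subseteq> SH K G"
  proof (rule forms.spanK_minimal[OF SH_subspace], clarify)
    fix I assume I: "I \<subseteq> {1..group_rank K G}"
    then have "finite I" using finite_subset by blast
    then show "ext_prod I (of_poly \<Delta>) \<in> SH K G"
      using I \<Delta> by (intro SH_detD(1) op_product_SH_det) (simp_all add: SH_det_of_poly)
  qed
  then have "\<eta> - a \<in> SH K G" using a SH_detD(1)[OF \<eta>] by (intro SH_diff) auto
  then have "pair \<rho> \<rho> = 0" using \<rho> by (simp add: N_def sum)
  then have "\<rho> = 0" by (rule pair_self_eq_0)
  then show ?thesis using a sum by simp
qed

lemma det_span_eq_vandermondian_span:
  assumes \<Delta>: "\<Delta> \<in> det_harmonics" and unique: "\<And>q. q \<in> det_harmonics \<Longrightarrow> \<exists>c\<in>K. q = Const c * \<Delta>"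
  shows "det_span = K_span form_scale K {dform (of_poly g) (op_product d is (of_poly \<Delta>)) | g is.
    g \<in> K_polys K \<and> set is \<subseteq> {1..group_rank K G}}" (is "_ = ?R")
proof
  show "?R \<subseteq> det_span"
  proof (rule forms.spanK_minimal[OF forms.K_subspace_spanK], clarify)
    fix g :: "'n mpoly" and "is" assume g: "g \<in> K_polys K" and "is": "set is \<subseteq> {1..group_rank K G}"
    have "op_product d is (of_poly \<Delta>) \<in> SH_det K G"
      using \<Delta> "is" by (intro op_product_SH_det) (simp_all add: SH_det_of_poly)
    then show "dform (of_poly g) (op_product d is (of_poly \<Delta>)) \<in> det_span"
      using g by (intro forms.spanK_base) blast
  qed
  show "det_span \<subseteq> ?R"
  proof (rule forms.spanK_minimal[OF forms.K_subspace_spanK], clarify)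
    fix g :: "'n mpoly" and \<eta> :: "'n form" assume g: "g \<in> K_polys K" and \<eta>: "\<eta> \<in> SH_det K G"
    let ?M = "{\<zeta>. dform (of_poly g) \<zeta> \<in> ?R}"
    have zero: "dform (of_poly g) 0 = 0" by (simp add: vec_eq_iff)
    have "K_span form_scale K {ext_prod I (of_poly \<Delta>) | I. I \<subseteq> {1..group_rank K G}} \<subseteq> ?M"
    proof (rule forms.spanK_minimal)
      show "forms.K_subspace ?M"
        unfolding forms.K_subspace_def mem_Collect_eq dform_add_right dform_scale_right zero
        by (blast intro: forms.spanK_0 forms.spanK_add forms.spanK_scale)
      show "{ext_prod I (of_poly \<Delta>) | I. I \<subseteq> {1..group_rank K G}} \<subseteq> ?M"
      proof clarify
        fix I assume I: "I \<subseteq> {1..group_rank K G}"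
        then have "finite I" using finite_subset by blast
        then have "set (sorted_list_of_set I) \<subseteq> {1..group_rank K G}" using I by simp
        then show "dform (of_poly g) (ext_prod I (of_poly \<Delta>)) \<in> ?R" using g by (intro forms.spanK_base) blast
      qed
    qed
    then show "dform (of_poly g) \<eta> \<in> ?R" using SH_det_rank_span[OF \<Delta> unique \<eta>] by blast
  qed
qed

end

context refl_group
begin

lemma det_harmonics_unique:
  assumes "group_rank K G \<le> 2" "(\<exists>m\<ge>1. G = Gmpn m 1) \<or> real_group G"
    and "basic_invariants K G f" "generalized_exterior_derivatives K G f d"
    and P: "P \<in> det_harmonics" and Q: "Q \<in> det_harmonics" "Q \<noteq> 0"
  shows "\<exists>c\<in>K. P = Const c * Q"
proof -
  have real: ?thesis if "real_group G"
  proof -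
    have "exterior_derivatives K G f d"
      by (intro exterior_derivatives.intro exterior_derivatives_axioms.intro refl_group_axioms assms(3,4))
    moreover have "\<And>s. s \<in> G \<Longrightarrow> cnj (det s) = det s" using real_group_form[OF that] by blast
    ultimately show ?thesis using exterior_derivatives.real_det_harmonics_unique P Q by blast
  qed
  have coeff: ?thesis
    if "\<And>R. R \<in> harmonic_polys K G \<Longrightarrow> (\<And>s. s \<in> G \<Longrightarrow> act_poly s R = Const (det s) * R) \<Longrightarrow> coeff R \<beta> = 0 \<Longrightarrow> R = 0" for \<beta>
    by (rule det_poly_unique_of_coeff[OF that]) (use det_harmonicsD P Q in blast)+
  from assms(2) show ?thesis
  proof
    assume "\<exists>m\<ge>1. G = Gmpn m 1"
    then obtain m where m: "G = Gmpn m 1" "m \<ge> 1" by blast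
    show ?thesis
    proof (rule mono_cases[OF m assms(1)])
      assume "CARD('n) = 1"
      then obtain p where "(UNIV :: 'n set) = {p}" by (rule card_1_singletonE)
      from coeff[OF mono_one_det_zero[OF m this]] show ?thesis by blast
    next
      fix p q assume "mono_two K G m p q"
      from coeff[OF mono_two.mono_two_det_zero[OF this]] show ?thesis by blast
    qed (rule real)
  qed (rule real)
qed

lemma det_span_eq_exterior_span:
  assumes "group_rank K G \<le> 2" "(\<exists>m\<ge>1. G = Gmpn m 1) \<or> real_group G"
    and f: "basic_invariants K G f" and d: "generalized_exterior_derivatives K G f d" and \<Delta>: "vandermondian K G \<Delta>"
  shows "det_span = K_span form_scale K {dform (of_poly g) (op_product d is (of_poly \<Delta>)) | g is.
    g \<in> K_polys K \<and> set is \<subseteq> {1..group_rank K G}}"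
proof -
  have "exterior_derivatives K G f d"
    by (intro exterior_derivatives.intro exterior_derivatives_axioms.intro refl_group_axioms f d)
  moreover have "\<Delta> \<in> det_harmonics" by (rule vandermondian_det[OF \<Delta>])
  moreover have "\<Delta> \<noteq> 0" using \<Delta> by (simp add: vandermondian_def)
  ultimately show ?thesis
    using det_harmonics_unique[OF assms(1-4)] by (intro exterior_derivatives.det_span_eq_vandermondian_span) auto
qed

end

theorem theorem1p6:
  fixes K :: "complex set"
    and G :: "'n::{finite,linorder} cmat set"
  assumes "conj_subfield K"
    and "pseudo_reflection_group K G"
    and "group_rank K G \<le> 2"
    and "(\<exists>m\<ge>1. G = Gmpn m 1) \<or> real_group G"
  shows "SH K G =
           K_span form_scale K {dform (of_poly g) \<eta> | g \<eta>. g \<in> K_polys K \<and> \<eta> \<in> SH_det K G} \<and>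
         (\<forall>f d \<Delta>. basic_invariants K G f \<and> generalized_exterior_derivatives K G f d \<and>
            vandermondian K G \<Delta> \<longrightarrow>
          K_span form_scale K {dform (of_poly g) \<eta> | g \<eta>. g \<in> K_polys K \<and> \<eta> \<in> SH_det K G} =
          K_span form_scale K {dform (of_poly g) (op_product d is (of_poly \<Delta>)) | g is.
            g \<in> K_polys K \<and> set is \<subseteq> {1..group_rank K G}})"
proof -
  interpret refl_group K G
    by (intro refl_group.intro subfield_conj.intro refl_group_axioms.intro assms(1,2))
  show ?thesis
    using SH_eq_det_span[OF assms(3,4)] det_span_eq_exterior_span[OF assms(3,4)] by blast
qed

end
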